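(* Let $V:\mathbb{R}^3\to\mathbb{R}$ be such that $V(x)(1+|x|)\in L^1(\mathbb{R}^3)\cap L^{3/2}(\mathbb{R}^3)$, and let $\mu>0$. Assume that the spectrum of $V^{1/2}\frac{1}{p^2}|V|^{1/2}$ is contained in $(-1,\infty)$, and that the scattering length $$a=\frac{1}{4\pi}\Big\langle|V|^{1/2}\Big|\frac{1}{1+V^{1/2}\frac{1}{p^2}|V|^{1/2}}\Big|V^{1/2}\Big\rangle$$ is negative. Then the critical temperature $T_c=T_c(V)$ at chemical potential $\mu$ satisfies $$\lim_{\mu\to0}\left(\ln\frac{\mu}{T_c}+\frac{\pi}{2\sqrt\mu\,a}\right)=2-\gamma-\ln\frac{8}{\pi},$$ where $\gamma\approx0.577$ denotes Euler's constant.
   Context: $V^{1/2}(x)=\operatorname{sgn}(V(x))\,|V(x)|^{1/2}$. The operator $V^{1/2}\frac{1}{p^2}|V|^{1/2}$ on $L^2(\mathbb{R}^3)$ (Birman–Schwinger operator) is the composition of multiplication by $|V|^{1/2}$, the operator $(-\nabla^2)^{-1}$ (multiplication by $p^{-2}$ in Fourier space), and multiplication by $V^{1/2}$; it is a Hilbert–Schmidt operator with real spectrum. The quantity $a$ is the scattering length of $2V$; the inner product is that of $L^2(\mathbb{R}^3)$, with $|V|^{1/2},V^{1/2}$ regarded as elements of $L^2(\mathbb{R}^3)$. For $T>0$ and $\mu>0$, $K_T$ is the operator on $L^2(\mathbb{R}^3)$ acting as multiplication in Fourier space by $K_T(p)=\dfrac{p^2-\mu}{\tanh\frac{p^2-\mu}{2T}}$,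 and $T_c(V)=\inf\{T>0:K_T+V\ge0\}$, the sum being understood in the sense of quadratic forms. It depends on $\mu$; the potential $V$ is fixed, and $\mu\to0$ means $\mu\downarrow0$. *)

theory Defs
  imports "HOL-Analysis.Analysis"
begin

text \<open>
  Elements of \<open>L\<^sup>2(\<real>\<^sup>3)\<close> are represented by square-integrable Lebesgue measurable functions, and
  equality in \<open>L\<^sup>2(\<real>\<^sup>3)\<close> is equality almost everywhere. An operator on \<open>L\<^sup>2(\<real>\<^sup>3)\<close> is a function on
  such representatives whose values matter only up to null sets.
\<close>

definition L2 :: "(real^3 \<Rightarrow> complex) set" where
  "L2 = {f \<in> borel_measurable lebesgue. integrable lebesgue (\<lambda>x. (cmod (f x))\<^sup>2)}"

definition L2_inner :: "(real^3 \<Rightarrow> complex) \<Rightarrow> (real^3 \<Rightarrow> complex) \<Rightarrow> complex" where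
  "L2_inner f g = (LINT x|lebesgue. cnj (f x) * g x)"

definition L2_norm :: "(real^3 \<Rightarrow> complex) \<Rightarrow> real" where
  "L2_norm f = sqrt (LINT x|lebesgue. (cmod (f x))\<^sup>2)"

definition L2_solution ::
  "((real^3 \<Rightarrow> complex) \<Rightarrow> (real^3 \<Rightarrow> complex)) \<Rightarrow> (real^3 \<Rightarrow> complex) \<Rightarrow> (real^3 \<Rightarrow> complex) \<Rightarrow> bool"
where
  "L2_solution A g f \<longleftrightarrow> f \<in> L2 \<and> (AE x in lebesgue. A f x = g x)"

text \<open>The operator is a bijection of \<open>L\<^sup>2(\<real>\<^sup>3)\<close> (modulo null sets) with bounded inverse.\<close>

definition L2_boundedly_invertible ::
  "((real^3 \<Rightarrow> complex) \<Rightarrow> (real^3 \<Rightarrow> complex)) \<Rightarrow> bool" where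
  "L2_boundedly_invertible A \<longleftrightarrow>
     (\<exists>C. \<forall>g\<in>L2. \<exists>f. L2_solution A g f \<and> L2_norm f \<le> C * L2_norm g \<and>
        (\<forall>f'. L2_solution A g f' \<longrightarrow> (AE x in lebesgue. f' x = f x)))"

definition L2_inverse ::
  "((real^3 \<Rightarrow> complex) \<Rightarrow> (real^3 \<Rightarrow> complex)) \<Rightarrow> (real^3 \<Rightarrow> complex) \<Rightarrow> (real^3 \<Rightarrow> complex)" where
  "L2_inverse A g = (SOME f. L2_solution A g f)"

definition L2_spectrum ::
  "((real^3 \<Rightarrow> complex) \<Rightarrow> (real^3 \<Rightarrow> complex)) \<Rightarrow> complex set" where
  "L2_spectrum A = {z. \<not> L2_boundedly_invertible (\<lambda>f x. A f x - z * f x)}"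

definition fourier :: "(real^3 \<Rightarrow> complex) \<Rightarrow> real^3 \<Rightarrow> complex" where
  "fourier f p = complex_of_real ((2 * pi) powr (-3/2)) * (LINT x|lebesgue. cis (- (p \<bullet> x)) * f x)"

definition inv_fourier :: "(real^3 \<Rightarrow> complex) \<Rightarrow> real^3 \<Rightarrow> complex" where
  "inv_fourier F x = complex_of_real ((2 * pi) powr (-3/2)) * (LINT p|lebesgue. cis (p \<bullet> x) * F p)"

definition truncate :: "real \<Rightarrow> (real^3 \<Rightarrow> complex) \<Rightarrow> real^3 \<Rightarrow> complex" where
  "truncate R f x = (if norm x \<le> R then f x else 0)"

text \<open>
  \<open>L\<^sup>2\<close>-convergence of \<open>u R\<close> to \<open>f\<close> as \<open>R \<rightarrow> \<infinity>\<close>. Only the differences have to be square-integrable,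
  not \<open>f\<close> itself; the nonnegative integral is used because it is infinite where the
  Bochner integral would be \<open>0\<close> by convention.
\<close>

definition L2_limit :: "(real \<Rightarrow> real^3 \<Rightarrow> complex) \<Rightarrow> (real^3 \<Rightarrow> complex) \<Rightarrow> bool" where
  "L2_limit u f \<longleftrightarrow> f \<in> borel_measurable lebesgue \<and>
     ((\<lambda>R. \<integral>\<^sup>+x. ennreal ((cmod (u R x - f x))\<^sup>2) \<partial>lebesgue) \<longlongrightarrow> 0) at_top"

text \<open>
  The Fourier transform on \<open>L\<^sup>2(\<real>\<^sup>3)\<close> (Plancherel). The inverse transform is also applied to sums of an
  integrable function of bounded support and a square-integrable function. Both are unique
  up to null sets.
\<close>

definition has_fourier :: "(real^3 \<Rightarrow> complex) \<Rightarrow> (real^3 \<Rightarrow> complex) \<Rightarrow> bool" where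
  "has_fourier f F \<longleftrightarrow> L2_limit (\<lambda>R. fourier (truncate R f)) F"

definition has_inv_fourier :: "(real^3 \<Rightarrow> complex) \<Rightarrow> (real^3 \<Rightarrow> complex) \<Rightarrow> bool" where
  "has_inv_fourier F f \<longleftrightarrow> L2_limit (\<lambda>R. inv_fourier (truncate R F)) f"

text \<open>
  Multiplication by \<open>p\<^sup>-\<^sup>2\<close> in Fourier space, for integrable \<open>g\<close>: then \<open>fourier g\<close> is bounded, so
  that \<open>fourier g p / p\<^sup>2\<close> is integrable on balls and square-integrable outside the unit ball.
\<close>

definition inv_neg_laplacian :: "(real^3 \<Rightarrow> complex) \<Rightarrow> real^3 \<Rightarrow> complex" where
  "inv_neg_laplacian g =
     (SOME h. has_inv_fourier (\<lambda>p. fourier g p / complex_of_real ((norm p)\<^sup>2)) h)"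

definition abs_root :: "(real^3 \<Rightarrow> real) \<Rightarrow> real^3 \<Rightarrow> complex" where
  "abs_root V x = complex_of_real (sqrt \<bar>V x\<bar>)"

definition sgn_root :: "(real^3 \<Rightarrow> real) \<Rightarrow> real^3 \<Rightarrow> complex" where
  "sgn_root V x = complex_of_real (sgn (V x) * sqrt \<bar>V x\<bar>)"

text \<open>
  For integrable \<open>V\<close> and \<open>f \<in> L2\<close> the product \<open>abs_root V * f\<close> is integrable, as
  \<^const>\<open>inv_neg_laplacian\<close> requires.
\<close>

definition birman_schwinger ::
  "(real^3 \<Rightarrow> real) \<Rightarrow> (real^3 \<Rightarrow> complex) \<Rightarrow> (real^3 \<Rightarrow> complex)" where
  "birman_schwinger V f = (\<lambda>x. sgn_root V x * inv_neg_laplacian (\<lambda>y. abs_root V y * f y) x)"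

text \<open>The inner product below is real because \<open>V\<close> is; \<open>Re\<close> only changes its type.\<close>

definition scattering_length :: "(real^3 \<Rightarrow> real) \<Rightarrow> real" where
  "scattering_length V =
     1 / (4 * pi) *
     Re (L2_inner (abs_root V)
           (L2_inverse (\<lambda>f x. f x + birman_schwinger V f x) (sgn_root V)))"

text \<open>
  On the null set \<open>p\<^sup>2 = \<mu>\<close> this is \<open>0 / 0 = 0\<close> instead of the limit \<open>2 T\<close>, which does not
  affect the multiplication operator.
\<close>

definition K_symbol :: "real \<Rightarrow> real \<Rightarrow> real^3 \<Rightarrow> real" where
  "K_symbol \<mu> T p = ((norm p)\<^sup>2 - \<mu>) / tanh (((norm p)\<^sup>2 - \<mu>) / (2 * T))"

text \<open>
  \<open>K\<^sub>T + V \<ge> 0\<close> as a quadratic form, on the intersection of the form domains of \<open>K\<^sub>T\<close> and \<open>V\<close>;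
  \<open>\<psi>'\<close> is the Fourier transform of \<open>\<psi>\<close>.
\<close>

definition K_plus_V_nonneg :: "(real^3 \<Rightarrow> real) \<Rightarrow> real \<Rightarrow> real \<Rightarrow> bool" where
  "K_plus_V_nonneg V \<mu> T \<longleftrightarrow>
     (\<forall>\<psi>\<in>L2. \<forall>\<psi>'. has_fourier \<psi> \<psi>' \<longrightarrow>
        integrable lebesgue (\<lambda>p. K_symbol \<mu> T p * (cmod (\<psi>' p))\<^sup>2) \<longrightarrow>
        integrable lebesgue (\<lambda>x. V x * (cmod (\<psi> x))\<^sup>2) \<longrightarrow>
        0 \<le> (LINT p|lebesgue. K_symbol \<mu> T p * (cmod (\<psi>' p))\<^sup>2)
             + (LINT x|lebesgue. V x * (cmod (\<psi> x))\<^sup>2))"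

definition critical_temperature :: "(real^3 \<Rightarrow> real) \<Rightarrow> real \<Rightarrow> real" where
  "critical_temperature V \<mu> = Inf {T. T > 0 \<and> K_plus_V_nonneg V \<mu> T}"

end

theory Submission
  imports Defs "HOL-Probability.Probability"
begin

text \<open>
  The spectral assumption says that \<open>p\<^sup>2 + e V\<close> has no zero mode for \<open>0 < e \<le> 1\<close>, which
  makes the form \<open>\<integral> |\<nabla>u|\<^sup>2 + V |u|\<^sup>2\<close> coercive for \<open>\<integral> |\<nabla>u|\<^sup>2\<close>. Hence there is a zero-energy
  scattering solution \<open>psi0 = 1 + u0\<close> of \<open>(p\<^sup>2 + V) psi0 = 0\<close> with \<open>\<nabla>u0 \<in> L\<^sup>2\<close>, and
  \<open>4 \<pi> a = \<integral> V psi0\<close> is the number \<open>G0\<close> below.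

  Since \<open>K\<^sub>T\<close> is small only near \<open>|p| = \<surd>\<mu>\<close>, at momenta tending to \<open>0\<close>, a bound state of \<open>K\<^sub>T + V\<close> looks like a
  multiple of \<open>psi0\<close> on the scale of \<open>V\<close>. Completing squares around \<open>c psi0\<close> shows that, up to errors
  \<open>o(\<surd>\<mu>)\<close>, positivity of \<open>K\<^sub>T + V\<close> is positivity of \<open>|c|\<^sup>2 (1 / gap_int + G0)\<close>, where \<open>gap_int\<close> is
  \<open>(2\<pi>)\<^sup>-\<^sup>3 \<integral> (1/K\<^sub>T - 1/p\<^sup>2)\<close>. The trial function \<open>-K\<^sub>T\<^sup>-\<^sup>1 V psi0\<close> gives the converse. The weight
  \<open>1 + |x|\<close> on \<open>V\<close> is what makes the errors \<open>o(\<surd>\<mu>)\<close>.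

  As \<open>\<mu>/T \<rightarrow> \<infinity>\<close>, \<open>gap_int = (\<surd>\<mu> / 2\<pi>\<^sup>2) (ln (\<mu>/T) + \<gamma> - 2 + ln (8/\<pi>) + o(1))\<close>. Setting this equal to
  \<open>-1 / G0 = -1 / (4 \<pi> a)\<close> and solving for \<open>ln (\<mu>/T)\<close> yields the limit.
\<close>

subsection \<open>Square-integrable functions\<close>

text \<open>A shift of \<open>ln (\<mu>/T)\<close> by a fixed \<sigma> moves \<open>gap_int\<close>
  by only about \<sigma> sqrt \<mu> / (2 pi^2) near \<open>-1 / G0\<close>. An error of order sqrt
  \<mu> in the forms would therefore already spoil the constant in the limit, and every estimate has
  to gain a little more. The errors come from the deviation of a function with momenta near sqrt
  \<mu> from a constant. That deviation is o(sqrt \<mu>) pointwise only because the part of the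
  kernel that is odd in p cancels; its majorant is a multiple of sqrt \<mu> (1 + |x|). Two obstacles
  shape the rest. \<open>F0\<close> behaves like a multiple of 1/p^2 at zero momentum, so the
  scattering solution leaves L^2 and the Fourier transform is developed for functions that are
  integrable on balls and square integrable far out. And 1/K_T - 1/p^2 changes sign, so it cannot
  serve as a weight in a Cauchy-Schwarz argument; since the integral of its negative part is itself
  of order sqrt \<mu>, that part cannot be thrown away either.\<close>

lemma sigma_finite_completion:
  assumes "sigma_finite_measure M" shows "sigma_finite_measure (completion M)"
proof -
  interpret sigma_finite_measure M by fact
  obtain A where A: "countable A" "A \<subseteq> sets M" "\<Union>A = space M" "\<forall>a\<in>A. emeasure M a \<noteq> \<infinity>"
    using sigma_finite_countable by blast
  show ?thesis
    by standard (use A in \<open>auto intro!: exI[of _ A]\<close>)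
qed

interpretation leb: sigma_finite_measure "lebesgue :: (real^3) measure"
  by (rule sigma_finite_completion) (rule sigma_finite_lborel)

interpretation leb_pair: pair_sigma_finite "lebesgue :: (real^3) measure" "lebesgue :: (real^3) measure" ..

lemma measurable_id_lebesgue [measurable (raw)]: "(\<lambda>x. x) \<in> borel_measurable lebesgue"
  using measurable_completion[of id lborel borel] by (simp add: id_def)

lemma borel_imp_lebesgue: "f \<in> borel_measurable borel \<Longrightarrow> f \<in> borel_measurable lebesgue"
  by (rule measurable_completion) simp

lemma measurable_cis [measurable]: "cis \<in> borel_measurable borel"
  by (intro borel_measurable_continuous_onI continuous_intros)

lemma measurable_cnj [measurable]: "cnj \<in> borel_measurable borel"
  by (intro borel_measurable_continuous_onI continuous_intros)

lemma measurable_fst_lebesgue [measurable (raw)]: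
  "fst \<in> borel_measurable ((lebesgue :: 'a::euclidean_space measure) \<Otimes>\<^sub>M N)"
  by (rule measurable_compose[OF measurable_fst measurable_id_lebesgue])

lemma measurable_snd_lebesgue [measurable (raw)]:
  "snd \<in> borel_measurable (N \<Otimes>\<^sub>M (lebesgue :: 'a::euclidean_space measure))"
  by (rule measurable_compose[OF measurable_snd measurable_id_lebesgue])

lemma norm_add_sq_le: "(norm (a + b :: 'a::real_normed_vector))\<^sup>2 \<le> 2 * (norm a)\<^sup>2 + 2 * (norm b)\<^sup>2"
proof -
  have "(norm (a + b))\<^sup>2 \<le> (norm a + norm b)\<^sup>2"
    by (intro power_mono norm_triangle_ineq) auto
  also have "\<dots> \<le> 2 * (norm a)\<^sup>2 + 2 * (norm b)\<^sup>2"
    using sum_squares_bound[of "norm a" "norm b"] by (simp add: power2_sum)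
  finally show ?thesis .
qed

lemma L2_measurable [measurable_dest]: "f \<in> L2 \<Longrightarrow> f \<in> borel_measurable lebesgue"
  by (simp add: L2_def)

lemma L2_integrable: "f \<in> L2 \<Longrightarrow> integrable lebesgue (\<lambda>x. (cmod (f x))\<^sup>2)"
  by (simp add: L2_def)

lemma L2I: "f \<in> borel_measurable lebesgue \<Longrightarrow> integrable lebesgue (\<lambda>x. (cmod (f x))\<^sup>2) \<Longrightarrow> f \<in> L2"
  by (simp add: L2_def)

lemma L2_iff_nn_integral:
  assumes "f \<in> borel_measurable lebesgue"
  shows "f \<in> L2 \<longleftrightarrow> (\<integral>\<^sup>+x. ennreal ((cmod (f x))\<^sup>2) \<partial>lebesgue) < \<infinity>"
  using assms by (auto simp: L2_def integrable_iff_bounded)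

lemma L2_norm_nonneg [simp]: "0 \<le> L2_norm f"
  by (simp add: L2_norm_def)

lemma L2_norm_sq: "(L2_norm f)\<^sup>2 = (LINT x|lebesgue. (cmod (f x))\<^sup>2)"
  by (simp add: L2_norm_def)

lemma nn_integral_L2: "f \<in> L2 \<Longrightarrow> (\<integral>\<^sup>+x. ennreal ((cmod (f x))\<^sup>2) \<partial>lebesgue) = ennreal ((L2_norm f)\<^sup>2)"
  unfolding L2_norm_sq by (rule nn_integral_eq_integral[OF L2_integrable]) auto

lemma L2_dominated:
  assumes "g \<in> L2" and [measurable]: "f \<in> borel_measurable lebesgue"
    and le: "AE x in lebesgue. cmod (f x) \<le> cmod (g x)"
  shows "f \<in> L2"
proof (rule L2I)
  show "integrable lebesgue (\<lambda>x. (cmod (f x))\<^sup>2)"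
    by (rule Bochner_Integration.integrable_bound[OF L2_integrable[OF assms(1)]])
       (measurable, use le in \<open>auto elim!: eventually_mono intro!: power_mono\<close>)
qed fact

lemma L2_add: "f \<in> L2 \<Longrightarrow> g \<in> L2 \<Longrightarrow> (\<lambda>x. f x + g x) \<in> L2"
proof (rule L2I)
  assume [measurable]: "f \<in> L2" "g \<in> L2"
  show "(\<lambda>x. f x + g x) \<in> borel_measurable lebesgue" by measurable
  show "integrable lebesgue (\<lambda>x. (cmod (f x + g x))\<^sup>2)"
    by (rule Bochner_Integration.integrable_bound
          [of _ "\<lambda>x. 2 * (cmod (f x))\<^sup>2 + 2 * (cmod (g x))\<^sup>2"])
       (use norm_add_sq_le[of "f _" "g _"] in \<open>auto intro!: L2_integrable \<open>f \<in> L2\<close> \<open>g \<in> L2\<close>\<close>)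
qed

lemma L2_scale: "f \<in> L2 \<Longrightarrow> (\<lambda>x. c * f x) \<in> L2"
proof (rule L2I)
  assume [measurable]: "f \<in> L2"
  show "(\<lambda>x. c * f x) \<in> borel_measurable lebesgue" by measurable
  show "integrable lebesgue (\<lambda>x. (cmod (c * f x))\<^sup>2)"
    using L2_integrable[OF \<open>f \<in> L2\<close>] by (simp add: norm_mult power_mult_distrib)
qed

lemma L2_uminus: "f \<in> L2 \<Longrightarrow> (\<lambda>x. - f x) \<in> L2"
  using L2_scale[of f "-1"] by simp

lemma L2_diff: "f \<in> L2 \<Longrightarrow> g \<in> L2 \<Longrightarrow> (\<lambda>x. f x - g x) \<in> L2"
  using L2_add[OF _ L2_uminus, of f g] by simp

lemma L2_cong_AE:
  assumes "f \<in> L2" "g \<in> borel_measurable lebesgue" "AE x in lebesgue. f x = g x"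
  shows "g \<in> L2"
  by (rule L2_dominated[OF assms(1,2)]) (use assms(3) in auto)

lemma L2_cmod_mult_integrable:
  assumes [measurable]: "f \<in> L2" "g \<in> L2"
  shows "integrable lebesgue (\<lambda>x. cmod (f x) * cmod (g x))"
proof (rule Bochner_Integration.integrable_bound [of _ "\<lambda>x. (cmod (f x))\<^sup>2 + (cmod (g x))\<^sup>2"])
  show "AE x in lebesgue. norm (cmod (f x) * cmod (g x)) \<le> norm ((cmod (f x))\<^sup>2 + (cmod (g x))\<^sup>2)"
  proof (rule AE_I2)
    fix x
    have "2 * (cmod (f x) * cmod (g x)) \<le> (cmod (f x))\<^sup>2 + (cmod (g x))\<^sup>2"
      using sum_squares_bound[of "cmod (f x)" "cmod (g x)"] by (simp add: algebra_simps)
    moreover have "0 \<le> cmod (f x) * cmod (g x)" by simp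
    ultimately show "norm (cmod (f x) * cmod (g x)) \<le> norm ((cmod (f x))\<^sup>2 + (cmod (g x))\<^sup>2)"
      unfolding real_norm_def by linarith
  qed
qed (use assms in \<open>auto intro!: L2_integrable\<close>)

lemma L2_mult_integrable:
  assumes [measurable]: "f \<in> L2" "g \<in> L2"
  shows "integrable lebesgue (\<lambda>x. f x * g x)"
  by (rule Bochner_Integration.integrable_bound[OF L2_cmod_mult_integrable[OF assms]]) (auto simp: norm_mult)

lemma L2_inner_integrable:
  assumes [measurable]: "f \<in> L2" "g \<in> L2"
  shows "integrable lebesgue (\<lambda>x. cnj (f x) * g x)"
  by (rule Bochner_Integration.integrable_bound[OF L2_cmod_mult_integrable[OF assms]]) (auto simp: norm_mult)

lemma L2_inner_add_right:
  "f \<in> L2 \<Longrightarrow> g \<in> L2 \<Longrightarrow> h \<in> L2 \<Longrightarrow> L2_inner f (\<lambda>x. g x + h x) = L2_inner f g + L2_inner f h"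
  by (simp add: L2_inner_def ring_distribs L2_inner_integrable)

lemma L2_inner_scale_right: "L2_inner f (\<lambda>x. c * g x) = c * L2_inner f g"
  by (simp add: L2_inner_def mult.left_commute[of _ c])

lemma L2_inner_cnj: "L2_inner g f = cnj (L2_inner f g)"
  unfolding L2_inner_def
  by (subst Bochner_Integration.integral_cnj[symmetric]) (simp add: mult.commute)

lemma L2_inner_add_left:
  "f \<in> L2 \<Longrightarrow> g \<in> L2 \<Longrightarrow> h \<in> L2 \<Longrightarrow> L2_inner (\<lambda>x. g x + h x) f = L2_inner g f + L2_inner h f"
  by (subst (1 2 3) L2_inner_cnj) (simp add: L2_inner_add_right)

lemma L2_inner_scale_left: "L2_inner (\<lambda>x. c * g x) f = cnj c * L2_inner g f"
  by (subst (1 2) L2_inner_cnj) (simp add: L2_inner_scale_right)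

lemma L2_inner_self: "L2_inner f f = complex_of_real ((L2_norm f)\<^sup>2)"
proof -
  have "L2_inner f f = (LINT x|lebesgue. complex_of_real ((cmod (f x))\<^sup>2))"
    unfolding L2_inner_def by (simp only: complex_norm_square[symmetric] mult.commute[of "cnj _"])
  then show ?thesis by (simp only: L2_norm_sq integral_complex_of_real)
qed

lemma L2_inner_cong_AE:
  assumes [measurable]: "f \<in> borel_measurable lebesgue" "f' \<in> borel_measurable lebesgue"
    "g \<in> borel_measurable lebesgue" "g' \<in> borel_measurable lebesgue"
    and "AE x in lebesgue. f x = f' x" "AE x in lebesgue. g x = g' x"
  shows "L2_inner f g = L2_inner f' g'"
  unfolding L2_inner_def by (rule integral_cong_AE) (use assms in auto)

lemma L2_norm_cong_AE:
  assumes [measurable]: "f \<in> borel_measurable lebesgue" "f' \<in> borel_measurable lebesgue"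
    and "AE x in lebesgue. f x = f' x"
  shows "L2_norm f = L2_norm f'"
  unfolding L2_norm_def by (rule arg_cong[of _ _ sqrt], rule integral_cong_AE) (use assms in auto)

lemma L2_norm_add_sq:
  assumes "f \<in> L2" "g \<in> L2"
  shows "(L2_norm (\<lambda>x. f x + g x))\<^sup>2 = (L2_norm f)\<^sup>2 + 2 * Re (L2_inner f g) + (L2_norm g)\<^sup>2"
proof -
  have "complex_of_real ((L2_norm (\<lambda>x. f x + g x))\<^sup>2) =
      L2_inner f f + (L2_inner f g + cnj (L2_inner f g)) + L2_inner g g"
    unfolding L2_inner_self[symmetric] L2_inner_cnj[of g f, symmetric]
    using assms by (simp add: L2_inner_add_left L2_inner_add_right L2_add)
  also have "\<dots> = complex_of_real ((L2_norm f)\<^sup>2 + 2 * Re (L2_inner f g) + (L2_norm g)\<^sup>2)"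
    by (simp add: L2_inner_self complex_add_cnj)
  finally show ?thesis using of_real_eq_iff by blast
qed

lemma L2_norm_scale: "L2_norm (\<lambda>x. c * f x) = cmod c * L2_norm f"
  by (simp add: L2_norm_def norm_mult power_mult_distrib real_sqrt_mult)

lemma L2_norm_uminus: "L2_norm (\<lambda>x. - f x) = L2_norm f"
  by (simp add: L2_norm_def)

lemma L2_norm_diff_sq:
  assumes "f \<in> L2" "g \<in> L2"
  shows "(L2_norm (\<lambda>x. f x - g x))\<^sup>2 = (L2_norm f)\<^sup>2 - 2 * Re (L2_inner f g) + (L2_norm g)\<^sup>2"
  using L2_norm_add_sq[OF assms(1) L2_uminus[OF assms(2)]] L2_inner_scale_right[of f "-1" g]
  by (simp add: L2_norm_uminus)

text \<open>Integrating \<open>(t * |f| - |g|)^2\<close> gives a quadratic inequality valid for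
  every \<open>t\<close>. The optimal \<open>t\<close> is the quotient of the norms; when a norm
  vanishes, other values of \<open>t\<close> force the integral to be 0.\<close>

lemma L2_Cauchy_Schwarz_cmod:
  assumes "f \<in> L2" "g \<in> L2"
  shows "(LINT x|lebesgue. cmod (f x) * cmod (g x)) \<le> L2_norm f * L2_norm g"
proof -
  let ?I = "LINT x|lebesgue. cmod (f x) * cmod (g x)"
  have I: "0 \<le> ?I" by (intro integral_nonneg_AE) auto
  have *: "2 * t * ?I \<le> t\<^sup>2 * (L2_norm f)\<^sup>2 + (L2_norm g)\<^sup>2" for t
  proof -
    have "2 * t * ?I = (LINT x|lebesgue. 2 * t * (cmod (f x) * cmod (g x)))" by simp
    also have "\<dots> \<le> (LINT x|lebesgue. t\<^sup>2 * (cmod (f x))\<^sup>2 + (cmod (g x))\<^sup>2)"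
    proof (rule integral_mono)
      fix x show "2 * t * (cmod (f x) * cmod (g x)) \<le> t\<^sup>2 * (cmod (f x))\<^sup>2 + (cmod (g x))\<^sup>2"
        using sum_squares_bound[of "t * cmod (f x)" "cmod (g x)"] by (simp add: algebra_simps power_mult_distrib)
    qed (use assms L2_cmod_mult_integrable in \<open>auto intro!: L2_integrable\<close>)
    also have "\<dots> = t\<^sup>2 * (L2_norm f)\<^sup>2 + (L2_norm g)\<^sup>2"
      using assms by (simp add: L2_norm_sq L2_integrable)
    finally show ?thesis .
  qed
  show ?thesis
  proof (cases "L2_norm f = 0")
    case True
    have "?I = 0"
    proof (rule ccontr)
      assume "?I \<noteq> 0"
      then have "0 < ?I" using I by linarith
      \<comment> \<open>With \<open>L2_norm f = 0\<close> the inequality reads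
        \<open>2 * t * I \<le> |g|^2\<close>. This \<open>t\<close> makes it
        \<open>2 * |g|^2 \<le> |g|^2\<close>, so the norm of \<open>g\<close> vanishes too, and
        \<open>t = 1\<close> then contradicts \<open>0 < I\<close>.\<close>
      have "2 * ((L2_norm g)\<^sup>2 / ?I) * ?I \<le> (L2_norm g)\<^sup>2" using *[of "(L2_norm g)\<^sup>2 / ?I"] True by simp
      then have "(L2_norm g)\<^sup>2 \<le> 0" using \<open>0 < ?I\<close> by simp
      then have "2 * 1 * ?I \<le> 0" using *[of 1] True by simp
      then show False using \<open>0 < ?I\<close> by simp
    qed
    then show ?thesis by simp
  next
    case False
    then have f: "0 < L2_norm f" using L2_norm_nonneg[of f] by linarith
    have "2 * (L2_norm g / L2_norm f) * ?I \<le> 2 * (L2_norm g)\<^sup>2"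
      using *[of "L2_norm g / L2_norm f"] f by (simp add: power_divide)
    then have le: "L2_norm g * ?I \<le> L2_norm f * (L2_norm g)\<^sup>2"
      using f by (simp add: field_simps)
    show ?thesis
    proof (cases "L2_norm g = 0")
      case True
      show ?thesis
      proof (rule ccontr)
        assume "\<not> ?thesis"
        then have "0 < ?I" using True by simp
        \<comment> \<open>Here the inequality reads \<open>2 * t * I \<le> t^2 * |f|^2\<close>; at
          this \<open>t\<close> its sides are \<open>2 * I^2 / |f|^2\<close> and
          \<open>I^2 / |f|^2\<close>.\<close>
        have "2 * (?I / (L2_norm f)\<^sup>2) * ?I \<le> ?I\<^sup>2 / (L2_norm f)\<^sup>2" 
          using *[of "?I / (L2_norm f)\<^sup>2"] f True by (simp add: power2_eq_square)
        then show False using \<open>0 < ?I\<close> f by (simp add: power2_eq_square field_simps)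
      qed
    next
      case False
      then have "0 < L2_norm g" using L2_norm_nonneg[of g] by linarith
      then show ?thesis using le by (simp add: power2_eq_square)
    qed
  qed
qed

lemma L2_Cauchy_Schwarz:
  assumes "f \<in> L2" "g \<in> L2"
  shows "cmod (L2_inner f g) \<le> L2_norm f * L2_norm g"
proof -
  have "cmod (L2_inner f g) \<le> (LINT x|lebesgue. cmod (cnj (f x) * g x))"
    unfolding L2_inner_def by (rule integral_norm_bound)
  then show ?thesis using L2_Cauchy_Schwarz_cmod[OF assms] by (simp add: norm_mult)
qed

lemma L2_norm_triangle:
  assumes "f \<in> L2" "g \<in> L2"
  shows "L2_norm (\<lambda>x. f x + g x) \<le> L2_norm f + L2_norm g"
proof (rule power2_le_imp_le)
  have "Re (L2_inner f g) \<le> L2_norm f * L2_norm g"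
    using L2_Cauchy_Schwarz[OF assms] complex_Re_le_cmod order_trans by blast
  then show "(L2_norm (\<lambda>x. f x + g x))\<^sup>2 \<le> (L2_norm f + L2_norm g)\<^sup>2"
    unfolding L2_norm_add_sq[OF assms] power2_sum by simp
qed simp

lemma L2_norm_mono:
  assumes "g \<in> L2" "\<And>x. cmod (f x) \<le> cmod (g x)" 
  shows "L2_norm f \<le> L2_norm g"
  unfolding L2_norm_def
  by (rule real_sqrt_le_mono, rule integral_mono_AE')
     (use assms L2_integrable in \<open>auto intro!: power_mono\<close>)

lemma nn_integral_cmod_add_sq_le:
  assumes [measurable]: "f \<in> borel_measurable M" "g \<in> borel_measurable M"
  shows "(\<integral>\<^sup>+x. ennreal ((cmod (f x + g x))\<^sup>2) \<partial>M) \<le>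
    2 * (\<integral>\<^sup>+x. ennreal ((cmod (f x))\<^sup>2) \<partial>M) + 2 * (\<integral>\<^sup>+x. ennreal ((cmod (g x))\<^sup>2) \<partial>M)"
proof -
  have "(\<integral>\<^sup>+x. ennreal ((cmod (f x + g x))\<^sup>2) \<partial>M) \<le>
    (\<integral>\<^sup>+x. 2 * ennreal ((cmod (f x))\<^sup>2) + 2 * ennreal ((cmod (g x))\<^sup>2) \<partial>M)"
  proof (rule nn_integral_mono)
    fix x
    have "ennreal ((cmod (f x + g x))\<^sup>2) \<le> ennreal (2 * (cmod (f x))\<^sup>2 + 2 * (cmod (g x))\<^sup>2)"
      by (rule ennreal_leI[OF norm_add_sq_le])
    also have "\<dots> = 2 * ennreal ((cmod (f x))\<^sup>2) + 2 * ennreal ((cmod (g x))\<^sup>2)"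
      by (simp add: ennreal_plus ennreal_mult)
    finally show "ennreal ((cmod (f x + g x))\<^sup>2) \<le> 2 * ennreal ((cmod (f x))\<^sup>2) + 2 * ennreal ((cmod (g x))\<^sup>2)" .
  qed
  also have "\<dots> = 2 * (\<integral>\<^sup>+x. ennreal ((cmod (f x))\<^sup>2) \<partial>M) + 2 * (\<integral>\<^sup>+x. ennreal ((cmod (g x))\<^sup>2) \<partial>M)"
    by (simp add: nn_integral_add nn_integral_cmult)
  finally show ?thesis .
qed

text \<open>Fatou's lemma, in the form in which a Cauchy bound passes to the limit function.\<close>

lemma nn_integral_cmod_diff_sq_lim_le:
  assumes [measurable]: "\<And>n::nat. u n \<in> borel_measurable M" "g \<in> borel_measurable M" "f \<in> borel_measurable M"
    and lim: "AE x in M. (\<lambda>n. u n x) \<longlonglongrightarrow> f x"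
    and le: "eventually (\<lambda>n. (\<integral>\<^sup>+x. ennreal ((cmod (u n x - g x))\<^sup>2) \<partial>M) \<le> c) sequentially"
  shows "(\<integral>\<^sup>+x. ennreal ((cmod (f x - g x))\<^sup>2) \<partial>M) \<le> c"
proof -
  have "(\<integral>\<^sup>+x. ennreal ((cmod (f x - g x))\<^sup>2) \<partial>M) =
      (\<integral>\<^sup>+x. liminf (\<lambda>n. ennreal ((cmod (u n x - g x))\<^sup>2)) \<partial>M)"
  proof (rule nn_integral_cong_AE)
    show "AE x in M. ennreal ((cmod (f x - g x))\<^sup>2) = liminf (\<lambda>n. ennreal ((cmod (u n x - g x))\<^sup>2))"
      using lim
    proof eventually_elim
      case (elim x)
      have "(\<lambda>n. ennreal ((cmod (u n x - g x))\<^sup>2)) \<longlonglongrightarrow> ennreal ((cmod (f x - g x))\<^sup>2)"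
        by (intro tendsto_ennrealI tendsto_intros elim)
      then show ?case by (intro lim_imp_Liminf[symmetric]) auto
    qed
  qed
  also have "\<dots> \<le> liminf (\<lambda>n. \<integral>\<^sup>+x. ennreal ((cmod (u n x - g x))\<^sup>2) \<partial>M)"
    by (rule nn_integral_liminf) measurable
  also have "\<dots> \<le> c"
  proof -
    have "liminf (\<lambda>n. \<integral>\<^sup>+x. ennreal ((cmod (u n x - g x))\<^sup>2) \<partial>M) \<le> liminf (\<lambda>n. c)"
      by (rule Liminf_mono) (use le in simp)
    then show ?thesis by (simp add: Liminf_const)
  qed
  finally show ?thesis .
qed

section \<open>Completeness of L^2 along a real cutoff parameter\<close>

definition L2_Cauchy :: "(real \<Rightarrow> real^3 \<Rightarrow> complex) \<Rightarrow> bool" where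
  "L2_Cauchy u \<longleftrightarrow> (\<forall>R. u R \<in> borel_measurable lebesgue) \<and>
     (\<forall>e>0. \<exists>R0. \<forall>R\<ge>R0. \<forall>S\<ge>R0. (\<integral>\<^sup>+x. ennreal ((cmod (u R x - u S x))\<^sup>2) \<partial>lebesgue) \<le> ennreal e)"

lemma L2_CauchyD:
  "L2_Cauchy u \<Longrightarrow> e > 0 \<Longrightarrow>
    \<exists>R0. \<forall>R\<ge>R0. \<forall>S\<ge>R0. (\<integral>\<^sup>+x. ennreal ((cmod (u R x - u S x))\<^sup>2) \<partial>lebesgue) \<le> ennreal e"
  by (simp add: L2_Cauchy_def)

lemma L2_limitI:
  assumes "f \<in> borel_measurable lebesgue"
    and "\<And>e. e > 0 \<Longrightarrow> eventually (\<lambda>R. (\<integral>\<^sup>+x. ennreal ((cmod (u R x - f x))\<^sup>2) \<partial>lebesgue) \<le> ennreal e) at_top"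
  shows "L2_limit u f"
  unfolding L2_limit_def
proof (intro conjI assms(1) order_tendstoI)
  fix a :: ennreal assume "0 < a"
  then obtain e where e: "0 < e" "ennreal e < a"
  proof (cases a)
    case (real r)
    with \<open>0 < a\<close> show ?thesis by (intro that[of "r/2"]) (auto simp: ennreal_lessI)
  next
    case top
    then show ?thesis by (intro that[of 1]) auto
  qed
  show "eventually (\<lambda>R. (\<integral>\<^sup>+x. ennreal ((cmod (u R x - f x))\<^sup>2) \<partial>lebesgue) < a) at_top"
    using assms(2)[OF e(1)] by eventually_elim (use e(2) in auto)
qed auto

text \<open>Used to identify an L^2-limit: almost everywhere convergence along one sequence of
  cutoffs suffices, because Fatou turns the Cauchy bound for \<open>u (r n) - u R\<close> into a
  bound for \<open>f - u R\<close>.\<close>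

lemma L2_limit_of_pointwise:
  assumes C: "L2_Cauchy u" and r: "filterlim r at_top sequentially"
    and f: "f \<in> borel_measurable lebesgue" and lim: "AE x in lebesgue. (\<lambda>n. u (r n) x) \<longlonglongrightarrow> f x"
  shows "L2_limit u f"
proof (rule L2_limitI[OF f])
  fix e :: real assume "e > 0"
  have [measurable]: "\<And>R. u R \<in> borel_measurable lebesgue" using C by (simp add: L2_Cauchy_def)
  obtain R0 where R0: "\<And>R S. R \<ge> R0 \<Longrightarrow> S \<ge> R0 \<Longrightarrow>
      (\<integral>\<^sup>+x. ennreal ((cmod (u R x - u S x))\<^sup>2) \<partial>lebesgue) \<le> ennreal e"
    using L2_CauchyD[OF C \<open>e > 0\<close>] by metis
  have "(\<integral>\<^sup>+x. ennreal ((cmod (f x - u R x))\<^sup>2) \<partial>lebesgue) \<le> ennreal e" if "R \<ge> R0" for R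
  proof (rule nn_integral_cmod_diff_sq_lim_le[OF _ _ f lim])
    have "eventually (\<lambda>n. r n \<ge> R0) sequentially" using r by (simp add: filterlim_at_top)
    then show "eventually (\<lambda>n. (\<integral>\<^sup>+x. ennreal ((cmod (u (r n) x - u R x))\<^sup>2) \<partial>lebesgue) \<le> ennreal e) sequentially"
      by eventually_elim (use R0 that in blast)
  qed auto
  then show "eventually (\<lambda>R. (\<integral>\<^sup>+x. ennreal ((cmod (u R x - f x))\<^sup>2) \<partial>lebesgue) \<le> ennreal e) at_top"
    by (subst norm_minus_commute) (auto simp: eventually_at_top_linorder)
qed

text \<open>The classical argument with a fast subsequence. The members of the family need not be
  square integrable themselves, only their differences; this matters for truncated transforms of
  functions outside \<open>L2\<close>.\<close>

theorem Riesz_Fischer: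
  assumes C: "L2_Cauchy u"
  shows "\<exists>f. L2_limit u f"
proof -
  have [measurable]: "\<And>R. u R \<in> borel_measurable lebesgue" using C by (simp add: L2_Cauchy_def)
  have "\<forall>k. \<exists>R0. \<forall>R\<ge>R0. \<forall>S\<ge>R0. (\<integral>\<^sup>+x. ennreal ((cmod (u R x - u S x))\<^sup>2) \<partial>lebesgue) \<le> ennreal ((1/8) ^ k)"
    by (intro allI L2_CauchyD[OF C]) simp
  from choice[OF this] obtain r0 :: "nat \<Rightarrow> real" where r0': "\<forall>k. \<forall>R\<ge>r0 k. \<forall>S\<ge>r0 k.
      (\<integral>\<^sup>+x. ennreal ((cmod (u R x - u S x))\<^sup>2) \<partial>lebesgue) \<le> ennreal ((1/8) ^ k)" ..
  have r0: "(\<integral>\<^sup>+x. ennreal ((cmod (u R x - u S x))\<^sup>2) \<partial>lebesgue) \<le> ennreal ((1/8) ^ k)"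
    if "R \<ge> r0 k" "S \<ge> r0 k" for k R S
    using r0'[THEN spec, THEN spec, THEN mp, OF that(1), THEN spec, THEN mp, OF that(2)] .
  \<comment> \<open>The sum of all previous thresholds makes \<open>r\<close> increasing and at
    least \<open>r0 n\<close>; the summand \<open>n\<close> makes it unbounded.\<close>
  define r where "r n = real n + (\<Sum>k\<le>n. \<bar>r0 k\<bar>)" for n
  have r_ge: "r0 n \<le> r n" for n
  proof -
    have "\<bar>r0 n\<bar> \<le> (\<Sum>k\<le>n. \<bar>r0 k\<bar>)" by (rule member_le_sum) auto
    then show ?thesis by (simp add: r_def)
  qed
  have r_mono: "r n \<le> r (Suc n)" for n by (simp add: r_def)
  have r_top: "filterlim r at_top sequentially"
    by (rule filterlim_at_top_mono[OF filterlim_real_sequentially]) (auto simp: r_def intro!: sum_nonneg)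
  \<comment> \<open>The squared norms of these differences are at most \<open>8^-n\<close>, so they
    remain summable against the weight \<open>4^n\<close>. Almost everywhere finiteness of the
    weighted sum gives \<open>|d n x| \<le> 2^-n\<close> eventually, and the telescoping series
    converges.\<close>
  define d where "d n x = u (r (Suc n)) x - u (r n) x" for n x
  have [measurable]: "\<And>n. d n \<in> borel_measurable lebesgue" unfolding d_def by measurable
  have "(\<integral>\<^sup>+x. (\<Sum>n. ennreal (4^n * (cmod (d n x))\<^sup>2)) \<partial>lebesgue) =
      (\<Sum>n. \<integral>\<^sup>+x. ennreal (4^n * (cmod (d n x))\<^sup>2) \<partial>lebesgue)"
    by (rule nn_integral_suminf) measurable
  also have "\<dots> \<le> (\<Sum>n. ennreal ((1/2) ^ n))"
  proof (rule suminf_le)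
    fix n
    have "(\<integral>\<^sup>+x. ennreal (4^n * (cmod (d n x))\<^sup>2) \<partial>lebesgue) =
        ennreal (4^n) * (\<integral>\<^sup>+x. ennreal ((cmod (d n x))\<^sup>2) \<partial>lebesgue)"
      by (simp add: ennreal_mult nn_integral_cmult del: ennreal_power)
    also have "\<dots> \<le> ennreal (4^n) * ennreal ((1/8) ^ n)"
      unfolding d_def by (intro mult_left_mono r0 r_ge order_trans[OF r_ge r_mono]) simp
    also have "\<dots> = ennreal ((1/2) ^ n)"
      by (subst ennreal_mult[symmetric]) (simp_all add: power_mult_distrib[symmetric] del: power_mult_distrib)
    finally show "(\<integral>\<^sup>+x. ennreal (4^n * (cmod (d n x))\<^sup>2) \<partial>lebesgue) \<le> ennreal ((1/2) ^ n)" .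
  qed auto
  also have "\<dots> < \<infinity>"
  proof -
    have "(\<lambda>n. (1/2::real) ^ n) sums 2" using geometric_sums[of "1/2::real"] by simp
    have "(\<Sum>n. ennreal ((1/2) ^ n)) = ennreal 2" by (rule suminf_ennreal_eq) (simp, fact)
    then show ?thesis by (simp only:) simp
  qed
  finally have fin: "AE x in lebesgue. (\<Sum>n. ennreal (4^n * (cmod (d n x))\<^sup>2)) \<noteq> \<infinity>"
    by (intro nn_integral_PInf_AE) auto
  define f where "f x = lim (\<lambda>n. u (r n) x)" for x
  have fm: "f \<in> borel_measurable lebesgue" unfolding f_def by (rule borel_measurable_lim_metric) measurable
  have "AE x in lebesgue. (\<lambda>n. u (r n) x) \<longlonglongrightarrow> f x"
    using fin
  proof eventually_elim
    case (elim x)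
    have s: "summable (\<lambda>n. 4^n * (cmod (d n x))\<^sup>2)"
      by (rule summable_suminf_not_top) (use elim in auto)
    then have "(\<lambda>n. 4^n * (cmod (d n x))\<^sup>2) \<longlonglongrightarrow> 0" by (rule summable_LIMSEQ_zero)
    then have "eventually (\<lambda>n. 4^n * (cmod (d n x))\<^sup>2 < 1) sequentially"
      by (rule order_tendstoD) simp
    then have "eventually (\<lambda>n. cmod (d n x) \<le> (1/2) ^ n) sequentially"
    proof eventually_elim
      case (elim n)
      have four: "(4::real) ^ n = 2 ^ n * 2 ^ n" by (subst power_mult_distrib[symmetric]) simp
      have "(cmod (d n x) * 2^n)\<^sup>2 \<le> 1\<^sup>2"
        using elim unfolding four by (simp add: power2_eq_square ac_simps)
      then have "cmod (d n x) * 2^n \<le> 1" by (rule power2_le_imp_le) simp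
      then show ?case by (simp add: field_simps power_divide)
    qed
    moreover have "summable (\<lambda>n. (1/2::real) ^ n)" by (rule summable_geometric) simp
    ultimately have "summable (\<lambda>n. d n x)"
      using summable_comparison_test_ev[of "\<lambda>n. d n x" "\<lambda>n. (1/2) ^ n"] by simp
    then have "convergent (\<lambda>n. \<Sum>k<n. d k x)" by (simp add: summable_iff_convergent)
    also have "(\<lambda>n. \<Sum>k<n. d k x) = (\<lambda>n. u (r n) x - u (r 0) x)"
      using sum_lessThan_telescope[of "\<lambda>n. u (r n) x"] by (auto simp: d_def)
    finally have "convergent (\<lambda>n. u (r n) x - u (r 0) x + u (r 0) x)"
      by (intro convergent_add) (auto simp: convergent_const)
    then show ?case unfolding f_def by (simp add: convergent_LIMSEQ_iff)
  qed
  from L2_limit_of_pointwise[OF C r_top fm this] show ?thesis by blast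
qed

lemma ennreal_tendsto_0_bound:
  fixes a b :: "'a \<Rightarrow> ennreal"
  assumes "(b \<longlongrightarrow> 0) F" "\<And>x. a x \<le> b x" shows "(a \<longlongrightarrow> 0) F"
  by (rule tendsto_sandwich[OF _ _ tendsto_const assms(1)]) (simp_all add: assms(2))

lemma L2_limit_measurable: "L2_limit u f \<Longrightarrow> f \<in> borel_measurable lebesgue"
  by (simp add: L2_limit_def)

lemma L2_limit_add:
  assumes u: "L2_limit u f" and v: "L2_limit v g"
    and [measurable]: "\<And>R. u R \<in> borel_measurable lebesgue" "\<And>R. v R \<in> borel_measurable lebesgue"
  shows "L2_limit (\<lambda>R x. u R x + v R x) (\<lambda>x. f x + g x)"
  unfolding L2_limit_def
proof
  note L2_limit_measurable[OF u, measurable] L2_limit_measurable[OF v, measurable]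
  show "(\<lambda>x. f x + g x) \<in> borel_measurable lebesgue" by measurable
  let ?b = "\<lambda>R. 2 * (\<integral>\<^sup>+x. ennreal ((cmod (u R x - f x))\<^sup>2) \<partial>lebesgue)
      + 2 * (\<integral>\<^sup>+x. ennreal ((cmod (v R x - g x))\<^sup>2) \<partial>lebesgue)"
  have lim: "(?b \<longlongrightarrow> 2 * 0 + 2 * 0) at_top"
    using u v unfolding L2_limit_def by (intro tendsto_add ennreal_tendsto_cmult) auto
  have le: "(\<integral>\<^sup>+x. ennreal ((cmod (u R x + v R x - (f x + g x)))\<^sup>2) \<partial>lebesgue) \<le> ?b R" for R
  proof -
    have "u R x + v R x - (f x + g x) = (u R x - f x) + (v R x - g x)" for x by simp
    then show ?thesis
      using nn_integral_cmod_add_sq_le[of "\<lambda>x. u R x - f x" lebesgue "\<lambda>x. v R x - g x"] by (simp only:) simp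
  qed
  show "((\<lambda>R. \<integral>\<^sup>+x. ennreal ((cmod (u R x + v R x - (f x + g x)))\<^sup>2) \<partial>lebesgue) \<longlongrightarrow> 0) at_top"
    by (rule ennreal_tendsto_0_bound[OF lim[unfolded mult_zero_right add_0_right] le])
qed

lemma L2_limit_scale:
  assumes u: "L2_limit u f" and [measurable]: "\<And>R. u R \<in> borel_measurable lebesgue"
  shows "L2_limit (\<lambda>R x. c * u R x) (\<lambda>x. c * f x)"
  unfolding L2_limit_def
proof
  note L2_limit_measurable[OF u, measurable]
  show "(\<lambda>x. c * f x) \<in> borel_measurable lebesgue" by measurable
  have "(\<integral>\<^sup>+x. ennreal ((cmod (c * u R x - c * f x))\<^sup>2) \<partial>lebesgue) =
      ennreal ((cmod c)\<^sup>2) * (\<integral>\<^sup>+x. ennreal ((cmod (u R x - f x))\<^sup>2) \<partial>lebesgue)" for R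
    by (simp add: right_diff_distrib[symmetric] norm_mult power_mult_distrib ennreal_mult nn_integral_cmult)
  moreover have "((\<lambda>R. ennreal ((cmod c)\<^sup>2) * (\<integral>\<^sup>+x. ennreal ((cmod (u R x - f x))\<^sup>2) \<partial>lebesgue))
      \<longlongrightarrow> ennreal ((cmod c)\<^sup>2) * 0) at_top"
    using u unfolding L2_limit_def by (intro ennreal_tendsto_cmult) auto
  ultimately show "((\<lambda>R. \<integral>\<^sup>+x. ennreal ((cmod (c * u R x - c * f x))\<^sup>2) \<partial>lebesgue) \<longlongrightarrow> 0) at_top"
    by simp
qed

subsection \<open>The Fourier transform of integrable functions\<close>

lemma real_tendsto_0_bound:
  fixes a b :: "'a \<Rightarrow> real"
  assumes "(b \<longlongrightarrow> 0) F" "\<And>x. 0 \<le> a x" "\<And>x. a x \<le> b x" shows "(a \<longlongrightarrow> 0) F"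
  by (rule tendsto_sandwich[OF _ _ tendsto_const assms(1)]) (simp_all add: assms(2,3))

lemma lborel_integrable_translate:
  fixes f :: "'a::euclidean_space \<Rightarrow> 'b::{banach,second_countable_topology}"
  assumes "integrable lborel f" shows "integrable lborel (\<lambda>x. f (h + x))"
proof -
  have "integrable (distr lborel borel ((+) h)) f" using assms by (simp add: lborel_distr_plus)
  then show ?thesis by (subst (asm) integrable_distr_eq) (use assms in auto)
qed

lemma lborel_integral_translate:
  fixes f :: "'a::euclidean_space \<Rightarrow> 'b::{banach,second_countable_topology}"
  assumes [measurable]: "f \<in> borel_measurable borel" shows "(LINT x|lborel. f (h + x)) = (LINT x|lborel. f x)"
proof -
  have "(LINT x|lborel. f x) = (LINT x|distr lborel borel ((+) h). f x)" by (simp add: lborel_distr_plus)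
  also have "\<dots> = (LINT x|lborel. f (h + x))" by (rule integral_distr) auto
  finally show ?thesis by simp
qed

lemma lborel_integral_affine:
  fixes f :: "'a::euclidean_space \<Rightarrow> 'b::{banach,second_countable_topology}"
  assumes [measurable]: "f \<in> borel_measurable borel" and c: "c \<noteq> 0"
  shows "(LINT x|lborel. f x) = \<bar>c\<bar>^DIM('a) *\<^sub>R (LINT x|lborel. f (t + c *\<^sub>R x))"
  by (subst lborel_affine[OF c, of t]) (simp add: integral_density integral_distr)

section \<open>Continuity of translations in the mean\<close>

definition L1_translation_continuous :: "('a::euclidean_space \<Rightarrow> real) \<Rightarrow> bool" where
  "L1_translation_continuous f \<longleftrightarrow>
     (\<forall>h. h \<longlonglongrightarrow> 0 \<longrightarrow> (\<lambda>n::nat. LINT x|lborel. \<bar>f (h n + x) - f x\<bar>) \<longlonglongrightarrow> 0)"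

text \<open>By translation invariance the translated error \<open>f - g\<close> is as small as the
  error itself. An approximation up to \<open>r/4\<close> therefore costs \<open>r/2\<close> and
  leaves \<open>r/2\<close> for the approximant.\<close>

lemma L1_translation_continuous_approx:
  assumes f: "integrable lborel f"
    and approx: "\<And>e. e > 0 \<Longrightarrow> \<exists>g. integrable lborel g \<and> L1_translation_continuous g \<and> (LINT x|lborel. \<bar>f x - g x\<bar>) \<le> e"
  shows "L1_translation_continuous f"
  unfolding L1_translation_continuous_def
proof safe
  fix h :: "nat \<Rightarrow> 'a" assume h: "h \<longlonglongrightarrow> 0"
  show "(\<lambda>n. LINT x|lborel. \<bar>f (h n + x) - f x\<bar>) \<longlonglongrightarrow> 0"
  proof (rule LIMSEQ_I)
    fix r :: real assume "r > 0"
    then obtain g where g: "integrable lborel g" "L1_translation_continuous g" "(LINT x|lborel. \<bar>f x - g x\<bar>) \<le> r/4"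
      using approx[of "r/4"] by auto
    note [measurable] = borel_measurable_integrable[OF f] borel_measurable_integrable[OF g(1)]
    have "(\<lambda>n. LINT x|lborel. \<bar>g (h n + x) - g x\<bar>) \<longlonglongrightarrow> 0"
      using g(2) h by (auto simp: L1_translation_continuous_def)
    then have "eventually (\<lambda>n. (LINT x|lborel. \<bar>g (h n + x) - g x\<bar>) < r/2) sequentially"
      by (rule order_tendstoD) (use \<open>r > 0\<close> in simp)
    then obtain N where N: "\<And>n. n \<ge> N \<Longrightarrow> (LINT x|lborel. \<bar>g (h n + x) - g x\<bar>) < r/2"
      by (auto simp: eventually_sequentially)
    have "norm ((LINT x|lborel. \<bar>f (h n + x) - f x\<bar>) - 0) < r" if "n \<ge> N" for n
    proof -
      have i: "integrable lborel (\<lambda>x. \<bar>f x - g x\<bar>)" "integrable lborel (\<lambda>x. \<bar>f (h n + x) - g (h n + x)\<bar>)"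
        "integrable lborel (\<lambda>x. \<bar>g (h n + x) - g x\<bar>)"
        using f g by (auto intro!: integrable_abs Bochner_Integration.integrable_diff lborel_integrable_translate)
      have "(LINT x|lborel. \<bar>f (h n + x) - f x\<bar>) \<le>
        (LINT x|lborel. \<bar>f (h n + x) - g (h n + x)\<bar> + \<bar>f x - g x\<bar> + \<bar>g (h n + x) - g x\<bar>)"
        by (rule integral_mono)
           (use f i in \<open>auto intro!: integrable_abs Bochner_Integration.integrable_diff Bochner_Integration.integrable_add lborel_integrable_translate\<close>)
      also have "\<dots> = (LINT x|lborel. \<bar>f (h n + x) - g (h n + x)\<bar>) + (LINT x|lborel. \<bar>f x - g x\<bar>) +
          (LINT x|lborel. \<bar>g (h n + x) - g x\<bar>)"
        using i by simp
      also have "(LINT x|lborel. \<bar>f (h n + x) - g (h n + x)\<bar>) = (LINT x|lborel. \<bar>f x - g x\<bar>)"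
        by (rule lborel_integral_translate[of "\<lambda>x. \<bar>f x - g x\<bar>"]) measurable
      finally have "(LINT x|lborel. \<bar>f (h n + x) - f x\<bar>) < r" using N[OF that] g(3) by simp
      moreover have "0 \<le> (LINT x|lborel. \<bar>f (h n + x) - f x\<bar>)" by (rule integral_nonneg_AE) auto
      ultimately show ?thesis by simp
    qed
    then show "\<exists>N. \<forall>n\<ge>N. norm ((LINT x|lborel. \<bar>f (h n + x) - f x\<bar>) - 0) < r" by blast
  qed
qed

text \<open>Openness controls translates only at points of \<open>U\<close>. The symmetric
  difference is therefore rewritten through the intersection of \<open>U\<close> with its translate,
  where points outside \<open>U\<close> contribute nothing, and dominated convergence
  applies.\<close>

lemma L1_translation_continuous_open:
  assumes U: "open U" and fin: "emeasure lborel U < \<infinity>"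
  shows "L1_translation_continuous (\<lambda>x. indicator U x :: real)"
  unfolding L1_translation_continuous_def
proof safe
  fix h :: "nat \<Rightarrow> 'a" assume h: "h \<longlonglongrightarrow> 0"
  have [measurable]: "U \<in> sets borel" using U by simp
  have i: "integrable lborel (\<lambda>x. indicator U x :: real)" using fin by simp
  note it = lborel_integrable_translate[OF i]
  have ip: "integrable lborel (\<lambda>x. indicator U x * indicator U (h n + x) :: real)" for n
    by (rule Bochner_Integration.integrable_bound[OF i]) (auto split: split_indicator)
  have eq: "(LINT x|lborel. \<bar>indicator U (h n + x) - indicator U x :: real\<bar>) =
      2 * (LINT x|lborel. indicator U x) - 2 * (LINT x|lborel. indicator U x * indicator U (h n + x))" for n
  proof -
    have "(LINT x|lborel. \<bar>indicator U (h n + x) - indicator U x :: real\<bar>) =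
      (LINT x|lborel. indicator U (h n + x) + indicator U x - 2 * (indicator U x * indicator U (h n + x)))"
      by (intro Bochner_Integration.integral_cong) (auto split: split_indicator)
    also have "\<dots> = (LINT x|lborel. indicator U (h n + x)) + (LINT x|lborel. indicator U x)
        - 2 * (LINT x|lborel. indicator U x * indicator U (h n + x))"
      using i it ip by (simp del: Bochner_Integration.integral_indicator)
    also have "(LINT x|lborel. indicator U (h n + x)) = (LINT x|lborel. indicator U x :: real)"
      by (rule lborel_integral_translate) measurable
    finally show ?thesis by simp
  qed
  have "(\<lambda>n. LINT x|lborel. indicator U x * indicator U (h n + x)) \<longlonglongrightarrow> (LINT x|lborel. indicator U x :: real)"
  proof (rule integral_dominated_convergence[OF _ _ i])
    show "AE x in lborel. (\<lambda>n. indicator U x * indicator U (h n + x)) \<longlonglongrightarrow> (indicator U x :: real)"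
    proof (rule AE_I2)
      fix x
      show "(\<lambda>n. indicator U x * indicator U (h n + x)) \<longlonglongrightarrow> (indicator U x :: real)"
      proof (cases "x \<in> U")
        case True
        have "(\<lambda>n. h n + x) \<longlonglongrightarrow> 0 + x" by (intro tendsto_intros h)
        then have "eventually (\<lambda>n. h n + x \<in> U) sequentially"
          using topological_tendstoD[of _ "0 + x" _ U] U True by simp
        then have "eventually (\<lambda>n. indicator U x * indicator U (h n + x) = (1::real)) sequentially"
          by eventually_elim (use True in simp)
        then show ?thesis using True by (simp add: tendsto_eventually)
      qed simp
    qed
  qed (auto split: split_indicator)
  then have "(\<lambda>n. 2 * (LINT x|lborel. indicator U x) - 2 * (LINT x|lborel. indicator U x * indicator U (h n + x)))
      \<longlonglongrightarrow> 2 * (LINT x|lborel. indicator U x) - 2 * (LINT x|lborel. indicator U x :: real)"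
    by (intro tendsto_intros)
  then show "(\<lambda>n. LINT x|lborel. \<bar>indicator U (h n + x) - indicator U x :: real\<bar>) \<longlonglongrightarrow> 0"
    unfolding eq by simp
qed

lemma L1_translation_continuous_scale:
  assumes "L1_translation_continuous f" shows "L1_translation_continuous (\<lambda>x. f x * c)"
proof -
  have "(LINT x|lborel. \<bar>f (h + x) * c - f x * c\<bar>) = (LINT x|lborel. \<bar>f (h + x) - f x\<bar>) * \<bar>c\<bar>" for h
    by (simp add: left_diff_distrib[symmetric] abs_mult)
  then show ?thesis
    using assms unfolding L1_translation_continuous_def by (auto intro!: tendsto_mult_left_zero)
qed

lemma L1_translation_continuous_add:
  assumes f: "L1_translation_continuous f" "integrable lborel f" and g: "L1_translation_continuous g" "integrable lborel g"
  shows "L1_translation_continuous (\<lambda>x. f x + g x)"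
  unfolding L1_translation_continuous_def
proof safe
  fix h :: "nat \<Rightarrow> 'a" assume h: "h \<longlonglongrightarrow> 0"
  let ?b = "\<lambda>n. (LINT x|lborel. \<bar>f (h n + x) - f x\<bar>) + (LINT x|lborel. \<bar>g (h n + x) - g x\<bar>)"
  have i: "integrable lborel (\<lambda>x. \<bar>f (h n + x) - f x\<bar>)" "integrable lborel (\<lambda>x. \<bar>g (h n + x) - g x\<bar>)" for n
    using f g by (auto intro!: integrable_abs Bochner_Integration.integrable_diff lborel_integrable_translate)
  have lim: "?b \<longlonglongrightarrow> 0 + 0" using f(1) g(1) h unfolding L1_translation_continuous_def by (intro tendsto_add) auto
  have le: "(LINT x|lborel. \<bar>f (h n + x) + g (h n + x) - (f x + g x)\<bar>) \<le> ?b n" for n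
  proof -
    have "(LINT x|lborel. \<bar>f (h n + x) + g (h n + x) - (f x + g x)\<bar>) \<le>
       (LINT x|lborel. \<bar>f (h n + x) - f x\<bar> + \<bar>g (h n + x) - g x\<bar>)"
      by (rule integral_mono) (use f g in \<open>auto intro!: integrable_abs Bochner_Integration.integrable_diff
        Bochner_Integration.integrable_add lborel_integrable_translate\<close>)
    then show ?thesis using i by simp
  qed
  show "(\<lambda>n. LINT x|lborel. \<bar>f (h n + x) + g (h n + x) - (f x + g x)\<bar>) \<longlonglongrightarrow> 0"
    by (rule real_tendsto_0_bound[OF lim[unfolded add_0_right] _ le]) simp
qed

text \<open>Induction over integrable functions: outer regularity reduces measurable sets to open
  ones, and the approximation lemma handles the limit step.\<close>

lemma L1_translation_continuous_integrable:
  assumes "integrable lborel f" shows "L1_translation_continuous f"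
  using assms
proof induct
  case (base A c)
  have A: "A \<in> sets borel" using base by simp
  have "L1_translation_continuous (\<lambda>x. indicator A x :: real)"
  proof (rule L1_translation_continuous_approx)
    show "integrable lborel (\<lambda>x. indicator A x :: real)" using base by simp
    fix e :: real assume "e > 0"
    then obtain U where U: "open U" "A \<subseteq> U" "emeasure lborel (U - A) < e" using outer_regular_lborel[OF A] by blast
    have "emeasure lborel U = emeasure lborel A + emeasure lborel (U - A)"
      using U A by (subst plus_emeasure) (auto simp: Un_absorb1)
    also have "\<dots> < \<infinity>" using base(2) U(3) by (auto simp: less_top[symmetric] ennreal_add_eq_top)
    finally have fin: "emeasure lborel U < \<infinity>" .
    have "(LINT x|lborel. \<bar>indicator A x - indicator U x :: real\<bar>) = (LINT x|lborel. indicator (U - A) x)"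
      by (intro Bochner_Integration.integral_cong) (use U in \<open>auto split: split_indicator\<close>)
    also have "\<dots> = measure lborel (U - A)" by simp
    also have "\<dots> \<le> e" unfolding measure_def using U(3) \<open>e > 0\<close> by (intro enn2real_leI) auto
    finally show "\<exists>g. integrable lborel g \<and> L1_translation_continuous g \<and> (LINT x|lborel. \<bar>indicator A x - g x\<bar>) \<le> e"
      using L1_translation_continuous_open[OF U(1) fin] fin U(1) by (intro exI[of _ "indicator U"]) auto
  qed
  then show ?case using L1_translation_continuous_scale by simp
next
  case (add f g) then show ?case by (intro L1_translation_continuous_add)
next
  case (lim f s)
  note [measurable] = borel_measurable_integrable[OF lim(5)] borel_measurable_integrable[OF lim(1)]
  show ?case
  proof (rule L1_translation_continuous_approx[OF lim(5)])
    fix e :: real assume "e > 0"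
    have "(\<lambda>i. LINT x|lborel. \<bar>f x - s i x\<bar>) \<longlonglongrightarrow> (LINT x|(lborel :: 'a measure). 0)"
    proof (rule integral_dominated_convergence[where w="\<lambda>x. 3 * \<bar>f x\<bar>"])
      show "AE x in lborel. (\<lambda>i. \<bar>f x - s i x\<bar>) \<longlonglongrightarrow> 0"
      proof (rule AE_I2)
        fix x
        have "(\<lambda>i. f x - s i x) \<longlonglongrightarrow> f x - f x" by (intro tendsto_intros lim(3)) simp
        then show "(\<lambda>i. \<bar>f x - s i x\<bar>) \<longlonglongrightarrow> 0" by (intro tendsto_rabs_zero) simp
      qed
      show "AE x in lborel. norm \<bar>f x - s i x\<bar> \<le> 3 * \<bar>f x\<bar>" for i
      proof (rule AE_I2)
        fix x show "norm \<bar>f x - s i x\<bar> \<le> 3 * \<bar>f x\<bar>" using lim(4)[of x i] by simp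
      qed
    qed (use lim in auto)
    then have "eventually (\<lambda>i. (LINT x|lborel. \<bar>f x - s i x\<bar>) < e) sequentially"
      by (intro order_tendstoD) (use \<open>e > 0\<close> in auto)
    then obtain i where "(LINT x|lborel. \<bar>f x - s i x\<bar>) < e" by (auto simp: eventually_sequentially)
    then show "\<exists>g. integrable lborel g \<and> L1_translation_continuous g \<and> (LINT x|lborel. \<bar>f x - g x\<bar>) \<le> e"
      using lim(1,2) by (intro exI[of _ "s i"]) auto
  qed
qed

text \<open>For nonnegative numbers \<open>(a - b)^2 \<le> |a^2 - b^2|\<close>, which reduces the
  claim to the continuity of translates of \<open>f^2\<close> in L^1.\<close>

lemma L2_translation_continuous_nonneg:
  fixes f :: "'a::euclidean_space \<Rightarrow> real"
  assumes [measurable]: "f \<in> borel_measurable borel" and i: "integrable lborel (\<lambda>x. (f x)\<^sup>2)" and f: "\<And>x. 0 \<le> f x" 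
    and h: "h \<longlonglongrightarrow> 0"
  shows "(\<lambda>n. LINT x|lborel. (f (h n + x) - f x)\<^sup>2) \<longlonglongrightarrow> 0"
proof -
  have *: "(a - b)\<^sup>2 \<le> \<bar>a\<^sup>2 - b\<^sup>2\<bar>" if "0 \<le> a" "0 \<le> b" for a b :: real
  proof -
    have "(a - b)\<^sup>2 = \<bar>a - b\<bar> * \<bar>a - b\<bar>" by (simp add: power2_eq_square)
    also have "\<dots> \<le> \<bar>a - b\<bar> * (a + b)" using that by (intro mult_left_mono) auto
    also have "\<dots> = \<bar>(a - b) * (a + b)\<bar>" using that by (simp add: abs_mult)
    finally show ?thesis by (simp add: power2_eq_square algebra_simps)
  qed
  have lim: "(\<lambda>n. LINT x|lborel. \<bar>(f (h n + x))\<^sup>2 - (f x)\<^sup>2\<bar>) \<longlonglongrightarrow> 0"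
    using L1_translation_continuous_integrable[OF i] h unfolding L1_translation_continuous_def by blast
  have le: "(LINT x|lborel. (f (h n + x) - f x)\<^sup>2) \<le> (LINT x|lborel. \<bar>(f (h n + x))\<^sup>2 - (f x)\<^sup>2\<bar>)" for n
    by (rule integral_mono_AE') (use * f in \<open>auto intro!: integrable_abs Bochner_Integration.integrable_diff i lborel_integrable_translate[OF i]\<close>)
  show ?thesis
    by (rule real_tendsto_0_bound[OF lim _ le]) simp
qed

lemma L2_translation_continuous:
  fixes f :: "'a::euclidean_space \<Rightarrow> complex"
  assumes [measurable]: "f \<in> borel_measurable borel" and i: "integrable lborel (\<lambda>x. (cmod (f x))\<^sup>2)" and h: "h \<longlonglongrightarrow> 0"
  shows "(\<lambda>n. LINT x|lborel. (cmod (f (h n + x) - f x))\<^sup>2) \<longlonglongrightarrow> 0"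
proof -
  \<comment> \<open>Positive and negative parts of the real and the imaginary part, since the
    passage to squares works for nonnegative functions only.\<close>
  define q where "q k x = (if k = 0 then max 0 (Re (f x)) else if k = 1 then max 0 (- Re (f x))
      else if k = 2 then max 0 (Im (f x)) else max 0 (- Im (f x)))" for k :: nat and x
  have [measurable]: "\<And>k. q k \<in> borel_measurable borel" unfolding q_def by measurable
  have q0: "\<And>k x. 0 \<le> q k x" unfolding q_def by auto
  have qle: "\<bar>q k x\<bar> \<le> cmod (f x)" for k x 
    using abs_Re_le_cmod[of "f x"] abs_Im_le_cmod[of "f x"] by (auto simp: q_def)
  have qi: "integrable lborel (\<lambda>x. (q k x)\<^sup>2)" for k
    by (rule Bochner_Integration.integrable_bound[OF i]) (use qle in \<open>auto intro!: power_mono simp: q0 abs_of_nonneg\<close>)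
  have lim: "(\<lambda>n. LINT x|lborel. (q k (h n + x) - q k x)\<^sup>2) \<longlonglongrightarrow> 0" for k
    by (rule L2_translation_continuous_nonneg[OF _ qi q0 h]) measurable
  have di: "integrable lborel (\<lambda>x. (q k (h n + x) - q k x)\<^sup>2)" for k n
  proof (rule Bochner_Integration.integrable_bound[of _ "\<lambda>x. 2 * (q k (h n + x))\<^sup>2 + 2 * (q k x)\<^sup>2"])
    show "AE x in lborel. norm ((q k (h n + x) - q k x)\<^sup>2) \<le> norm (2 * (q k (h n + x))\<^sup>2 + 2 * (q k x)\<^sup>2)"
      using norm_add_sq_le[of "q k _" "- q k _"] by auto
  qed (auto intro!: qi lborel_integrable_translate[OF qi])
  have **: "(a - b)\<^sup>2 \<le> 2 * (a\<^sup>2 + b\<^sup>2)" for a b :: real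
    using norm_add_sq_le[of a "- b"] by simp
  have Re_eq: "Re (f x) = q 0 x - q 1 x" and Im_eq: "Im (f x) = q 2 x - q 3 x" for x
    by (auto simp: q_def)
  have pw: "(cmod (f (h n + x) - f x))\<^sup>2 \<le> (\<Sum>k<4. 2 * (q k (h n + x) - q k x)\<^sup>2)" for n x
  proof -
    have "(cmod (f (h n + x) - f x))\<^sup>2 = ((q 0 (h n + x) - q 0 x) - (q 1 (h n + x) - q 1 x))\<^sup>2
       + ((q 2 (h n + x) - q 2 x) - (q 3 (h n + x) - q 3 x))\<^sup>2"
      unfolding cmod_power2 minus_complex.sel Re_eq Im_eq by (simp add: algebra_simps)
    also have "\<dots> \<le> (\<Sum>k<4. 2 * (q k (h n + x) - q k x)\<^sup>2)"
      using **[of "q 0 (h n + x) - q 0 x" "q 1 (h n + x) - q 1 x"] **[of "q 2 (h n + x) - q 2 x" "q 3 (h n + x) - q 3 x"]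
      by (simp add: numeral_eq_Suc)
    finally show ?thesis .
  qed
  have le: "(LINT x|lborel. (cmod (f (h n + x) - f x))\<^sup>2) \<le> (\<Sum>k<4. 2 * (LINT x|lborel. (q k (h n + x) - q k x)\<^sup>2))" for n
  proof -
    have "(LINT x|lborel. (cmod (f (h n + x) - f x))\<^sup>2) \<le> (LINT x|lborel. (\<Sum>k<4. 2 * (q k (h n + x) - q k x)\<^sup>2))"
      by (rule integral_mono_AE') (use pw in \<open>auto intro!: Bochner_Integration.integrable_sum di sum_nonneg\<close>)
    also have "\<dots> = (\<Sum>k<4. 2 * (LINT x|lborel. (q k (h n + x) - q k x)\<^sup>2))"
      using di by simp
    finally show ?thesis .
  qed
  have "(\<lambda>n. \<Sum>k<4. 2 * (LINT x|lborel. (q k (h n + x) - q k x)\<^sup>2)) \<longlonglongrightarrow> (\<Sum>k<(4::nat). 2 * 0)"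
    by (intro tendsto_intros lim)
  then have lim2: "(\<lambda>n. \<Sum>k<4. 2 * (LINT x|lborel. (q k (h n + x) - q k x)\<^sup>2)) \<longlonglongrightarrow> 0" by simp
  show ?thesis
    by (rule real_tendsto_0_bound[OF lim2 _ le]) simp
qed

text \<open>The sign \<open>s\<close> is a parameter so that the transform and its inverse are
  treated at once; the theorems that need it assume \<open>s^2 = 1\<close>.\<close>

definition FT :: "real \<Rightarrow> (real^3 \<Rightarrow> complex) \<Rightarrow> real^3 \<Rightarrow> complex" where
  "FT s f p = complex_of_real ((2 * pi) powr (-3/2)) * (LINT x|lebesgue. cis (s * (p \<bullet> x)) * f x)"

lemma fourier_eq_FT: "fourier = FT (-1)"
  by (simp add: fun_eq_iff fourier_def FT_def)

lemma inv_fourier_eq_FT: "inv_fourier = FT 1"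
  by (simp add: fun_eq_iff inv_fourier_def FT_def inner_commute)

lemma FT_const_sq: "((2 * pi) powr (-3/2))\<^sup>2 * (2 * pi) ^ 3 = (1::real)"
proof -
  have "((2 * pi) powr (-3/2))\<^sup>2 * (2 * pi) ^ 3 = (2 * pi) powr (-3/2) * (2 * pi) powr (-3/2) * (2 * pi) powr 3"
    by (simp add: power2_eq_square powr_numeral)
  also have "\<dots> = 1" by (simp only: powr_add[symmetric]) simp
  finally show ?thesis .
qed

lemma integrable_cis_mult:
  assumes f: "integrable lebesgue f" shows "integrable lebesgue (\<lambda>x::real^3. cis (s * (p \<bullet> x)) * f x)"
proof (rule Bochner_Integration.integrable_bound[OF f])
  note [measurable] = borel_measurable_integrable[OF f]
  show "(\<lambda>x. cis (s * (p \<bullet> x)) * f x) \<in> borel_measurable lebesgue" by measurable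
qed (simp add: norm_mult)

lemma FT_measurable [measurable (raw)]:
  assumes [measurable]: "f \<in> borel_measurable lebesgue" shows "FT s f \<in> borel_measurable lebesgue"
  unfolding FT_def by measurable

lemma FT_bound: "cmod (FT s f p) \<le> (2 * pi) powr (-3/2) * (LINT x|lebesgue. cmod (f x))"
proof -
  have "cmod (LINT x|lebesgue. cis (s * (p \<bullet> x)) * f x) \<le> (LINT x|lebesgue. cmod (cis (s * (p \<bullet> x)) * f x))"
    by (rule integral_norm_bound)
  then show ?thesis by (simp add: FT_def norm_mult mult_left_mono)
qed

lemma FT_add:
  assumes "integrable lebesgue f" "integrable lebesgue g"
  shows "FT s (\<lambda>x. f x + g x) p = FT s f p + FT s g p"
  using assms by (simp add: FT_def ring_distribs integrable_cis_mult)

lemma FT_scale: "FT s (\<lambda>x. c * f x) p = c * FT s f p"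
  by (simp add: FT_def mult.left_commute[of _ c])

lemma FT_diff:
  assumes "integrable lebesgue f" "integrable lebesgue g"
  shows "FT s (\<lambda>x. f x - g x) p = FT s f p - FT s g p"
  using assms by (simp add: FT_def ring_distribs integrable_cis_mult)

lemma FT_cong_AE:
  assumes [measurable]: "f \<in> borel_measurable lebesgue" "g \<in> borel_measurable lebesgue"
    and "AE x in lebesgue. f x = g x"
  shows "FT s f = FT s g"
proof
  fix p
  have "(LINT x|lebesgue. cis (s * (p \<bullet> x)) * f x) = (LINT x|lebesgue. cis (s * (p \<bullet> x)) * g x)"
  proof (rule integral_cong_AE)
    show "AE x in lebesgue. cis (s * (p \<bullet> x)) * f x = cis (s * (p \<bullet> x)) * g x" using assms(3) by auto
  qed measurable
  then show "FT s f p = FT s g p" by (simp add: FT_def)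
qed

lemma integrable_pair_bounded_kernel:
  fixes f h :: "real^3 \<Rightarrow> complex"
  assumes f: "integrable lebesgue f" and h: "integrable lebesgue h"
    and [measurable]: "k \<in> borel_measurable (lebesgue \<Otimes>\<^sub>M lebesgue)" and k: "\<And>z. cmod (k z) \<le> B"
  shows "integrable (lebesgue \<Otimes>\<^sub>M lebesgue) (\<lambda>(x, y). k (x, y) * (f x * h y))"
proof (rule Bochner_Integration.integrable_bound[of _ "\<lambda>(x, y). B * (f x * h y)"])
  note [measurable] = borel_measurable_integrable[OF f] borel_measurable_integrable[OF h]
  have "integrable (lebesgue \<Otimes>\<^sub>M lebesgue) (\<lambda>(x, y). f x * h y)"
  proof (rule leb_pair.Fubini_integrable)
    show "integrable lebesgue (\<lambda>x. LINT y|lebesgue. norm (case (x, y) of (x, y) \<Rightarrow> f x * h y))"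
      using f by (simp add: norm_mult)
    show "AE x in lebesgue. integrable lebesgue (\<lambda>y. case (x, y) of (x, y) \<Rightarrow> f x * h y)"
      using h by simp
  qed measurable
  then show "integrable (lebesgue \<Otimes>\<^sub>M lebesgue) (\<lambda>(x, y). B * (f x * h y))"
    by (simp add: case_prod_unfold)
  show "AE z in lebesgue \<Otimes>\<^sub>M lebesgue. norm (case z of (x, y) \<Rightarrow> k (x, y) * (f x * h y)) \<le>
      norm (case z of (x, y) \<Rightarrow> complex_of_real B * (f x * h y))"
  proof (rule AE_I2)
    fix z :: "(real^3) \<times> (real^3)"
    have "cmod (k z) \<le> \<bar>B\<bar>" using k[of z] by linarith
    then show "norm (case z of (x, y) \<Rightarrow> k (x, y) * (f x * h y)) \<le> norm (case z of (x, y) \<Rightarrow> complex_of_real B * (f x * h y))"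
      by (cases z) (auto simp: norm_mult intro!: mult_right_mono)
  qed
  show "(\<lambda>(x, y). k (x, y) * (f x * h y)) \<in> borel_measurable (lebesgue \<Otimes>\<^sub>M lebesgue)" by measurable
qed

lemma Fubini_bounded_kernel:
  fixes f h :: "real^3 \<Rightarrow> complex"
  assumes f: "integrable lebesgue f" and h: "integrable lebesgue h"
    and k: "k \<in> borel_measurable (lebesgue \<Otimes>\<^sub>M lebesgue)" "\<And>z. cmod (k z) \<le> B"
  shows "(LINT y|lebesgue. LINT x|lebesgue. k (x, y) * (f x * h y)) =
         (LINT x|lebesgue. LINT y|lebesgue. k (x, y) * (f x * h y))"
  using leb_pair.Fubini_integral[OF integrable_pair_bounded_kernel[OF assms]] by simp

theorem FT_multiplication_formula:
  assumes f: "integrable lebesgue f" and h: "integrable lebesgue h"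
  shows "(LINT p|lebesgue. cnj (FT s f p) * h p) = (LINT x|lebesgue. cnj (f x) * FT (-s) h x)"
proof -
  let ?c = "complex_of_real ((2 * pi) powr (-3/2))"
  let ?k = "\<lambda>(x::real^3, p::real^3). cis (- s * (p \<bullet> x))"
  have cf: "integrable lebesgue (\<lambda>x. cnj (f x))" using f by simp
  have "(LINT p|lebesgue. cnj (FT s f p) * h p) = ?c * (LINT p|lebesgue. LINT x|lebesgue. ?k (x, p) * (cnj (f x) * h p))"
  proof -
    have "cnj (FT s f p) * h p = ?c * (LINT x|lebesgue. ?k (x, p) * (cnj (f x) * h p))" for p
      by (simp add: FT_def Bochner_Integration.integral_cnj[symmetric] cis_cnj mult.assoc[symmetric])
    then show ?thesis by simp
  qed
  also have "(LINT p|lebesgue. LINT x|lebesgue. ?k (x, p) * (cnj (f x) * h p)) =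
      (LINT x|lebesgue. LINT p|lebesgue. ?k (x, p) * (cnj (f x) * h p))"
    by (rule Fubini_bounded_kernel[OF cf h, of _ 1]) (measurable, auto)
  also have "?c * \<dots> = (LINT x|lebesgue. cnj (f x) * FT (-s) h x)"
  proof -
    have "?c * (LINT p|lebesgue. ?k (x, p) * (cnj (f x) * h p)) = cnj (f x) * FT (-s) h x" for x
      by (simp add: FT_def mult.left_commute[of _ "cnj (f x)"] inner_commute)
    then show ?thesis by (simp flip: integral_mult_right_zero)
  qed
  finally show ?thesis .
qed

subsection \<open>Gaussian regularization\<close>

text \<open>A rescaling of the characteristic function of the standard normal distribution.\<close>

lemma integral_cis_gaussian:
  assumes s: "\<sigma> > 0"
  shows "integrable lborel (\<lambda>x. cis (t * x) * complex_of_real (exp (- (\<sigma> * x)\<^sup>2 / 2)))" (is ?I)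
    and "(LINT x|lborel. cis (t * x) * complex_of_real (exp (- (\<sigma> * x)\<^sup>2 / 2))) =
      complex_of_real (2 * pi * normal_density 0 \<sigma> t)" (is ?E)
proof -
  have e: "exp (- (\<sigma> * x)\<^sup>2 / 2) = sqrt (2 * pi) / \<sigma> * normal_density 0 (1/\<sigma>) x" for x
    using s by (simp add: normal_density_def power_mult_distrib power_divide real_sqrt_divide)
  show ?I
    unfolding e by (rule Bochner_Integration.integrable_bound[of _ "\<lambda>x. sqrt (2 * pi) / \<sigma> * normal_density 0 (1/\<sigma>) x"])
      (use s in \<open>auto simp: norm_mult norm_divide\<close>)
  have "complex_of_real (exp (- ((t/\<sigma>)\<^sup>2) / 2)) = (LINT x|std_normal_distribution. iexp (t/\<sigma> * x))"
    using fun_cong[OF char_std_normal_distribution, of "t/\<sigma>"] by (simp add: char_def)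
  also have "\<dots> = (LINT x|lborel. std_normal_density x *\<^sub>R iexp (t/\<sigma> * x))"
    by (rule integral_density) auto
  also have "\<dots> = \<bar>\<sigma>\<bar> *\<^sub>R (LINT x|lborel. std_normal_density (0 + \<sigma> * x) *\<^sub>R iexp (t/\<sigma> * (0 + \<sigma> * x)))"
    using s by (intro lborel_integral_real_affine) auto
  also have "\<dots> = complex_of_real (\<sigma> / sqrt (2 * pi)) * (LINT x|lborel. cis (t * x) * complex_of_real (exp (- (\<sigma> * x)\<^sup>2 / 2)))"
  proof -
    have "std_normal_density (0 + \<sigma> * x) *\<^sub>R iexp (t/\<sigma> * (0 + \<sigma> * x)) =
       complex_of_real (1 / sqrt (2 * pi)) * (cis (t * x) * complex_of_real (exp (- (\<sigma> * x)\<^sup>2 / 2)))" for x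
      using s by (simp add: std_normal_density_def cis_conv_exp scaleR_conv_of_real)
    then show ?thesis using s by (simp add: scaleR_conv_of_real)
  qed
  finally have "(LINT x|lborel. cis (t * x) * complex_of_real (exp (- (\<sigma> * x)\<^sup>2 / 2))) =
    complex_of_real (sqrt (2 * pi) / \<sigma>) * complex_of_real (exp (- ((t/\<sigma>)\<^sup>2) / 2))"
    using s by (simp add: field_simps)
  also have "\<dots> = complex_of_real (2 * pi * normal_density 0 \<sigma> t)"
  proof -
    have "sqrt (2 * pi) / \<sigma> = 2 * pi * (1 / sqrt (2 * pi * \<sigma>\<^sup>2))"
    proof -
      have q: "sqrt (2 * pi * \<sigma>\<^sup>2) = sqrt (2 * pi) * \<sigma>" using s by (simp add: real_sqrt_mult)
      show ?thesis unfolding q using s by (simp add: field_simps)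
    qed
    then show ?thesis by (simp add: normal_density_def power_divide flip: of_real_mult)
  qed
  finally show ?E .
qed

lemma lborel_integral_prod_Basis:
  fixes f :: "'a::euclidean_space \<Rightarrow> real \<Rightarrow> complex"
  assumes f: "\<And>b. b \<in> Basis \<Longrightarrow> integrable lborel (f b)"
  shows "integrable lborel (\<lambda>x::'a. \<Prod>b\<in>Basis. f b (x \<bullet> b))" (is ?I)
    and "(LINT x|lborel. (\<Prod>b\<in>Basis. f b (x \<bullet> b))) = (\<Prod>b\<in>Basis. LINT x|lborel. f b x)" (is ?E)
proof -
  interpret P: product_sigma_finite "\<lambda>b::'a. lborel :: real measure" ..
  have [measurable]: "b \<in> Basis \<Longrightarrow> f b \<in> borel_measurable borel" for b
    using borel_measurable_integrable[OF f] by simp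
  have m: "(\<lambda>g. \<Sum>b\<in>Basis. g b *\<^sub>R b) \<in> (\<Pi>\<^sub>M b\<in>(Basis::'a set). (lborel::real measure)) \<rightarrow>\<^sub>M borel" by measurable
  have fm: "(\<lambda>x::'a. \<Prod>b\<in>Basis. f b (x \<bullet> b)) \<in> borel_measurable borel" by measurable
  have eq: "(\<Prod>b\<in>Basis. f b ((\<Sum>b\<in>Basis. g b *\<^sub>R b) \<bullet> b)) = (\<Prod>b\<in>Basis. f b (g b))" for g :: "'a \<Rightarrow> real"
    by (intro prod.cong refl) simp
  show ?I
    by (subst lborel_eq, subst integrable_distr_eq[OF m fm])
       (simp only: eq, rule P.product_integrable_prod[OF finite_Basis f])
  show ?E
    by (subst lborel_eq, subst integral_distr[OF m fm])
       (simp only: eq, rule P.product_integral_prod[OF finite_Basis f])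
qed

definition gaussian :: "real \<Rightarrow> real^3 \<Rightarrow> real" where
  "gaussian \<sigma> z = (\<Prod>b\<in>Basis. normal_density 0 \<sigma> (z \<bullet> b))"

lemma gaussian_measurable [measurable]: "gaussian \<sigma> \<in> borel_measurable borel"
  unfolding gaussian_def by measurable

lemma gaussian_nonneg: "0 \<le> gaussian \<sigma> z"
  unfolding gaussian_def by (intro prod_nonneg) auto

lemma gaussian_integrable:
  assumes "\<sigma> > 0" shows "integrable lborel (gaussian \<sigma>)" "(LINT z|lborel. gaussian \<sigma> z) = 1"
proof -
  have i: "integrable lborel (\<lambda>x. complex_of_real (normal_density 0 \<sigma> x))" using assms by simp
  have *: "(\<Prod>b\<in>Basis. complex_of_real (normal_density 0 \<sigma> (z \<bullet> b))) = complex_of_real (gaussian \<sigma> z)" for z :: "real^3"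
    by (simp add: gaussian_def)
  have "integrable lborel (\<lambda>z. complex_of_real (gaussian \<sigma> z))"
    using lborel_integral_prod_Basis(1)[of "\<lambda>b::real^3. \<lambda>x. complex_of_real (normal_density 0 \<sigma> x)"] i unfolding * by simp
  then show "integrable lborel (gaussian \<sigma>)" by (rule complex_of_real_integrable_eq[THEN iffD1])
  have "(LINT z|lborel. complex_of_real (gaussian \<sigma> z)) = 1"
    using lborel_integral_prod_Basis(2)[of "\<lambda>b::real^3. \<lambda>x. complex_of_real (normal_density 0 \<sigma> x)"] i assms unfolding * 
    by simp
  then show "(LINT z|lborel. gaussian \<sigma> z) = 1" by simp
qed

lemma gaussian_uminus: "gaussian \<sigma> (- z) = gaussian \<sigma> z"
  by (simp add: gaussian_def normal_density_def)

lemma gaussian_scale: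
  assumes "\<sigma> > 0" shows "\<sigma> ^ 3 * gaussian \<sigma> (\<sigma> *\<^sub>R z) = gaussian 1 z"
proof -
  have "\<sigma> * normal_density 0 \<sigma> (\<sigma> * x) = normal_density 0 1 x" for x
    using assms by (simp add: normal_density_def real_sqrt_mult power_mult_distrib)
  moreover have "\<sigma> ^ 3 = (\<Prod>b\<in>(Basis::(real^3) set). \<sigma>)" by simp
  ultimately show ?thesis by (simp only: gaussian_def inner_scaleR_left prod.distrib[symmetric])
qed

lemma gaussian_weight:
  "complex_of_real (exp (- (\<sigma> * norm p)\<^sup>2 / 2)) = (\<Prod>b\<in>Basis. complex_of_real (exp (- (\<sigma> * (p \<bullet> b))\<^sup>2 / 2)))"
  for p :: "real^3"
proof -
  have "(norm p)\<^sup>2 = (\<Sum>b\<in>Basis. (p \<bullet> b)\<^sup>2)"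
    by (subst power2_norm_eq_inner, subst euclidean_inner) (simp add: power2_eq_square)
  then have "- (\<sigma> * norm p)\<^sup>2 / 2 = (\<Sum>b\<in>Basis. - (\<sigma> * (p \<bullet> b))\<^sup>2 / 2)"
    by (simp add: power_mult_distrib sum_distrib_left sum_negf sum_divide_distrib)
  then show ?thesis by (simp only: exp_sum[OF finite_Basis] of_real_prod)
qed

lemma integral_cis_gaussian_weight:
  assumes s: "\<sigma> > 0"
  shows "integrable lebesgue (\<lambda>p::real^3. exp (- (\<sigma> * norm p)\<^sup>2 / 2))" (is ?I)
    and "(LINT p|lebesgue. cis (p \<bullet> z) * complex_of_real (exp (- (\<sigma> * norm p)\<^sup>2 / 2))) =
      complex_of_real ((2 * pi) ^ 3 * gaussian \<sigma> z)" (is ?E)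
proof -
  let ?f = "\<lambda>t x. cis (t * x) * complex_of_real (exp (- (\<sigma> * x)\<^sup>2 / 2))"
  have cis_eq: "cis (p \<bullet> z) * complex_of_real (exp (- (\<sigma> * norm p)\<^sup>2 / 2)) = (\<Prod>b\<in>Basis. ?f (z \<bullet> b) (p \<bullet> b))" for p z :: "real^3"
  proof -
    have "cis (p \<bullet> z) = (\<Prod>b\<in>Basis. cis ((z \<bullet> b) * (p \<bullet> b)))"
      by (subst euclidean_inner) (simp add: cis_conv_exp sum_distrib_left exp_sum mult.commute)
    then show ?thesis by (simp only: gaussian_weight prod.distrib)
  qed
  have m: "(\<lambda>p. cis (p \<bullet> z) * complex_of_real (exp (- (\<sigma> * norm p)\<^sup>2 / 2))) \<in> borel_measurable lborel" for z :: "real^3"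
    by measurable
  have "integrable lborel (\<lambda>p::real^3. cis (p \<bullet> z) * complex_of_real (exp (- (\<sigma> * norm p)\<^sup>2 / 2)))" for z
    unfolding cis_eq by (rule lborel_integral_prod_Basis(1)) (rule integral_cis_gaussian(1)[OF s])
  from this[of 0] have "integrable lborel (\<lambda>p::real^3. exp (- (\<sigma> * norm p)\<^sup>2 / 2))" 
    by (intro complex_of_real_integrable_eq[THEN iffD1]) simp
  then show ?I by (subst integrable_completion) auto
  have "(LINT p|lebesgue. cis (p \<bullet> z) * complex_of_real (exp (- (\<sigma> * norm p)\<^sup>2 / 2))) =
      (LINT p|lborel. cis (p \<bullet> z) * complex_of_real (exp (- (\<sigma> * norm p)\<^sup>2 / 2)))"
    by (rule integral_completion[OF m])
  also have "\<dots> = (\<Prod>b\<in>(Basis::(real^3) set). LINT x|lborel. ?f (z \<bullet> b) x)"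
    unfolding cis_eq by (rule lborel_integral_prod_Basis(2)) (rule integral_cis_gaussian(1)[OF s])
  also have "\<dots> = (\<Prod>b\<in>(Basis::(real^3) set). complex_of_real (2 * pi * normal_density 0 \<sigma> (z \<bullet> b)))"
    by (simp only: integral_cis_gaussian(2)[OF s])
  also have "\<dots> = complex_of_real ((2 * pi) ^ 3 * gaussian \<sigma> z)"
    by (simp add: gaussian_def prod.distrib)
  finally show ?E .
qed

text \<open>The Gaussian weight makes the double integral absolutely convergent, so that Fubini
  applies. The inner momentum integral is then a Gaussian density: the regularized inversion formula
  is a mollification of \<open>f\<close>.\<close>

lemma FT_gaussian_FT:
  assumes f: "integrable lebesgue f" and s: "s\<^sup>2 = 1" and \<sigma>: "\<sigma> > 0"
  shows "FT (-s) (\<lambda>p. complex_of_real (exp (- (\<sigma> * norm p)\<^sup>2 / 2)) * FT s f p) x =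
    (LINT y|lebesgue. complex_of_real (gaussian \<sigma> (y - x)) * f y)"
proof -
  let ?c = "complex_of_real ((2 * pi) powr (-3/2))"
  let ?w = "\<lambda>p::real^3. complex_of_real (exp (- (\<sigma> * norm p)\<^sup>2 / 2))"
  let ?k = "\<lambda>(y, p::real^3). cis (s * (p \<bullet> (y - x)))"
  have w: "integrable lebesgue ?w" using integral_cis_gaussian_weight(1)[OF \<sigma>] by simp
  have "FT (-s) (\<lambda>p. ?w p * FT s f p) x = ?c * ?c * (LINT p|lebesgue. LINT y|lebesgue. ?k (y, p) * (f y * ?w p))"
  proof -
    have "cis (- s * (x \<bullet> p)) * (?w p * FT s f p) = ?c * (LINT y|lebesgue. ?k (y, p) * (f y * ?w p))" for p
    proof -
      have eq: "?k (y, p) * (f y * ?w p) = (cis (- s * (x \<bullet> p)) * ?w p) * (cis (s * (p \<bullet> y)) * f y)" for y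
      proof -
        have "cis (- s * (x \<bullet> p)) * cis (s * (p \<bullet> y)) = cis (s * (p \<bullet> (y - x)))"
          by (simp add: cis_mult inner_diff_right inner_commute algebra_simps)
        then show ?thesis by (simp add: ac_simps)
      qed
      have "(LINT y|lebesgue. ?k (y, p) * (f y * ?w p)) =
          (cis (- s * (x \<bullet> p)) * ?w p) * (LINT y|lebesgue. cis (s * (p \<bullet> y)) * f y)"
        unfolding eq by (rule integral_mult_right_zero)
      then show ?thesis unfolding FT_def by (simp only:) (simp only: ac_simps)
    qed
    then show ?thesis by (simp add: FT_def[of "-s"] mult.assoc)
  qed
  also have "(LINT p|lebesgue. LINT y|lebesgue. ?k (y, p) * (f y * ?w p)) =
      (LINT y|lebesgue. LINT p|lebesgue. ?k (y, p) * (f y * ?w p))"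
    by (rule Fubini_bounded_kernel[OF f w, of _ 1]) (measurable, auto)
  also have "?c * ?c * \<dots> = (LINT y|lebesgue. complex_of_real (gaussian \<sigma> (y - x)) * f y)"
  proof -
    have "?c * ?c * (LINT p|lebesgue. ?k (y, p) * (f y * ?w p)) = complex_of_real (gaussian \<sigma> (y - x)) * f y" for y
    proof -
      \<comment> \<open>Evenness of the Gaussian absorbs the sign \<open>s\<close>.\<close>
      have "gaussian \<sigma> (s *\<^sub>R (y - x)) = gaussian \<sigma> (y - x)"
        using s gaussian_uminus[of \<sigma> "y - x"] by (auto simp: power2_eq_1_iff)
      then have I: "(LINT p|lebesgue. ?k (y, p) * (f y * ?w p)) = f y * complex_of_real ((2 * pi) ^ 3 * gaussian \<sigma> (y - x))"
        using integral_cis_gaussian_weight(2)[OF \<sigma>, of "s *\<^sub>R (y - x)"]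
        by (simp add: mult.left_commute[of _ "f y"])
      have c1: "?c * ?c * complex_of_real ((2 * pi) ^ 3) = 1"
        using FT_const_sq by (simp only: of_real_mult[symmetric] power2_eq_square) simp
      have "?c * ?c * (f y * complex_of_real ((2 * pi) ^ 3 * gaussian \<sigma> (y - x))) =
          (?c * ?c * complex_of_real ((2 * pi) ^ 3)) * (complex_of_real (gaussian \<sigma> (y - x)) * f y)"
        by (simp only: of_real_mult ac_simps)
      then show ?thesis unfolding I c1 by simp
    qed
    then show ?thesis by (simp flip: integral_mult_right_zero)
  qed
  finally show ?thesis .
qed

text \<open>After the substitution \<open>y = x + \<sigma> z\<close> the double integral is the mean
  of the autocorrelation \<open>C (\<sigma> z)\<close> under a standard Gaussian. \<open>C\<close>
  is bounded by its value at 0 through Cauchy-Schwarz and continuous at 0 because translations are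
  continuous in L^2, so dominated convergence gives \<open>C 0\<close>.\<close>

lemma correlation_gaussian_tendsto:
  fixes f :: "real^3 \<Rightarrow> complex"
  assumes [measurable]: "f \<in> borel_measurable borel" and i2: "integrable lborel (\<lambda>x. (cmod (f x))\<^sup>2)"
  shows "(\<lambda>n. LINT x|lborel. cnj (f x) * (LINT y|lborel. complex_of_real (gaussian (1 / Suc n) (y - x)) * f y))
     \<longlonglongrightarrow> complex_of_real (LINT x|lborel. (cmod (f x))\<^sup>2)"
proof -
  define \<sigma> where "\<sigma> n = 1 / real (Suc n)" for n
  have \<sigma>: "\<sigma> n > 0" for n by (simp add: \<sigma>_def)
  have \<sigma>0: "\<sigma> \<longlonglongrightarrow> 0" unfolding \<sigma>_def by (rule LIMSEQ_Suc[OF lim_1_over_n])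
  define N where "N = (LINT x|lborel. (cmod (f x))\<^sup>2)"
  have f2: "f \<in> L2" using i2 by (auto simp: L2_def integrable_completion intro!: borel_imp_lebesgue)
  have tr2: "(\<lambda>x. f (h + x)) \<in> L2" for h
    using lborel_integrable_translate[OF i2, of h] by (auto simp: L2_def integrable_completion intro!: borel_imp_lebesgue)
  have N: "(L2_norm f)\<^sup>2 = N" unfolding N_def L2_norm_sq by (rule integral_completion) simp
  have Nt: "(L2_norm (\<lambda>x. f (h + x)))\<^sup>2 = N" for h
  proof -
    have "(L2_norm (\<lambda>x. f (h + x)))\<^sup>2 = (LINT x|lborel. (cmod (f (h + x)))\<^sup>2)"
      unfolding L2_norm_sq by (rule integral_completion) simp
    also have "\<dots> = N" unfolding N_def by (rule lborel_integral_translate[of "\<lambda>x. (cmod (f x))\<^sup>2"]) simp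
    finally show ?thesis .
  qed
  have N0: "0 \<le> N" using N by (metis zero_le_power2)
  define C where "C h = (LINT x|lborel. cnj (f x) * f (h + x))" for h
  have C_inner: "C h = L2_inner f (\<lambda>x. f (h + x))" for h
    unfolding C_def L2_inner_def by (rule integral_completion[symmetric]) simp
  have C0: "C 0 = complex_of_real N" unfolding C_inner by (simp add: L2_inner_self N)
  have C_bound: "cmod (C h) \<le> N" for h
  proof -
    have "L2_norm (\<lambda>x. f (h + x)) = L2_norm f" by (rule power2_eq_imp_eq) (simp_all add: N Nt)
    then show ?thesis using L2_Cauchy_Schwarz[OF f2 tr2, of h] N by (simp add: C_inner power2_eq_square)
  qed
  have C_lim: "(\<lambda>n. C (h n)) \<longlonglongrightarrow> C 0" if h: "h \<longlonglongrightarrow> 0" for h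
  proof -
    have *: "cmod (C (h n) - C 0) \<le> L2_norm f * sqrt (LINT x|lborel. (cmod (f (h n + x) - f x))\<^sup>2)" for n
    proof -
      have "C (h n) - C 0 = L2_inner f (\<lambda>x. f (h n + x) - f x)"
        using L2_inner_add_right[OF f2 tr2 L2_uminus[OF f2]] L2_inner_scale_right[of f "-1" f] by (simp add: C_inner)
      moreover have "L2_norm (\<lambda>x. f (h n + x) - f x) = sqrt (LINT x|lborel. (cmod (f (h n + x) - f x))\<^sup>2)"
        unfolding L2_norm_def by (subst integral_completion) simp_all
      ultimately show ?thesis using L2_Cauchy_Schwarz[OF f2 L2_diff[OF tr2 f2], of "h n"] by simp
    qed
    have lim: "(\<lambda>n. L2_norm f * sqrt (LINT x|lborel. (cmod (f (h n + x) - f x))\<^sup>2)) \<longlonglongrightarrow> L2_norm f * sqrt 0"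
      by (intro tendsto_intros L2_translation_continuous i2 h) simp
    have "(\<lambda>n. cmod (C (h n) - C 0)) \<longlonglongrightarrow> 0"
      by (rule real_tendsto_0_bound[OF lim[unfolded real_sqrt_zero mult_zero_right] norm_ge_zero *])
    then show ?thesis by (simp add: tendsto_norm_zero_iff LIM_zero_iff)
  qed
  have g1: "integrable lborel (\<lambda>z. complex_of_real (gaussian 1 z))" using gaussian_integrable(1)[of 1] by simp
  have eq: "(LINT x|lborel. cnj (f x) * (LINT y|lborel. complex_of_real (gaussian (\<sigma> n) (y - x)) * f y))
    = (LINT z|lborel. complex_of_real (gaussian 1 z) * C (\<sigma> n *\<^sub>R z))" for n
  proof -
    have "(LINT y|lborel. complex_of_real (gaussian (\<sigma> n) (y - x)) * f y) =
       (LINT z|lborel. complex_of_real (gaussian 1 z) * f (\<sigma> n *\<^sub>R z + x))" for x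
    proof -
      have "(LINT y|lborel. complex_of_real (gaussian (\<sigma> n) (y - x)) * f y) =
        \<bar>\<sigma> n\<bar> ^ DIM(real^3) *\<^sub>R (LINT z|lborel. complex_of_real (gaussian (\<sigma> n) (x + \<sigma> n *\<^sub>R z - x)) * f (x + \<sigma> n *\<^sub>R z))"
        by (rule lborel_integral_affine) (use \<sigma>[of n] in auto)
      also have "\<dots> = (LINT z|lborel. complex_of_real (gaussian 1 z) * f (\<sigma> n *\<^sub>R z + x))"
      proof -
        have "complex_of_real (gaussian 1 z) * f (\<sigma> n *\<^sub>R z + x) =
            (\<sigma> n) ^ 3 *\<^sub>R (complex_of_real (gaussian (\<sigma> n) (x + \<sigma> n *\<^sub>R z - x)) * f (x + \<sigma> n *\<^sub>R z))" for z
          unfolding gaussian_scale[OF \<sigma>[of n], symmetric, of z] by (simp add: scaleR_conv_of_real add.commute)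
        moreover have "\<bar>\<sigma> n\<bar> ^ DIM(real^3) = (\<sigma> n) ^ 3" using \<sigma>[of n] by simp
        ultimately show ?thesis by (simp only: integral_scaleR_right)
      qed
      finally show ?thesis .
    qed
    then have "(LINT x|lborel. cnj (f x) * (LINT y|lborel. complex_of_real (gaussian (\<sigma> n) (y - x)) * f y)) =
      (LINT x|lborel. LINT z|lborel. complex_of_real (gaussian 1 z) * (cnj (f x) * f (\<sigma> n *\<^sub>R z + x)))"
      by (simp only: integral_mult_right_zero[symmetric] mult.left_commute[of "cnj _"])
    also have "\<dots> = (LINT z|lborel. LINT x|lborel. complex_of_real (gaussian 1 z) * (cnj (f x) * f (\<sigma> n *\<^sub>R z + x)))"
    proof (rule lborel_pair.Fubini_integral)
      have *: "integrable lborel (\<lambda>x. cmod (f x) * cmod (f (h + x)))" "(LINT x|lborel. cmod (f x) * cmod (f (h + x))) \<le> N" for h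
      proof -
        show "integrable lborel (\<lambda>x. cmod (f x) * cmod (f (h + x)))"
          using L2_cmod_mult_integrable[OF f2 tr2[of h]] by (subst (asm) integrable_completion) auto
        have "(LINT x|lborel. cmod (f x) * cmod (f (h + x))) = (LINT x|lebesgue. cmod (f x) * cmod (f (h + x)))"
          by (rule integral_completion[symmetric]) simp
        also have "\<dots> \<le> L2_norm f * L2_norm (\<lambda>x. f (h + x))" by (rule L2_Cauchy_Schwarz_cmod[OF f2 tr2])
        also have "L2_norm (\<lambda>x. f (h + x)) = L2_norm f" by (rule power2_eq_imp_eq) (simp_all add: N Nt)
        finally show "(LINT x|lborel. cmod (f x) * cmod (f (h + x))) \<le> N" using N by (simp add: power2_eq_square)
      qed
      have "integrable (lborel \<Otimes>\<^sub>M lborel) (\<lambda>(z, x). complex_of_real (gaussian 1 z) * (cnj (f x) * f (\<sigma> n *\<^sub>R z + x)))"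
      proof (rule lborel_pair.Fubini_integrable)
        show "integrable lborel (\<lambda>z. LINT x|lborel. norm (case (z, x) of (z, x) \<Rightarrow>
            complex_of_real (gaussian 1 z) * (cnj (f x) * f (\<sigma> n *\<^sub>R z + x))))"
        proof (rule Bochner_Integration.integrable_bound[of _ "\<lambda>z. gaussian 1 z * N"])
          show "AE z in lborel. norm (LINT x|lborel. norm (case (z, x) of (z, x) \<Rightarrow>
              complex_of_real (gaussian 1 z) * (cnj (f x) * f (\<sigma> n *\<^sub>R z + x)))) \<le> norm (gaussian 1 z * N)"
          proof (rule AE_I2)
            fix z :: "real^3"
            have "norm (LINT x|lborel. norm (case (z, x) of (z, x) \<Rightarrow>
                complex_of_real (gaussian 1 z) * (cnj (f x) * f (\<sigma> n *\<^sub>R z + x)))) =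
                gaussian 1 z * (LINT x|lborel. cmod (f x) * cmod (f (\<sigma> n *\<^sub>R z + x)))"
              by (simp add: norm_mult gaussian_nonneg abs_mult)
            also have "\<dots> \<le> gaussian 1 z * N" by (intro mult_left_mono *(2) gaussian_nonneg)
            finally show "norm (LINT x|lborel. norm (case (z, x) of (z, x) \<Rightarrow>
                complex_of_real (gaussian 1 z) * (cnj (f x) * f (\<sigma> n *\<^sub>R z + x)))) \<le> norm (gaussian 1 z * N)" by simp
          qed
        qed (use gaussian_integrable[of 1] in auto)
        show "AE z in lborel. integrable lborel (\<lambda>x. case (z, x) of (z, x) \<Rightarrow>
            complex_of_real (gaussian 1 z) * (cnj (f x) * f (\<sigma> n *\<^sub>R z + x)))"
        proof (rule AE_I2)
          fix z :: "real^3"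
          have "integrable lborel (\<lambda>x. cnj (f x) * f (\<sigma> n *\<^sub>R z + x))"
            by (rule Bochner_Integration.integrable_bound[OF *(1)[of "\<sigma> n *\<^sub>R z"]]) (auto simp: norm_mult)
          then show "integrable lborel (\<lambda>x. case (z, x) of (z, x) \<Rightarrow>
            complex_of_real (gaussian 1 z) * (cnj (f x) * f (\<sigma> n *\<^sub>R z + x)))" by simp
        qed
      qed measurable
      then show "integrable (lborel \<Otimes>\<^sub>M lborel) (\<lambda>(z, x). complex_of_real (gaussian 1 z) * (cnj (f x) * f (\<sigma> n *\<^sub>R z + x)))" .
    qed
    finally show ?thesis by (simp add: C_def)
  qed
  have Cm[measurable]: "C \<in> borel_measurable borel" unfolding C_def by measurable
  have "(\<lambda>n. LINT z|lborel. complex_of_real (gaussian 1 z) * C (\<sigma> n *\<^sub>R z)) \<longlonglongrightarrow> (LINT z|lborel. complex_of_real (gaussian 1 z) * C 0)"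
  proof (rule integral_dominated_convergence[where w="\<lambda>z. gaussian 1 z * N"])
    show "AE z in lborel. (\<lambda>n. complex_of_real (gaussian 1 z) * C (\<sigma> n *\<^sub>R z)) \<longlonglongrightarrow> complex_of_real (gaussian 1 z) * C 0"
    proof (rule AE_I2, intro tendsto_intros C_lim)
      fix z :: "real^3" show "(\<lambda>n. \<sigma> n *\<^sub>R z) \<longlonglongrightarrow> 0" using tendsto_scaleR[OF \<sigma>0 tendsto_const[of z]] by simp
    qed
    show "AE z in lborel. norm (complex_of_real (gaussian 1 z) * C (\<sigma> n *\<^sub>R z)) \<le> gaussian 1 z * N" for n
      by (auto simp: norm_mult gaussian_nonneg intro!: mult_left_mono C_bound)
  qed (use gaussian_integrable(1)[of 1] in auto)
  then have "(\<lambda>n. LINT z|lborel. complex_of_real (gaussian 1 z) * C (\<sigma> n *\<^sub>R z)) \<longlonglongrightarrow> complex_of_real N"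
    using gaussian_integrable(2)[of 1] by (simp add: C0)
  then show ?thesis unfolding eq[symmetric] unfolding N_def \<sigma>_def .
qed

text \<open>The Gaussian-weighted integral of \<open>|FT s f|^2\<close> is evaluated in two ways. As
  the weights increase to 1 it converges monotonically to the full integral, without prior knowledge
  that this is finite; by the multiplication formula it equals the mollified correlation of
  \<open>f\<close>, which converges to the squared norm.\<close>

lemma plancherel_borel:
  fixes f :: "real^3 \<Rightarrow> complex"
  assumes [measurable]: "f \<in> borel_measurable borel" and i1: "integrable lborel f"
    and i2: "integrable lborel (\<lambda>x. (cmod (f x))\<^sup>2)" and s: "s\<^sup>2 = 1"
  shows "(\<integral>\<^sup>+p. ennreal ((cmod (FT s f p))\<^sup>2) \<partial>lebesgue) = ennreal (LINT x|lborel. (cmod (f x))\<^sup>2)"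
proof -
  have fl: "integrable lebesgue f" using i1 by (simp add: integrable_completion)
  note [measurable] = borel_measurable_integrable[OF fl]
  define \<sigma> where "\<sigma> n = 1 / real (Suc n)" for n
  have \<sigma>: "\<sigma> n > 0" for n by (simp add: \<sigma>_def)
  define w where "w n p = exp (- (\<sigma> n * norm p)\<^sup>2 / 2)" for n and p :: "real^3"
  have [measurable]: "w n \<in> borel_measurable lebesgue" for n unfolding w_def by measurable
  define M where "M = (2 * pi) powr (-3/2) * (LINT x|lebesgue. cmod (f x))"
  have M: "cmod (FT s f p) \<le> M" for p unfolding M_def by (rule FT_bound)
  have wi: "integrable lebesgue (w n)" for n unfolding w_def by (rule integral_cis_gaussian_weight(1)[OF \<sigma>])
  have w0: "0 \<le> w n p" for n p by (simp add: w_def)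
  have wFi: "integrable lebesgue (\<lambda>p. complex_of_real (w n p) * FT s f p)" for n
  proof (rule Bochner_Integration.integrable_bound[of _ "\<lambda>p. M * w n p"])
    show "AE p in lebesgue. norm (complex_of_real (w n p) * FT s f p) \<le> norm (M * w n p)"
    proof (rule AE_I2)
      fix p
      have "norm (complex_of_real (w n p) * FT s f p) \<le> w n p * M"
        unfolding norm_mult using w0[of n p] by (auto intro!: mult_left_mono M)
      then show "norm (complex_of_real (w n p) * FT s f p) \<le> norm (M * w n p)"
        by (simp add: mult.commute)
    qed
  qed (use wi in auto)
  have w2i: "integrable lebesgue (\<lambda>p. w n p * (cmod (FT s f p))\<^sup>2)" for n
  proof (rule Bochner_Integration.integrable_bound[of _ "\<lambda>p. M\<^sup>2 * w n p"])
    show "AE p in lebesgue. norm (w n p * (cmod (FT s f p))\<^sup>2) \<le> norm (M\<^sup>2 * w n p)"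
    proof (rule AE_I2)
      fix p
      have "w n p * (cmod (FT s f p))\<^sup>2 \<le> w n p * M\<^sup>2" by (intro mult_left_mono power_mono M w0) simp
      then show "norm (w n p * (cmod (FT s f p))\<^sup>2) \<le> norm (M\<^sup>2 * w n p)" using w0[of n p] by (simp add: mult.commute)
    qed
  qed (use wi in auto)
  have eq: "complex_of_real (LINT p|lebesgue. w n p * (cmod (FT s f p))\<^sup>2) =
      (LINT x|lborel. cnj (f x) * (LINT y|lborel. complex_of_real (gaussian (\<sigma> n) (y - x)) * f y))" for n
  proof -
    have "complex_of_real (LINT p|lebesgue. w n p * (cmod (FT s f p))\<^sup>2) =
        (LINT p|lebesgue. cnj (FT s f p) * (complex_of_real (w n p) * FT s f p))"
      unfolding integral_complex_of_real[symmetric]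
      by (intro Bochner_Integration.integral_cong) (auto simp: complex_norm_square mult.commute[of "cnj _"] mult.assoc
          simp del: of_real_power)
    also have "\<dots> = (LINT x|lebesgue. cnj (f x) * FT (-s) (\<lambda>p. complex_of_real (w n p) * FT s f p) x)"
      by (rule FT_multiplication_formula[OF fl wFi])
    also have "\<dots> = (LINT x|lebesgue. cnj (f x) * (LINT y|lebesgue. complex_of_real (gaussian (\<sigma> n) (y - x)) * f y))"
      unfolding w_def FT_gaussian_FT[OF fl s \<sigma>] ..
    also have "\<dots> = (LINT x|lebesgue. cnj (f x) * (LINT y|lborel. complex_of_real (gaussian (\<sigma> n) (y - x)) * f y))"
      by (subst integral_completion[of "\<lambda>y. complex_of_real (gaussian (\<sigma> n) (y - _)) * f y"]) auto
    also have "\<dots> = (LINT x|lborel. cnj (f x) * (LINT y|lborel. complex_of_real (gaussian (\<sigma> n) (y - x)) * f y))"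
      by (rule integral_completion) measurable
    finally show ?thesis .
  qed
  have "(\<lambda>n. complex_of_real (LINT p|lebesgue. w n p * (cmod (FT s f p))\<^sup>2)) \<longlonglongrightarrow> complex_of_real (LINT x|lborel. (cmod (f x))\<^sup>2)"
    unfolding eq \<sigma>_def by (rule correlation_gaussian_tendsto[OF assms(1) i2])
  then have lim: "(\<lambda>n. LINT p|lebesgue. w n p * (cmod (FT s f p))\<^sup>2) \<longlonglongrightarrow> (LINT x|lborel. (cmod (f x))\<^sup>2)"
    by (rule tendsto_of_real_iff[THEN iffD1])
  have nn: "(\<integral>\<^sup>+p. ennreal (w n p * (cmod (FT s f p))\<^sup>2) \<partial>lebesgue) = ennreal (LINT p|lebesgue. w n p * (cmod (FT s f p))\<^sup>2)" for n
    by (rule nn_integral_eq_integral[OF w2i]) (simp add: w0)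
  have "incseq (\<lambda>n p. ennreal (w n p * (cmod (FT s f p))\<^sup>2))"
  proof (rule incseq_SucI, rule le_funI, rule ennreal_leI, rule mult_right_mono)
    fix n and p :: "real^3"
    have "(\<sigma> (Suc n) * norm p)\<^sup>2 \<le> (\<sigma> n * norm p)\<^sup>2"
      by (intro power_mono mult_right_mono) (auto simp: \<sigma>_def frac_le)
    then show "w n p \<le> w (Suc n) p" by (simp add: w_def)
  qed simp
  then have "(\<integral>\<^sup>+p. (SUP n. ennreal (w n p * (cmod (FT s f p))\<^sup>2)) \<partial>lebesgue) =
      (SUP n. \<integral>\<^sup>+p. ennreal (w n p * (cmod (FT s f p))\<^sup>2) \<partial>lebesgue)"
    by (intro nn_integral_monotone_convergence_SUP) auto
  moreover have "(SUP n. ennreal (w n p * (cmod (FT s f p))\<^sup>2)) = ennreal ((cmod (FT s f p))\<^sup>2)" for p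
  proof (rule LIMSEQ_unique[OF LIMSEQ_SUP])
    show "incseq (\<lambda>n. ennreal (w n p * (cmod (FT s f p))\<^sup>2))"
      using \<open>incseq (\<lambda>n p. ennreal (w n p * (cmod (FT s f p))\<^sup>2))\<close> by (simp add: incseq_def le_fun_def)
    have "\<sigma> \<longlonglongrightarrow> 0" unfolding \<sigma>_def by (rule LIMSEQ_Suc[OF lim_1_over_n])
    then have "(\<lambda>n. w n p * (cmod (FT s f p))\<^sup>2) \<longlonglongrightarrow> exp (- (0 * norm p)\<^sup>2 / 2) * (cmod (FT s f p))\<^sup>2"
      unfolding w_def by (intro tendsto_intros) auto
    then show "(\<lambda>n. ennreal (w n p * (cmod (FT s f p))\<^sup>2)) \<longlonglongrightarrow> ennreal ((cmod (FT s f p))\<^sup>2)"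
      by (intro tendsto_ennrealI) simp
  qed
  moreover have "(SUP n. ennreal (LINT p|lebesgue. w n p * (cmod (FT s f p))\<^sup>2)) = ennreal (LINT x|lborel. (cmod (f x))\<^sup>2)"
  proof (rule LIMSEQ_unique[OF LIMSEQ_SUP])
    show "incseq (\<lambda>n. ennreal (LINT p|lebesgue. w n p * (cmod (FT s f p))\<^sup>2))"
      unfolding nn[symmetric] using \<open>incseq (\<lambda>n p. ennreal (w n p * (cmod (FT s f p))\<^sup>2))\<close>
      by (auto simp: incseq_def le_fun_def intro!: nn_integral_mono)
    show "(\<lambda>n. ennreal (LINT p|lebesgue. w n p * (cmod (FT s f p))\<^sup>2)) \<longlonglongrightarrow> ennreal (LINT x|lborel. (cmod (f x))\<^sup>2)"
      by (rule tendsto_ennrealI[OF lim])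
  qed
  ultimately show ?thesis by (simp add: nn)
qed

text \<open>Translations and affine substitutions were carried out for Borel functions. A Lebesgue
  measurable function is replaced by a Borel one that agrees with it almost everywhere, which
  changes neither the transform nor the norms.\<close>

theorem plancherel:
  assumes i1: "integrable lebesgue f" and f2: "f \<in> L2" and s: "s\<^sup>2 = 1"
  shows "FT s f \<in> L2" "L2_norm (FT s f) = L2_norm f"
proof -
  note fm[measurable] = borel_measurable_integrable[OF i1]
  have m: "(\<lambda>x. Re (f x)) \<in> borel_measurable lebesgue" "(\<lambda>x. Im (f x)) \<in> borel_measurable lebesgue" by measurable
  from completion_ex_borel_measurable_real[OF m(1)] obtain g
    where [measurable]: "g \<in> borel_measurable lborel" and g: "AE x in lborel. Re (f x) = g x" by blast
  from completion_ex_borel_measurable_real[OF m(2)] obtain h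
    where [measurable]: "h \<in> borel_measurable lborel" and h: "AE x in lborel. Im (f x) = h x" by blast
  define f' where "f' x = complex_of_real (g x) + \<i> * complex_of_real (h x)" for x
  have f'[measurable]: "f' \<in> borel_measurable lborel" unfolding f'_def by measurable
  have ae: "AE x in lborel. f x = f' x"
    using g h by eventually_elim (simp add: f'_def complex_eq_iff)
  have aeL: "AE x in lebesgue. f x = f' x" using AE_completion[OF ae] .
  have f'b: "f' \<in> borel_measurable borel" using f' by simp
  have f'l[measurable]: "f' \<in> borel_measurable lebesgue" by (rule borel_imp_lebesgue[OF f'b])
  have F: "FT s f = FT s f'" by (rule FT_cong_AE[OF fm f'l aeL])
  have "integrable lebesgue f'" using integrable_cong_AE[OF fm f'l aeL] i1 by simp
  then have i1': "integrable lborel f'" using integrable_completion[OF f'] by simp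
  have "f' \<in> L2" by (rule L2_cong_AE[OF f2 f'l aeL])
  then have i2': "integrable lborel (\<lambda>x. (cmod (f' x))\<^sup>2)"
    using integrable_completion[of "\<lambda>x. (cmod (f' x))\<^sup>2" lborel] by (auto simp: L2_def)
  have n: "(L2_norm f)\<^sup>2 = (LINT x|lborel. (cmod (f' x))\<^sup>2)"
    unfolding L2_norm_cong_AE[OF fm f'l aeL] L2_norm_sq by (rule integral_completion) measurable
  have nn: "(\<integral>\<^sup>+p. ennreal ((cmod (FT s f p))\<^sup>2) \<partial>lebesgue) = ennreal ((L2_norm f)\<^sup>2)"
    unfolding n F by (rule plancherel_borel[OF f'b i1' i2' s])
  show "FT s f \<in> L2" by (subst L2_iff_nn_integral) (auto simp: nn)
  then have "(L2_norm (FT s f))\<^sup>2 = (L2_norm f)\<^sup>2"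
    using nn nn_integral_L2[of "FT s f"] by (simp add: ennreal_inj)
  then show "L2_norm (FT s f) = L2_norm f" by (rule power2_eq_imp_eq) simp_all
qed

subsection \<open>The Fourier transform on \<open>L\<^sup>2\<close>\<close>

definition has_FT :: "real \<Rightarrow> (real^3 \<Rightarrow> complex) \<Rightarrow> (real^3 \<Rightarrow> complex) \<Rightarrow> bool" where
  "has_FT s F f \<longleftrightarrow> L2_limit (\<lambda>R. FT s (truncate R F)) f"

lemma has_fourier_iff: "has_fourier f F \<longleftrightarrow> has_FT (-1) f F"
  by (simp add: has_fourier_def has_FT_def fourier_eq_FT)

lemma has_inv_fourier_iff: "has_inv_fourier F f \<longleftrightarrow> has_FT 1 F f"
  by (simp add: has_inv_fourier_def has_FT_def inv_fourier_eq_FT)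

lemma truncate_measurable [measurable (raw)]:
  assumes [measurable]: "f \<in> borel_measurable lebesgue" shows "truncate R f \<in> borel_measurable lebesgue"
  unfolding truncate_def by measurable

lemma cmod_truncate_le: "cmod (truncate R f x) \<le> cmod (f x)"
  by (simp add: truncate_def)

lemma truncate_add: "truncate R (\<lambda>x. f x + g x) = (\<lambda>x. truncate R f x + truncate R g x)"
  by (auto simp: truncate_def)

lemma truncate_scale: "truncate R (\<lambda>x. c * f x) = (\<lambda>x. c * truncate R f x)"
  by (auto simp: truncate_def)

lemma truncate_L2: "f \<in> L2 \<Longrightarrow> truncate R f \<in> L2"
  by (rule L2_dominated) (auto intro!: truncate_measurable L2_measurable cmod_truncate_le)

lemma integrable_indicator_cball: "integrable lebesgue (\<lambda>x::real^3. indicator (cball 0 R) x :: real)"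
proof -
  have "integrable lborel (\<lambda>x::real^3. indicator (cball 0 R) x :: real)"
    using emeasure_lborel_cball_finite[of "0::real^3" R] by (intro integrable_real_indicator) auto
  then show ?thesis by (subst integrable_completion) auto
qed

lemma truncate_L2_integrable:
  assumes "f \<in> L2" shows "integrable lebesgue (truncate R f)"
proof (rule Bochner_Integration.integrable_bound[of _ "\<lambda>x. indicator (cball 0 R) x + (cmod (f x))\<^sup>2"])
  note L2_measurable[OF assms, measurable]
  show "AE x in lebesgue. norm (truncate R f x) \<le> norm (indicator (cball 0 R) x + (cmod (f x))\<^sup>2 :: real)"
  proof (rule AE_I2)
    fix x
    have "2 * cmod (f x) \<le> 1 + (cmod (f x))\<^sup>2" using sum_squares_bound[of 1 "cmod (f x)"] by simp
    moreover have "0 \<le> (cmod (f x))\<^sup>2" by simp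
    ultimately have "cmod (f x) \<le> 1 + (cmod (f x))\<^sup>2" by linarith
    then show "norm (truncate R f x) \<le> norm (indicator (cball 0 R) x + (cmod (f x))\<^sup>2 :: real)"
      by (auto simp: truncate_def indicator_def)
  qed
qed (use assms in \<open>auto intro!: integrable_indicator_cball L2_integrable truncate_measurable L2_measurable\<close>)

text \<open>The domain of the extended transform. It contains \<open>L2\<close> and also functions
  such as \<open>F0\<close>, whose singularity of type \<open>1/p^2\<close> at the origin is
  integrable but not square integrable. Beyond radius 1 truncations differ by elements of
  \<open>L2\<close>, to which Plancherel applies.\<close>

definition L1_L2 :: "(real^3 \<Rightarrow> complex) \<Rightarrow> bool" where
  "L1_L2 F \<longleftrightarrow> F \<in> borel_measurable lebesgue \<and> (\<forall>R. integrable lebesgue (truncate R F)) \<and>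
     (\<lambda>x. F x - truncate 1 F x) \<in> L2"

lemma L1_L2_measurable: "L1_L2 F \<Longrightarrow> F \<in> borel_measurable lebesgue"
  by (simp add: L1_L2_def)

lemma L1_L2_integrable: "L1_L2 F \<Longrightarrow> integrable lebesgue (truncate R F)"
  by (simp add: L1_L2_def)

lemma L1_L2_of_L2: "F \<in> L2 \<Longrightarrow> L1_L2 F"
  by (simp add: L1_L2_def L2_measurable truncate_L2_integrable L2_diff truncate_L2)

lemma L1_L2_add: "L1_L2 F \<Longrightarrow> L1_L2 G \<Longrightarrow> L1_L2 (\<lambda>x. F x + G x)"
  unfolding L1_L2_def truncate_add
  using L2_add[of "\<lambda>x. F x - truncate 1 F x" "\<lambda>x. G x - truncate 1 G x"] by (auto simp: algebra_simps)

lemma L1_L2_scale: "L1_L2 F \<Longrightarrow> L1_L2 (\<lambda>x. c * F x)"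
  unfolding L1_L2_def truncate_scale
  using L2_scale[of "\<lambda>x. F x - truncate 1 F x" c] by (auto simp: algebra_simps)

lemma L1_L2_tail:
  assumes F: "L1_L2 F" and R: "1 \<le> R" shows "(\<lambda>x. F x - truncate R F x) \<in> L2"
proof (rule L2_dominated)
  note L1_L2_measurable[OF F, measurable]
  show "(\<lambda>x. F x - truncate 1 F x) \<in> L2" using F by (simp add: L1_L2_def)
  show "(\<lambda>x. F x - truncate R F x) \<in> borel_measurable lebesgue" by measurable
  show "AE x in lebesgue. cmod (F x - truncate R F x) \<le> cmod (F x - truncate 1 F x)"
    using R by (auto simp: truncate_def)
qed

lemma L1_L2_tail_norm_mono:
  assumes F: "L1_L2 F" and R: "1 \<le> R" "R \<le> S"
  shows "L2_norm (\<lambda>x. F x - truncate S F x) \<le> L2_norm (\<lambda>x. F x - truncate R F x)"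
  by (rule L2_norm_mono[OF L1_L2_tail[OF F R(1)]]) (use R in \<open>auto simp: truncate_def\<close>)

lemma L1_L2_tail_tendsto:
  assumes F: "L1_L2 F" shows "((\<lambda>R. L2_norm (\<lambda>x. F x - truncate R F x)) \<longlongrightarrow> 0) at_top"
proof -
  note L1_L2_measurable[OF F, measurable]
  have i: "integrable lebesgue (\<lambda>x. (cmod (F x - truncate 1 F x))\<^sup>2)"
    using L1_L2_tail[OF F, of 1] by (simp add: L2_integrable)
  have "((\<lambda>R. LINT x|lebesgue. (cmod (F x - truncate R F x))\<^sup>2) \<longlongrightarrow> (LINT x|(lebesgue::(real^3) measure). 0)) at_top"
  proof (rule integral_dominated_convergence_at_top[OF _ _ i])
    show "\<forall>\<^sub>F R in at_top. AE x in lebesgue. norm ((cmod (F x - truncate R F x))\<^sup>2) \<le> (cmod (F x - truncate 1 F x))\<^sup>2"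
      using eventually_ge_at_top[of 1] by eventually_elim (auto simp: truncate_def)
    show "AE x in lebesgue. ((\<lambda>R. (cmod (F x - truncate R F x))\<^sup>2) \<longlongrightarrow> 0) at_top"
    proof (rule AE_I2)
      fix x
      have "eventually (\<lambda>R. (cmod (F x - truncate R F x))\<^sup>2 = 0) at_top"
        using eventually_ge_at_top[of "norm x"] by eventually_elim (simp add: truncate_def)
      then show "((\<lambda>R. (cmod (F x - truncate R F x))\<^sup>2) \<longlongrightarrow> 0) at_top" by (rule tendsto_eventually)
    qed
  qed measurable
  then have "((\<lambda>R. sqrt (LINT x|lebesgue. (cmod (F x - truncate R F x))\<^sup>2)) \<longlongrightarrow> sqrt 0) at_top"
    by (intro tendsto_real_sqrt) simp
  then show ?thesis by (simp add: L2_norm_def)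
qed

text \<open>The difference of two truncations lives in a shell where \<open>F\<close> is square
  integrable, so Plancherel turns the tail of \<open>F\<close> into a bound on the difference of the
  transforms.\<close>

lemma FT_truncate_diff:
  assumes F: "L1_L2 F" and s: "s\<^sup>2 = 1" and R: "1 \<le> R" "R \<le> S"
  shows "(\<lambda>x. FT s (truncate S F) x - FT s (truncate R F) x) \<in> L2"
    and "L2_norm (\<lambda>x. FT s (truncate S F) x - FT s (truncate R F) x) \<le> L2_norm (\<lambda>x. F x - truncate R F x)"
proof -
  note L1_L2_measurable[OF F, measurable]
  let ?G = "\<lambda>x. truncate S F x - truncate R F x"
  have eq: "(\<lambda>x. FT s (truncate S F) x - FT s (truncate R F) x) = FT s ?G"
    by (auto simp: FT_diff L1_L2_integrable[OF F])
  have G1: "integrable lebesgue ?G" using L1_L2_integrable[OF F] by simp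
  have le: "cmod (?G x) \<le> cmod (F x - truncate R F x)" for x using R by (auto simp: truncate_def)
  have G2: "?G \<in> L2" by (rule L2_dominated[OF L1_L2_tail[OF F R(1)]]) (measurable, use le in auto)
  show "(\<lambda>x. FT s (truncate S F) x - FT s (truncate R F) x) \<in> L2"
    unfolding eq by (rule plancherel(1)[OF G1 G2 s])
  show "L2_norm (\<lambda>x. FT s (truncate S F) x - FT s (truncate R F) x) \<le> L2_norm (\<lambda>x. F x - truncate R F x)"
    unfolding eq plancherel(2)[OF G1 G2 s] by (rule L2_norm_mono[OF L1_L2_tail[OF F R(1)] le])
qed

lemma FT_truncate_Cauchy:
  assumes F: "L1_L2 F" and s: "s\<^sup>2 = 1"
  shows "L2_Cauchy (\<lambda>R. FT s (truncate R F))"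
  unfolding L2_Cauchy_def
proof (intro conjI allI impI)
  note L1_L2_measurable[OF F, measurable]
  show "FT s (truncate R F) \<in> borel_measurable lebesgue" for R by measurable
  fix e :: real assume "0 < e"
  then have "eventually (\<lambda>R. L2_norm (\<lambda>x. F x - truncate R F x) < sqrt e) at_top"
    by (intro order_tendstoD[OF L1_L2_tail_tendsto[OF F]]) simp
  with eventually_ge_at_top[of 1] have "eventually (\<lambda>R. 1 \<le> R \<and> L2_norm (\<lambda>x. F x - truncate R F x) < sqrt e) at_top"
    by (rule eventually_conj)
  then obtain R0 where R0: "1 \<le> R0" "L2_norm (\<lambda>x. F x - truncate R0 F x) < sqrt e"
    by (auto simp: eventually_at_top_linorder)
  have *: "(\<integral>\<^sup>+x. ennreal ((cmod (FT s (truncate S F) x - FT s (truncate R F) x))\<^sup>2) \<partial>lebesgue) \<le> ennreal e"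
    if "R0 \<le> R" "R \<le> S" for R S
  proof -
    have R1: "1 \<le> R" using R0 that by simp
    have "L2_norm (\<lambda>x. FT s (truncate S F) x - FT s (truncate R F) x) \<le> sqrt e"
      using FT_truncate_diff(2)[OF F s R1 that(2)] L1_L2_tail_norm_mono[OF F R0(1) that(1)] R0(2) by linarith
    then have "(L2_norm (\<lambda>x. FT s (truncate S F) x - FT s (truncate R F) x))\<^sup>2 \<le> (sqrt e)\<^sup>2"
      by (intro power_mono) auto
    then show ?thesis
      unfolding nn_integral_L2[OF FT_truncate_diff(1)[OF F s R1 that(2)]] using \<open>0 < e\<close> by (intro ennreal_leI) simp
  qed
  show "\<exists>R0. \<forall>R\<ge>R0. \<forall>S\<ge>R0. (\<integral>\<^sup>+x. ennreal ((cmod (FT s (truncate R F) x - FT s (truncate S F) x))\<^sup>2) \<partial>lebesgue) \<le> ennreal e"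
  proof (intro exI allI impI)
    fix R S assume "R0 \<le> R" "R0 \<le> S"
    then show "(\<integral>\<^sup>+x. ennreal ((cmod (FT s (truncate R F) x - FT s (truncate S F) x))\<^sup>2) \<partial>lebesgue) \<le> ennreal e"
      using *[of R S] *[of S R] by (cases "R \<le> S") (simp_all add: norm_minus_commute)
  qed
qed

lemma has_FT_exists: "L1_L2 F \<Longrightarrow> s\<^sup>2 = 1 \<Longrightarrow> \<exists>f. has_FT s F f"
  unfolding has_FT_def by (intro Riesz_Fischer FT_truncate_Cauchy)

lemma has_FT_measurable: "has_FT s F f \<Longrightarrow> f \<in> borel_measurable lebesgue"
  unfolding has_FT_def by (rule L2_limit_measurable)

lemma has_FT_add:
  assumes "has_FT s F f" "has_FT s G g" and F: "L1_L2 F" and G: "L1_L2 G"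
  shows "has_FT s (\<lambda>x. F x + G x) (\<lambda>x. f x + g x)"
proof -
  note L1_L2_measurable[OF F, measurable] L1_L2_measurable[OF G, measurable]
  have eq: "FT s (truncate R (\<lambda>x. F x + G x)) = (\<lambda>x. FT s (truncate R F) x + FT s (truncate R G) x)" for R
    by (auto simp: truncate_add FT_add L1_L2_integrable F G)
  show ?thesis
    unfolding has_FT_def eq by (rule L2_limit_add[OF assms(1,2)[unfolded has_FT_def]]) measurable
qed

lemma has_FT_scale:
  assumes "has_FT s F f" and [measurable]: "F \<in> borel_measurable lebesgue"
  shows "has_FT s (\<lambda>x. c * F x) (\<lambda>x. c * f x)"
proof -
  have eq: "FT s (truncate R (\<lambda>x. c * F x)) = (\<lambda>x. c * FT s (truncate R F) x)" for R
    by (auto simp: truncate_scale FT_scale)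
  show ?thesis
    unfolding has_FT_def eq by (rule L2_limit_scale[OF assms(1)[unfolded has_FT_def]]) measurable
qed

lemma has_FT_diff:
  assumes "has_FT s F f" "has_FT s G g" and F: "L1_L2 F" and G: "L1_L2 G"
  shows "has_FT s (\<lambda>x. F x - G x) (\<lambda>x. f x - g x)"
  using has_FT_add[OF assms(1) has_FT_scale[OF assms(2) L1_L2_measurable[OF G], of "-1"] F L1_L2_scale[OF G, of "-1"]]
  by simp

text \<open>For integrable \<open>F\<close> the truncated transforms converge pointwise by dominated
  convergence, and the pointwise limit must be the L^2-limit.\<close>

lemma has_FT_integrable:
  assumes F: "L1_L2 F" and i: "integrable lebesgue F" and s: "s\<^sup>2 = 1"
  shows "has_FT s F (FT s F)"
  unfolding has_FT_def
proof (rule L2_limit_of_pointwise[OF FT_truncate_Cauchy[OF F s] filterlim_real_sequentially])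
  note L1_L2_measurable[OF F, measurable]
  show "FT s F \<in> borel_measurable lebesgue" by measurable
  show "AE x in lebesgue. (\<lambda>n. FT s (truncate (real n) F) x) \<longlonglongrightarrow> FT s F x"
  proof (rule AE_I2)
    fix x
    have "(\<lambda>n. LINT p|lebesgue. cis (s * (x \<bullet> p)) * truncate (real n) F p) \<longlonglongrightarrow> (LINT p|lebesgue. cis (s * (x \<bullet> p)) * F p)"
    proof (rule integral_dominated_convergence[where w="\<lambda>p. cmod (F p)"])
      show "AE p in lebesgue. (\<lambda>n. cis (s * (x \<bullet> p)) * truncate (real n) F p) \<longlonglongrightarrow> cis (s * (x \<bullet> p)) * F p"
      proof (rule AE_I2, rule tendsto_eventually)
        fix p :: "real^3"
        have "eventually (\<lambda>n. norm p \<le> real n) sequentially"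
          using filterlim_real_sequentially unfolding filterlim_at_top by blast
        then show "eventually (\<lambda>n. cis (s * (x \<bullet> p)) * truncate (real n) F p = cis (s * (x \<bullet> p)) * F p) sequentially"
          by eventually_elim (simp add: truncate_def)
      qed
    qed (use i in \<open>auto simp: norm_mult cmod_truncate_le\<close>)
    then show "(\<lambda>n. FT s (truncate (real n) F) x) \<longlonglongrightarrow> FT s F x"
      unfolding FT_def by (intro tendsto_intros)
  qed
qed

lemma L2_limit_norm_diff:
  assumes u: "L2_limit u f" and um: "\<And>R. u R \<in> borel_measurable lebesgue"
  shows "eventually (\<lambda>R. (\<lambda>x. f x - u R x) \<in> L2) at_top"
    and "((\<lambda>R. L2_norm (\<lambda>x. f x - u R x)) \<longlongrightarrow> 0) at_top"
proof -
  note L2_limit_measurable[OF u, measurable] um[measurable]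
  have eq: "cmod (f x - u R x) = cmod (u R x - f x)" for x R by (rule norm_minus_commute)
  have lim: "((\<lambda>R. \<integral>\<^sup>+x. ennreal ((cmod (f x - u R x))\<^sup>2) \<partial>lebesgue) \<longlongrightarrow> 0) at_top"
    unfolding eq by (rule conjunct2[OF u[unfolded L2_limit_def]])
  have "eventually (\<lambda>R. (\<integral>\<^sup>+x. ennreal ((cmod (f x - u R x))\<^sup>2) \<partial>lebesgue) < \<infinity>) at_top"
    by (rule order_tendstoD(2)[OF lim]) simp
  then show ev: "eventually (\<lambda>R. (\<lambda>x. f x - u R x) \<in> L2) at_top"
    by eventually_elim (subst L2_iff_nn_integral; measurable)
  have "((\<lambda>R. enn2real (\<integral>\<^sup>+x. ennreal ((cmod (f x - u R x))\<^sup>2) \<partial>lebesgue)) \<longlongrightarrow> 0) at_top"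
    by (rule tendsto_enn2real[of _ 0]) (use lim in simp_all)
  then have "((\<lambda>R. sqrt (enn2real (\<integral>\<^sup>+x. ennreal ((cmod (f x - u R x))\<^sup>2) \<partial>lebesgue))) \<longlongrightarrow> sqrt 0) at_top"
    by (rule tendsto_real_sqrt)
  then show "((\<lambda>R. L2_norm (\<lambda>x. f x - u R x)) \<longlongrightarrow> 0) at_top"
    unfolding L2_norm_def by (simp add: integral_eq_nn_integral)
qed

lemma L2_limit_norm_le:
  assumes u: "L2_limit u f" and um: "\<And>R. u R \<in> borel_measurable lebesgue"
    and ev: "eventually (\<lambda>R. (\<lambda>x. u R x - v x) \<in> L2 \<and> L2_norm (\<lambda>x. u R x - v x) \<le> c) at_top"
  shows "(\<lambda>x. f x - v x) \<in> L2" "L2_norm (\<lambda>x. f x - v x) \<le> c"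
proof -
  have eq: "(\<lambda>x. f x - v x) = (\<lambda>x. (f x - u R x) + (u R x - v x))" for R by auto
  obtain R where "(\<lambda>x. f x - u R x) \<in> L2" "(\<lambda>x. u R x - v x) \<in> L2"
    using eventually_happens'[OF trivial_limit_at_top_linorder eventually_conj[OF L2_limit_norm_diff(1)[OF u um] ev]] by blast
  then show "(\<lambda>x. f x - v x) \<in> L2" unfolding eq[of R] by (rule L2_add)
  have lim: "((\<lambda>R. L2_norm (\<lambda>x. f x - u R x) + c) \<longlongrightarrow> 0 + c) at_top"
    by (intro tendsto_intros L2_limit_norm_diff[OF u um])
  have "eventually (\<lambda>R. L2_norm (\<lambda>x. f x - v x) \<le> L2_norm (\<lambda>x. f x - u R x) + c) at_top"
    using L2_limit_norm_diff(1)[OF u um] ev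
  proof eventually_elim
    case (elim R)
    then show ?case unfolding eq[of R] using L2_norm_triangle[of "\<lambda>x. f x - u R x" "\<lambda>x. u R x - v x"] by linarith
  qed
  then show "L2_norm (\<lambda>x. f x - v x) \<le> c"
    using tendsto_lowerbound[OF lim _ trivial_limit_at_top_linorder] by simp
qed

lemma has_FT_tail:
  assumes h: "has_FT s F f" and F: "L1_L2 F" and s: "s\<^sup>2 = 1" and R: "1 \<le> R"
  shows "(\<lambda>x. f x - FT s (truncate R F) x) \<in> L2"
    "L2_norm (\<lambda>x. f x - FT s (truncate R F) x) \<le> L2_norm (\<lambda>x. F x - truncate R F x)"
proof -
  note L1_L2_measurable[OF F, measurable]
  have m: "FT s (truncate S F) \<in> borel_measurable lebesgue" for S by measurable
  have "eventually (\<lambda>S. (\<lambda>x. FT s (truncate S F) x - FT s (truncate R F) x) \<in> L2 \<and>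
      L2_norm (\<lambda>x. FT s (truncate S F) x - FT s (truncate R F) x) \<le> L2_norm (\<lambda>x. F x - truncate R F x)) at_top"
    using eventually_ge_at_top[of R] by eventually_elim (use FT_truncate_diff[OF F s R] in blast)
  from L2_limit_norm_le[OF h[unfolded has_FT_def] m this]
  show "(\<lambda>x. f x - FT s (truncate R F) x) \<in> L2"
    "L2_norm (\<lambda>x. f x - FT s (truncate R F) x) \<le> L2_norm (\<lambda>x. F x - truncate R F x)" by auto
qed

lemma has_FT_L2:
  assumes h: "has_FT s F f" and F: "F \<in> L2" and s: "s\<^sup>2 = 1" shows "f \<in> L2"
proof -
  have "FT s (truncate 1 F) \<in> L2" by (rule plancherel(1)[OF truncate_L2_integrable[OF F] truncate_L2[OF F] s])
  from L2_add[OF has_FT_tail(1)[OF h L1_L2_of_L2[OF F] s order_refl] this] show ?thesis by simp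
qed

lemma L2_limit_tendsto:
  assumes u: "L2_limit u f" and uL: "\<And>R. u R \<in> L2" and f: "f \<in> L2"
  shows "((\<lambda>R. L2_norm (u R)) \<longlongrightarrow> L2_norm f) at_top"
    and "g \<in> L2 \<Longrightarrow> ((\<lambda>R. L2_inner (u R) g) \<longlongrightarrow> L2_inner f g) at_top"
proof -
  have um: "u R \<in> borel_measurable lebesgue" for R by (rule L2_measurable[OF uL])
  note d = L2_limit_norm_diff(2)[OF u um]
  have *: "norm (L2_norm (u R) - L2_norm f) \<le> L2_norm (\<lambda>x. f x - u R x)" for R
    using L2_norm_triangle[OF L2_diff[OF f uL] uL, of R R] L2_norm_triangle[OF L2_uminus[OF L2_diff[OF f uL]] f, of R]
    by (simp add: L2_norm_uminus[of "\<lambda>x. f x - u R x", simplified])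
  have "((\<lambda>R. L2_norm (u R) - L2_norm f) \<longlongrightarrow> 0) at_top"
    by (rule Lim_null_comparison[OF always_eventually[OF allI[OF *]] d])
  then show "((\<lambda>R. L2_norm (u R)) \<longlongrightarrow> L2_norm f) at_top" by (simp add: LIM_zero_iff)
  assume g: "g \<in> L2"
  have **: "norm (L2_inner (u R) g - L2_inner f g) \<le> L2_norm (\<lambda>x. f x - u R x) * L2_norm g" for R
  proof -
    have "L2_inner f g = L2_inner (\<lambda>x. f x - u R x) g + L2_inner (u R) g"
      using L2_inner_add_left[OF g L2_diff[OF f uL] uL, of R R] by simp
    then show ?thesis using L2_Cauchy_Schwarz[OF L2_diff[OF f uL] g, of R] by (simp add: norm_minus_commute)
  qed
  have "((\<lambda>R. L2_norm (\<lambda>x. f x - u R x) * L2_norm g) \<longlongrightarrow> 0) at_top"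
    by (rule tendsto_mult_left_zero[OF d])
  then have "((\<lambda>R. L2_inner (u R) g - L2_inner f g) \<longlongrightarrow> 0) at_top"
    by (rule Lim_null_comparison[OF always_eventually[OF allI[OF **]]])
  then show "((\<lambda>R. L2_inner (u R) g) \<longlongrightarrow> L2_inner f g) at_top" by (simp add: LIM_zero_iff)
qed

lemma truncate_L2_limit:
  assumes f: "f \<in> L2" shows "L2_limit (\<lambda>R. truncate R f) f"
  unfolding L2_limit_def
proof
  have "(\<integral>\<^sup>+x. ennreal ((cmod (truncate R f x - f x))\<^sup>2) \<partial>lebesgue) = ennreal ((L2_norm (\<lambda>x. f x - truncate R f x))\<^sup>2)" for R
    using nn_integral_L2[OF L2_diff[OF f truncate_L2[OF f]], of R] by (simp add: norm_minus_commute)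
  moreover have "((\<lambda>R. ennreal ((L2_norm (\<lambda>x. f x - truncate R f x))\<^sup>2)) \<longlongrightarrow> ennreal (0\<^sup>2)) at_top"
    by (intro tendsto_ennrealI tendsto_power L1_L2_tail_tendsto L1_L2_of_L2 f)
  ultimately show "((\<lambda>R. \<integral>\<^sup>+x. ennreal ((cmod (truncate R f x - f x))\<^sup>2) \<partial>lebesgue) \<longlongrightarrow> 0) at_top" by simp
qed (rule L2_measurable[OF f])

lemma has_FT_norm:
  assumes h: "has_FT s F f" and F: "F \<in> L2" and s: "s\<^sup>2 = 1" shows "L2_norm f = L2_norm F"
proof (rule tendsto_unique[OF trivial_limit_at_top_linorder])
  show "((\<lambda>R. L2_norm (FT s (truncate R F))) \<longlongrightarrow> L2_norm f) at_top"
    by (rule L2_limit_tendsto(1)[OF h[unfolded has_FT_def] _ has_FT_L2[OF h F s]])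
       (rule plancherel(1)[OF truncate_L2_integrable[OF F] truncate_L2[OF F] s])
  show "((\<lambda>R. L2_norm (FT s (truncate R F))) \<longlongrightarrow> L2_norm F) at_top"
    unfolding plancherel(2)[OF truncate_L2_integrable[OF F] truncate_L2[OF F] s]
    by (rule L2_limit_tendsto(1)[OF truncate_L2_limit[OF F] truncate_L2[OF F] F])
qed

text \<open>Expand the square of \<open>f - FT (- s) (truncate R F)\<close>. By the multiplication
  formula the cross term equals the squared norm of \<open>truncate R F\<close>, so the squared
  distance is \<open>|f|^2 - |truncate R F|^2\<close>, and this tends to 0 because \<open>F\<close>
  and \<open>f\<close> have equal norm.\<close>

theorem FT_inversion:
  assumes h: "has_FT s f F" and f: "f \<in> L2" and s: "s\<^sup>2 = 1"
  shows "has_FT (- s) F f"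
proof -
  have s': "(- s)\<^sup>2 = 1" using s by simp
  have F: "F \<in> L2" by (rule has_FT_L2[OF h f s])
  have FR1: "integrable lebesgue (truncate R F)" and FR2: "truncate R F \<in> L2" for R
    using truncate_L2_integrable[OF F] truncate_L2[OF F] by auto
  have iF2: "FT (- s) (truncate R F) \<in> L2" for R by (rule plancherel(1)[OF FR1 FR2 s'])
  have inner: "L2_inner f (FT (- s) (truncate R F)) = complex_of_real ((L2_norm (truncate R F))\<^sup>2)" for R
  proof -
    have "L2_inner (truncate S f) (FT (- s) (truncate R F)) = L2_inner (FT s (truncate S f)) (truncate R F)" for S
      unfolding L2_inner_def by (rule FT_multiplication_formula[symmetric, OF truncate_L2_integrable[OF f] FR1])
    moreover have "((\<lambda>S. L2_inner (truncate S f) (FT (- s) (truncate R F))) \<longlongrightarrow> L2_inner f (FT (- s) (truncate R F))) at_top"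
      by (rule L2_limit_tendsto(2)[OF truncate_L2_limit[OF f] truncate_L2[OF f] f iF2])
    moreover have "((\<lambda>S. L2_inner (FT s (truncate S f)) (truncate R F)) \<longlongrightarrow> L2_inner F (truncate R F)) at_top"
      by (rule L2_limit_tendsto(2)[OF h[unfolded has_FT_def] _ F FR2])
         (rule plancherel(1)[OF truncate_L2_integrable[OF f] truncate_L2[OF f] s])
    ultimately have "L2_inner f (FT (- s) (truncate R F)) = L2_inner F (truncate R F)"
      using tendsto_unique[OF trivial_limit_at_top_linorder] by simp
    also have "\<dots> = L2_inner (truncate R F) (truncate R F)"
      unfolding L2_inner_def by (intro Bochner_Integration.integral_cong) (auto simp: truncate_def)
    finally show ?thesis by (simp add: L2_inner_self)
  qed
  have eq: "(L2_norm (\<lambda>x. f x - FT (- s) (truncate R F) x))\<^sup>2 = (L2_norm f)\<^sup>2 - (L2_norm (truncate R F))\<^sup>2" for R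
    unfolding L2_norm_diff_sq[OF f iF2] inner plancherel(2)[OF FR1 FR2 s'] by simp
  have "(\<integral>\<^sup>+x. ennreal ((cmod (FT (- s) (truncate R F) x - f x))\<^sup>2) \<partial>lebesgue) =
      ennreal ((L2_norm f)\<^sup>2 - (L2_norm (truncate R F))\<^sup>2)" for R
    using nn_integral_L2[OF L2_diff[OF f iF2], of R] unfolding eq by (simp add: norm_minus_commute)
  moreover have "((\<lambda>R. ennreal ((L2_norm f)\<^sup>2 - (L2_norm (truncate R F))\<^sup>2)) \<longlongrightarrow> ennreal ((L2_norm f)\<^sup>2 - (L2_norm F)\<^sup>2)) at_top"
    by (intro tendsto_ennrealI tendsto_intros L2_limit_tendsto(1)[OF truncate_L2_limit[OF F] truncate_L2[OF F] F])
  ultimately show ?thesis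
    unfolding has_FT_def L2_limit_def using L2_measurable[OF f] has_FT_norm[OF h f s] by simp
qed

section \<open>Radial integration in three dimensions\<close>

lemma distr_norm_lborel:
  "distr (lborel :: (real^3) measure) borel norm = density lborel (\<lambda>r. ennreal (4 * pi * r\<^sup>2) * indicator {0..} r)"
  (is "?M = ?N")
proof -
  \<comment> \<open>Half-lines generate the Borel sets and are stable under intersection, so the
    ball volumes \<open>4/3 pi a^3\<close> determine the image measure.\<close>
  have eq: "emeasure ?M {..a} = emeasure ?N {..a} \<and> emeasure ?M {..a} < \<infinity>" for a
  proof (cases "0 \<le> a")
    case True
    have "emeasure ?M {..a} = emeasure lborel (cball (0::real^3) a)"
      by (subst emeasure_distr) (auto simp: space_borel vimage_def cball_def intro!: arg_cong[of _ _ "emeasure lborel"])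
    also have "\<dots> = ennreal (4/3 * pi * a ^ 3)"
      using emeasure_cball[OF True, of "0::real^3"] by (simp add: eval_unit_ball_vol)
    finally have M: "emeasure ?M {..a} = ennreal (4/3 * pi * a ^ 3)" .
    have "emeasure ?N {..a} = (\<integral>\<^sup>+r. ennreal (4 * pi * r\<^sup>2) * indicator {0..a} r \<partial>lborel)"
      by (subst emeasure_density) (auto intro!: nn_integral_cong split: split_indicator)
    also have "\<dots> = ennreal (4/3 * pi * a ^ 3 - 4/3 * pi * 0 ^ 3)"
      by (rule nn_integral_FTC_Icc[where F="\<lambda>r. 4/3 * pi * r ^ 3"]) (use True in \<open>auto intro!: derivative_eq_intros\<close>)
    finally show ?thesis using M by simp
  next
    case False
    have "{x::real^3. norm x \<le> a} = {}" using False norm_ge_zero order_trans by blast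
    then have "emeasure ?M {..a} = 0" by (subst emeasure_distr) (auto simp: vimage_def)
    moreover have "emeasure ?N {..a} = 0"
      by (subst emeasure_density) (use False in \<open>auto simp: nn_integral_0_iff_AE split: split_indicator\<close>)
    ultimately show ?thesis by simp
  qed
  show ?thesis
  proof (rule measure_eqI_generator_eq[where E="range (\<lambda>a::real. {..a})" and \<Omega>=UNIV and A="\<lambda>i. {..real i}"])
    show "Int_stable (range (\<lambda>a::real. {..a}))"
      by (auto simp: Int_stable_def image_iff)
    show "sets ?M = sigma_sets UNIV (range (\<lambda>a::real. {..a}))" "sets ?N = sigma_sets UNIV (range (\<lambda>a::real. {..a}))"
      by (auto simp: borel_eq_atMost)
    show "(\<Union>i. {..real i}) = UNIV" by (auto intro: real_nat_ceiling_ge)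
    show "emeasure ?M {..real i} \<noteq> \<infinity>" for i using eq[of "real i"] by auto
  qed (use eq in auto)
qed

lemma nn_integral_radial:
  fixes g :: "real \<Rightarrow> ennreal"
  assumes [measurable]: "g \<in> borel_measurable borel"
  shows "(\<integral>\<^sup>+x. g (norm (x::real^3)) \<partial>lebesgue) = (\<integral>\<^sup>+r. ennreal (4 * pi * r\<^sup>2) * indicator {0..} r * g r \<partial>lborel)"
proof -
  have "(\<integral>\<^sup>+x. g (norm (x::real^3)) \<partial>lebesgue) = (\<integral>\<^sup>+x. g (norm (x::real^3)) \<partial>lborel)"
    by (rule nn_integral_completion)
  also have "\<dots> = (\<integral>\<^sup>+r. g r \<partial>distr (lborel :: (real^3) measure) borel norm)"
    by (rule nn_integral_distr[symmetric]) measurable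
  also have "\<dots> = (\<integral>\<^sup>+r. ennreal (4 * pi * r\<^sup>2) * indicator {0..} r * g r \<partial>lborel)"
    unfolding distr_norm_lborel by (rule nn_integral_density) measurable
  finally show ?thesis .
qed

lemma integrable_radial:
  fixes g :: "real \<Rightarrow> real"
  assumes g[measurable]: "g \<in> borel_measurable borel"
  shows "integrable lebesgue (\<lambda>x::real^3. g (norm x)) \<longleftrightarrow> integrable lborel (\<lambda>r. 4 * pi * r\<^sup>2 * indicator {0..} r * g r)"
    and "(LINT x|lebesgue. g (norm (x::real^3))) = (LINT r|lborel. 4 * pi * r\<^sup>2 * indicator {0..} r * g r)"
proof -
  have d: "density lborel (\<lambda>r. ennreal (4 * pi * r\<^sup>2) * indicator {0..} r) = density lborel (\<lambda>r. ennreal (4 * pi * r\<^sup>2 * indicator {0..} r))"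
    by (intro density_cong) (auto split: split_indicator)
  have "integrable lebesgue (\<lambda>x::real^3. g (norm x)) \<longleftrightarrow> integrable lborel (\<lambda>x::real^3. g (norm x))"
    by (rule integrable_completion) measurable
  also have "\<dots> \<longleftrightarrow> integrable (distr (lborel :: (real^3) measure) borel norm) g"
    by (rule integrable_distr_eq[symmetric]) measurable
  also have "\<dots> \<longleftrightarrow> integrable lborel (\<lambda>r. (4 * pi * r\<^sup>2 * indicator {0..} r) *\<^sub>R g r)"
    unfolding distr_norm_lborel d by (rule integrable_density) auto
  finally show "integrable lebesgue (\<lambda>x::real^3. g (norm x)) \<longleftrightarrow> integrable lborel (\<lambda>r. 4 * pi * r\<^sup>2 * indicator {0..} r * g r)"
    by simp
  have "(LINT x|lebesgue. g (norm (x::real^3))) = (LINT x|lborel. g (norm (x::real^3)))"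
    by (rule integral_completion) measurable
  also have "\<dots> = (LINT r|distr (lborel :: (real^3) measure) borel norm. g r)"
    by (rule integral_distr[symmetric]) measurable
  also have "\<dots> = (LINT r|lborel. (4 * pi * r\<^sup>2 * indicator {0..} r) *\<^sub>R g r)"
    unfolding distr_norm_lborel d by (rule integral_density) auto
  finally show "(LINT x|lebesgue. g (norm (x::real^3))) = (LINT r|lborel. 4 * pi * r\<^sup>2 * indicator {0..} r * g r)"
    by simp
qed

text \<open>Used to discard \<open>p = 0\<close> and the sphere \<open>p^2 = \<mu>\<close>, where
  division by zero returns 0 instead of the intended value.\<close>

lemma AE_norm_neq: "AE p in lebesgue. norm (p::real^3) \<noteq> r"
proof -
  have "(\<integral>\<^sup>+x. indicator {r} (norm (x::real^3)) \<partial>lebesgue) = (\<integral>\<^sup>+t. ennreal (4 * pi * t\<^sup>2) * indicator {0..} t * indicator {r} t \<partial>lborel)"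
    by (rule nn_integral_radial) measurable
  also have "\<dots> = 0"
  proof (subst nn_integral_0_iff_AE)
    have "AE t in lborel. t \<noteq> r" by (rule AE_lborel_singleton)
    then show "AE t in lborel. ennreal (4 * pi * t\<^sup>2) * indicator {0..} t * indicator {r} t = 0" by eventually_elim simp
  qed measurable
  finally show ?thesis by (subst (asm) nn_integral_0_iff_AE) (auto split: split_indicator_asm)
qed

text \<open>In dimension three the Jacobian \<open>4 pi r^2\<close> cancels the singularity, so the
  integral is linear in the radius.\<close>

lemma integral_inverse_square_ball:
  assumes "0 \<le> R"
  shows "integrable lebesgue (\<lambda>p::real^3. if norm p \<le> R then 1 / (norm p)\<^sup>2 else 0)" (is ?I)
    and "(LINT p|lebesgue. (if norm (p::real^3) \<le> R then 1 / (norm p)\<^sup>2 else 0)) = 4 * pi * R" (is ?E)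
proof -
  let ?g = "\<lambda>r. if r \<le> R then 1 / r\<^sup>2 else 0::real"
  have ae: "AE r in lborel. indicator {0..R} r * (4 * pi) = 4 * pi * r\<^sup>2 * indicator {0..} r * ?g r"
    using AE_lborel_singleton[of 0] by eventually_elim (auto split: split_indicator)
  have "integrable lborel (indicator {0..R} :: real \<Rightarrow> real)" 
    by (rule integrable_real_indicator) (auto simp: emeasure_lborel_Icc_eq)
  then have i: "integrable lborel (\<lambda>r. indicator {0..R} r * (4 * pi))" by simp
  show ?I
    unfolding integrable_radial(1)[of ?g, simplified]
    using integrable_cong_AE[OF _ _ ae] i by simp
  have "(LINT p|lebesgue. ?g (norm (p::real^3))) = (LINT r|lborel. 4 * pi * r\<^sup>2 * indicator {0..} r * ?g r)"
    by (rule integrable_radial(2)) measurable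
  also have "\<dots> = (LINT r|lborel. indicator {0..R} r * (4 * pi))"
    by (rule integral_cong_AE[symmetric]) (use ae in auto)
  also have "\<dots> = 4 * pi * R" using assms by simp
  finally show ?E .
qed

section \<open>Functions of finite kinetic energy\<close>

definition energy :: "(real^3 \<Rightarrow> complex) \<Rightarrow> bool" where
  "energy F \<longleftrightarrow> F \<in> borel_measurable lebesgue \<and> (\<lambda>p. complex_of_real (norm p) * F p) \<in> L2"

text \<open>In position space this is the L^2-norm of the gradient. Since the weight vanishes at
  \<open>p = 0\<close>, a finite value does not place \<open>F\<close> in \<open>L2\<close>.\<close>

definition enorm :: "(real^3 \<Rightarrow> complex) \<Rightarrow> real" where
  "enorm F = L2_norm (\<lambda>p. complex_of_real (norm p) * F p)"

lemma energy_measurable: "energy F \<Longrightarrow> F \<in> borel_measurable lebesgue"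
  by (simp add: energy_def)

lemma energy_L2: "energy F \<Longrightarrow> (\<lambda>p. complex_of_real (norm p) * F p) \<in> L2"
  by (simp add: energy_def)

lemma enorm_nonneg [simp]: "0 \<le> enorm F" by (simp add: enorm_def)

lemma enorm_sq: "(enorm F)\<^sup>2 = (LINT p|lebesgue. (norm p)\<^sup>2 * (cmod (F p))\<^sup>2)"
  by (simp add: enorm_def L2_norm_sq norm_mult power_mult_distrib)

lemma energy_integrable: "energy F \<Longrightarrow> integrable lebesgue (\<lambda>p. (norm p)\<^sup>2 * (cmod (F p))\<^sup>2)"
  using L2_integrable[OF energy_L2] by (simp add: norm_mult power_mult_distrib)

lemma energy_add: "energy F \<Longrightarrow> energy G \<Longrightarrow> energy (\<lambda>p. F p + G p)"
  unfolding energy_def using L2_add[of "\<lambda>p. complex_of_real (norm p) * F p" "\<lambda>p. complex_of_real (norm p) * G p"]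
  by (auto simp: ring_distribs)

lemma energy_scale: "energy F \<Longrightarrow> energy (\<lambda>p. c * F p)"
  unfolding energy_def using L2_scale[of "\<lambda>p. complex_of_real (norm p) * F p" c]
  by (auto simp: mult.left_commute)

lemma energy_diff: "energy F \<Longrightarrow> energy G \<Longrightarrow> energy (\<lambda>p. F p - G p)"
  using energy_add[OF _ energy_scale, of F G "-1"] by simp

lemma energyI:
  assumes "F \<in> borel_measurable lebesgue" "integrable lebesgue (\<lambda>p. (norm p)\<^sup>2 * (cmod (F p))\<^sup>2)"
  shows "energy F"
  unfolding energy_def
proof
  note assms(1)[measurable]
  show "(\<lambda>p. complex_of_real (norm p) * F p) \<in> L2"
    by (rule L2I) (measurable, use assms(2) in \<open>simp add: norm_mult power_mult_distrib\<close>)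
qed fact

lemma energy_dominated:
  assumes "energy G" and [measurable]: "F \<in> borel_measurable lebesgue" and "\<And>p. cmod (F p) \<le> cmod (G p)"
  shows "energy F" "enorm F \<le> enorm G"
proof -
  have le: "cmod (complex_of_real (norm p) * F p) \<le> cmod (complex_of_real (norm p) * G p)" for p
    using assms(3) by (auto simp: norm_mult intro!: mult_left_mono)
  show "energy F" unfolding energy_def
    by (intro conjI assms(2) L2_dominated[OF energy_L2[OF assms(1)]]) (measurable, use le in auto)
  show "enorm F \<le> enorm G" unfolding enorm_def by (rule L2_norm_mono[OF energy_L2[OF assms(1)] le])
qed

text \<open>Cauchy-Schwarz against \<open>1 / |p|\<close> on the ball, whose square integrates to
  \<open>4 pi R\<close>. It makes the low-frequency part of a finite-energy function bounded by a
  multiple of \<open>sqrt R\<close>, the input of the Sobolev argument.\<close>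

lemma energy_truncate:
  assumes F: "energy F" and R: "0 \<le> R"
  shows "integrable lebesgue (truncate R F)"
    "(LINT p|lebesgue. cmod (truncate R F p)) \<le> sqrt (4 * pi * R) * enorm F"
proof -
  note energy_measurable[OF F, measurable]
  let ?h = "\<lambda>p::real^3. if norm p \<le> R then complex_of_real (1 / norm p) else 0"
  have hm: "?h \<in> borel_measurable lebesgue" by measurable
  have hsq: "(cmod (?h p))\<^sup>2 = (if norm p \<le> R then 1 / (norm p)\<^sup>2 else 0)" for p
    by (simp add: norm_divide power_divide)
  have h2: "?h \<in> L2"
    by (rule L2I[OF hm]) (unfold hsq, rule integral_inverse_square_ball(1)[OF R])
  have hn: "L2_norm ?h = sqrt (4 * pi * R)"
    unfolding L2_norm_def hsq integral_inverse_square_ball(2)[OF R] ..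
  have ae: "AE p in lebesgue. truncate R F p = ?h p * (complex_of_real (norm p) * F p)"
    using AE_norm_neq[of 0] by eventually_elim (auto simp: truncate_def)
  have aec: "AE p in lebesgue. cmod (truncate R F p) = cmod (?h p) * cmod (complex_of_real (norm p) * F p)"
    using ae by eventually_elim (simp only: norm_mult)
  show "integrable lebesgue (truncate R F)"
  proof (subst integrable_cong_AE[OF _ _ ae])
    show "(\<lambda>p. ?h p * (complex_of_real (norm p) * F p)) \<in> borel_measurable lebesgue"
      by (intro borel_measurable_times hm) measurable
  qed (measurable, rule L2_mult_integrable[OF h2 energy_L2[OF F]])
  have "(LINT p|lebesgue. cmod (truncate R F p)) = (LINT p|lebesgue. cmod (?h p) * cmod (complex_of_real (norm p) * F p))"
    by (rule integral_cong_AE[OF _ _ aec]) measurable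
  also have "\<dots> \<le> L2_norm ?h * enorm F" unfolding enorm_def by (rule L2_Cauchy_Schwarz_cmod[OF h2 energy_L2[OF F]])
  finally show "(LINT p|lebesgue. cmod (truncate R F p)) \<le> sqrt (4 * pi * R) * enorm F" unfolding hn .
qed

lemma energy_L1_L2:
  assumes F: "energy F" shows "L1_L2 F"
  unfolding L1_L2_def
proof (intro conjI allI)
  note energy_measurable[OF F, measurable]
  show "F \<in> borel_measurable lebesgue" by measurable
  show "integrable lebesgue (truncate R F)" for R
  proof (cases "0 \<le> R")
    case True then show ?thesis by (rule energy_truncate[OF F])
  next
    case False
    have "truncate R F = (\<lambda>x. 0)"
    proof
      fix x :: "real^3" show "truncate R F x = 0" using False order_trans[OF norm_ge_zero[of x], of R] by (auto simp: truncate_def)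
    qed
    then show ?thesis by simp
  qed
  show "(\<lambda>x. F x - truncate 1 F x) \<in> L2"
  proof (rule L2_dominated[OF energy_L2[OF F]])
    show "AE x in lebesgue. cmod (F x - truncate 1 F x) \<le> cmod (complex_of_real (norm x) * F x)"
    proof (rule AE_I2)
      fix x :: "real^3"
      show "cmod (F x - truncate 1 F x) \<le> cmod (complex_of_real (norm x) * F x)"
        using mult_right_mono[of 1 "norm x" "cmod (F x)"] by (auto simp: truncate_def norm_mult)
    qed
  qed measurable
qed

lemma FT_energy_bound:
  assumes F: "energy F" and R: "0 \<le> R"
  shows "cmod (FT s (truncate R F) x) \<le> (2 * pi) powr (-3/2) * (sqrt (4 * pi * R) * enorm F)"
  using order_trans[OF FT_bound mult_left_mono[OF energy_truncate(2)[OF F R]]] by simp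

subsection \<open>The Sobolev inequality\<close>

lemma sets_level_set:
  assumes [measurable]: "f \<in> borel_measurable lebesgue" shows "{x. t \<le> cmod (f x)} \<in> sets lebesgue"
proof -
  have "{x \<in> space lebesgue. t \<le> cmod (f x)} \<in> sets lebesgue" by measurable
  then show ?thesis by simp
qed

lemma nn_integral_layer_cake6:
  assumes [measurable]: "f \<in> borel_measurable (lebesgue :: (real^3) measure)"
  shows "(\<integral>\<^sup>+x. ennreal ((cmod (f x)) ^ 6) \<partial>lebesgue) =
    (\<integral>\<^sup>+t. ennreal (6 * t ^ 5) * indicator {0..} t * emeasure lebesgue {x. t \<le> cmod (f x)} \<partial>lborel)"
proof -
  interpret P: pair_sigma_finite "lebesgue :: (real^3) measure" "lborel :: real measure" ..
  have "ennreal ((cmod (f x)) ^ 6) = (\<integral>\<^sup>+t. ennreal (6 * t ^ 5) * indicator {0..} t * indicator {t. t \<le> cmod (f x)} t \<partial>lborel)" for x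
  proof -
    have "(\<integral>\<^sup>+t. ennreal (6 * t ^ 5) * indicator {0..} t * indicator {t. t \<le> cmod (f x)} t \<partial>lborel) =
        (\<integral>\<^sup>+t. ennreal (6 * t ^ 5) * indicator {0..cmod (f x)} t \<partial>lborel)"
      by (intro nn_integral_cong) (auto split: split_indicator)
    also have "\<dots> = ennreal ((cmod (f x)) ^ 6 - 0 ^ 6)"
      by (rule nn_integral_FTC_Icc[where F="\<lambda>t. t ^ 6"]) (auto intro!: derivative_eq_intros)
    finally show ?thesis by simp
  qed
  then have "(\<integral>\<^sup>+x. ennreal ((cmod (f x)) ^ 6) \<partial>lebesgue) =
      (\<integral>\<^sup>+x. \<integral>\<^sup>+t. ennreal (6 * t ^ 5) * indicator {0..} t * indicator {t. t \<le> cmod (f x)} t \<partial>lborel \<partial>lebesgue)" by simp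
  also have "\<dots> = (\<integral>\<^sup>+t. \<integral>\<^sup>+x. ennreal (6 * t ^ 5) * indicator {0..} t * indicator {t. t \<le> cmod (f x)} t \<partial>lebesgue \<partial>lborel)"
    by (rule P.Fubini'[symmetric]) measurable
  also have "\<dots> = (\<integral>\<^sup>+t. ennreal (6 * t ^ 5) * indicator {0..} t * emeasure lebesgue {x. t \<le> cmod (f x)} \<partial>lborel)"
  proof (intro nn_integral_cong)
    fix t :: real
    have "(\<integral>\<^sup>+x. indicator {t. t \<le> cmod (f x)} t \<partial>lebesgue) = (\<integral>\<^sup>+x. indicator {x. t \<le> cmod (f x)} x \<partial>lebesgue)"
      by (intro nn_integral_cong) (auto split: split_indicator)
    also have "\<dots> = emeasure lebesgue {x. t \<le> cmod (f x)}" by (rule nn_integral_indicator[OF sets_level_set]) fact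
    finally show "(\<integral>\<^sup>+x. ennreal (6 * t ^ 5) * indicator {0..} t * indicator {t. t \<le> cmod (f x)} t \<partial>lebesgue) =
      ennreal (6 * t ^ 5) * indicator {0..} t * emeasure lebesgue {x. t \<le> cmod (f x)}"
      by (simp add: nn_integral_cmult)
  qed
  finally show ?thesis .
qed

text \<open>The argument of Chemin and Xu: at height \<open>t\<close>, the frequencies below \<open>R\<close>, a multiple of
  \<open>t\<^sup>2\<close>, contribute at most \<open>t/2\<close> to \<open>f\<close> pointwise, so that the level set
  \<open>{t \<le> |f|}\<close> is controlled by the \<open>L\<^sup>2\<close>-norm of the high frequencies.\<close>

lemma level_set_bound:
  assumes h: "has_FT s F f" and F: "energy F" and s: "s\<^sup>2 = 1" and t: "0 < t" and R: "0 < R"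
    and low: "(2 * pi) powr (-3/2) * (sqrt (4 * pi * R) * enorm F) \<le> t / 2"
  shows "ennreal (t\<^sup>2) * emeasure lebesgue {x. t \<le> cmod (f x)} \<le>
    4 * (\<integral>\<^sup>+p. ennreal ((cmod (F p))\<^sup>2) * indicator {p. R < norm p} p \<partial>lebesgue)"
proof -
  note has_FT_measurable[OF h, measurable] energy_measurable[OF F, measurable]
  let ?v = "\<lambda>x. f x - FT s (truncate R F) x"
  have tail_le: "(\<integral>\<^sup>+x. ennreal ((cmod (?v x))\<^sup>2) \<partial>lebesgue) \<le>
      (\<integral>\<^sup>+p. ennreal ((cmod (F p))\<^sup>2) * indicator {p. R < norm p} p \<partial>lebesgue)" (is "?l \<le> ?r")
  proof -
    \<comment> \<open>\<open>has_FT_tail\<close> concerns radii at least 1, while \<open>R\<close>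
      may be any positive number here. Finite energy makes the tail square integrable beyond every
      positive radius.\<close>
    have tl: "(\<lambda>p. F p - truncate R F p) \<in> L2"
    proof (rule L2_dominated[OF L2_scale[OF energy_L2[OF F], of "complex_of_real (1/R)"]])
      show "AE x in lebesgue. cmod (F x - truncate R F x) \<le> cmod (complex_of_real (1 / R) * (complex_of_real (norm x) * F x))"
      proof (rule AE_I2)
        fix x :: "real^3"
        show "cmod (F x - truncate R F x) \<le> cmod (complex_of_real (1 / R) * (complex_of_real (norm x) * F x))"
          using R mult_right_mono[of 1 "norm x / R" "cmod (F x)"] by (auto simp: truncate_def norm_mult norm_divide field_simps)
      qed
    qed measurable
    have m: "FT s (truncate S F) \<in> borel_measurable lebesgue" for S by measurable
    have ev: "eventually (\<lambda>S. (\<lambda>x. FT s (truncate S F) x - FT s (truncate R F) x) \<in> L2 \<and>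
        L2_norm (\<lambda>x. FT s (truncate S F) x - FT s (truncate R F) x) \<le> L2_norm (\<lambda>x. F x - truncate R F x)) at_top"
      using eventually_ge_at_top[of R]
    proof eventually_elim
      case (elim S)
      let ?G = "\<lambda>x. truncate S F x - truncate R F x"
      have eq: "(\<lambda>x. FT s (truncate S F) x - FT s (truncate R F) x) = FT s ?G"
        by (auto simp: FT_diff L1_L2_integrable[OF energy_L1_L2[OF F]])
      have G1: "integrable lebesgue ?G" using L1_L2_integrable[OF energy_L1_L2[OF F]] by simp
      have le: "cmod (?G x) \<le> cmod (F x - truncate R F x)" for x using elim by (auto simp: truncate_def)
      have G2: "?G \<in> L2" by (rule L2_dominated[OF tl]) (measurable, use le in auto)
      show ?case unfolding eq using plancherel[OF G1 G2 s] L2_norm_mono[OF tl le] by simp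
    qed
    note v = L2_limit_norm_le[OF h[unfolded has_FT_def] m ev]
    have "?l = ennreal ((L2_norm ?v)\<^sup>2)" by (rule nn_integral_L2[OF v(1)])
    also have "\<dots> \<le> ennreal ((L2_norm (\<lambda>x. F x - truncate R F x))\<^sup>2)"
      by (intro ennreal_leI power_mono v(2)) simp
    also have "\<dots> = (\<integral>\<^sup>+x. ennreal ((cmod (F x - truncate R F x))\<^sup>2) \<partial>lebesgue)"
      by (rule nn_integral_L2[OF tl, symmetric])
    also have "\<dots> = ?r" by (intro nn_integral_cong) (auto simp: truncate_def split: split_indicator)
    finally show ?thesis .
  qed
  have "ennreal (t\<^sup>2) * emeasure lebesgue {x. t \<le> cmod (f x)} =
      (\<integral>\<^sup>+x. ennreal (t\<^sup>2) * indicator {x. t \<le> cmod (f x)} x \<partial>lebesgue)"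
    by (rule nn_integral_cmult_indicator[OF sets_level_set, symmetric]) measurable
  also have "\<dots> \<le> (\<integral>\<^sup>+x. 4 * ennreal ((cmod (?v x))\<^sup>2) \<partial>lebesgue)"
  proof (rule nn_integral_mono)
    fix x
    show "ennreal (t\<^sup>2) * indicator {x. t \<le> cmod (f x)} x \<le> 4 * ennreal ((cmod (?v x))\<^sup>2)"
    proof (cases "t \<le> cmod (f x)")
      case True
      have "cmod (FT s (truncate R F) x) \<le> t / 2" using FT_energy_bound[OF F, of R s x] R low by linarith
      then have "t / 2 \<le> cmod (?v x)" using True norm_triangle_ineq2[of "f x" "FT s (truncate R F) x"] by linarith
      then have "(t/2)\<^sup>2 \<le> (cmod (?v x))\<^sup>2" using t by (intro power_mono) auto
      then have "t\<^sup>2 \<le> 4 * (cmod (?v x))\<^sup>2" by (simp add: power_divide)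
      then have "ennreal (t\<^sup>2) \<le> ennreal (4 * (cmod (?v x))\<^sup>2)" by (rule ennreal_leI)
      then show ?thesis using True by (simp add: ennreal_mult)
    qed simp
  qed
  also have "\<dots> = 4 * ?l" by (rule nn_integral_cmult) measurable
  also have "\<dots> \<le> 4 * ?r" by (intro mult_left_mono tail_le) simp
  finally show ?thesis .
qed

text \<open>Four times the square of the factor in \<open>FT_energy_bound\<close>, per unit radius.
  With radius \<open>t^2 / (sobolev_const * (enorm F)^2)\<close> the low frequencies contribute at
  most \<open>t / 2\<close>.\<close>

definition sobolev_const :: real where
  "sobolev_const = 4 * ((2 * pi) powr (-3/2))\<^sup>2 * (4 * pi)"

lemma sobolev_const_pos: "0 < sobolev_const"
  unfolding sobolev_const_def by simp

theorem sobolev: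
  assumes h: "has_FT s F f" and F: "energy F" and s: "s\<^sup>2 = 1"
  shows "(\<integral>\<^sup>+x. ennreal ((cmod (f x)) ^ 6) \<partial>lebesgue) \<le> ennreal (6 * sobolev_const\<^sup>2 * (enorm F) ^ 6)"
proof -
  note has_FT_measurable[OF h, measurable] energy_measurable[OF F, measurable]
  \<comment> \<open>The positive \<open>d\<close> keeps the cutoff radius \<open>t^2 / B d\<close>
    meaningful when \<open>enorm F = 0\<close>; it is sent to 0 at the end.\<close>
  define B where "B d = sobolev_const * ((enorm F)\<^sup>2 + d)" for d :: real
  have main: "(\<integral>\<^sup>+x. ennreal ((cmod (f x)) ^ 6) \<partial>lebesgue) \<le> ennreal (6 * (B d)\<^sup>2 * (enorm F)\<^sup>2)" if d: "0 < d" for d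
  proof -
    interpret P: pair_sigma_finite "lebesgue :: (real^3) measure" "lborel :: real measure" ..
    have Bpos: "0 < B d" unfolding B_def using d sobolev_const_pos by (intro mult_pos_pos add_nonneg_pos) auto
    have "(\<integral>\<^sup>+x. ennreal ((cmod (f x)) ^ 6) \<partial>lebesgue) =
      (\<integral>\<^sup>+t. ennreal (6 * t ^ 5) * indicator {0..} t * emeasure lebesgue {x. t \<le> cmod (f x)} \<partial>lborel)"
      by (rule nn_integral_layer_cake6) measurable
    also have "\<dots> \<le> (\<integral>\<^sup>+t. (\<integral>\<^sup>+p. ennreal (24 * t ^ 3) * indicator {0..} t * (ennreal ((cmod (F p))\<^sup>2) * indicator {p. t\<^sup>2 < B d * norm p} p) \<partial>lebesgue) \<partial>lborel)"
    proof (rule nn_integral_mono_AE)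
      show "AE t in lborel. ennreal (6 * t ^ 5) * indicator {0..} t * emeasure lebesgue {x. t \<le> cmod (f x)} \<le>
        (\<integral>\<^sup>+p. ennreal (24 * t ^ 3) * indicator {0..} t * (ennreal ((cmod (F p))\<^sup>2) * indicator {p. t\<^sup>2 < B d * norm p} p) \<partial>lebesgue)"
        using AE_lborel_singleton[of 0]
      proof eventually_elim
        case (elim t)
        show ?case
        proof (cases "0 < t")
          case True
          let ?R = "t\<^sup>2 / B d"
          have R: "0 < ?R" using True Bpos by simp
          have "((2 * pi) powr (-3/2) * (sqrt (4 * pi * ?R) * enorm F))\<^sup>2 = sobolev_const / 4 * (enorm F)\<^sup>2 * ?R"
          proof -
            have sq: "(sqrt (4 * pi * ?R))\<^sup>2 = 4 * pi * ?R" by (rule real_sqrt_pow2) (use Bpos in simp)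
            show ?thesis unfolding power_mult_distrib sq by (simp add: sobolev_const_def)
          qed
          also have "\<dots> \<le> sobolev_const / 4 * ((enorm F)\<^sup>2 + d) * ?R"
            using R d sobolev_const_pos by (intro mult_right_mono mult_left_mono) auto
          also have "\<dots> = B d * ?R / 4"
          proof -
            have "a / 4 * b * r = a * b * r / 4" for a b r :: real by simp
            from this[of sobolev_const "(enorm F)\<^sup>2 + d" ?R] show ?thesis by (simp only: B_def[of d, symmetric])
          qed
          also have "\<dots> = (t / 2)\<^sup>2" using Bpos by (simp add: power_divide)
          finally have low: "(2 * pi) powr (-3/2) * (sqrt (4 * pi * ?R) * enorm F) \<le> t / 2"
            by (rule power2_le_imp_le) (use True in simp)
          have set_eq: "{p::real^3. ?R < norm p} = {p. t\<^sup>2 < B d * norm p}"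
            using Bpos by (auto simp: field_simps)
          have "ennreal (6 * t ^ 5) * emeasure lebesgue {x. t \<le> cmod (f x)} =
              ennreal (6 * t ^ 3) * (ennreal (t\<^sup>2) * emeasure lebesgue {x. t \<le> cmod (f x)})"
          proof -
            have "6 * t ^ 5 = 6 * t ^ 3 * t\<^sup>2" by (simp add: power_add[symmetric] mult.assoc)
            then have "ennreal (6 * t ^ 5) = ennreal (6 * t ^ 3) * ennreal (t\<^sup>2)"
              using True by (simp only:) (rule ennreal_mult, auto)
            then show ?thesis by (simp only: mult.assoc)
          qed
          also have "\<dots> \<le> ennreal (6 * t ^ 3) * (4 * (\<integral>\<^sup>+p. ennreal ((cmod (F p))\<^sup>2) * indicator {p. t\<^sup>2 < B d * norm p} p \<partial>lebesgue))"
            unfolding set_eq[symmetric] by (intro mult_left_mono level_set_bound[OF h F s True R low]) simp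
          also have "\<dots> = ennreal (24 * t ^ 3) * (\<integral>\<^sup>+p. ennreal ((cmod (F p))\<^sup>2) * indicator {p. t\<^sup>2 < B d * norm p} p \<partial>lebesgue)"
          proof -
            have "ennreal (24 * t ^ 3) = ennreal (6 * t ^ 3) * ennreal 4"
              using True by (subst ennreal_mult[symmetric]) auto
            then show ?thesis by (simp add: mult.assoc)
          qed
          also have "\<dots> = (\<integral>\<^sup>+p. ennreal (24 * t ^ 3) * (ennreal ((cmod (F p))\<^sup>2) * indicator {p. t\<^sup>2 < B d * norm p} p) \<partial>lebesgue)"
            by (rule nn_integral_cmult[symmetric]) measurable
          finally show ?thesis using True by simp
        qed (use elim in simp)
      qed
    qed
    \<comment> \<open>Exchanging the integrals makes the level integral elementary: for fixed
      \<open>p\<close> the height runs up to \<open>sqrt (B d * |p|)\<close>, so that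
      \<open>24 t^3\<close> integrates to \<open>6 (B d)^2 |p|^2\<close>, which restores the energy
      density.\<close>
    also have "\<dots> = (\<integral>\<^sup>+p. (\<integral>\<^sup>+t. ennreal (24 * t ^ 3) * indicator {0..} t * (ennreal ((cmod (F p))\<^sup>2) * indicator {p. t\<^sup>2 < B d * norm p} p) \<partial>lborel) \<partial>lebesgue)"
      by (rule P.Fubini') measurable
    also have "\<dots> \<le> (\<integral>\<^sup>+p. ennreal (6 * (B d)\<^sup>2 * ((norm p)\<^sup>2 * (cmod (F p))\<^sup>2)) \<partial>lebesgue)"
    proof (rule nn_integral_mono)
      fix p :: "real^3"
      have "(\<integral>\<^sup>+t. ennreal (24 * t ^ 3) * indicator {0..} t * (ennreal ((cmod (F p))\<^sup>2) * indicator {p. t\<^sup>2 < B d * norm p} p) \<partial>lborel) \<le>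
          (\<integral>\<^sup>+t. ennreal ((cmod (F p))\<^sup>2) * (ennreal (24 * t ^ 3) * indicator {0..sqrt (B d * norm p)} t) \<partial>lborel)"
        by (intro nn_integral_mono) (auto intro!: real_le_rsqrt simp: mult.commute split: split_indicator)
      also have "\<dots> = ennreal ((cmod (F p))\<^sup>2) * (\<integral>\<^sup>+t. ennreal (24 * t ^ 3) * indicator {0..sqrt (B d * norm p)} t \<partial>lborel)"
        by (rule nn_integral_cmult) measurable
      also have "(\<integral>\<^sup>+t. ennreal (24 * t ^ 3) * indicator {0..sqrt (B d * norm p)} t \<partial>lborel) = ennreal (6 * sqrt (B d * norm p) ^ 4 - 6 * 0 ^ 4)"
        by (rule nn_integral_FTC_Icc[where F="\<lambda>t. 6 * t ^ 4"]) (use Bpos in \<open>auto intro!: derivative_eq_intros\<close>)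
      also have "sqrt (B d * norm p) ^ 4 = (B d * norm p)\<^sup>2"
      proof -
        have "sqrt (B d * norm p) ^ 4 = ((sqrt (B d * norm p))\<^sup>2)\<^sup>2" by (simp flip: power_mult)
        then show ?thesis using Bpos by simp
      qed
      also have "ennreal ((cmod (F p))\<^sup>2) * ennreal (6 * (B d * norm p)\<^sup>2 - 6 * 0 ^ 4) = ennreal (6 * (B d)\<^sup>2 * ((norm p)\<^sup>2 * (cmod (F p))\<^sup>2))"
        by (subst ennreal_mult[symmetric]) (auto simp: power_mult_distrib ac_simps)
      finally show "(\<integral>\<^sup>+t. ennreal (24 * t ^ 3) * indicator {0..} t * (ennreal ((cmod (F p))\<^sup>2) * indicator {p. t\<^sup>2 < B d * norm p} p) \<partial>lborel) \<le>
          ennreal (6 * (B d)\<^sup>2 * ((norm p)\<^sup>2 * (cmod (F p))\<^sup>2))" .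
    qed
    also have "\<dots> = ennreal (LINT p|lebesgue. 6 * (B d)\<^sup>2 * ((norm p)\<^sup>2 * (cmod (F p))\<^sup>2))"
      by (rule nn_integral_eq_integral) (use energy_integrable[OF F] in auto)
    also have "\<dots> = ennreal (6 * (B d)\<^sup>2 * (enorm F)\<^sup>2)" by (simp add: enorm_sq)
    finally show ?thesis .
  qed
  have "((\<lambda>d. ennreal (6 * (B d)\<^sup>2 * (enorm F)\<^sup>2)) \<longlongrightarrow> ennreal (6 * (sobolev_const * ((enorm F)\<^sup>2 + 0))\<^sup>2 * (enorm F)\<^sup>2)) (at_right 0)"
    unfolding B_def by (intro tendsto_ennrealI tendsto_intros)
  moreover have "eventually (\<lambda>d. (\<integral>\<^sup>+x. ennreal ((cmod (f x)) ^ 6) \<partial>lebesgue) \<le> ennreal (6 * (B d)\<^sup>2 * (enorm F)\<^sup>2)) (at_right 0)"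
    using eventually_at_right_less[of "0::real"] by eventually_elim (rule main)
  ultimately have "(\<integral>\<^sup>+x. ennreal ((cmod (f x)) ^ 6) \<partial>lebesgue) \<le> ennreal (6 * (sobolev_const * ((enorm F)\<^sup>2 + 0))\<^sup>2 * (enorm F)\<^sup>2)"
    by (rule tendsto_lowerbound) simp
  also have "6 * (sobolev_const * ((enorm F)\<^sup>2 + 0))\<^sup>2 * (enorm F)\<^sup>2 = 6 * sobolev_const\<^sup>2 * (enorm F) ^ 6"
    by (simp add: power_mult_distrib power_add[symmetric] flip: power_mult)
  finally show ?thesis .
qed

subsection \<open>Potentials as form perturbations of the Laplacian\<close>

text \<open>In place of Hoelder with exponents 3/2 and 3, the pointwise inequality
  \<open>x * y \<le> x^(3/2) + y^3\<close> is applied to \<open>W\<close> and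
  \<open>(|f| / enorm F)^2\<close>. The normalization makes the resulting bound homogeneous of
  degree 2 and forces the separate case \<open>enorm F = 0\<close>, where \<open>f\<close> vanishes
  almost everywhere by the Sobolev inequality.\<close>

lemma weighted_sobolev:
  fixes W :: "real^3 \<Rightarrow> real"
  assumes W[measurable]: "W \<in> borel_measurable lebesgue" and W0: "\<And>x. 0 \<le> W x"
    and Wi: "integrable lebesgue (\<lambda>x. W x powr (3/2))"
    and h: "has_FT s F f" and F: "energy F" and s: "s\<^sup>2 = 1"
  shows "integrable lebesgue (\<lambda>x. W x * (cmod (f x))\<^sup>2)"
    and "(LINT x|lebesgue. W x * (cmod (f x))\<^sup>2) \<le> ((LINT x|lebesgue. W x powr (3/2)) + 6 * sobolev_const\<^sup>2) * (enorm F)\<^sup>2"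
proof -
  note has_FT_measurable[OF h, measurable]
  have sob: "(\<integral>\<^sup>+x. ennreal ((cmod (f x)) ^ 6) \<partial>lebesgue) \<le> ennreal (6 * sobolev_const\<^sup>2 * (enorm F) ^ 6)"
    by (rule sobolev[OF h F s])
  then have i6: "integrable lebesgue (\<lambda>x. (cmod (f x)) ^ 6)"
    by (intro integrableI_bounded) (auto intro: le_less_trans)
  have "ennreal (LINT x|lebesgue. (cmod (f x)) ^ 6) \<le> ennreal (6 * sobolev_const\<^sup>2 * (enorm F) ^ 6)"
    using sob nn_integral_eq_integral[OF i6] by simp
  then have l6: "(LINT x|lebesgue. (cmod (f x)) ^ 6) \<le> 6 * sobolev_const\<^sup>2 * (enorm F) ^ 6"
    by (subst (asm) ennreal_le_iff) auto
  let ?e = "enorm F"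
  have "integrable lebesgue (\<lambda>x. W x * (cmod (f x))\<^sup>2) \<and> (LINT x|lebesgue. W x * (cmod (f x))\<^sup>2) \<le>
      ((LINT x|lebesgue. W x powr (3/2)) + 6 * sobolev_const\<^sup>2) * ?e\<^sup>2"
  proof (cases "?e = 0")
    case True
    then have "(LINT x|lebesgue. (cmod (f x)) ^ 6) = 0"
      using l6 by (intro antisym) (auto intro!: integral_nonneg_AE)
    then have "AE x in lebesgue. (cmod (f x)) ^ 6 = 0"
      using integral_nonneg_eq_0_iff_AE[OF i6] by simp
    then have ae: "AE x in lebesgue. W x * (cmod (f x))\<^sup>2 = 0" by eventually_elim simp
    have "(LINT x|lebesgue. W x * (cmod (f x))\<^sup>2) = (LINT x|(lebesgue :: (real^3) measure). 0)"
      by (rule integral_cong_AE[OF _ _ ae]) measurable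
    moreover have "integrable lebesgue (\<lambda>x. W x * (cmod (f x))\<^sup>2)"
      using integrable_cong_AE[OF _ _ ae] by simp
    ultimately show ?thesis using True by simp
  next
    case False
    then have e: "0 < ?e" using enorm_nonneg[of F] by linarith
    have young: "x * y \<le> x powr (3/2) + y ^ 3" if "0 \<le> x" "0 \<le> y" for x y :: real
    proof (cases "y \<le> sqrt x")
      case True
      have "x powr (3/2) = x * sqrt x"
        using powr_add[of x 1 "1/2"] that by (cases "x = 0") (auto simp: powr_half_sqrt)
      then have "x * y \<le> x powr (3/2)" using True that by (simp add: mult_left_mono)
      moreover have "0 \<le> y ^ 3" using that by simp
      ultimately show ?thesis by linarith
    next
      case False
      then have "x \<le> y\<^sup>2" using that by (metis less_eq_real_def linorder_not_le real_sqrt_le_iff real_sqrt_abs abs_of_nonneg)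
      then have "x * y \<le> y\<^sup>2 * y" using that by (intro mult_right_mono) auto
      also have "\<dots> = y ^ 3" by (simp add: power2_eq_square power3_eq_cube)
      finally show ?thesis using powr_ge_zero[of x "3/2"] by linarith
    qed
    let ?b = "\<lambda>x. ?e\<^sup>2 * (W x powr (3/2) + (cmod (f x)) ^ 6 / ?e ^ 6)"
    have bi: "integrable lebesgue ?b" using Wi i6 by auto
    have le: "W x * (cmod (f x))\<^sup>2 \<le> ?b x" for x
    proof -
      have "W x * (cmod (f x))\<^sup>2 = ?e\<^sup>2 * (W x * (cmod (f x) / ?e)\<^sup>2)" using e by (simp add: power_divide)
      also have "\<dots> \<le> ?e\<^sup>2 * (W x powr (3/2) + ((cmod (f x) / ?e)\<^sup>2) ^ 3)" by (intro mult_left_mono young W0) auto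
      finally show ?thesis by (simp add: power_divide flip: power_mult)
    qed
    have i: "integrable lebesgue (\<lambda>x. W x * (cmod (f x))\<^sup>2)"
      by (rule Bochner_Integration.integrable_bound[OF bi]) (measurable, use le in \<open>auto simp: abs_mult W0 intro: order_trans[OF _ abs_ge_self]\<close>)
    have "(LINT x|lebesgue. W x * (cmod (f x))\<^sup>2) \<le> (LINT x|lebesgue. ?b x)"
      by (rule integral_mono[OF i bi le])
    also have "\<dots> = ?e\<^sup>2 * ((LINT x|lebesgue. W x powr (3/2)) + (LINT x|lebesgue. (cmod (f x)) ^ 6) / ?e ^ 6)"
      using Wi i6 by simp
    also have "\<dots> \<le> ?e\<^sup>2 * ((LINT x|lebesgue. W x powr (3/2)) + 6 * sobolev_const\<^sup>2)"
      using e l6 by (intro mult_left_mono add_left_mono) (auto simp: field_simps)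
    finally show ?thesis using i by (simp add: mult.commute)
  qed
  then show "integrable lebesgue (\<lambda>x. W x * (cmod (f x))\<^sup>2)"
    "(LINT x|lebesgue. W x * (cmod (f x))\<^sup>2) \<le> ((LINT x|lebesgue. W x powr (3/2)) + 6 * sobolev_const\<^sup>2) * (enorm F)\<^sup>2"
    by auto
qed

definition einner :: "(real^3 \<Rightarrow> complex) \<Rightarrow> (real^3 \<Rightarrow> complex) \<Rightarrow> complex" where
  "einner F G = L2_inner (\<lambda>p. complex_of_real (norm p) * F p) (\<lambda>p. complex_of_real (norm p) * G p)"

lemma einner_eq: "einner F G = (LINT p|lebesgue. complex_of_real ((norm p)\<^sup>2) * (cnj (F p) * G p))"
  unfolding einner_def L2_inner_def
  by (intro Bochner_Integration.integral_cong) (auto simp: power2_eq_square)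

lemma einner_self: "einner F F = complex_of_real ((enorm F)\<^sup>2)"
  by (simp add: einner_def enorm_def L2_inner_self)

section \<open>The weighted potential and the inverse Laplacian\<close>

locale potential =
  fixes V :: "real^3 \<Rightarrow> real"
  assumes V_weighted_L1: "integrable lebesgue (\<lambda>x. V x * (1 + norm x))"
    and V_weighted_L32: "integrable lebesgue (\<lambda>x. \<bar>V x * (1 + norm x)\<bar> powr (3/2))"
begin

lemma V_measurable [measurable]: "V \<in> borel_measurable lebesgue"
proof -
  have "(\<lambda>x. V x * (1 + norm x) / (1 + norm x)) \<in> borel_measurable lebesgue"
    by (intro borel_measurable_divide borel_measurable_integrable[OF V_weighted_L1]) measurable
  moreover have "V x * (1 + norm x) / (1 + norm x) = V x" for x using norm_ge_zero[of x] by (simp add: add_nonneg_eq_0_iff)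
  ultimately show ?thesis by simp
qed

text \<open>Form bounds are proved for the weighted potential rather than for \<open>|V|\<close>,
  because the first moment of \<open>V psi0\<close> has to be finite later on.\<close>

definition W :: "real^3 \<Rightarrow> real" where "W x = \<bar>V x\<bar> * (1 + norm x)"

lemma W_measurable [measurable]: "W \<in> borel_measurable lebesgue" unfolding W_def by measurable

lemma W_nonneg: "0 \<le> W x" by (simp add: W_def)

lemma abs_V_le_W: "\<bar>V x\<bar> \<le> W x"
  using mult_left_mono[of 1 "1 + norm x" "\<bar>V x\<bar>"] by (simp add: W_def)

lemma W_integrable: "integrable lebesgue W"
  using integrable_abs[OF V_weighted_L1] by (simp add: W_def[abs_def] abs_mult)

lemma abs_V_integrable: "integrable lebesgue (\<lambda>x. \<bar>V x\<bar>)"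
  by (rule Bochner_Integration.integrable_bound[OF W_integrable]) (auto simp: abs_V_le_W W_nonneg)

text \<open>The relative form bound of \<open>W\<close> with respect to the Laplacian, from
  \<open>weighted_sobolev\<close>.\<close>

definition S :: real where "S = (LINT x|lebesgue. W x powr (3/2)) + 6 * sobolev_const\<^sup>2"

lemma S_pos: "0 < S"
  unfolding S_def using sobolev_const_pos by (intro add_nonneg_pos integral_nonneg_AE) auto

lemma W_sobolev:
  assumes "has_FT s F f" "energy F" "s\<^sup>2 = 1"
  shows "integrable lebesgue (\<lambda>x. W x * (cmod (f x))\<^sup>2)"
    "(LINT x|lebesgue. W x * (cmod (f x))\<^sup>2) \<le> S * (enorm F)\<^sup>2"
proof -
  have "integrable lebesgue (\<lambda>x. W x powr (3/2))"
    using V_weighted_L32 by (simp add: W_def[abs_def] abs_mult)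
  note weighted_sobolev[OF W_measurable W_nonneg this assms]
  then show "integrable lebesgue (\<lambda>x. W x * (cmod (f x))\<^sup>2)"
    "(LINT x|lebesgue. W x * (cmod (f x))\<^sup>2) \<le> S * (enorm F)\<^sup>2" by (auto simp: S_def)
qed

lemma abs_root_measurable [measurable]: "abs_root V \<in> borel_measurable lebesgue"
  unfolding abs_root_def by measurable

lemma sgn_root_measurable [measurable]: "sgn_root V \<in> borel_measurable lebesgue"
  unfolding sgn_root_def by measurable

lemma cmod_abs_root: "cmod (abs_root V x) = sqrt \<bar>V x\<bar>" by (simp add: abs_root_def)

lemma cmod_sgn_root: "cmod (sgn_root V x) = sqrt \<bar>V x\<bar>"
  by (simp add: sgn_root_def norm_mult sgn_if)

lemma cnj_abs_root [simp]: "cnj (abs_root V x) = abs_root V x" by (simp add: abs_root_def)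

lemma cnj_sgn_root [simp]: "cnj (sgn_root V x) = sgn_root V x" by (simp add: sgn_root_def)

lemma abs_root_mult_sgn_root: "abs_root V x * sgn_root V x = complex_of_real (V x)"
proof -
  have "sqrt \<bar>V x\<bar> * (sgn (V x) * sqrt \<bar>V x\<bar>) = sgn (V x) * (sqrt \<bar>V x\<bar> * sqrt \<bar>V x\<bar>)" by (simp only: ac_simps)
  also have "\<dots> = V x" by (simp add: sgn_mult_abs)
  finally show ?thesis by (simp only: abs_root_def sgn_root_def of_real_mult[symmetric])
qed

lemma abs_root_L2: "abs_root V \<in> L2"
  by (rule L2I) (use abs_V_integrable in \<open>auto simp: cmod_abs_root\<close>)

lemma sgn_root_L2: "sgn_root V \<in> L2"
  by (rule L2_dominated[OF abs_root_L2]) (auto simp: cmod_abs_root cmod_sgn_root)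

lemma abs_V_sobolev:
  assumes h: "has_FT s F f" "energy F" "s\<^sup>2 = 1"
  shows "integrable lebesgue (\<lambda>x. \<bar>V x\<bar> * (cmod (f x))\<^sup>2)"
    "(LINT x|lebesgue. \<bar>V x\<bar> * (cmod (f x))\<^sup>2) \<le> S * (enorm F)\<^sup>2"
proof -
  note has_FT_measurable[OF h(1), measurable]
  have le: "\<bar>V x\<bar> * (cmod (f x))\<^sup>2 \<le> W x * (cmod (f x))\<^sup>2" for x by (intro mult_right_mono abs_V_le_W) simp
  show i: "integrable lebesgue (\<lambda>x. \<bar>V x\<bar> * (cmod (f x))\<^sup>2)"
    by (rule Bochner_Integration.integrable_bound[OF W_sobolev(1)[OF h]]) (use le W_nonneg in \<open>auto simp: abs_mult\<close>)
  have "(LINT x|lebesgue. \<bar>V x\<bar> * (cmod (f x))\<^sup>2) \<le> (LINT x|lebesgue. W x * (cmod (f x))\<^sup>2)"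
    by (rule integral_mono[OF i W_sobolev(1)[OF h] le])
  then show "(LINT x|lebesgue. \<bar>V x\<bar> * (cmod (f x))\<^sup>2) \<le> S * (enorm F)\<^sup>2" using W_sobolev(2)[OF h] by linarith
qed

lemma abs_root_mult_L2:
  assumes h: "has_FT s F f" "energy F" "s\<^sup>2 = 1"
  shows "(\<lambda>x. abs_root V x * f x) \<in> L2" "(\<lambda>x. sgn_root V x * f x) \<in> L2"
    "L2_norm (\<lambda>x. abs_root V x * f x) \<le> sqrt S * enorm F"
    "L2_norm (\<lambda>x. sgn_root V x * f x) \<le> sqrt S * enorm F"
proof -
  note has_FT_measurable[OF h(1), measurable]
  have eq: "(cmod (abs_root V x * f x))\<^sup>2 = \<bar>V x\<bar> * (cmod (f x))\<^sup>2"
    "(cmod (sgn_root V x * f x))\<^sup>2 = \<bar>V x\<bar> * (cmod (f x))\<^sup>2" for x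
    by (simp_all add: norm_mult cmod_abs_root cmod_sgn_root power_mult_distrib)
  show "(\<lambda>x. abs_root V x * f x) \<in> L2" "(\<lambda>x. sgn_root V x * f x) \<in> L2"
    by (rule L2I, measurable, simp only: eq abs_V_sobolev(1)[OF h])+
  have "sqrt (LINT x|lebesgue. \<bar>V x\<bar> * (cmod (f x))\<^sup>2) \<le> sqrt (S * (enorm F)\<^sup>2)"
    by (rule real_sqrt_le_mono[OF abs_V_sobolev(2)[OF h]])
  then show "L2_norm (\<lambda>x. abs_root V x * f x) \<le> sqrt S * enorm F"
    "L2_norm (\<lambda>x. sgn_root V x * f x) \<le> sqrt S * enorm F"
    unfolding L2_norm_def eq by (simp_all add: real_sqrt_mult)
qed

lemma abs_root_mult_integrable: "f \<in> L2 \<Longrightarrow> integrable lebesgue (\<lambda>x. abs_root V x * f x)"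
  by (rule L2_mult_integrable[OF abs_root_L2])

text \<open>The momentum-space side of \<open>p^-2 |V|^(1/2) f\<close>, before multiplication by the
  second root gives the Birman-Schwinger operator.\<close>

definition inv_lap :: "(real^3 \<Rightarrow> complex) \<Rightarrow> real^3 \<Rightarrow> complex" where
  "inv_lap f p = fourier (\<lambda>y. abs_root V y * f y) p / complex_of_real ((norm p)\<^sup>2)"

lemma inv_lap_measurable:
  assumes f: "f \<in> L2" shows "inv_lap f \<in> borel_measurable lebesgue"
  using L2_measurable[OF f, measurable] unfolding inv_lap_def fourier_eq_FT by measurable

text \<open>A duality argument. The cutoff at small and at large momenta makes
  \<open>enorm G\<close> finite from the outset. By the multiplication formula its square is the
  pairing of \<open>|V|^(1/2)\<close> times the transform of \<open>G\<close> with \<open>f\<close>;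
  the Sobolev bound on the former then allows one factor \<open>enorm G\<close> to be cancelled. The
  bound is uniform in \<open>n\<close>.\<close>

lemma inv_lap_cutoff:
  assumes f: "f \<in> L2" and n: "0 < (n::real)"
  defines "G \<equiv> (\<lambda>p. if 1 / n < norm p \<and> norm p \<le> n then inv_lap f p else 0)"
  shows "energy G" "enorm G \<le> sqrt S * L2_norm f"
proof -
  let ?g = "\<lambda>y. abs_root V y * f y"
  have gi: "integrable lebesgue ?g" by (rule abs_root_mult_integrable[OF f])
  define M where "M = (2 * pi) powr (-3/2) * (LINT x|lebesgue. cmod (?g x))"
  have M: "cmod (fourier ?g p) \<le> M" for p unfolding M_def fourier_eq_FT by (rule FT_bound)
  have M0: "0 \<le> M" using M[of 0] norm_ge_zero order_trans by blast
  note L2_measurable[OF f, measurable]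
  have [measurable]: "G \<in> borel_measurable lebesgue" unfolding G_def inv_lap_def fourier_eq_FT by measurable
  have bnd: "cmod (G p) \<le> M * n\<^sup>2 * indicator (cball 0 n) p" for p
  proof (cases "1 / n < norm p \<and> norm p \<le> n")
    case True
    then have "1 < n * norm p" using n by (simp add: field_simps)
    then have "1 \<le> n\<^sup>2 * (norm p)\<^sup>2" using power_mono[of 1 "n * norm p" 2] by (simp add: power_mult_distrib)
    moreover have "0 < (norm p)\<^sup>2" using True n by (metis divide_pos_pos less_trans zero_less_one zero_less_power)
    ultimately have "1 / (norm p)\<^sup>2 \<le> n\<^sup>2" by (simp add: field_simps)
    then have "cmod (fourier ?g p) * (1 / (norm p)\<^sup>2) \<le> M * n\<^sup>2" by (intro mult_mono M M0) auto
    then show ?thesis using True by (simp add: G_def inv_lap_def norm_divide norm_power)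
  qed (auto simp: G_def M0)
  have i1: "integrable lebesgue (\<lambda>p. M * n\<^sup>2 * indicator (cball 0 n) (p::real^3))" using integrable_indicator_cball by simp
  have Gi: "integrable lebesgue G"
    by (rule Bochner_Integration.integrable_bound[OF i1]) (use bnd M0 in \<open>auto simp: abs_mult\<close>)
  have G2: "G \<in> L2"
  proof (rule L2I)
    show "integrable lebesgue (\<lambda>x. (cmod (G x))\<^sup>2)"
    proof (rule Bochner_Integration.integrable_bound[of _ "\<lambda>p. (M * n\<^sup>2)\<^sup>2 * indicator (cball 0 n) (p::real^3)"])
      show "integrable lebesgue (\<lambda>p. (M * n\<^sup>2)\<^sup>2 * indicator (cball 0 n) (p::real^3))" using integrable_indicator_cball by simp
      show "AE x in lebesgue. norm ((cmod (G x))\<^sup>2) \<le> norm ((M * n\<^sup>2)\<^sup>2 * indicator (cball 0 n) x)"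
      proof (rule AE_I2)
        fix x
        have "(cmod (G x))\<^sup>2 \<le> (M * n\<^sup>2 * indicator (cball 0 n) x)\<^sup>2" by (intro power_mono bnd) simp
        then show "norm ((cmod (G x))\<^sup>2) \<le> norm ((M * n\<^sup>2)\<^sup>2 * indicator (cball 0 n) x)"
          by (auto simp: power_mult_distrib indicator_def)
      qed
    qed measurable
  qed measurable
  have nG: "cmod (complex_of_real (norm p) * G p) \<le> cmod (complex_of_real n * G p)" for p
    using n by (cases "norm p \<le> n") (auto simp: norm_mult G_def intro!: mult_right_mono)
  show E: "energy G" unfolding energy_def
    by (intro conjI L2_dominated[OF L2_scale[OF G2, of "complex_of_real n"]]) (measurable, use nG in auto)
  have h: "has_FT 1 G (FT 1 G)" by (rule has_FT_integrable[OF energy_L1_L2[OF E] Gi]) simp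
  note r = abs_root_mult_L2[OF h E, simplified]
  have "complex_of_real ((enorm G)\<^sup>2) = einner G G" by (simp add: einner_self)
  also have "\<dots> = (LINT p|lebesgue. cnj (G p) * FT (-1) ?g p)"
    unfolding einner_eq
  proof (intro Bochner_Integration.integral_cong refl)
    fix p show "complex_of_real ((norm p)\<^sup>2) * (cnj (G p) * G p) = cnj (G p) * FT (-1) ?g p"
    proof (cases "G p = 0")
      case False
      then have "G p = inv_lap f p" "norm p \<noteq> 0" using n by (auto simp: G_def split: if_splits)
      then have "complex_of_real ((norm p)\<^sup>2) * G p = FT (-1) ?g p"
        by (simp add: inv_lap_def fourier_eq_FT)
      then show ?thesis by (metis mult.left_commute)
    qed simp
  qed
  also have "\<dots> = (LINT x|lebesgue. cnj (FT 1 G x) * ?g x)"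
    by (rule FT_multiplication_formula[symmetric, OF Gi gi])
  also have "\<dots> = L2_inner (\<lambda>x. abs_root V x * FT 1 G x) f"
    unfolding L2_inner_def by (intro Bochner_Integration.integral_cong) (auto simp: ac_simps)
  finally have "(enorm G)\<^sup>2 = cmod (L2_inner (\<lambda>x. abs_root V x * FT 1 G x) f)"
    by (metis norm_of_real abs_of_nonneg zero_le_power2)
  also have "\<dots> \<le> L2_norm (\<lambda>x. abs_root V x * FT 1 G x) * L2_norm f" by (rule L2_Cauchy_Schwarz[OF r(1) f])
  also have "\<dots> \<le> sqrt S * enorm G * L2_norm f" by (intro mult_right_mono r) simp
  finally have "enorm G * enorm G \<le> enorm G * (sqrt S * L2_norm f)" by (simp add: power2_eq_square ac_simps)
  then show "enorm G \<le> sqrt S * L2_norm f"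
    using S_pos enorm_nonneg[of G] by (cases "enorm G = 0") (auto simp: mult_le_cancel_left)
qed

text \<open>Monotone convergence as the cutoff is removed: the uniform bound gives both finiteness
  and the estimate.\<close>

lemma inv_lap_energy:
  assumes f: "f \<in> L2"
  shows "energy (inv_lap f)" "enorm (inv_lap f) \<le> sqrt S * L2_norm f"
proof -
  note L2_measurable[OF f, measurable] inv_lap_measurable[OF f, measurable]
  define G where "G n p = (if 1 / real (Suc n) < norm p \<and> norm p \<le> real (Suc n) then inv_lap f p else 0)" for n p
  have Gm[measurable]: "G n \<in> borel_measurable lebesgue" for n unfolding G_def by measurable
  have G: "energy (G n)" "enorm (G n) \<le> sqrt S * L2_norm f" for n
    using inv_lap_cutoff[OF f, of "real (Suc n)"] unfolding G_def by auto
  define a where "a n p = ennreal ((norm p)\<^sup>2 * (cmod (G n p))\<^sup>2)" for n p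
  have am: "a n \<in> borel_measurable lebesgue" for n unfolding a_def by measurable
  have inc: "incseq a"
  proof (rule incseq_SucI, rule le_funI)
    fix n p
    have "1 / real (Suc (Suc n)) \<le> 1 / real (Suc n)" by (simp add: frac_le)
    then show "a n p \<le> a (Suc n) p" unfolding a_def G_def by (auto intro!: ennreal_leI)
  qed
  have SUP: "AE p in lebesgue. (SUP n. a n p) = ennreal ((norm p)\<^sup>2 * (cmod (inv_lap f p))\<^sup>2)"
    using AE_norm_neq[of 0]
  proof eventually_elim
    case (elim p)
    have "(\<lambda>n. a n p) \<longlonglongrightarrow> ennreal ((norm p)\<^sup>2 * (cmod (inv_lap f p))\<^sup>2)"
    proof (rule tendsto_eventually)
      have "eventually (\<lambda>n. 1 / real (Suc n) < norm p) sequentially"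
        by (rule order_tendstoD[OF LIMSEQ_Suc[OF lim_1_over_n]]) (use elim in simp)
      moreover have "eventually (\<lambda>n. norm p \<le> real (Suc n)) sequentially"
        using eventually_ge_at_top[of "nat \<lceil>norm p\<rceil>"]
        by eventually_elim (use real_nat_ceiling_ge[of "norm p"] in linarith)
      ultimately show "eventually (\<lambda>n. a n p = ennreal ((norm p)\<^sup>2 * (cmod (inv_lap f p))\<^sup>2)) sequentially"
        by eventually_elim (simp add: a_def G_def)
    qed
    moreover have "(\<lambda>n. a n p) \<longlonglongrightarrow> (SUP n. a n p)" using inc by (intro LIMSEQ_SUP) (simp add: incseq_def le_fun_def)
    ultimately show ?case by (rule LIMSEQ_unique[rotated])
  qed
  have "(\<integral>\<^sup>+p. ennreal ((norm p)\<^sup>2 * (cmod (inv_lap f p))\<^sup>2) \<partial>lebesgue) = (\<integral>\<^sup>+p. (SUP n. a n p) \<partial>lebesgue)"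
    by (rule nn_integral_cong_AE) (use SUP in auto)
  also have "\<dots> = (SUP n. \<integral>\<^sup>+p. a n p \<partial>lebesgue)"
    by (rule nn_integral_monotone_convergence_SUP[OF inc am])
  also have "\<dots> \<le> ennreal ((sqrt S * L2_norm f)\<^sup>2)"
  proof (rule SUP_least)
    fix n
    have "(\<integral>\<^sup>+p. a n p \<partial>lebesgue) = ennreal ((enorm (G n))\<^sup>2)"
      unfolding a_def enorm_sq by (rule nn_integral_eq_integral[OF energy_integrable[OF G(1)]]) simp
    also have "\<dots> \<le> ennreal ((sqrt S * L2_norm f)\<^sup>2)" by (intro ennreal_leI power_mono G) simp
    finally show "(\<integral>\<^sup>+p. a n p \<partial>lebesgue) \<le> ennreal ((sqrt S * L2_norm f)\<^sup>2)" .
  qed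
  finally have bnd: "(\<integral>\<^sup>+p. ennreal ((norm p)\<^sup>2 * (cmod (inv_lap f p))\<^sup>2) \<partial>lebesgue) \<le> ennreal ((sqrt S * L2_norm f)\<^sup>2)" .
  have i: "integrable lebesgue (\<lambda>p. (norm p)\<^sup>2 * (cmod (inv_lap f p))\<^sup>2)"
    by (rule integrableI_bounded) (measurable, use bnd in \<open>auto intro: le_less_trans\<close>)
  show "energy (inv_lap f)" by (rule energyI[OF inv_lap_measurable[OF f] i])
  have "(\<integral>\<^sup>+p. ennreal ((norm p)\<^sup>2 * (cmod (inv_lap f p))\<^sup>2) \<partial>lebesgue) = ennreal ((enorm (inv_lap f))\<^sup>2)"
    unfolding enorm_sq by (rule nn_integral_eq_integral[OF i]) simp
  with bnd have "ennreal ((enorm (inv_lap f))\<^sup>2) \<le> ennreal ((sqrt S * L2_norm f)\<^sup>2)" by (simp only:)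
  then have "(enorm (inv_lap f))\<^sup>2 \<le> (sqrt S * L2_norm f)\<^sup>2" by (subst (asm) ennreal_le_iff) auto
  then show "enorm (inv_lap f) \<le> sqrt S * L2_norm f" by (rule power2_le_imp_le) (use S_pos in simp)
qed

text \<open>With respect to \<open>einner\<close>, \<open>inv_lap f\<close> represents the
  functional pairing \<open>|V|^(1/2) u\<close> with \<open>f\<close>. Both sides depend
  continuously on \<open>F\<close> in the energy norm, so the identity passes from truncated
  \<open>F\<close>, where the multiplication formula for integrable functions applies.\<close>

theorem parseval:
  assumes h: "has_FT 1 F u" and F: "energy F" and f: "f \<in> L2"
  shows "einner F (inv_lap f) = L2_inner (\<lambda>x. abs_root V x * u x) f"
proof -
  let ?g = "\<lambda>y. abs_root V y * f y"
  have gi: "integrable lebesgue ?g" by (rule abs_root_mult_integrable[OF f])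
  note energy_measurable[OF F, measurable]
  have FR: "energy (truncate R F)" for R by (rule energy_dominated(1)[OF F]) (measurable, rule cmod_truncate_le)
  have FRi: "integrable lebesgue (truncate R F)" for R by (rule L1_L2_integrable[OF energy_L1_L2[OF F]])
  have hR: "has_FT 1 (truncate R F) (FT 1 (truncate R F))" for R
    by (rule has_FT_integrable[OF energy_L1_L2[OF FR] FRi]) simp
  note r = abs_root_mult_L2[OF h F, simplified]
  note rR = abs_root_mult_L2[OF hR FR, simplified]
  have eq: "einner (truncate R F) (inv_lap f) = L2_inner (\<lambda>x. abs_root V x * FT 1 (truncate R F) x) f" for R
  proof -
    have "einner (truncate R F) (inv_lap f) = (LINT p|lebesgue. cnj (truncate R F p) * FT (-1) ?g p)"
      unfolding einner_eq
    proof (rule integral_cong_AE)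
      show "AE p in lebesgue. complex_of_real ((norm p)\<^sup>2) * (cnj (truncate R F p) * inv_lap f p) = cnj (truncate R F p) * FT (-1) ?g p"
        using AE_norm_neq[of 0] by eventually_elim (simp add: inv_lap_def fourier_eq_FT)
      note L2_measurable[OF f, measurable] inv_lap_measurable[OF f, measurable]
      show "(\<lambda>p. complex_of_real ((norm p)\<^sup>2) * (cnj (truncate R F p) * inv_lap f p)) \<in> borel_measurable lebesgue" by measurable
      show "(\<lambda>p. cnj (truncate R F p) * FT (-1) ?g p) \<in> borel_measurable lebesgue" by measurable
    qed
    also have "\<dots> = (LINT x|lebesgue. cnj (FT 1 (truncate R F) x) * ?g x)"
      by (rule FT_multiplication_formula[symmetric, OF FRi gi])
    also have "\<dots> = L2_inner (\<lambda>x. abs_root V x * FT 1 (truncate R F) x) f"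
      unfolding L2_inner_def by (intro Bochner_Integration.integral_cong) (auto simp: ac_simps)
    finally show ?thesis .
  qed
  let ?pF = "\<lambda>p. complex_of_real (norm p) * F p"
  have tr: "(\<lambda>p. complex_of_real (norm p) * truncate R F p) = truncate R ?pF" for R by (auto simp: truncate_def)
  have lim1: "((\<lambda>R. einner (truncate R F) (inv_lap f)) \<longlongrightarrow> einner F (inv_lap f)) at_top"
    unfolding einner_def tr
    by (intro L2_limit_tendsto(2) truncate_L2_limit truncate_L2 energy_L2 F inv_lap_energy f)
  have le: "norm (L2_inner (\<lambda>x. abs_root V x * FT 1 (truncate R F) x) f - L2_inner (\<lambda>x. abs_root V x * u x) f)
      \<le> sqrt S * L2_norm (\<lambda>p. ?pF p - truncate R ?pF p) * L2_norm f" for R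
  proof -
    have hd: "has_FT 1 (\<lambda>p. F p - truncate R F p) (\<lambda>x. u x - FT 1 (truncate R F) x)"
      by (rule has_FT_diff[OF h hR energy_L1_L2[OF F] energy_L1_L2[OF FR]])
    note rd = abs_root_mult_L2[OF hd energy_diff[OF F FR], simplified]
    have "L2_inner (\<lambda>x. abs_root V x * u x) f =
        L2_inner (\<lambda>x. abs_root V x * (u x - FT 1 (truncate R F) x)) f + L2_inner (\<lambda>x. abs_root V x * FT 1 (truncate R F) x) f"
      using L2_inner_add_left[OF f rd(1) rR(1)[of R]] by (simp add: algebra_simps)
    then have "norm (L2_inner (\<lambda>x. abs_root V x * FT 1 (truncate R F) x) f - L2_inner (\<lambda>x. abs_root V x * u x) f) =
        norm (L2_inner (\<lambda>x. abs_root V x * (u x - FT 1 (truncate R F) x)) f)" by simp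
    also have "\<dots> \<le> L2_norm (\<lambda>x. abs_root V x * (u x - FT 1 (truncate R F) x)) * L2_norm f"
      by (rule L2_Cauchy_Schwarz[OF rd(1) f])
    also have "\<dots> \<le> sqrt S * enorm (\<lambda>p. F p - truncate R F p) * L2_norm f" by (intro mult_right_mono rd) simp
    also have "enorm (\<lambda>p. F p - truncate R F p) = L2_norm (\<lambda>p. ?pF p - truncate R ?pF p)"
      by (simp add: enorm_def tr[symmetric] right_diff_distrib)
    finally show ?thesis .
  qed
  have lim: "((\<lambda>R. sqrt S * L2_norm (\<lambda>p. ?pF p - truncate R ?pF p) * L2_norm f) \<longlongrightarrow> sqrt S * 0 * L2_norm f) at_top"
    by (intro tendsto_intros L1_L2_tail_tendsto L1_L2_of_L2 energy_L2 F)
  have "((\<lambda>R. L2_inner (\<lambda>x. abs_root V x * FT 1 (truncate R F) x) f - L2_inner (\<lambda>x. abs_root V x * u x) f) \<longlongrightarrow> 0) at_top"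
    by (rule Lim_null_comparison[OF always_eventually[OF allI[OF le]] lim[unfolded mult_zero_right mult_zero_left]])
  then have "((\<lambda>R. L2_inner (\<lambda>x. abs_root V x * FT 1 (truncate R F) x) f) \<longlongrightarrow> L2_inner (\<lambda>x. abs_root V x * u x) f) at_top"
    by (simp add: LIM_zero_iff)
  with lim1 show ?thesis unfolding eq using tendsto_unique[OF trivial_limit_at_top_linorder] by blast
qed

lemma has_FT_inv_neg_laplacian:
  assumes f: "f \<in> L2"
  shows "has_FT 1 (inv_lap f) (inv_neg_laplacian (\<lambda>y. abs_root V y * f y))"
proof -
  have "\<exists>h. has_inv_fourier (inv_lap f) h"
    unfolding has_inv_fourier_iff by (rule has_FT_exists[OF energy_L1_L2[OF inv_lap_energy(1)[OF f]]]) simp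
  then have "has_inv_fourier (inv_lap f) (SOME h. has_inv_fourier (inv_lap f) h)" by (rule someI_ex)
  then have "has_FT 1 (inv_lap f) (SOME h. has_inv_fourier (inv_lap f) h)" by (rule has_inv_fourier_iff[THEN iffD1])
  moreover have eq: "(\<lambda>p. fourier (\<lambda>y. abs_root V y * f y) p / complex_of_real ((norm p)\<^sup>2)) = inv_lap f"
    by (simp add: inv_lap_def fun_eq_iff)
  ultimately show ?thesis
    unfolding inv_neg_laplacian_def eq by simp
qed

end

section \<open>The quadratic form of the potential\<close>

context potential begin

text \<open>Larger than the space of finite-energy functions: it also contains constants and bounded
  functions, hence \<open>psi0\<close> and the deviations from a constant that occur below.\<close>

definition VL2 :: "(real^3 \<Rightarrow> complex) \<Rightarrow> bool" where
  "VL2 u \<longleftrightarrow> u \<in> borel_measurable lebesgue \<and> (\<lambda>x. abs_root V x * u x) \<in> L2"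

definition vnorm :: "(real^3 \<Rightarrow> complex) \<Rightarrow> real" where
  "vnorm u = L2_norm (\<lambda>x. abs_root V x * u x)"

text \<open>Distributing the two roots of \<open>V\<close> over the factors makes the Cauchy-Schwarz
  inequality of L^2 available although \<open>V\<close> changes sign.\<close>

definition vform :: "(real^3 \<Rightarrow> complex) \<Rightarrow> (real^3 \<Rightarrow> complex) \<Rightarrow> complex" where
  "vform u v = L2_inner (\<lambda>x. abs_root V x * u x) (\<lambda>x. sgn_root V x * v x)"

definition vquad :: "(real^3 \<Rightarrow> complex) \<Rightarrow> real" where
  "vquad u = (LINT x|lebesgue. V x * (cmod (u x))\<^sup>2)"

lemma VL2_measurable: "VL2 u \<Longrightarrow> u \<in> borel_measurable lebesgue"
  by (simp add: VL2_def)

lemma VL2_abs_root: "VL2 u \<Longrightarrow> (\<lambda>x. abs_root V x * u x) \<in> L2"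
  by (simp add: VL2_def)

lemma VL2_sgn_root:
  assumes u: "VL2 u" shows "(\<lambda>x. sgn_root V x * u x) \<in> L2"
proof (rule L2_dominated[OF VL2_abs_root[OF u]])
  note VL2_measurable[OF u, measurable]
  show "(\<lambda>x. sgn_root V x * u x) \<in> borel_measurable lebesgue" by measurable
qed (simp add: norm_mult cmod_abs_root cmod_sgn_root)

lemma L2_norm_sgn_root: "L2_norm (\<lambda>x. sgn_root V x * u x) = vnorm u"
  by (simp add: vnorm_def L2_norm_def norm_mult cmod_abs_root cmod_sgn_root)

lemma VL2_I:
  assumes [measurable]: "u \<in> borel_measurable lebesgue" and "integrable lebesgue (\<lambda>x. \<bar>V x\<bar> * (cmod (u x))\<^sup>2)"
  shows "VL2 u"
  unfolding VL2_def
proof (intro conjI L2I)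
  show "(\<lambda>x. abs_root V x * u x) \<in> borel_measurable lebesgue" by measurable
  show "integrable lebesgue (\<lambda>x. (cmod (abs_root V x * u x))\<^sup>2)"
    using assms(2) by (simp add: norm_mult power_mult_distrib cmod_abs_root)
qed fact

lemma VL2_integrable: "VL2 u \<Longrightarrow> integrable lebesgue (\<lambda>x. \<bar>V x\<bar> * (cmod (u x))\<^sup>2)"
  using L2_integrable[OF VL2_abs_root] by (simp add: norm_mult power_mult_distrib cmod_abs_root)

lemma VL2_V_integrable:
  assumes u: "VL2 u" shows "integrable lebesgue (\<lambda>x. V x * (cmod (u x))\<^sup>2)"
proof (rule Bochner_Integration.integrable_bound[OF VL2_integrable[OF u]])
  note VL2_measurable[OF u, measurable]
  show "(\<lambda>x. V x * (cmod (u x))\<^sup>2) \<in> borel_measurable lebesgue" by measurable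
qed (simp add: abs_mult)

lemma vnorm_sq: "(vnorm u)\<^sup>2 = (LINT x|lebesgue. \<bar>V x\<bar> * (cmod (u x))\<^sup>2)"
  by (simp add: vnorm_def L2_norm_sq norm_mult power_mult_distrib cmod_abs_root)

lemma VL2_add: "VL2 u \<Longrightarrow> VL2 v \<Longrightarrow> VL2 (\<lambda>x. u x + v x)"
  unfolding VL2_def using L2_add[of "\<lambda>x. abs_root V x * u x" "\<lambda>x. abs_root V x * v x"] by (auto simp: ring_distribs)

lemma VL2_scale: "VL2 u \<Longrightarrow> VL2 (\<lambda>x. c * u x)"
  unfolding VL2_def using L2_scale[of "\<lambda>x. abs_root V x * u x" c] by (auto simp: mult.left_commute)

lemma VL2_const: "VL2 (\<lambda>x. c)"
  unfolding VL2_def using L2_scale[OF abs_root_L2, of c] by (auto simp: mult.commute)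

lemma VL2_energy: "has_FT 1 F u \<Longrightarrow> energy F \<Longrightarrow> VL2 u"
  unfolding VL2_def using abs_root_mult_L2(1)[of 1 F u] has_FT_measurable[of 1 F u] by simp

lemma vnorm_energy: "has_FT 1 F u \<Longrightarrow> energy F \<Longrightarrow> vnorm u \<le> sqrt S * enorm F"
  unfolding vnorm_def using abs_root_mult_L2(3)[of 1 F u] by simp

lemma vform_add_left: "VL2 u \<Longrightarrow> VL2 v \<Longrightarrow> VL2 w \<Longrightarrow> vform (\<lambda>x. u x + v x) w = vform u w + vform v w"
  using L2_inner_add_left[OF VL2_sgn_root VL2_abs_root VL2_abs_root, of w u v] by (simp add: vform_def ring_distribs)

lemma vform_add_right: "VL2 u \<Longrightarrow> VL2 v \<Longrightarrow> VL2 w \<Longrightarrow> vform w (\<lambda>x. u x + v x) = vform w u + vform w v"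
  using L2_inner_add_right[OF VL2_abs_root VL2_sgn_root VL2_sgn_root, of w u v] by (simp add: vform_def ring_distribs)

lemma vform_scale_left: "vform (\<lambda>x. c * u x) w = cnj c * vform u w"
  using L2_inner_scale_left[of c "\<lambda>x. abs_root V x * u x"] by (simp add: vform_def mult.left_commute)

lemma vform_scale_right: "vform w (\<lambda>x. c * u x) = c * vform w u"
  using L2_inner_scale_right[of _ c "\<lambda>x. sgn_root V x * u x"] by (simp add: vform_def mult.left_commute)

lemma vform_eq: "vform u v = (LINT x|lebesgue. complex_of_real (V x) * (cnj (u x) * v x))"
proof -
  have "cnj (abs_root V x * u x) * (sgn_root V x * v x) = complex_of_real (V x) * (cnj (u x) * v x)" for x
    unfolding abs_root_mult_sgn_root[symmetric] by (simp add: ac_simps)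
  then show ?thesis unfolding vform_def L2_inner_def by (simp only:)
qed

lemma vform_cnj: "vform v u = cnj (vform u v)"
  unfolding vform_eq by (subst Bochner_Integration.integral_cnj[symmetric]) (simp add: mult.commute)

lemma vform_self: "vform u u = complex_of_real (vquad u)"
proof -
  have "complex_of_real (V x) * (cnj (u x) * u x) = complex_of_real (V x * (cmod (u x))\<^sup>2)" for x
    by (simp only: of_real_mult complex_norm_square mult.commute[of "cnj _"])
  then show ?thesis unfolding vform_eq vquad_def by (simp only: integral_complex_of_real)
qed

lemma vform_bound: "VL2 u \<Longrightarrow> VL2 v \<Longrightarrow> cmod (vform u v) \<le> vnorm u * vnorm v"
  using L2_Cauchy_Schwarz[OF VL2_abs_root VL2_sgn_root, of u v] by (simp add: vform_def L2_norm_sgn_root vnorm_def)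

lemma vquad_bound: "VL2 u \<Longrightarrow> \<bar>vquad u\<bar> \<le> (vnorm u)\<^sup>2"
  using vform_bound[of u u] by (simp add: vform_self power2_eq_square)

lemma vquad_add:
  assumes "VL2 u" "VL2 v"
  shows "vquad (\<lambda>x. u x + v x) = vquad u + 2 * Re (vform u v) + vquad v"
proof -
  have "complex_of_real (vquad (\<lambda>x. u x + v x)) = vform u u + (vform u v + cnj (vform u v)) + vform v v"
    unfolding vform_self[symmetric] vform_cnj[of v u, symmetric]
    using assms by (simp add: vform_add_left vform_add_right VL2_add)
  also have "\<dots> = complex_of_real (vquad u + 2 * Re (vform u v) + vquad v)"
    by (simp add: vform_self complex_add_cnj)
  finally show ?thesis using of_real_eq_iff by blast
qed

lemma vquad_scale: "vquad (\<lambda>x. c * u x) = (cmod c)\<^sup>2 * vquad u"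
  unfolding vquad_def norm_mult power_mult_distrib mult.left_commute[of "V _"] by (rule integral_mult_right_zero)

lemma vquad_energy_bound:
  assumes "has_FT 1 F u" "energy F" shows "\<bar>vquad u\<bar> \<le> S * (enorm F)\<^sup>2"
proof -
  have "(vnorm u)\<^sup>2 \<le> (sqrt S * enorm F)\<^sup>2"
    by (intro power_mono vnorm_energy assms) (simp add: vnorm_def)
  then show ?thesis using vquad_bound[OF VL2_energy[OF assms]] S_pos by (simp add: power_mult_distrib)
qed

end

lemma enorm_scale: "enorm (\<lambda>p. c * F p) = cmod c * enorm F"
  using L2_norm_scale[of c "\<lambda>p. complex_of_real (norm p) * F p"] by (simp add: enorm_def mult.left_commute)

lemma enorm_add_sq:
  assumes "energy F" "energy G"
  shows "(enorm (\<lambda>p. F p + G p))\<^sup>2 = (enorm F)\<^sup>2 + 2 * Re (einner F G) + (enorm G)\<^sup>2"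
  using L2_norm_add_sq[OF energy_L2 energy_L2, OF assms] by (simp add: enorm_def einner_def ring_distribs)

lemma einner_scale_right: "einner F (\<lambda>p. c * G p) = c * einner F G"
  using L2_inner_scale_right[of _ c "\<lambda>p. complex_of_real (norm p) * G p"] by (simp add: einner_def mult.left_commute)

lemma einner_cnj: "einner G F = cnj (einner F G)"
  unfolding einner_def by (rule L2_inner_cnj)

lemma einner_add_right: "energy F \<Longrightarrow> energy G \<Longrightarrow> energy H \<Longrightarrow> einner F (\<lambda>p. G p + H p) = einner F G + einner F H"
  using L2_inner_add_right[OF energy_L2 energy_L2 energy_L2, of F G H] by (simp add: einner_def ring_distribs)

section \<open>Coercivity of the zero-energy form\<close>

locale scattering_potential = potential +
  assumes spectrum: "L2_spectrum (birman_schwinger V) \<subseteq> complex_of_real ` {-1<..}"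
begin

lemma boundedly_invertible:
  assumes "e \<le> -1" shows "L2_boundedly_invertible (\<lambda>f x. birman_schwinger V f x - complex_of_real e * f x)"
proof (rule ccontr)
  assume "\<not> ?thesis"
  then have "complex_of_real e \<in> L2_spectrum (birman_schwinger V)" by (simp add: L2_spectrum_def)
  then have "e > -1" using spectrum by auto
  then show False using assms by simp
qed

text \<open>If the infimum \<open>e\<close> of the quotients \<open>\<integral> V |u|\<^sup>2 / \<integral> |\<nabla>u|\<^sup>2\<close> were at most \<open>-1\<close>, then
  \<open>V\<^sup>1\<^sup>/\<^sup>2 u\<close>, for \<open>u\<close> close to optimal, would be an approximate eigenvector of the
  Birman--Schwinger operator at \<open>e\<close>: by the Cauchy--Schwarz inequality for the nonnegative form
  \<open>\<integral> V |u|\<^sup>2 - e \<integral> |\<nabla>u|\<^sup>2\<close>, being close to optimal controls the residual.\<close>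

theorem coercive:
  "\<exists>\<epsilon>>0. \<forall>F u. has_FT 1 F u \<longrightarrow> energy F \<longrightarrow> \<epsilon> * (enorm F)\<^sup>2 \<le> (enorm F)\<^sup>2 + vquad u"
proof -
  define A where "A = {vquad u | F u. has_FT 1 F u \<and> energy F \<and> enorm F = 1}"
  have A_bound: "- S \<le> a" if "a \<in> A" for a
    using that vquad_energy_bound unfolding A_def by fastforce
  \<comment> \<open>If no function has energy norm 1, all energies and hence all values of
    \<open>vquad\<close> vanish and any constant is a lower bound; 0 is chosen as a value above
    -1.\<close>
  define e where "e = (if A = {} then 0 else Inf A)"
  have e_le: "e * (enorm F)\<^sup>2 \<le> vquad u" if h: "has_FT 1 F u" and F: "energy F" for F u
  proof (cases "enorm F = 0")
    case True then show ?thesis using vquad_energy_bound[OF h F] by simp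
  next
    case False
    then have pos: "0 < enorm F" using enorm_nonneg[of F] by linarith
    let ?c = "complex_of_real (1 / enorm F)"
    have "has_FT 1 (\<lambda>p. ?c * F p) (\<lambda>x. ?c * u x)" by (rule has_FT_scale[OF h energy_measurable[OF F]])
    moreover have "enorm (\<lambda>p. ?c * F p) = 1" unfolding enorm_scale using pos by (simp add: norm_divide)
    ultimately have "vquad (\<lambda>x. ?c * u x) \<in> A" using energy_scale[OF F, of ?c] unfolding A_def by blast
    moreover have "bdd_below A" using A_bound by (rule bdd_belowI)
    ultimately have "e \<le> vquad (\<lambda>x. ?c * u x)" unfolding e_def by (auto intro: cInf_lower)
    also have "\<dots> = vquad u / (enorm F)\<^sup>2" unfolding vquad_scale using pos by (simp add: norm_divide power_divide)
    finally show ?thesis using pos by (simp add: field_simps)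
  qed
  have "-1 < e"
  proof (rule ccontr)
    assume "\<not> -1 < e"
    then have e1: "e \<le> -1" by simp
    then have A: "A \<noteq> {}" "e = Inf A" by (auto simp: e_def split: if_splits)
    let ?A = "\<lambda>f x. birman_schwinger V f x - complex_of_real e * f x"
    obtain C where C: "\<And>g. g \<in> L2 \<Longrightarrow> \<exists>f. L2_solution ?A g f \<and> L2_norm f \<le> C * L2_norm g \<and>
        (\<forall>f'. L2_solution ?A g f' \<longrightarrow> (AE x in lebesgue. f' x = f x))"
      using boundedly_invertible[OF e1] unfolding L2_boundedly_invertible_def by blast
    define M where "M = S + \<bar>e\<bar>"
    have M: "0 < M" unfolding M_def using S_pos by linarith
    \<comment> \<open>The first bound keeps \<open>1 - \<delta>\<close> at least 1/2; the second
      makes the residual estimate \<open>C^2 * S * \<delta> * M\<close> at most 1/4. The two are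
      incompatible, and the added 1 only keeps the denominator positive.\<close>
    define \<delta> where "\<delta> = min (1/2) (1 / (4 * (C\<^sup>2 * S * M + 1)))"
    have den: "0 < C\<^sup>2 * S * M + 1" using S_pos M by (intro add_nonneg_pos mult_nonneg_nonneg) auto
    have \<delta>: "0 < \<delta>" "\<delta> \<le> 1/2" using den by (auto simp: \<delta>_def)
    have "Inf A < e + \<delta>" using A(2) \<delta> by simp
    then obtain a where "a \<in> A" "a < e + \<delta>" using cInf_lessD[OF A(1)] by blast
    then obtain F u where h: "has_FT 1 F u" and F: "energy F" and F1: "enorm F = 1" and u: "vquad u < e + \<delta>"
      unfolding A_def by blast
    have uV: "VL2 u" by (rule VL2_energy[OF h F])
    let ?g = "\<lambda>x. sgn_root V x * u x"
    have g: "?g \<in> L2" by (rule VL2_sgn_root[OF uV])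
    let ?h = "inv_neg_laplacian (\<lambda>y. abs_root V y * ?g y)"
    have hh: "has_FT 1 (inv_lap ?g) ?h" by (rule has_FT_inv_neg_laplacian[OF g])
    have Eg: "energy (inv_lap ?g)" by (rule inv_lap_energy(1)[OF g])
    \<comment> \<open>\<open>ug\<close> is the residual before multiplication by the root: with
      \<open>B\<close> the Birman-Schwinger operator,
      \<open>V^(1/2) ug = (B - e) (V^(1/2) u)\<close>. Its momentum-space form \<open>G\<close>
      represents, with respect to \<open>einner\<close>, the functional that pairs a test function
      with \<open>u\<close> in the form \<open>vform - e * einner\<close>.\<close>
    define G where "G p = inv_lap ?g p + complex_of_real (- e) * F p" for p
    define ug where "ug x = ?h x + complex_of_real (- e) * u x" for x
    have EF: "energy (\<lambda>p. complex_of_real (- e) * F p)" by (rule energy_scale[OF F])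
    have hG: "has_FT 1 G ug" unfolding G_def ug_def
      by (rule has_FT_add[OF hh has_FT_scale[OF h energy_measurable[OF F]] energy_L1_L2[OF Eg] energy_L1_L2[OF EF]])
    have EG: "energy G" unfolding G_def by (rule energy_add[OF Eg EF])
    have ugV: "VL2 ug" by (rule VL2_energy[OF hG EG])
    let ?r = "\<lambda>x. sgn_root V x * ug x"
    have r: "?r \<in> L2" by (rule VL2_sgn_root[OF ugV])
    have "?A ?g x = ?r x" for x by (simp add: birman_schwinger_def ug_def algebra_simps)
    then have sol: "L2_solution ?A ?r ?g" unfolding L2_solution_def using g by simp
    obtain f where f: "L2_solution ?A ?r f" "L2_norm f \<le> C * L2_norm ?r"
        "\<And>f'. L2_solution ?A ?r f' \<Longrightarrow> (AE x in lebesgue. f' x = f x)" using C[OF r] by blast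
    have "L2_norm ?g = L2_norm f"
      by (rule L2_norm_cong_AE) (use g f(1) f(3)[OF sol] in \<open>auto simp: L2_solution_def intro: L2_measurable\<close>)
    then have g_le: "vnorm u \<le> C * vnorm ug" using f(2) by (simp add: L2_norm_sgn_root)
    have q: "complex_of_real ((enorm G)\<^sup>2) = vform ug u + complex_of_real (- e) * einner G F"
    proof -
      have "complex_of_real ((enorm G)\<^sup>2) = einner G (\<lambda>p. inv_lap ?g p + complex_of_real (- e) * F p)"
        unfolding einner_self[symmetric] by (rule arg_cong[of _ _ "einner G"]) (simp add: G_def[abs_def])
      also have "\<dots> = einner G (inv_lap ?g) + complex_of_real (- e) * einner G F"
        by (simp only: einner_add_right[OF EG Eg EF] einner_scale_right)
      also have "einner G (inv_lap ?g) = vform ug u"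
        unfolding vform_def by (rule parseval[OF hG EG g])
      finally show ?thesis .
    qed
    then have qr: "(enorm G)\<^sup>2 = Re (vform ug u) - e * Re (einner G F)"
      by (metis Re_complex_of_real plus_complex.simps(1) times_complex.simps(1) Im_complex_of_real mult_zero_left
          diff_zero minus_mult_left diff_conv_add_uminus)
    \<comment> \<open>Varying \<open>u\<close> in the direction of the residual, as in a proof of
      the Cauchy-Schwarz inequality; this \<open>s\<close> minimizes the upper bound
      \<open>2 * s * |G|^2 + s^2 * M * |G|^2\<close> obtained below.\<close>
    define s where "s = - (1 / M)"
    have I1: "e * (enorm (\<lambda>p. F p + complex_of_real s * G p))\<^sup>2 \<le> vquad (\<lambda>x. u x + complex_of_real s * ug x)"
      by (rule e_le[OF has_FT_add[OF h has_FT_scale[OF hG energy_measurable[OF EG]] energy_L1_L2[OF F]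
          energy_L1_L2[OF energy_scale[OF EG]]] energy_add[OF F energy_scale[OF EG]]])
    have I2: "(enorm (\<lambda>p. F p + complex_of_real s * G p))\<^sup>2 = 1 + 2 * s * Re (einner G F) + s\<^sup>2 * (enorm G)\<^sup>2"
      unfolding enorm_add_sq[OF F energy_scale[OF EG]] einner_scale_right enorm_scale F1 einner_cnj[of F G]
      by (simp add: power_mult_distrib)
    have I3: "vquad (\<lambda>x. u x + complex_of_real s * ug x) = vquad u + 2 * s * Re (vform ug u) + s\<^sup>2 * vquad ug"
      unfolding vquad_add[OF uV VL2_scale[OF ugV]] vform_scale_right vquad_scale vform_cnj[of u ug]
      by (simp add: power_mult_distrib)
    have "2 * s * (enorm G)\<^sup>2 = 2 * s * Re (vform ug u) - e * (2 * s * Re (einner G F))"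
      unfolding qr by (simp add: algebra_simps)
    then have "0 \<le> vquad u - e + 2 * s * (enorm G)\<^sup>2 + s\<^sup>2 * (vquad ug - e * (enorm G)\<^sup>2)"
      using I1 unfolding I2 I3 by (simp add: algebra_simps)
    also have "\<dots> \<le> \<delta> + 2 * s * (enorm G)\<^sup>2 + s\<^sup>2 * (M * (enorm G)\<^sup>2)"
    proof -
      have "vquad ug - e * (enorm G)\<^sup>2 \<le> M * (enorm G)\<^sup>2"
        using vquad_energy_bound[OF hG EG] e1 by (simp add: M_def algebra_simps)
      then have "s\<^sup>2 * (vquad ug - e * (enorm G)\<^sup>2) \<le> s\<^sup>2 * (M * (enorm G)\<^sup>2)" by (intro mult_left_mono) auto
      then show ?thesis using u by linarith
    qed
    also have "\<dots> = \<delta> - (enorm G)\<^sup>2 / M" using M by (simp add: s_def power2_eq_square field_simps)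
    finally have G_le: "(enorm G)\<^sup>2 \<le> \<delta> * M" using M by (simp add: field_simps)
    \<comment> \<open>As \<open>e \<le> -1\<close> and \<open>enorm F = 1\<close>, near-optimality
      keeps \<open>|vquad u|\<close> away from 0. Bounded invertibility, on the other hand, bounds
      \<open>V^(1/2) u\<close> by the residual, which is small.\<close>
    have "1 - \<delta> \<le> (vnorm u)\<^sup>2" using vquad_bound[OF uV] u e1 by linarith
    also have "\<dots> \<le> (C * vnorm ug)\<^sup>2" by (rule power_mono[OF g_le]) (simp add: vnorm_def)
    also have "\<dots> \<le> C\<^sup>2 * (S * (enorm G)\<^sup>2)"
    proof -
      have "(vnorm ug)\<^sup>2 \<le> (sqrt S * enorm G)\<^sup>2" by (rule power_mono[OF vnorm_energy[OF hG EG]]) (simp add: vnorm_def)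
      then show ?thesis using S_pos by (simp add: power_mult_distrib mult_left_mono)
    qed
    also have "\<dots> \<le> C\<^sup>2 * (S * (\<delta> * M))" using S_pos by (intro mult_left_mono G_le) auto
    also have "\<dots> \<le> \<delta> * (C\<^sup>2 * S * M + 1)" using \<delta> by (simp add: algebra_simps)
    also have "\<dots> \<le> 1 / 4"
    proof -
      have "\<delta> \<le> 1 / (4 * (C\<^sup>2 * S * M + 1))" by (simp add: \<delta>_def)
      then have "\<delta> * (C\<^sup>2 * S * M + 1) \<le> 1 / (4 * (C\<^sup>2 * S * M + 1)) * (C\<^sup>2 * S * M + 1)"
        using den by (intro mult_right_mono) auto
      also have "\<dots> = 1 / 4" using den by (simp add: field_simps)
      finally show ?thesis .
    qed
    finally show False using \<delta> by simp
  qed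
  then show ?thesis
    by (intro exI[of _ "1 + e"] conjI allI impI) (use e_le in \<open>auto simp: algebra_simps\<close>)
qed

section \<open>The zero-energy scattering solution\<close>

definition phi :: "real^3 \<Rightarrow> complex" where
  "phi = L2_inverse (\<lambda>f x. f x + birman_schwinger V f x) (sgn_root V)"

lemma phi_solution: "L2_solution (\<lambda>f x. f x + birman_schwinger V f x) (sgn_root V) phi"
proof -
  have "(\<lambda>f x. f x + birman_schwinger V f x) = (\<lambda>f x. birman_schwinger V f x - complex_of_real (-1) * f x)"
    by (simp add: fun_eq_iff)
  then have "\<exists>f. L2_solution (\<lambda>f x. f x + birman_schwinger V f x) (sgn_root V) f"
    using boundedly_invertible[of "-1"] sgn_root_L2 unfolding L2_boundedly_invertible_def by fastforce
  then show ?thesis unfolding phi_def L2_inverse_def by (rule someI_ex)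
qed

lemma phi_L2: "phi \<in> L2" using phi_solution by (simp add: L2_solution_def)

definition F0 :: "real^3 \<Rightarrow> complex" where "F0 p = - inv_lap phi p"
definition u0 :: "real^3 \<Rightarrow> complex" where "u0 x = - inv_neg_laplacian (\<lambda>y. abs_root V y * phi y) x"
definition psi0 :: "real^3 \<Rightarrow> complex" where "psi0 x = 1 + u0 x"
text \<open>Almost everywhere this is \<open>V psi0\<close>. Written through \<open>phi\<close> it
  is a product of two square-integrable functions, hence integrable.\<close>

definition src :: "real^3 \<Rightarrow> complex" where "src x = abs_root V x * phi x"

lemma F0_energy: "energy F0" and has_FT_F0: "has_FT 1 F0 u0"
  using energy_scale[OF inv_lap_energy(1)[OF phi_L2], of "-1"]
    has_FT_scale[OF has_FT_inv_neg_laplacian[OF phi_L2] inv_lap_measurable[OF phi_L2], of "-1"]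
  by (simp_all add: F0_def[abs_def] u0_def[abs_def])

lemma u0_measurable [measurable]: "u0 \<in> borel_measurable lebesgue"
  by (rule has_FT_measurable[OF has_FT_F0])

lemma psi0_measurable [measurable]: "psi0 \<in> borel_measurable lebesgue"
  unfolding psi0_def by measurable

lemma psi0_VL2: "VL2 psi0"
  unfolding psi0_def[abs_def] by (rule VL2_add[OF VL2_const VL2_energy[OF has_FT_F0 F0_energy]])

text \<open>The equation \<open>(1 + B) phi = V^(1/2)\<close> for the Birman-Schwinger operator
  \<open>B\<close>, solved for \<open>phi\<close>: the definition of \<open>u0\<close> makes
  \<open>B phi\<close> equal to \<open>- V^(1/2) u0\<close>.\<close>

lemma phi_eq: "AE x in lebesgue. phi x = sgn_root V x * psi0 x"
proof -
  have "AE x in lebesgue. phi x + birman_schwinger V phi x = sgn_root V x" using phi_solution by (simp add: L2_solution_def)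
  then show ?thesis by eventually_elim (simp add: birman_schwinger_def psi0_def u0_def algebra_simps eq_diff_eq)
qed

lemma src_eq: "AE x in lebesgue. src x = complex_of_real (V x) * psi0 x"
  using phi_eq by eventually_elim (simp add: src_def abs_root_mult_sgn_root[symmetric] mult.assoc)

lemma src_integrable: "integrable lebesgue src"
  unfolding src_def[abs_def] by (rule abs_root_mult_integrable[OF phi_L2])

lemma F0_eq: "F0 p = - (fourier src p / complex_of_real ((norm p)\<^sup>2))"
  by (simp add: F0_def inv_lap_def src_def[abs_def])

lemma L2_inner_phi:
  assumes u: "VL2 u" shows "L2_inner (\<lambda>x. abs_root V x * u x) phi = vform u psi0"
  unfolding vform_def
  by (rule L2_inner_cong_AE)
     (use phi_eq u VL2_sgn_root[OF psi0_VL2] in \<open>auto intro: L2_measurable VL2_abs_root phi_L2\<close>)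

text \<open>The weak form of \<open>p^2 u0 = - V psi0\<close>, tested with functions of finite
  energy. It is what cancels the cross terms when squares are completed around multiples of
  \<open>psi0\<close>.\<close>

lemma einner_F0:
  assumes "has_FT 1 F u" "energy F" shows "einner F F0 = - vform u psi0"
proof -
  have "einner F F0 = - einner F (inv_lap phi)"
    using einner_scale_right[of F "-1" "inv_lap phi"] by (simp add: F0_def[abs_def])
  also have "einner F (inv_lap phi) = L2_inner (\<lambda>x. abs_root V x * u x) phi"
    by (rule parseval[OF assms phi_L2])
  finally show ?thesis by (simp add: L2_inner_phi VL2_energy[OF assms])
qed

text \<open>The energy form evaluated at \<open>psi0\<close>. Testing the weak equation with
  \<open>u0\<close> shows that it equals the integral of \<open>V psi0\<close>; the present
  expression is manifestly real and is the one that appears on completing squares.\<close>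

definition G0 :: real where "G0 = vquad psi0 + (enorm F0)\<^sup>2"

lemma integral_src: "(LINT x|lebesgue. src x) = complex_of_real G0"
proof -
  have 1: "VL2 (\<lambda>x. 1)" by (rule VL2_const)
  have "(LINT x|lebesgue. src x) = L2_inner (\<lambda>x. abs_root V x * 1) phi" by (simp add: L2_inner_def src_def[abs_def])
  also have "\<dots> = vform (\<lambda>x. 1) psi0" by (rule L2_inner_phi[OF 1])
  also have "\<dots> = vform psi0 psi0 - vform u0 psi0"
    using vform_add_left[OF 1 VL2_energy[OF has_FT_F0 F0_energy] psi0_VL2] by (simp add: psi0_def[abs_def])
  also have "\<dots> = vform psi0 psi0 + einner F0 F0" by (simp add: einner_F0[OF has_FT_F0 F0_energy])
  finally show ?thesis by (simp add: vform_self einner_self G0_def)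
qed

lemma scattering_length_eq: "scattering_length V = G0 / (4 * pi)"
proof -
  have "L2_inner (abs_root V) phi = complex_of_real G0"
    unfolding integral_src[symmetric] by (simp add: L2_inner_def src_def[abs_def])
  then show ?thesis by (simp add: scattering_length_def phi_def)
qed

text \<open>Since \<open>|psi0| \<le> 2 + |u0|^2\<close>, it suffices that \<open>W\<close> is
  integrable and that \<open>W |u0|^2\<close> is integrable by the form bound. This first moment
  gives the error terms their majorant.\<close>

lemma src_weighted_integrable: "integrable lebesgue (\<lambda>x. cmod (src x) * (1 + norm x))"
proof -
  have i: "integrable lebesgue (\<lambda>x. 2 * W x + W x * (cmod (u0 x))\<^sup>2)"
    using W_integrable W_sobolev(1)[OF has_FT_F0 F0_energy] by auto
  note borel_measurable_integrable[OF src_integrable, measurable]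
  show ?thesis
  proof (rule Bochner_Integration.integrable_bound[OF i])
    show "AE x in lebesgue. norm (cmod (src x) * (1 + norm x)) \<le> norm (2 * W x + W x * (cmod (u0 x))\<^sup>2)"
      using src_eq
    proof eventually_elim
      case (elim x)
      have "cmod (psi0 x) \<le> 1 + cmod (u0 x)" unfolding psi0_def using norm_triangle_ineq[of 1 "u0 x"] by simp
      also have "\<dots> \<le> 2 + (cmod (u0 x))\<^sup>2"
        using sum_squares_bound[of 1 "cmod (u0 x)"] zero_le_power2[of "cmod (u0 x)"]
        unfolding power_one mult_1_right by linarith
      finally have "W x * cmod (psi0 x) \<le> W x * (2 + (cmod (u0 x))\<^sup>2)" by (intro mult_left_mono W_nonneg)
      moreover have "cmod (src x) * (1 + norm x) = W x * cmod (psi0 x)"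
        by (simp add: elim W_def norm_mult)
      ultimately show ?case by (simp add: W_nonneg abs_mult algebra_simps)
    qed
  qed measurable
qed

end

subsection \<open>The integral of \<open>1/K\<^sub>T - 1/p\<^sup>2\<close>\<close>

lemma integral_FTC_Ioc:
  fixes f F :: "real \<Rightarrow> real"
  assumes ab: "a \<le> b" and F: "\<And>x. a \<le> x \<Longrightarrow> x \<le> b \<Longrightarrow> DERIV F x :> f x"
    and f: "continuous_on {a..b} f"
  shows "integrable lborel (\<lambda>x. indicator {a<..b} x * f x)"
    and "(LINT x|lborel. indicator {a<..b} x * f x) = F b - F a"
proof -
  have Fv: "(F has_vector_derivative f x) (at x within {a..b})" if "a \<le> x" "x \<le> b" for x
    using F[OF that] by (simp add: has_real_derivative_iff_has_vector_derivative has_vector_derivative_at_within)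
  have i: "integrable lborel (\<lambda>x. indicator {a..b} x *\<^sub>R f x)"
    using borel_integrable_atLeastAtMost'[OF f] by (simp add: set_integrable_def)
  have ae: "AE x in lborel. indicator {a..b} x *\<^sub>R f x = indicator {a<..b} x * f x"
    using AE_lborel_singleton[of a] by eventually_elim (auto split: split_indicator)
  have fm: "(\<lambda>x. indicator {a..b} x *\<^sub>R f x) \<in> borel_measurable borel" using borel_measurable_integrable[OF i] by simp
  have eq: "indicator {a<..b} x * f x = indicator {a<..b} x * (indicator {a..b} x *\<^sub>R f x)" for x
    by (auto split: split_indicator)
  have gm: "(\<lambda>x. indicator {a<..b} x * f x) \<in> borel_measurable lborel"
    unfolding eq by (intro borel_measurable_times) (use fm in auto)
  show "integrable lborel (\<lambda>x. indicator {a<..b} x * f x)"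
    using integrable_cong_AE[OF _ gm ae] fm i by simp
  have "(LINT x|lborel. indicator {a<..b} x * f x) = (LINT x|lborel. indicator {a..b} x *\<^sub>R f x)"
    by (rule integral_cong_AE[symmetric]) (use fm gm ae in auto)
  also have "\<dots> = F b - F a" by (rule integral_FTC_atLeastAtMost[OF ab Fv f])
  finally show "(LINT x|lborel. indicator {a<..b} x * f x) = F b - F a" .
qed

section \<open>Exponential integrals, the Wallis product and Euler's constant\<close>

lemma integral_exp_Ioi:
  fixes t :: real assumes t: "0 < t"
  shows "(\<integral>\<^sup>+y. ennreal (indicator {0<..} y * exp (- t * y)) \<partial>lborel) = ennreal (1 / t)"
    and "integrable lborel (\<lambda>y. indicator {0<..} y * exp (- t * y))"
    and "(LINT y|lborel. indicator {0<..} y * exp (- t * y)) = 1 / t"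
proof -
  have "(\<integral>\<^sup>+y. ennreal (indicator {0<..} y * exp (- t * y)) \<partial>lborel) = (\<integral>\<^sup>+y. ennreal (exp (- t * y)) * indicator {0..} y \<partial>lborel)"
    by (rule nn_integral_cong_AE) (use AE_lborel_singleton[of 0] in eventually_elim, auto split: split_indicator)
  also have "\<dots> = ennreal (0 - (- exp (- t * 0) / t))"
  proof (rule nn_integral_FTC_atLeast)
    show "DERIV (\<lambda>y. - exp (- t * y) / t) y :> exp (- t * y)" for y
      using t by (auto intro!: derivative_eq_intros)
    show "((\<lambda>y. - exp (- t * y) / t) \<longlongrightarrow> 0) at_top"
      using t by real_asymp
  qed auto
  finally show nn: "(\<integral>\<^sup>+y. ennreal (indicator {0<..} y * exp (- t * y)) \<partial>lborel) = ennreal (1 / t)" by simp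
  show i: "integrable lborel (\<lambda>y. indicator {0<..} y * exp (- t * y))"
    by (rule integrableI_nonneg) (use nn in auto)
  have "ennreal (LINT y|lborel. indicator {0<..} y * exp (- t * y)) = ennreal (1 / t)"
    using nn nn_integral_eq_integral[OF i] by simp
  then show "(LINT y|lborel. indicator {0<..} y * exp (- t * y)) = 1 / t"
    using t by (subst (asm) ennreal_inj) (auto intro!: integral_nonneg_AE)
qed

text \<open>Write the integrand as the integral of \<open>exp (- t * y)\<close> over
  \<open>t\<close> from \<open>a\<close> to \<open>b\<close> and exchange the integrals.\<close>

lemma frullani_exp:
  fixes a b :: real assumes ab: "0 < a" "a \<le> b"
  shows "integrable lborel (\<lambda>y. indicator {0<..} y * ((exp (- a * y) - exp (- b * y)) / y))"
    and "(LINT y|lborel. indicator {0<..} y * ((exp (- a * y) - exp (- b * y)) / y)) = ln b - ln a"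
proof -
  let ?f = "\<lambda>y. indicator {0<..} y * ((exp (- a * y) - exp (- b * y)) / y) :: real"
  have pos: "0 \<le> ?f y" for y using ab by (auto split: split_indicator intro!: divide_nonneg_pos)
  have "(\<integral>\<^sup>+y. ennreal (?f y) \<partial>lborel) = (\<integral>\<^sup>+y. (\<integral>\<^sup>+t. ennreal (indicator {0<..} y * exp (- t * y)) * indicator {a..b} t \<partial>lborel) \<partial>lborel)"
  proof (rule nn_integral_cong)
    fix y :: real
    show "ennreal (?f y) = (\<integral>\<^sup>+t. ennreal (indicator {0<..} y * exp (- t * y)) * indicator {a..b} t \<partial>lborel)"
    proof (cases "0 < y")
      case True
      have "(\<integral>\<^sup>+t. ennreal (exp (- t * y)) * indicator {a..b} t \<partial>lborel) = ennreal (- exp (- b * y) / y - (- exp (- a * y) / y))"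
        by (rule nn_integral_FTC_Icc[where F="\<lambda>t. - exp (- t * y) / y"]) (use ab True in \<open>auto intro!: derivative_eq_intros\<close>)
      then show ?thesis using True by (simp add: diff_divide_distrib)
    qed simp
  qed
  also have "\<dots> = (\<integral>\<^sup>+t. (\<integral>\<^sup>+y. ennreal (indicator {0<..} y * exp (- t * y)) * indicator {a..b} t \<partial>lborel) \<partial>lborel)"
    by (rule lborel_pair.Fubini') measurable
  also have "\<dots> = (\<integral>\<^sup>+t. ennreal (1 / t) * indicator {a..b} t \<partial>lborel)"
  proof (rule nn_integral_cong)
    fix t :: real
    show "(\<integral>\<^sup>+y. ennreal (indicator {0<..} y * exp (- t * y)) * indicator {a..b} t \<partial>lborel) = ennreal (1 / t) * indicator {a..b} t"
      using integral_exp_Ioi(1)[of t] ab by (auto split: split_indicator)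
  qed
  also have "\<dots> = (\<integral>\<^sup>+t. ennreal (inverse (max a t)) * indicator {a..b} t \<partial>lborel)"
    by (intro nn_integral_cong) (auto split: split_indicator simp: inverse_eq_divide max_def)
  also have "\<dots> = ennreal (ln b - ln a)"
    by (rule nn_integral_FTC_Icc) (use ab in \<open>auto intro!: derivative_eq_intros simp: max_def inverse_eq_divide\<close>)
  finally have nn: "(\<integral>\<^sup>+y. ennreal (?f y) \<partial>lborel) = ennreal (ln b - ln a)" .
  show i: "integrable lborel ?f" by (rule integrableI_nonneg) (use nn pos in auto)
  have "ennreal (LINT y|lborel. ?f y) = ennreal (ln b - ln a)"
    using nn nn_integral_eq_integral[OF i] pos by simp
  then show "(LINT y|lborel. ?f y) = ln b - ln a"
    using ab pos by (subst (asm) ennreal_inj) (auto intro!: integral_nonneg_AE)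
qed

text \<open>Two consecutive terms combine to the logarithm of one Wallis factor
  \<open>(2M+2)^2 / ((2M+1) (2M+3))\<close>.\<close>

lemma wallis_ln: "(\<lambda>M. \<Sum>k<2*M. (-1) ^ k * (ln (real k + 2) - ln (real k + 1))) \<longlonglongrightarrow> ln (pi / 2)"
proof -
  have "(\<Sum>k<2*M. (-1) ^ k * (ln (real k + 2) - ln (real k + 1))) = ln (\<Prod>k=1..M. (4*real k^2) / (4*real k^2 - 1))" for M
  proof (induction M)
    case (Suc M)
    have pos: "0 < (\<Prod>k=1..M. (4*real k^2) / (4*real k^2 - 1))"
    proof (rule prod_pos)
      fix k assume "k \<in> {1..M}"
      then have "1 \<le> (real k)\<^sup>2" by (simp add: one_le_power)
      then show "0 < (4*real k^2) / (4*real k^2 - 1)" by (intro divide_pos_pos) linarith+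
    qed
    have f: "4 * (real (Suc M))\<^sup>2 - 1 = (2 * real M + 1) * (2 * real M + 3)" by (simp add: power2_eq_square algebra_simps)
    have g: "4 * (real (Suc M))\<^sup>2 = (2 * real M + 2) * (2 * real M + 2)" by (simp add: power2_eq_square algebra_simps)
    have l: "ln ((4*real (Suc M)^2) / (4*real (Suc M)^2 - 1)) = 2 * ln (2 * real M + 2) - ln (2 * real M + 1) - ln (2 * real M + 3)"
      unfolding f unfolding g by (subst ln_div, (simp add: add_pos_pos)+, subst ln_mult, (simp add: add_pos_pos)+, subst ln_mult, auto)
    have "ln (\<Prod>k=1..Suc M. (4*real k^2) / (4*real k^2 - 1)) = ln (\<Prod>k=1..M. (4*real k^2) / (4*real k^2 - 1)) +
        (2 * ln (2 * real M + 2) - ln (2 * real M + 1) - ln (2 * real M + 3))"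
    proof -
      have "1 \<le> (real (Suc M))\<^sup>2" by (simp add: one_le_power)
      then have "0 < (4*real (Suc M)^2) / (4*real (Suc M)^2 - 1)" by (intro divide_pos_pos) linarith+
      with pos have "ln ((\<Prod>k=1..M. (4*real k^2) / (4*real k^2 - 1)) * ((4*real (Suc M)^2) / (4*real (Suc M)^2 - 1))) =
          ln (\<Prod>k=1..M. (4*real k^2) / (4*real k^2 - 1)) + ln ((4*real (Suc M)^2) / (4*real (Suc M)^2 - 1))"
        by (rule ln_mult_pos)
      then show ?thesis unfolding l by (subst prod.cl_ivl_Suc) simp
    qed
    moreover have "(\<Sum>k<2 * Suc M. (-1) ^ k * (ln (real k + 2) - ln (real k + 1))) =
      (\<Sum>k<2*M. (-1) ^ k * (ln (real k + 2) - ln (real k + 1))) + (2 * ln (2 * real M + 2) - ln (2 * real M + 1) - ln (2 * real M + 3))"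
      by (simp add: algebra_simps)
    ultimately show ?case using Suc by simp
  qed simp
  moreover have "(\<lambda>M. ln (\<Prod>k=1..M. (4*real k^2) / (4*real k^2 - 1))) \<longlonglongrightarrow> ln (pi / 2)"
    by (rule tendsto_ln[OF wallis]) simp
  ultimately show ?thesis by simp
qed

lemma tanh_half_eq: "tanh (y / 2 :: real) = (1 - exp (- y)) / (1 + exp (- y))"
proof -
  have "exp (- y / 2) * exp (- y / 2) = exp (- y)" by (simp add: exp_add[symmetric])
  then have "exp (- (2 * (y / 2))) = exp (- y)" by simp
  then show ?thesis by (simp add: tanh_real_altdef)
qed

text \<open>For \<open>y > 0\<close> this is \<open>(1 - exp (- y)) / y - tanh (y / 2) / y\<close>,
  the difference between the integrand that produces Euler's constant and the one that is
  wanted.\<close>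

definition tanh_defect :: "real \<Rightarrow> real" where
  "tanh_defect y = indicator {0<..} y * (exp (- y) * (1 - exp (- y)) / ((1 + exp (- y)) * y))"

text \<open>Expanding \<open>1 / (1 + q)\<close> geometrically in \<open>q = exp (- y)\<close> gives
  an alternating sum of Frullani integrals, hence the Wallis product. After \<open>N\<close> terms
  the remainder is at most \<open>exp (- (N + 1) * y)\<close>, whose integral
  \<open>1 / (N + 1)\<close> tends to 0.\<close>

lemma tanh_defect_integral:
  "integrable lborel tanh_defect" "(LINT y|lborel. tanh_defect y) = ln (pi / 2)"
proof -
  let ?g = "\<lambda>k y. indicator {0<..} y * ((exp (- (real k + 1) * y) - exp (- (real k + 2) * y)) / y) :: real"
  let ?s = "\<lambda>N y. \<Sum>k<N. (-1) ^ k * ?g k y"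
  have gi: "integrable lborel (?g k)" and gI: "(LINT y|lborel. ?g k y) = ln (real k + 2) - ln (real k + 1)" for k
    using frullani_exp[of "real k + 1" "real k + 2"] by auto
  have si: "integrable lborel (?s N)" for N by (intro Bochner_Integration.integrable_sum integrable_mult_right gi)
  have sI: "(LINT y|lborel. ?s N y) = (\<Sum>k<N. (-1) ^ k * (ln (real k + 2) - ln (real k + 1)))" for N
  proof -
    have "(LINT y|lborel. ?s N y) = (\<Sum>k<N. LINT y|lborel. (-1) ^ k * ?g k y)"
      by (rule Bochner_Integration.integral_sum) (intro integrable_mult_right gi)
    also have "\<dots> = (\<Sum>k<N. (-1) ^ k * (ln (real k + 2) - ln (real k + 1)))"
      by (intro sum.cong refl) (simp only: integral_mult_right_zero gI)
    finally show ?thesis .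
  qed
  have rem: "\<bar>tanh_defect y - ?s N y\<bar> \<le> indicator {0<..} y * exp (- (real N + 1) * y)" for N y
  proof (cases "0 < y")
    case True
    define q where "q = exp (- y)"
    have q: "0 < q" "q < 1" using True by (auto simp: q_def)
    have ex: "exp (- (real k + 1) * y) = q ^ (k + 1)" "exp (- (real k + 2) * y) = q ^ (k + 2)" for k
    proof -
      have "exp (- (real k + 1) * y) = exp (real (k + 1) * (- y))" by (simp add: algebra_simps)
      then show "exp (- (real k + 1) * y) = q ^ (k + 1)" unfolding q_def by (simp only: exp_of_nat_mult)
      have "exp (- (real k + 2) * y) = exp (real (k + 2) * (- y))" by (simp add: algebra_simps)
      then show "exp (- (real k + 2) * y) = q ^ (k + 2)" unfolding q_def by (simp only: exp_of_nat_mult)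
    qed
    have "?s N y = (\<Sum>k<N. (- q) ^ k) * (q * (1 - q) / y)"
      using True unfolding ex sum_distrib_right
      by (intro sum.cong refl) (simp add: field_simps power_minus[of q])
    also have "(\<Sum>k<N. (- q) ^ k) = (1 - (- q) ^ N) / (1 + q)"
      using geometric_sum[of "- q" N] q by (simp add: field_simps)
    finally have sN: "?s N y = (1 - (- q) ^ N) / (1 + q) * (q * (1 - q) / y)" .
    have "tanh_defect y - ?s N y = (- q) ^ N * (q * (1 - q) / (y * (1 + q)))"
    proof -
      have "a / ((1 + q) * y) - (1 - r) / (1 + q) * (a / y) = r * (a / (y * (1 + q)))" for a r :: real
      proof -
        have "a / ((1 + q) * y) - (1 - r) / (1 + q) * (a / y) = (a - (1 - r) * a) / ((1 + q) * y)"
          unfolding times_divide_times_eq by (rule diff_divide_distrib[symmetric])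
        also have "\<dots> = r * (a / (y * (1 + q)))" by (simp add: algebra_simps)
        finally show ?thesis .
      qed
      then show ?thesis using True unfolding sN by (simp add: tanh_defect_def q_def[symmetric])
    qed
    then have "\<bar>tanh_defect y - ?s N y\<bar> = q ^ N * (q * ((1 - q) / y) / (1 + q))"
      using q True by (simp add: abs_mult power_abs)
    also have "\<dots> \<le> q ^ N * (q * 1 / 1)"
    proof -
      have "1 - q \<le> y" using exp_ge_add_one_self[of "- y"] by (simp add: q_def)
      then have "(1 - q) / y \<le> 1" using True by simp
      then show ?thesis using q by (intro mult_left_mono frac_le) auto
    qed
    finally show ?thesis using True ex(1)[of N] by (simp add: mult.commute)
  qed (simp add: tanh_defect_def)
  have m[measurable]: "tanh_defect \<in> borel_measurable borel" unfolding tanh_defect_def by measurable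
  show i: "integrable lborel tanh_defect"
  proof (rule Bochner_Integration.integrable_bound[of _ "\<lambda>y. indicator {0<..} y * exp (- 1 * y)"])
    show "integrable lborel (\<lambda>y::real. indicator {0<..} y * exp (- 1 * y) :: real)" by (rule integral_exp_Ioi(2)) simp
    show "AE y in lborel. norm (tanh_defect y) \<le> norm (indicator {0<..} y * exp (- 1 * y) :: real)"
      using rem[of _ 0] by (auto simp: abs_mult)
  qed simp
  have "(\<lambda>N. LINT y|lborel. ?s N y) \<longlonglongrightarrow> (LINT y|lborel. tanh_defect y)"
  proof (rule LIMSEQ_I)
    fix r :: real assume "0 < r"
    then obtain N0 :: nat where N0: "1 / r < real N0" using reals_Archimedean2 by blast
    have "norm ((LINT y|lborel. ?s N y) - (LINT y|lborel. tanh_defect y)) < r" if "N0 \<le> N" for N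
    proof -
      have "norm ((LINT y|lborel. ?s N y) - (LINT y|lborel. tanh_defect y)) = \<bar>LINT y|lborel. tanh_defect y - ?s N y\<bar>"
        using i si by (simp only: Bochner_Integration.integral_diff real_norm_def abs_minus_commute)
      also have "\<dots> \<le> (LINT y|lborel. \<bar>tanh_defect y - ?s N y\<bar>)" by (rule integral_abs_bound)
      also have "\<dots> \<le> (LINT y|lborel. indicator {0<..} y * exp (- (real N + 1) * y))"
        by (rule integral_mono) (intro integrable_abs Bochner_Integration.integrable_diff i si, rule integral_exp_Ioi(2), simp, rule rem)
      also have "\<dots> = 1 / (real N + 1)" by (rule integral_exp_Ioi(3)) simp
      also have "\<dots> < r"
      proof -
        have "1 / r < real N + 1" using N0 that by linarith
        then show ?thesis using \<open>0 < r\<close> by (simp add: field_simps)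
      qed
      finally show ?thesis .
    qed
    then show "\<exists>N0. \<forall>N\<ge>N0. norm ((LINT y|lborel. ?s N y) - (LINT y|lborel. tanh_defect y)) < r" by blast
  qed
  then have "(\<lambda>M. LINT y|lborel. ?s (2 * M) y) \<longlonglongrightarrow> (LINT y|lborel. tanh_defect y)"
    by (rule LIMSEQ_subseq_LIMSEQ[unfolded o_def]) (simp add: strict_mono_def)
  then show "(LINT y|lborel. tanh_defect y) = ln (pi / 2)"
    unfolding sI by (rule LIMSEQ_unique[OF _ wallis_ln])
qed

text \<open>Replacing \<open>exp (- y)\<close> by \<open>(1 - y/n)^n\<close> turns the integrand
  into a geometric sum whose integral over \<open>(0, n]\<close> is exactly \<open>harm n\<close>.
  The replacement changes the integrand by at most \<open>y * exp (- y) / n\<close>, hence the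
  integral by at most \<open>1 / n\<close>.\<close>

lemma euler_mascheroni_integral:
  "(\<lambda>n. (LINT y|lborel. indicator {0<..real (Suc n)} y * ((1 - exp (- y)) / y)) - ln (real (Suc n))) \<longlonglongrightarrow> euler_mascheroni"
proof -
  let ?E = "\<lambda>n. LINT y|lborel. indicator {0<..real n} y * ((1 - exp (- y)) / y)"
  let ?h = "\<lambda>n y. indicator {0<..real n} y * ((1 - (1 - y / n) ^ n) / y) :: real"
  have h: "integrable lborel (?h n)" "(LINT y|lborel. ?h n y) = harm n" if n: "0 < n" for n :: nat
  proof -
    let ?t = "\<lambda>k y. indicator {0<..real n} y * ((1 - y / n) ^ k / n) :: real"
    have t: "integrable lborel (?t k)" "(LINT y|lborel. ?t k y) = 1 / (real k + 1)" for k
    proof -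
      have D: "DERIV (\<lambda>y. - (1 / (real k + 1)) * (1 - y / n) ^ (k + 1)) y :> (1 - y / n) ^ k / n" for y
      proof -
        have "DERIV (\<lambda>y. 1 - y / n) y :> - (1 / n)" using n by (auto intro!: derivative_eq_intros)
        from DERIV_cmult[OF DERIV_power[OF this, of "k + 1"], of "- (1 / (real k + 1))"]
        have D1: "DERIV (\<lambda>y. - (1 / (real k + 1)) * (1 - y / n) ^ (k + 1)) y :>
            - (1 / (real k + 1)) * (real (k + 1) * (- (1 / n) * (1 - y / n) ^ (k + 1 - Suc 0)))" .
        have "- (1 / a) * (a * (- b * c)) = c * b" if "a \<noteq> 0" for a b c :: real using that by simp
        from this[of "real k + 1" "1 / n" "(1 - y / n) ^ k"]
        have "- (1 / (real k + 1)) * (real (k + 1) * (- (1 / n) * (1 - y / n) ^ (k + 1 - Suc 0))) = (1 - y / n) ^ k / n"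
          by (simp add: add.commute)
        with D1 show ?thesis by simp
      qed
      have c: "continuous_on {0..real n} (\<lambda>y. (1 - y / n) ^ k / n)" using n by (intro continuous_intros) auto
      show "integrable lborel (?t k)" "(LINT y|lborel. ?t k y) = 1 / (real k + 1)"
        using integral_FTC_Ioc[OF _ D c] n by auto
    qed
    have eq: "?h n y = (\<Sum>k<n. ?t k y)" for y
    proof (cases "y \<in> {0<..real n}")
      case True
      have "(\<Sum>k<n. (1 - y / n) ^ k) = ((1 - y / n) ^ n - 1) / (- y / n)"
        using geometric_sum[of "1 - y / n" n] True n by simp
      moreover have "(X - 1) / (- y / n) / n = (1 - X) / y" for X :: real using True n by (simp add: field_simps)
      ultimately show ?thesis using True by (simp add: sum_divide_distrib[symmetric])
    qed simp
    show "integrable lborel (?h n)" unfolding eq by (intro Bochner_Integration.integrable_sum t)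
    have "(LINT y|lborel. ?h n y) = (\<Sum>k<n. 1 / (real k + 1))"
      unfolding eq using t by (simp only: Bochner_Integration.integral_sum)
    also have "\<dots> = harm n"
      unfolding harm_def by (rule sum.reindex_bij_witness[of _ "\<lambda>k. k - 1" Suc]) (auto simp: inverse_eq_divide)
    finally show "(LINT y|lborel. ?h n y) = harm n" .
  qed
  have diff: "\<bar>?E n - harm n\<bar> \<le> 1 / n" if n: "0 < n" for n :: nat
  proof -
    have Ei: "integrable lborel (\<lambda>y. indicator {0<..real n} y * ((1 - exp (- y)) / y))"
    proof (rule Bochner_Integration.integrable_bound[of _ "\<lambda>y. indicator {0<..real n} y :: real"])
      show "integrable lborel (\<lambda>y. indicator {0<..real n} y :: real)" by (rule integrable_real_indicator) (auto simp: emeasure_lborel_Ioc)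
      show "AE y in lborel. norm (indicator {0<..real n} y * ((1 - exp (- y)) / y)) \<le> norm (indicator {0<..real n} y :: real)"
      proof (rule AE_I2)
        fix y :: real
        show "norm (indicator {0<..real n} y * ((1 - exp (- y)) / y)) \<le> norm (indicator {0<..real n} y :: real)"
          using exp_ge_add_one_self[of "- y"] by (auto split: split_indicator simp: abs_of_nonneg field_simps)
      qed
    qed measurable
    have "\<bar>?E n - harm n\<bar> = \<bar>LINT y|lborel. indicator {0<..real n} y * ((1 - exp (- y)) / y) - ?h n y\<bar>"
      using Ei h[OF n] by (simp only: Bochner_Integration.integral_diff)
    also have "\<dots> \<le> (LINT y|lborel. \<bar>indicator {0<..real n} y * ((1 - exp (- y)) / y) - ?h n y\<bar>)" by (rule integral_abs_bound)
    also have "\<dots> \<le> (LINT y|lborel. indicator {0<..real n} y * (y * exp (- y) / n))"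
    proof (rule integral_mono)
      show "integrable lborel (\<lambda>y. \<bar>indicator {0<..real n} y * ((1 - exp (- y)) / y) - ?h n y\<bar>)"
        using Ei h(1)[OF n] by (intro integrable_abs Bochner_Integration.integrable_diff)
      show "integrable lborel (\<lambda>y. indicator {0<..real n} y * (y * exp (- y) / n))"
        by (rule integral_FTC_Ioc(1)[where F="\<lambda>y. - (y + 1) * exp (- y) / n"])
           (use n in \<open>auto intro!: derivative_eq_intros continuous_intros simp: field_simps\<close>)
      fix y :: real
      show "\<bar>indicator {0<..real n} y * ((1 - exp (- y)) / y) - ?h n y\<bar> \<le> indicator {0<..real n} y * (y * exp (- y) / n)"
      proof (cases "y \<in> {0<..real n}")
        case True
        then have y: "0 < y" "y \<le> n" by auto
        have yn: "0 \<le> y / n" "y / n \<le> 1" using y n by auto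
        have up: "(1 - y / n) ^ n \<le> exp (- y)"
        proof -
          have "(1 - y / n) ^ n \<le> exp (- y / n) ^ n" using exp_ge_add_one_self[of "- y / n"] yn by (intro power_mono) auto
          also have "\<dots> = exp (- y)" using n by (simp add: exp_of_nat_mult[symmetric])
          finally show ?thesis .
        qed
        \<comment> \<open>Bernoulli's inequality for the power of
          \<open>1 - (y/n)^2 = (1 + y/n) * (1 - y/n)\<close>, in which the power of the first factor
          is at most \<open>exp y\<close>.\<close>
        have low: "exp (- y) * (1 - y\<^sup>2 / n) \<le> (1 - y / n) ^ n"
        proof -
          have "1 + real n * (- (y / n)\<^sup>2) \<le> (1 + (- (y / n)\<^sup>2)) ^ n"
            by (rule Bernoulli_inequality) (use yn in \<open>simp add: power_le_one\<close>)
          then have "1 - y\<^sup>2 / n \<le> (1 - (y / n)\<^sup>2) ^ n" using n by (simp add: power_divide power2_eq_square)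
          also have "\<dots> = (1 + y / n) ^ n * (1 - y / n) ^ n"
            by (simp add: power_mult_distrib[symmetric] power2_eq_square algebra_simps)
          also have "\<dots> \<le> exp (y / n) ^ n * (1 - y / n) ^ n"
            using yn by (intro mult_right_mono power_mono) auto
          also have "exp (y / n) ^ n = exp y" using n by (simp add: exp_of_nat_mult[symmetric])
          finally have "exp (- y) * (1 - y\<^sup>2 / n) \<le> exp (- y) * (exp y * (1 - y / n) ^ n)" by (intro mult_left_mono) auto
          then show ?thesis by (simp add: exp_minus field_simps)
        qed
        have "\<bar>(1 - exp (- y)) / y - (1 - (1 - y / n) ^ n) / y\<bar> = (exp (- y) - (1 - y / n) ^ n) / y"
          using up y by (simp add: diff_divide_distrib[symmetric] abs_minus_commute)
        also have "\<dots> \<le> (exp (- y) * y\<^sup>2 / n) / y" using low y by (intro divide_right_mono) (auto simp: algebra_simps)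
        also have "\<dots> = y * exp (- y) / n" using y by (simp add: power2_eq_square)
        finally show ?thesis using True by simp
      qed simp
    qed
    also have "\<dots> = - (real n + 1) * exp (- real n) / n - (- (0 + 1) * exp (- 0) / n)"
      by (rule integral_FTC_Ioc(2)[where F="\<lambda>y. - (y + 1) * exp (- y) / n"])
         (use n in \<open>auto intro!: derivative_eq_intros continuous_intros simp: field_simps\<close>)
    also have "\<dots> \<le> 1 / n"
    proof -
      have "0 \<le> (real n + 1) * exp (- real n) / n" by simp
      moreover have "- (real n + 1) * exp (- real n) / n = - ((real n + 1) * exp (- real n) / n)"
        "- (- (0 + 1) * exp (- 0) / real n) = 1 / n" by (simp_all only: minus_divide_left mult_minus_left minus_minus) simp
      ultimately show ?thesis by linarith
    qed
    finally show ?thesis .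
  qed
  have "(\<lambda>n. ?E (Suc n) - harm (Suc n)) \<longlonglongrightarrow> 0"
    by (rule Lim_null_comparison[OF _ LIMSEQ_Suc[OF lim_1_over_n]]) (use diff in \<open>auto intro!: always_eventually simp del: of_nat_Suc\<close>)
  moreover have "(\<lambda>n. harm (Suc n) - ln (real (Suc n))) \<longlonglongrightarrow> (euler_mascheroni :: real)"
    by (rule LIMSEQ_Suc[OF euler_mascheroni_LIMSEQ])
  ultimately have "(\<lambda>n. (?E (Suc n) - harm (Suc n)) + (harm (Suc n) - ln (real (Suc n)))) \<longlonglongrightarrow> 0 + euler_mascheroni"
    by (rule tendsto_add)
  then show ?thesis by (simp del: of_nat_Suc)
qed

definition tanh_int :: "real \<Rightarrow> real" where
  "tanh_int Y = (LINT y|lborel. indicator {0<..Y} y * (tanh (y / 2) / y))"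

lemma tanh_measurable [measurable]: "(tanh :: real \<Rightarrow> real) \<in> borel_measurable borel"
  by (intro borel_measurable_continuous_onI continuous_intros) simp

lemma tanh_le_self: "0 \<le> x \<Longrightarrow> tanh x \<le> (x::real)"
proof -
  assume "0 \<le> x"
  then have "0 - tanh 0 \<le> x - tanh x"
  proof (rule DERIV_nonneg_imp_nondecreasing)
    fix z :: real
    have "DERIV (\<lambda>z. z - tanh z) z :> (tanh z)\<^sup>2"
      by (auto intro!: derivative_eq_intros)
    then show "\<exists>y. DERIV (\<lambda>z. z - tanh z) z :> y \<and> 0 \<le> y" by (intro exI[of _ "(tanh z)\<^sup>2"]) simp
  qed
  then show ?thesis by simp
qed

lemma tanh_half_le: "0 < y \<Longrightarrow> tanh (y / 2) / y \<le> 1 / (2::real)"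
  using tanh_le_self[of "y / 2"] by (simp add: field_simps)

text \<open>The tail \<open>tanh (y/2) - 1 = - 2 / (e\<^sup>y + 1)\<close> is integrable against \<open>dy/y\<close>, so that the limit
  exists along the reals; its value is computed along the integers, where the integral of
  \<open>(1 - e\<^sup>-\<^sup>y) / y\<close> is compared with the harmonic numbers.\<close>

lemma tanh_int_asymp: "((\<lambda>Y. tanh_int Y - ln Y) \<longlongrightarrow> euler_mascheroni - ln (pi / 2)) at_top"
proof -
  let ?a = "\<lambda>y. indicator {0<..1} y * (tanh (y / 2) / y) :: real"
  let ?b = "\<lambda>y. indicator {1<..} y * ((tanh (y / 2) - 1) / y) :: real"
  have th01: "0 \<le> tanh (y / 2)" "tanh (y / 2) \<le> 1" if "0 \<le> y" for y :: real
    using that tanh_real_lt_1[of "y / 2"] by auto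
  have ths: "1 - tanh (y / 2) \<le> 2 * exp (- y)" for y :: real
  proof -
    have "1 - tanh (y / 2) = 2 * exp (- y) / (1 + exp (- y))"
    proof -
      have "1 - (1 - q) / (1 + q) = 2 * q / (1 + q)" if "0 < q" for q :: real using that by (simp add: divide_simps)
      then show ?thesis unfolding tanh_half_eq by simp
    qed
    also have "\<dots> \<le> 2 * exp (- y) / 1" by (rule divide_left_mono) (auto intro: add_pos_pos)
    finally show ?thesis by simp
  qed
  have bi: "integrable lborel ?b"
  proof (rule Bochner_Integration.integrable_bound[of _ "\<lambda>y. 2 * (indicator {0<..} y * exp (- 1 * y))"])
    show "integrable lborel (\<lambda>y::real. 2 * (indicator {0<..} y * exp (- 1 * y)) :: real)"
      by (intro integrable_mult_right integral_exp_Ioi(2)) simp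
    show "AE y in lborel. norm (?b y) \<le> norm (2 * (indicator {0<..} y * exp (- 1 * y)) :: real)"
    proof (rule AE_I2)
      fix y :: real
      show "norm (?b y) \<le> norm (2 * (indicator {0<..} y * exp (- 1 * y)) :: real)"
      proof (cases "1 < y")
        case True
        have "\<bar>(tanh (y / 2) - 1) / y\<bar> = (1 - tanh (y / 2)) / y" using th01[of y] True by (simp add: abs_divide)
        also have "\<dots> \<le> (1 - tanh (y / 2)) / 1" using True th01[of y] by (intro divide_left_mono) auto
        finally show ?thesis using True ths[of y] by simp
      qed simp
    qed
  qed measurable
  have ai: "integrable lborel (\<lambda>y. indicator {0<..Y} y * (tanh (y / 2) / y))" for Y :: real
  proof (rule Bochner_Integration.integrable_bound[of _ "\<lambda>y. indicator {0<..Y} y :: real"])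
    show "integrable lborel (\<lambda>y. indicator {0<..Y} y :: real)"
      by (rule integrable_real_indicator, simp) (cases "0 \<le> Y", auto simp: emeasure_lborel_Ioc)
    show "AE y in lborel. norm (indicator {0<..Y} y * (tanh (y / 2) / y)) \<le> norm (indicator {0<..Y} y :: real)"
    proof (rule AE_I2)
      fix y :: real
      show "norm (indicator {0<..Y} y * (tanh (y / 2) / y)) \<le> norm (indicator {0<..Y} y :: real)"
      proof (cases "0 < y")
        case True
        then have "\<bar>tanh (y / 2) / y\<bar> \<le> 1" using th01[of y] tanh_half_le[of y] by (simp add: abs_of_nonneg)
        then show ?thesis by (auto split: split_indicator)
      qed simp
    qed
  qed measurable
  \<comment> \<open>The logarithm is produced by splitting off \<open>1/y\<close> beyond 1; what
    remains there decays exponentially.\<close>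
  have split: "tanh_int Y - ln Y = (LINT y|lborel. ?a y) + (LINT y|lborel. indicator {..Y} y * ?b y)" if Y: "1 \<le> Y" for Y
  proof -
    have D: "DERIV ln x :> 1 / x" if "1 \<le> x" for x :: real using that by (intro derivative_eq_intros) auto
    have c: "continuous_on {1..Y} (\<lambda>x. 1 / x)" by (intro continuous_intros) auto
    note L = integral_FTC_Ioc[OF Y D c]
    have biY: "integrable lborel (\<lambda>y. indicator {..Y} y * ?b y)"
      by (rule Bochner_Integration.integrable_bound[OF bi]) (auto split: split_indicator)
    have "tanh_int Y = (LINT y|lborel. ?a y + (indicator {..Y} y * ?b y + indicator {1<..Y} y * (1 / y)))"
      unfolding tanh_int_def using Y
      by (intro Bochner_Integration.integral_cong refl) (auto split: split_indicator simp: diff_divide_distrib)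
    also have "\<dots> = (LINT y|lborel. ?a y) + ((LINT y|lborel. indicator {..Y} y * ?b y) + (LINT y|lborel. indicator {1<..Y} y * (1 / y)))"
      using ai[of 1] biY L(1) by (simp only: Bochner_Integration.integral_add Bochner_Integration.integrable_add)
    finally show ?thesis using L(2) by simp
  qed
  define I where "I = (LINT y|lborel. ?a y) + (LINT y|lborel. ?b y)"
  have "((\<lambda>Y. LINT y|lborel. indicator {..Y} y * ?b y) \<longlongrightarrow> (LINT y|lborel. ?b y)) at_top"
  proof (rule integral_dominated_convergence_at_top[where w="\<lambda>y. \<bar>?b y\<bar>"])
    show "AE y in lborel. ((\<lambda>Y. indicator {..Y} y * ?b y) \<longlongrightarrow> ?b y) at_top"
    proof (rule AE_I2, rule tendsto_eventually)
      fix y :: real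
      show "eventually (\<lambda>Y. indicator {..Y} y * ?b y = ?b y) at_top"
        using eventually_ge_at_top[of y] by eventually_elim simp
    qed
    show "integrable lborel (\<lambda>y. \<bar>?b y\<bar>)" by (rule integrable_abs[OF bi])
    show "\<forall>\<^sub>F Y in at_top. AE y in lborel. norm (indicator {..Y} y * ?b y) \<le> \<bar>?b y\<bar>"
      by (intro always_eventually allI AE_I2) (auto split: split_indicator)
  qed measurable
  then have "((\<lambda>Y. (LINT y|lborel. ?a y) + (LINT y|lborel. indicator {..Y} y * ?b y)) \<longlongrightarrow> I) at_top"
    unfolding I_def by (intro tendsto_intros)
  moreover have "eventually (\<lambda>Y. (LINT y|lborel. ?a y) + (LINT y|lborel. indicator {..Y} y * ?b y) = tanh_int Y - ln Y) at_top"
    using eventually_ge_at_top[of 1] by eventually_elim (simp add: split)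
  ultimately have lim: "((\<lambda>Y. tanh_int Y - ln Y) \<longlongrightarrow> I) at_top" by (rule Lim_transform_eventually)
  have "filterlim (\<lambda>n. real (Suc n)) at_top sequentially"
    using filterlim_real_sequentially by (rule filterlim_compose) (rule filterlim_Suc)
  from filterlim_compose[OF lim this] have lim1: "(\<lambda>n. tanh_int (real (Suc n)) - ln (real (Suc n))) \<longlonglongrightarrow> I" .
  let ?E = "\<lambda>Y. LINT y|lborel. indicator {0<..Y} y * ((1 - exp (- y)) / y)"
  have eq: "tanh_int Y = ?E Y - (LINT y|lborel. indicator {..Y} y * tanh_defect y)" for Y
  proof -
    have di: "integrable lborel (\<lambda>y. indicator {..Y} y * tanh_defect y)"
      by (rule Bochner_Integration.integrable_bound[OF tanh_defect_integral(1)])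
         (use borel_measurable_integrable[OF tanh_defect_integral(1)] in \<open>auto split: split_indicator\<close>)
    have pw: "indicator {0<..Y} y * ((1 - exp (- y)) / y) = indicator {0<..Y} y * (tanh (y / 2) / y) + indicator {..Y} y * tanh_defect y" for y
    proof (cases "y \<in> {0<..Y}")
      case True
      define q where "q = exp (- y)"
      have "0 < q" by (simp add: q_def)
      then have "(1 - q) / y = (1 - q) / (1 + q) / y + q * (1 - q) / ((1 + q) * y)"
        using True by (simp add: divide_simps) (simp add: algebra_simps)
      then show ?thesis using True by (simp add: tanh_defect_def tanh_half_eq q_def)
    qed (auto simp: tanh_defect_def split: split_indicator)
    show ?thesis unfolding tanh_int_def pw using ai[of Y] di by simp
  qed
  have "(\<lambda>n. LINT y|lborel. indicator {..real (Suc n)} y * tanh_defect y) \<longlonglongrightarrow> (LINT y|lborel. tanh_defect y)"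
  proof (rule integral_dominated_convergence[where w="\<lambda>y. \<bar>tanh_defect y\<bar>"])
    show "AE y in lborel. (\<lambda>n. indicator {..real (Suc n)} y * tanh_defect y) \<longlonglongrightarrow> tanh_defect y"
    proof (rule AE_I2, rule tendsto_eventually)
      fix y :: real
      show "eventually (\<lambda>n. indicator {..real (Suc n)} y * tanh_defect y = tanh_defect y) sequentially"
        using eventually_ge_at_top[of "nat \<lceil>y\<rceil>"]
      proof eventually_elim
        case (elim n)
        then have "y \<le> real (Suc n)" using real_nat_ceiling_ge[of y] by linarith
        then show ?case by simp
      qed
    qed
    show "(\<lambda>y. indicator {..real (Suc n)} y * tanh_defect y) \<in> borel_measurable lborel" for n
      using borel_measurable_integrable[OF tanh_defect_integral(1)] by auto
  qed (use tanh_defect_integral(1) borel_measurable_integrable[OF tanh_defect_integral(1)] in \<open>auto split: split_indicator\<close>)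
  then have lim0: "(\<lambda>n. (?E (real (Suc n)) - ln (real (Suc n))) - (LINT y|lborel. indicator {..real (Suc n)} y * tanh_defect y))
      \<longlonglongrightarrow> euler_mascheroni - ln (pi / 2)"
    unfolding tanh_defect_integral(2) by (intro tendsto_diff euler_mascheroni_integral)
  have lim2: "(\<lambda>n. tanh_int (real (Suc n)) - ln (real (Suc n))) \<longlonglongrightarrow> euler_mascheroni - ln (pi / 2)"
  proof -
    have "tanh_int (real (Suc n)) - ln (real (Suc n)) =
        (?E (real (Suc n)) - ln (real (Suc n))) - (LINT y|lborel. indicator {..real (Suc n)} y * tanh_defect y)" for n
      unfolding eq by simp
    then show ?thesis using lim0 by (simp only:)
  qed
  have "I = euler_mascheroni - ln (pi / 2)" by (rule LIMSEQ_unique[OF lim1 lim2])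
  then show ?thesis using lim by simp
qed

section \<open>The inverse symbol, its tail and its scaling\<close>

definition Kinv :: "real \<Rightarrow> real \<Rightarrow> real \<Rightarrow> real" where
  "Kinv \<mu> T r = tanh ((r\<^sup>2 - \<mu>) / (2 * T)) / (r\<^sup>2 - \<mu>)"

definition Kdiff :: "real \<Rightarrow> real \<Rightarrow> real \<Rightarrow> real" where
  "Kdiff \<mu> T r = Kinv \<mu> T r - 1 / r\<^sup>2"

lemma Kinv_measurable [measurable]: "Kinv \<mu> T \<in> borel_measurable borel"
  unfolding Kinv_def by measurable

lemma Kdiff_measurable [measurable]: "Kdiff \<mu> T \<in> borel_measurable borel"
  unfolding Kdiff_def by measurable

lemma K_symbol_eq: "K_symbol \<mu> T p = inverse (Kinv \<mu> T (norm p))"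
  by (simp add: K_symbol_def Kinv_def)

text \<open>The quotient is even, so sign and size of \<open>Kinv\<close> follow from nonnegative
  arguments; at \<open>y = 0\<close> both sides are 0 by the convention for division.\<close>

lemma tanh_quotient_abs: "tanh (y / c) / y = tanh (\<bar>y\<bar> / c) / \<bar>y\<bar>" for y c :: real
  by (cases "0 \<le> y") (auto simp: tanh_minus)

lemma Kinv_nonneg: "0 < T \<Longrightarrow> 0 \<le> Kinv \<mu> T r"
  unfolding Kinv_def by (subst tanh_quotient_abs) simp

lemma Kinv_pos: "0 < T \<Longrightarrow> r\<^sup>2 \<noteq> \<mu> \<Longrightarrow> 0 < Kinv \<mu> T r"
  unfolding Kinv_def by (subst tanh_quotient_abs) simp

lemma Kinv_le: assumes T: "0 < T" shows "Kinv \<mu> T r \<le> 1 / (2 * T)"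
proof (cases "r\<^sup>2 = \<mu>")
  case False
  let ?y = "\<bar>r\<^sup>2 - \<mu>\<bar>"
  have "tanh (?y / (2 * T)) / ?y \<le> (?y / (2 * T)) / ?y"
    using T by (intro divide_right_mono tanh_le_self) auto
  also have "\<dots> = 1 / (2 * T)" using False by simp
  finally show ?thesis unfolding Kinv_def by (subst tanh_quotient_abs)
qed (use T in \<open>simp add: Kinv_def\<close>)

text \<open>Uses \<open>1 - tanh z \<le> 1 / z\<close> for \<open>z > 0\<close>.\<close>

lemma Kdiff_tail:
  assumes T: "0 < T" "T \<le> \<mu>" and r: "2 * \<mu> \<le> r\<^sup>2"
  shows "\<bar>Kdiff \<mu> T r\<bar> \<le> 8 * \<mu> / r ^ 4"
proof -
  define E where "E = r\<^sup>2"
  define y where "y = E - \<mu>"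
  have mu: "0 < \<mu>" using T by simp
  have E: "0 < E" and yE: "E / 2 \<le> y" and y: "0 < y" "y < E" using r mu by (auto simp: E_def y_def)
  have r4: "r ^ 4 = E * E" by (simp add: E_def power2_eq_square power4_eq_xxxx)
  have th1: "tanh (y / (2 * T)) \<le> 1" using tanh_real_lt_1[of "y / (2 * T)"] by simp
  have th2: "1 - tanh (y / (2 * T)) \<le> 2 * \<mu> / y"
  proof -
    define q where "q = exp (- (y / T))"
    have q: "0 < q" by (simp add: q_def)
    have "1 - tanh (y / (2 * T)) = 1 - (1 - q) / (1 + q)"
      using tanh_half_eq[of "y / T"] by (simp add: q_def mult.commute)
    also have "\<dots> = 2 * q / (1 + q)" using q by (simp add: divide_simps)
    also have "\<dots> \<le> 2 * q / 1" using q by (intro divide_left_mono) auto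
    also have "q \<le> T / y"
    proof -
      have "y / T \<le> exp (y / T)" using exp_ge_add_one_self[of "y / T"] by linarith
      then have "inverse (exp (y / T)) \<le> inverse (y / T)" using y T by (intro le_imp_inverse_le) auto
      then show ?thesis by (simp add: q_def exp_minus)
    qed
    also have "2 * (T / y) / 1 \<le> 2 * \<mu> / y" using T y by (simp add: divide_right_mono)
    finally show ?thesis by simp
  qed
  have K: "Kdiff \<mu> T r = tanh (y / (2 * T)) / y - 1 / E" by (simp add: Kdiff_def Kinv_def y_def E_def)
  have "tanh (y / (2 * T)) / y - 1 / E \<le> 1 / y - 1 / E" using th1 y by (simp add: divide_right_mono)
  also have "\<dots> = \<mu> / (y * E)" using y E by (simp add: y_def field_simps)
  also have "\<dots> \<le> \<mu> / ((E / 2) * E)" using yE E mu by (intro divide_left_mono mult_right_mono mult_pos_pos) auto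
  also have "\<dots> \<le> 8 * \<mu> / (E * E)" using mu E by (simp add: field_simps)
  finally have up: "Kdiff \<mu> T r \<le> 8 * \<mu> / r ^ 4" by (simp add: K r4)
  have "1 / E - tanh (y / (2 * T)) / y \<le> 1 / y - tanh (y / (2 * T)) / y" using y by (simp add: frac_le)
  also have "\<dots> = (1 - tanh (y / (2 * T))) / y" by (simp add: diff_divide_distrib)
  also have "\<dots> \<le> (2 * \<mu> / y) / y" using th2 y by (intro divide_right_mono) auto
  also have "\<dots> = 2 * \<mu> / (y * y)" by simp
  also have "\<dots> \<le> 2 * \<mu> / ((E / 2) * (E / 2))" using yE E mu by (intro divide_left_mono mult_mono mult_pos_pos) auto
  also have "\<dots> = 8 * \<mu> / (E * E)" by simp
  finally have "- Kdiff \<mu> T r \<le> 8 * \<mu> / r ^ 4" by (simp add: K r4)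
  with up show ?thesis by linarith
qed

lemma integral_Ici_power:
  fixes R :: real assumes R: "0 < R"
  shows "integrable lborel (\<lambda>r. indicator {R..} r * (1 / r\<^sup>2))" "(LINT r|lborel. indicator {R..} r * (1 / r\<^sup>2)) = 1 / R"
    and "integrable lborel (\<lambda>r. indicator {R..} r * (1 / (r * sqrt r)))"
        "(LINT r|lborel. indicator {R..} r * (1 / (r * sqrt r))) = 2 / sqrt R"
proof -
  have *: "integrable lborel (\<lambda>r. indicator {R..} r * f r) \<and> (LINT r|lborel. indicator {R..} r * f r) = c"
    if nn: "(\<integral>\<^sup>+r. ennreal (f r) * indicator {R..} r \<partial>lborel) = ennreal c" and c: "0 \<le> c"
      and f: "\<And>r. R \<le> r \<Longrightarrow> 0 \<le> f r" and [measurable]: "f \<in> borel_measurable borel" for f :: "real \<Rightarrow> real" and c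
  proof -
    have eq: "(\<integral>\<^sup>+r. ennreal (indicator {R..} r * f r) \<partial>lborel) = ennreal c"
      unfolding nn[symmetric] by (intro nn_integral_cong) (auto split: split_indicator)
    have nonneg: "0 \<le> indicator {R..} r * f r" for r using f by (auto split: split_indicator)
    have i: "integrable lborel (\<lambda>r. indicator {R..} r * f r)"
      by (rule integrableI_nonneg) (use eq nonneg in auto)
    have "ennreal (LINT r|lborel. indicator {R..} r * f r) = ennreal c"
      using eq nn_integral_eq_integral[OF i] nonneg by simp
    then show ?thesis using i c nonneg by (subst (asm) ennreal_inj) (auto intro!: integral_nonneg_AE)
  qed
  have "(\<integral>\<^sup>+r. ennreal (1 / r\<^sup>2) * indicator {R..} r \<partial>lborel) = ennreal (0 - (- 1 / R))"
  proof (rule nn_integral_FTC_atLeast)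
    show "DERIV (\<lambda>r. - 1 / r) x :> 1 / x\<^sup>2" if "R \<le> x" for x
      using R that by (auto intro!: derivative_eq_intros simp: power2_eq_square)
    show "((\<lambda>r::real. - 1 / r) \<longlongrightarrow> 0) at_top" by real_asymp
  qed auto
  from *[OF _ _ _ _, of "\<lambda>r. 1 / r\<^sup>2" "1 / R"] this R
  show "integrable lborel (\<lambda>r. indicator {R..} r * (1 / r\<^sup>2))" "(LINT r|lborel. indicator {R..} r * (1 / r\<^sup>2)) = 1 / R" by auto
  have "(\<integral>\<^sup>+r. ennreal (1 / (r * sqrt r)) * indicator {R..} r \<partial>lborel) = ennreal (0 - (- 2 / sqrt R))"
  proof (rule nn_integral_FTC_atLeast)
    show "DERIV (\<lambda>r. - 2 / sqrt r) x :> 1 / (x * sqrt x)" if "R \<le> x" for x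
      using R that by (auto intro!: derivative_eq_intros simp: field_simps)
    show "((\<lambda>r::real. - 2 / sqrt r) \<longlongrightarrow> 0) at_top" by real_asymp
    show "0 \<le> 1 / (x * sqrt x)" if "R \<le> x" for x using R that by simp
  qed auto
  from *[OF _ _ _ _, of "\<lambda>r. 1 / (r * sqrt r)" "2 / sqrt R"] this R
  show "integrable lborel (\<lambda>r. indicator {R..} r * (1 / (r * sqrt r)))"
    "(LINT r|lborel. indicator {R..} r * (1 / (r * sqrt r))) = 2 / sqrt R" by auto
qed

text \<open>The split is at \<open>r^2 = 2 \<mu>\<close>: below, \<open>Kinv \<le> 1 / (2 T)\<close>
  gives the crude bound in \<open>\<mu> / T\<close>, and beyond, \<open>Kdiff_tail\<close> is
  integrable against the Jacobian. It serves integrability only, not the asymptotics.\<close>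

lemma Kdiff_radial_bound:
  assumes T: "0 < T" "T \<le> \<mu>" and r: "0 \<le> r"
  shows "\<bar>r\<^sup>2 * Kdiff \<mu> T r\<bar> \<le> (\<mu> / T + 1) * indicator {0..sqrt (2 * \<mu>)} r + 8 * \<mu> * (indicator {sqrt (2 * \<mu>)..} r * (1 / r\<^sup>2))"
proof (cases "r \<le> sqrt (2 * \<mu>)")
  case True
  then have r2: "r\<^sup>2 \<le> 2 * \<mu>" using r by (metis power_mono real_sqrt_pow2 T less_imp_le order_trans mult_nonneg_nonneg zero_le_numeral)
  have "r\<^sup>2 * Kinv \<mu> T r \<le> 2 * \<mu> * (1 / (2 * T))"
    using r2 Kinv_le[OF T(1)] Kinv_nonneg[OF T(1)] T by (intro mult_mono) auto
  then have "r\<^sup>2 * Kinv \<mu> T r \<le> \<mu> / T" by simp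
  moreover have "0 \<le> r\<^sup>2 * Kinv \<mu> T r" using Kinv_nonneg[OF T(1)] by simp
  \<comment> \<open>At \<open>r = 0\<close> the term \<open>1 / r^2\<close> is 0 by convention, so
    the subtracted 1 is absent there.\<close>
  moreover have "r\<^sup>2 * Kdiff \<mu> T r = r\<^sup>2 * Kinv \<mu> T r - (if r = 0 then 0 else 1)" by (simp add: Kdiff_def right_diff_distrib)
  ultimately have "\<bar>r\<^sup>2 * Kdiff \<mu> T r\<bar> \<le> \<mu> / T + 1" using T by (auto split: if_splits)
  moreover have "0 \<le> 8 * \<mu> * (indicator {sqrt (2 * \<mu>)..} r * (1 / r\<^sup>2))" using T by simp
  ultimately show ?thesis using True r by simp
next
  case False
  then have "sqrt (2 * \<mu>) \<le> r" by simp
  then have "(sqrt (2 * \<mu>))\<^sup>2 \<le> r\<^sup>2" using T by (intro power_mono) auto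
  then have "2 * \<mu> \<le> r\<^sup>2" using T by simp
  note Kdiff_tail[OF T this]
  then have "r\<^sup>2 * \<bar>Kdiff \<mu> T r\<bar> \<le> r\<^sup>2 * (8 * \<mu> / r ^ 4)" by (rule mult_left_mono) simp
  also have "\<dots> = 8 * \<mu> * (1 / r\<^sup>2)" by (simp add: power2_eq_square power4_eq_xxxx)
  finally show ?thesis using False by (simp add: abs_mult)
qed

lemma Kdiff_radial_integrable:
  assumes T: "0 < T" "T \<le> \<mu>"
  shows "integrable lborel (\<lambda>r. indicator {0..} r * (r\<^sup>2 * Kdiff \<mu> T r))"
proof (rule Bochner_Integration.integrable_bound)
  have "0 < sqrt (2 * \<mu>)" using T by simp
  have "integrable lborel (indicator {0..sqrt (2 * \<mu>)} :: real \<Rightarrow> real)"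
    by (rule integrable_real_indicator) (auto simp: emeasure_lborel_Icc_eq)
  then show "integrable lborel (\<lambda>r. (\<mu> / T + 1) * indicator {0..sqrt (2 * \<mu>)} r + 8 * \<mu> * (indicator {sqrt (2 * \<mu>)..} r * (1 / r\<^sup>2)))"
    using integral_Ici_power(1)[OF \<open>0 < sqrt (2 * \<mu>)\<close>]
    by (intro Bochner_Integration.integrable_add integrable_mult_right)
  show "AE r in lborel. norm (indicator {0..} r * (r\<^sup>2 * Kdiff \<mu> T r)) \<le>
      norm ((\<mu> / T + 1) * indicator {0..sqrt (2 * \<mu>)} r + 8 * \<mu> * (indicator {sqrt (2 * \<mu>)..} r * (1 / r\<^sup>2)))"
  proof (rule AE_I2)
    fix r :: real
    show "norm (indicator {0..} r * (r\<^sup>2 * Kdiff \<mu> T r)) \<le>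
      norm ((\<mu> / T + 1) * indicator {0..sqrt (2 * \<mu>)} r + 8 * \<mu> * (indicator {sqrt (2 * \<mu>)..} r * (1 / r\<^sup>2)))"
      using Kdiff_radial_bound[OF T, of r] by (cases "0 \<le> r") auto
  qed
qed measurable

definition gap_int :: "real \<Rightarrow> real \<Rightarrow> real" where
  "gap_int \<mu> T = ((2 * pi) powr (-3/2))\<^sup>2 * (LINT p|lebesgue. Kdiff \<mu> T (norm (p::real^3)))"

lemma Kdiff_integrable:
  assumes T: "0 < T" "T \<le> \<mu>" shows "integrable lebesgue (\<lambda>p::real^3. Kdiff \<mu> T (norm p))"
proof -
  have eq: "4 * pi * r\<^sup>2 * indicator {0..} r * Kdiff \<mu> T r = 4 * pi * (indicator {0..} r * (r\<^sup>2 * Kdiff \<mu> T r))" for r by simp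
  show ?thesis
    unfolding integrable_radial(1)[OF Kdiff_measurable] eq by (rule integrable_mult_right) (rule Kdiff_radial_integrable[OF T])
qed

text \<open>The radial gap integral with momenta measured in units of \<open>sqrt \<mu>\<close>;
  scaling leaves \<open>Y = \<mu> / T\<close> as the only parameter.\<close>

definition scaled_gap :: "real \<Rightarrow> real" where
  "scaled_gap Y = (LINT v|lborel. indicator {0..} v * (v\<^sup>2 * Kdiff 1 (1 / Y) v))"

lemma gap_int_eq:
  assumes T: "0 < T" "T \<le> \<mu>"
  shows "gap_int \<mu> T = sqrt \<mu> / (2 * pi\<^sup>2) * scaled_gap (\<mu> / T)"
proof -
  have mu: "0 < \<mu>" using T by simp
  have sc: "Kdiff \<mu> T (0 + sqrt \<mu> * v) = Kdiff 1 (1 / (\<mu> / T)) v / \<mu>" for v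
  proof -
    have "(sqrt \<mu> * v)\<^sup>2 = \<mu> * v\<^sup>2" using mu by (simp add: power_mult_distrib)
    moreover have "(\<mu> * v\<^sup>2 - \<mu>) = \<mu> * (v\<^sup>2 - 1)" by (simp add: algebra_simps)
    ultimately show ?thesis using T mu by (simp add: Kdiff_def Kinv_def diff_divide_distrib mult.commute)
  qed
  have "(LINT p|lebesgue. Kdiff \<mu> T (norm (p::real^3))) = (LINT r|lborel. 4 * pi * r\<^sup>2 * indicator {0..} r * Kdiff \<mu> T r)"
    by (rule integrable_radial(2)) measurable
  also have "\<dots> = \<bar>sqrt \<mu>\<bar> *\<^sub>R (LINT v|lborel. 4 * pi * (0 + sqrt \<mu> * v)\<^sup>2 * indicator {0..} (0 + sqrt \<mu> * v) * Kdiff \<mu> T (0 + sqrt \<mu> * v))"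
    by (rule lborel_integral_real_affine) (use mu in simp)
  also have "\<dots> = sqrt \<mu> * (LINT v|lborel. (4 * pi) * (indicator {0..} v * (v\<^sup>2 * Kdiff 1 (1 / (\<mu> / T)) v)))"
  proof -
    have eq: "4 * pi * (0 + sqrt \<mu> * v)\<^sup>2 * indicator {0..} (0 + sqrt \<mu> * v) * Kdiff \<mu> T (0 + sqrt \<mu> * v) =
      (4 * pi) * (indicator {0..} v * (v\<^sup>2 * Kdiff 1 (1 / (\<mu> / T)) v))" for v
      unfolding sc using mu by (auto simp: power_mult_distrib zero_le_mult_iff split: split_indicator)
    show ?thesis unfolding eq using mu by simp
  qed
  also have "\<dots> = 4 * pi * sqrt \<mu> * scaled_gap (\<mu> / T)" by (simp add: scaled_gap_def)
  finally have "gap_int \<mu> T = ((2 * pi) powr (-3/2))\<^sup>2 * (4 * pi * sqrt \<mu> * scaled_gap (\<mu> / T))" by (simp add: gap_int_def)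
  also have "((2 * pi) powr (-3/2))\<^sup>2 = 1 / (2 * pi) ^ 3"
    using FT_const_sq by (simp add: eq_divide_eq)
  finally show ?thesis by (simp add: power2_eq_square power3_eq_cube)
qed

text \<open>The cut \<open>sqrt 2\<close> is chosen so that \<open>s = v^2 - 1\<close> runs over the
  symmetric interval from -1 to 1. The integrand is even in \<open>s\<close>, and rescaling by
  \<open>Y\<close> gives \<open>tanh_int Y\<close> exactly; the whole logarithm sits in this
  piece.\<close>

lemma scaled_gap_core:
  assumes Y: "0 < Y"
  shows "(LINT v|lborel. indicator {0..sqrt 2} v * (v * (tanh ((v\<^sup>2 - 1) * Y / 2) / (v\<^sup>2 - 1)))) = tanh_int Y" (is "?L = _")
    and "integrable lborel (\<lambda>v. indicator {0..sqrt 2} v * (v * (tanh ((v\<^sup>2 - 1) * Y / 2) / (v\<^sup>2 - 1))))" (is ?I)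
proof -
  let ?f = "\<lambda>s. tanh (s * Y / 2) / (2 * s)"
  let ?g = "\<lambda>v::real. v\<^sup>2 - 1"
  have f0: "0 \<le> ?f s" and fle: "?f s \<le> Y / 4" for s
  proof -
    have "tanh (s / (2 / Y)) / s = tanh (\<bar>s\<bar> / (2 / Y)) / \<bar>s\<bar>" by (rule tanh_quotient_abs)
    then have eq: "?f s = tanh (\<bar>s\<bar> * Y / 2) / \<bar>s\<bar> / 2" by simp
    show "0 \<le> ?f s" unfolding eq using Y by simp
    have "tanh (\<bar>s\<bar> * Y / 2) / \<bar>s\<bar> \<le> (\<bar>s\<bar> * Y / 2) / \<bar>s\<bar>" using Y by (intro divide_right_mono tanh_le_self) auto
    also have "\<dots> \<le> Y / 2" using Y by simp
    finally have "tanh (\<bar>s\<bar> * Y / 2) / \<bar>s\<bar> / 2 \<le> Y / 2 / 2" by (rule divide_right_mono) simp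
    moreover have "Y / 2 / 2 = Y / 4" by simp
    ultimately show "?f s \<le> Y / 4" unfolding eq by (simp only:)
  qed
  have fi: "integrable lborel (\<lambda>s. indicator A s * ?f s)" if "A \<in> sets borel" "emeasure lborel A < \<infinity>" for A
  proof (rule Bochner_Integration.integrable_bound[of _ "\<lambda>s. Y / 4 * indicator A s"])
    show "integrable lborel (\<lambda>s. Y / 4 * indicator A s)" using that by (intro integrable_mult_right integrable_real_indicator) auto
    note that(1)[measurable]
    show "(\<lambda>s. indicator A s * ?f s) \<in> borel_measurable lborel" by measurable
    show "AE s in lborel. norm (indicator A s * ?f s) \<le> norm (Y / 4 * indicator A s)"
    proof (rule AE_I2)
      fix s show "norm (indicator A s * ?f s) \<le> norm (Y / 4 * indicator A s)"
        using f0[of s] fle[of s] by (cases "s \<in> A") (simp_all add: abs_of_nonneg)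
    qed
  qed
  have g0: "?g 0 = -1" and g2: "?g (sqrt 2) = 1" by simp_all
  have si: "set_integrable lborel {?g 0..?g (sqrt 2)} ?f"
    unfolding set_integrable_def using fi[of "{-1..1}"] by simp
  have D: "((\<lambda>v. v\<^sup>2 - 1) has_real_derivative 2 * x) (at x)" for x :: real by (auto intro!: derivative_eq_intros)
  have c: "continuous_on {0..sqrt 2} (\<lambda>v. 2 * v)" by (intro continuous_intros)
  note sub = integral_substitution[OF si D c, simplified]
  have pw: "indicator {0..sqrt 2} v * (v * (tanh ((v\<^sup>2 - 1) * Y / 2) / (v\<^sup>2 - 1))) =
      ?f (v\<^sup>2 - 1) * (2 * v) * indicator {0..sqrt 2} v" for v
  proof -
    have "i * (v * (t / d)) = t / (2 * d) * (2 * v) * i" for i t d :: real by simp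
    then show ?thesis .
  qed
  show ?I
  proof -
    have "integrable lborel (\<lambda>v. indicator {0..sqrt 2} v *\<^sub>R (?f (v\<^sup>2 - 1) * (2 * v)))"
      using integral_substitution(1)[OF si D c] by (simp add: set_integrable_def)
    then show ?thesis unfolding pw by (simp add: mult.commute)
  qed
  have ineg: "integrable lborel (\<lambda>s. indicator {-1..<0} s * ?f s)" and ipos: "integrable lborel (\<lambda>s. indicator {0<..1} s * ?f s)"
    by (rule fi; simp)+
  have "?L = (LINT v|lborel. ?f (v\<^sup>2 - 1) * (2 * v) * indicator {0..sqrt 2} v)" unfolding pw ..
  also have "\<dots> = (LINT s|lborel. ?f s * indicator {?g 0..?g (sqrt 2)} s)"
    by (rule integral_substitution(2)[OF si D c, symmetric]) auto
  also have "\<dots> = (LINT s|lborel. indicator {-1..<0} s * ?f s + indicator {0<..1} s * ?f s)"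
    by (rule Bochner_Integration.integral_cong) (auto split: split_indicator)
  also have "\<dots> = (LINT s|lborel. indicator {-1..<0} s * ?f s) + (LINT s|lborel. indicator {0<..1} s * ?f s)"
    using ineg ipos by (rule Bochner_Integration.integral_add)
  also have "(LINT s|lborel. indicator {-1..<0} s * ?f s) = (LINT s|lborel. indicator {0<..1} s * ?f s)"
  proof -
    have "(LINT s|lborel. indicator {-1..<0} s * ?f s) = \<bar>-1\<bar> *\<^sub>R (LINT s|lborel. indicator {-1..<0} (0 + (-1) * s) * ?f (0 + (-1) * s))"
      by (rule lborel_integral_real_affine) simp
    also have "\<dots> = (LINT s|lborel. indicator {0<..1} s * ?f s)"
      by (simp, rule Bochner_Integration.integral_cong) (auto simp: tanh_minus split: split_indicator)
    finally show ?thesis .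
  qed
  also have "(LINT s|lborel. indicator {0<..1} s * ?f s) + (LINT s|lborel. indicator {0<..1} s * ?f s) = tanh_int Y"
  proof -
    have "(LINT s|lborel. indicator {0<..1} s * ?f s) = \<bar>1 / Y\<bar> *\<^sub>R (LINT y|lborel. indicator {0<..1} (0 + 1 / Y * y) * ?f (0 + 1 / Y * y))"
      by (rule lborel_integral_real_affine) (use Y in simp)
    also have "\<dots> = (LINT y|lborel. indicator {0<..Y} y * (tanh (y / 2) / y) / 2)"
    proof -
      have "indicator {0<..1} (0 + 1 / Y * y) * ?f (0 + 1 / Y * y) = Y * (indicator {0<..Y} y * (tanh (y / 2) / y) / 2)" for y
        using Y by (auto split: split_indicator simp: field_simps)
      then show ?thesis using Y by (simp only: integral_mult_right_zero) simp
    qed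
    also have "\<dots> = tanh_int Y / 2" unfolding tanh_int_def by (rule integral_divide_zero)
    finally show ?thesis by simp
  qed
  finally show "?L = tanh_int Y" .
qed

lemma tanh_scaled_tendsto:
  fixes c :: real assumes "c \<noteq> 0" shows "((\<lambda>Y. tanh (c * Y / 2)) \<longlongrightarrow> sgn c) at_top"
proof (cases "0 < c")
  case True
  have "filterlim (\<lambda>Y. c * Y / 2) at_top at_top" using True by real_asymp
  from filterlim_compose[OF tanh_real_at_top this] show ?thesis using True by simp
next
  case False
  then have "filterlim (\<lambda>Y. c * Y / 2) at_bot at_top" using assms by real_asymp
  from filterlim_compose[OF tanh_real_at_bot this] show ?thesis using False assms by simp
qed

text \<open>The factor comes from \<open>v^2 / (v^2 - 1) = v / (v^2 - 1) + v / (v + 1)\<close>,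
  whose first summand is treated in \<open>scaled_gap_core\<close>. Without the pole,
  \<open>tanh\<close> may be replaced by the sign of \<open>v^2 - 1\<close> in the limit, so the
  part below 1 counts negatively.\<close>

lemma scaled_gap_smooth_part:
  "((\<lambda>Y. LINT v|lborel. indicator {0..sqrt 2} v * (tanh ((v\<^sup>2 - 1) * Y / 2) * (v / (v + 1)))) \<longlongrightarrow>
     sqrt 2 - ln (1 + sqrt 2) - 2 + 2 * ln 2) at_top"
proof -
  let ?f = "\<lambda>v::real. v / (v + 1)"
  have D: "DERIV (\<lambda>v. v - ln (1 + v)) v :> ?f v" if "0 \<le> v" for v
    using that by (auto intro!: derivative_eq_intros simp: field_simps)
  have c: "continuous_on {a..b} ?f" if "0 \<le> a" for a b using that by (intro continuous_intros) auto
  have s2: "1 \<le> sqrt 2" by simp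
  have l: "integrable lborel (\<lambda>v. indicator {0<..1} v * ?f v)" "(LINT v|lborel. indicator {0<..1} v * ?f v) = 1 - ln 2"
    using integral_FTC_Ioc[OF _ D c, of 0 1] by auto
  have u: "integrable lborel (\<lambda>v. indicator {1<..sqrt 2} v * ?f v)"
    "(LINT v|lborel. indicator {1<..sqrt 2} v * ?f v) = (sqrt 2 - ln (1 + sqrt 2)) - (1 - ln 2)"
    using integral_FTC_Ioc[OF s2 D c] by auto
  have "((\<lambda>Y. LINT v|lborel. indicator {0..sqrt 2} v * (tanh ((v\<^sup>2 - 1) * Y / 2) * ?f v)) \<longlongrightarrow>
      (LINT v|lborel. indicator {1<..sqrt 2} v * ?f v - indicator {0<..1} v * ?f v)) at_top"
  proof (rule integral_dominated_convergence_at_top[where w="\<lambda>v. indicator {0..sqrt 2} v"])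
    show "integrable lborel (\<lambda>v. indicator {0..sqrt 2} v :: real)" by (rule integrable_real_indicator) auto
    show "AE v in lborel. ((\<lambda>Y. indicator {0..sqrt 2} v * (tanh ((v\<^sup>2 - 1) * Y / 2) * ?f v)) \<longlongrightarrow>
        indicator {1<..sqrt 2} v * ?f v - indicator {0<..1} v * ?f v) at_top"
      using AE_lborel_singleton[of 0] AE_lborel_singleton[of 1]
    proof eventually_elim
      case (elim v)
      show ?case
      proof (cases "0 \<le> v")
        case True
        have "v\<^sup>2 - 1 \<noteq> 0" using elim True by (auto simp: power2_eq_1_iff)
        have sg: "sgn (v\<^sup>2 - 1) = (if 1 < v then 1 else -1)"
        proof (cases "1 < v")
          case False
          then have "v\<^sup>2 < 1" using elim True power_strict_mono[of v 1 2] by simp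
          then show ?thesis using False by simp
        qed (use one_less_power[of v 2] in simp)
        have "((\<lambda>Y. indicator {0..sqrt 2} v * (tanh ((v\<^sup>2 - 1) * Y / 2) * ?f v)) \<longlongrightarrow> indicator {0..sqrt 2} v * (sgn (v\<^sup>2 - 1) * ?f v)) at_top"
          by (intro tendsto_intros tanh_scaled_tendsto) fact
        moreover have "indicator {0..sqrt 2} v * (sgn (v\<^sup>2 - 1) * ?f v) = indicator {1<..sqrt 2} v * ?f v - indicator {0<..1} v * ?f v"
        proof -
          have "\<not> v \<le> sqrt 2 \<Longrightarrow> 1 < v" using s2 by linarith
          then show ?thesis unfolding sg using elim True by (auto split: split_indicator)
        qed
        ultimately show ?thesis by simp
      qed auto
    qed
    show "\<forall>\<^sub>F Y in at_top. AE v in lborel. norm (indicator {0..sqrt 2} v * (tanh ((v\<^sup>2 - 1) * Y / 2) * ?f v)) \<le> indicator {0..sqrt 2} v"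
    proof (intro always_eventually allI AE_I2)
      fix Y v :: real
      have "\<bar>tanh ((v\<^sup>2 - 1) * Y / 2)\<bar> \<le> 1" using tanh_real_abs[of "(v\<^sup>2 - 1) * Y / 2"] tanh_real_lt_1[of "\<bar>(v\<^sup>2 - 1) * Y / 2\<bar>"] by linarith
      moreover have "\<bar>?f v\<bar> \<le> 1" if "0 \<le> v" using that by (simp add: abs_of_nonneg)
      ultimately have "\<bar>tanh ((v\<^sup>2 - 1) * Y / 2)\<bar> * \<bar>?f v\<bar> \<le> 1 * 1" if "0 \<le> v" using that by (intro mult_mono) auto
      then show "norm (indicator {0..sqrt 2} v * (tanh ((v\<^sup>2 - 1) * Y / 2) * ?f v)) \<le> indicator {0..sqrt 2} v"
        by (auto split: split_indicator simp: abs_mult)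
    qed
  qed measurable
  moreover have "(LINT v|lborel. indicator {1<..sqrt 2} v * ?f v - indicator {0<..1} v * ?f v) = sqrt 2 - ln (1 + sqrt 2) - 2 + 2 * ln 2"
    unfolding Bochner_Integration.integral_diff[OF u(1) l(1)] l(2) u(2) by simp
  ultimately show ?thesis by simp
qed

text \<open>Beyond the cut \<open>tanh\<close> tends to 1 and the integrand to
  \<open>v^2 / (v^2 - 1) - 1 = 1 / (v^2 - 1)\<close>, with \<open>Kdiff_tail\<close> as a majorant
  uniform in \<open>Y\<close>.\<close>

lemma scaled_gap_tail:
  "((\<lambda>Y. LINT v|lborel. indicator {sqrt 2<..} v * (v\<^sup>2 * Kdiff 1 (1 / Y) v)) \<longlongrightarrow> ln (1 + sqrt 2)) at_top"
proof -
  let ?f = "\<lambda>v::real. 1 / (v\<^sup>2 - 1)"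
  have s2: "1 < sqrt 2" by simp
  have v2: "2 \<le> v\<^sup>2" if "sqrt 2 \<le> v" for v :: real using that by (metis real_sqrt_le_iff real_sqrt_abs abs_ge_self order_trans real_le_lsqrt zero_le_numeral sqrt_le_D)
  have "(\<integral>\<^sup>+v. ennreal (?f v) * indicator {sqrt 2..} v \<partial>lborel) = ennreal (0 - (1/2 * (ln (sqrt 2 - 1) - ln (sqrt 2 + 1))))"
  proof (rule nn_integral_FTC_atLeast)
    show "DERIV (\<lambda>v. 1/2 * (ln (v - 1) - ln (v + 1))) x :> ?f x" if "sqrt 2 \<le> x" for x
    proof -
      have x: "1 < x" using that s2 by linarith
      have "DERIV (\<lambda>v. 1/2 * (ln (v - 1) - ln (v + 1))) x :> 1/2 * (1 / (x - 1) - 1 / (x + 1))"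
        using x by (auto intro!: derivative_eq_intros)
      moreover have "1/2 * (1 / (x - 1) - 1 / (x + 1)) = ?f x"
      proof -
        have "x\<^sup>2 - 1 = (x - 1) * (x + 1)" by (simp add: power2_eq_square algebra_simps)
        then show ?thesis using x by (simp add: field_simps)
      qed
      ultimately show ?thesis by (simp only:)
    qed
    show "0 \<le> ?f x" if "sqrt 2 \<le> x" for x using v2[OF that] by simp
    show "((\<lambda>v::real. 1/2 * (ln (v - 1) - ln (v + 1))) \<longlongrightarrow> 0) at_top" by real_asymp
  qed measurable
  also have "0 - (1/2 * (ln (sqrt 2 - 1) - ln (sqrt 2 + 1))) = ln (1 + sqrt 2)"
  proof -
    have "(1 + sqrt 2) * (sqrt 2 - 1) = (1::real)" by (simp add: algebra_simps)
    then have "inverse (1 + sqrt 2) = sqrt 2 - 1" by (rule inverse_unique)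
    then have "ln (sqrt 2 - 1) = - ln (1 + sqrt 2)" by (metis add_pos_pos ln_inverse real_sqrt_gt_0_iff zero_less_numeral zero_less_one)
    then show ?thesis by (simp add: add.commute)
  qed
  finally have nn: "(\<integral>\<^sup>+v. ennreal (?f v) * indicator {sqrt 2..} v \<partial>lborel) = ennreal (ln (1 + sqrt 2))" .
  have nn': "(\<integral>\<^sup>+v. ennreal (indicator {sqrt 2<..} v * ?f v) \<partial>lborel) = ennreal (ln (1 + sqrt 2))"
    unfolding nn[symmetric] by (rule nn_integral_cong_AE)
      (use AE_lborel_singleton[of "sqrt 2"] in eventually_elim, auto split: split_indicator)
  have pos: "0 \<le> indicator {sqrt 2<..} v * ?f v" for v using v2[of v] by (auto split: split_indicator)
  have fi: "integrable lborel (\<lambda>v. indicator {sqrt 2<..} v * ?f v)" by (rule integrableI_nonneg) (use nn' pos in auto)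
  have "ennreal (LINT v|lborel. indicator {sqrt 2<..} v * ?f v) = ennreal (ln (1 + sqrt 2))"
    using nn' nn_integral_eq_integral[OF fi] pos by simp
  then have fI: "(LINT v|lborel. indicator {sqrt 2<..} v * ?f v) = ln (1 + sqrt 2)"
    by (rule ennreal_inj[THEN iffD1, rotated 2]) (rule Bochner_Integration.integral_nonneg[OF pos], simp)
  have "((\<lambda>Y. LINT v|lborel. indicator {sqrt 2<..} v * (v\<^sup>2 * Kdiff 1 (1 / Y) v)) \<longlongrightarrow> (LINT v|lborel. indicator {sqrt 2<..} v * ?f v)) at_top"
  proof (rule integral_dominated_convergence_at_top[where w="\<lambda>v. 8 * (indicator {sqrt 2..} v * (1 / v\<^sup>2))"])
    show "integrable lborel (\<lambda>v. 8 * (indicator {sqrt 2..} v * (1 / v\<^sup>2)) :: real)"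
      by (intro integrable_mult_right integral_Ici_power(1)) simp
    show "AE v in lborel. ((\<lambda>Y. indicator {sqrt 2<..} v * (v\<^sup>2 * Kdiff 1 (1 / Y) v)) \<longlongrightarrow> indicator {sqrt 2<..} v * ?f v) at_top"
    proof (rule AE_I2)
      fix v :: real
      show "((\<lambda>Y. indicator {sqrt 2<..} v * (v\<^sup>2 * Kdiff 1 (1 / Y) v)) \<longlongrightarrow> indicator {sqrt 2<..} v * ?f v) at_top"
      proof (cases "sqrt 2 < v")
        case True
        have v: "2 \<le> v\<^sup>2" "0 < v" using v2[of v] True s2 by (simp, linarith)
        have e: "v\<^sup>2 * Kdiff 1 (1 / Y) v = v\<^sup>2 / (v\<^sup>2 - 1) * tanh ((v\<^sup>2 - 1) * Y / 2) - 1" for Y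
          using v by (simp add: Kdiff_def Kinv_def right_diff_distrib)
        have "((\<lambda>Y. v\<^sup>2 / (v\<^sup>2 - 1) * tanh ((v\<^sup>2 - 1) * Y / 2) - 1) \<longlongrightarrow> v\<^sup>2 / (v\<^sup>2 - 1) * sgn (v\<^sup>2 - 1) - 1) at_top"
          using v by (intro tendsto_intros tanh_scaled_tendsto) auto
        moreover have "v\<^sup>2 / (v\<^sup>2 - 1) * sgn (v\<^sup>2 - 1) - 1 = ?f v" using v by (simp add: field_simps)
        ultimately show ?thesis using True by (simp add: e)
      qed simp
    qed
    show "\<forall>\<^sub>F Y in at_top. AE v in lborel. norm (indicator {sqrt 2<..} v * (v\<^sup>2 * Kdiff 1 (1 / Y) v)) \<le> 8 * (indicator {sqrt 2..} v * (1 / v\<^sup>2))"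
      using eventually_ge_at_top[of 1]
    proof eventually_elim
      case (elim Y)
      then have Y: "0 < 1 / Y" "1 / Y \<le> 1" by auto
      show ?case
      proof (rule AE_I2)
        fix v :: real
        show "norm (indicator {sqrt 2<..} v * (v\<^sup>2 * Kdiff 1 (1 / Y) v)) \<le> 8 * (indicator {sqrt 2..} v * (1 / v\<^sup>2))"
        proof (cases "sqrt 2 < v")
          case True
          have "\<bar>Kdiff 1 (1 / Y) v\<bar> \<le> 8 / v ^ 4" using Kdiff_tail[OF Y, of v] v2[of v] True by simp
          then have "v\<^sup>2 * \<bar>Kdiff 1 (1 / Y) v\<bar> \<le> v\<^sup>2 * (8 / v ^ 4)" by (rule mult_left_mono) simp
          also have "\<dots> = 8 / v\<^sup>2" by (simp add: power2_eq_square power4_eq_xxxx)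
          finally show ?thesis using True by (simp add: abs_mult)
        qed simp
      qed
    qed
  qed measurable
  then show ?thesis unfolding fI .
qed

text \<open>Sum of the three pieces and of \<open>- sqrt 2\<close>, the integral of the subtracted 1
  up to the cut. The terms \<open>sqrt 2\<close> and \<open>ln (1 + sqrt 2)\<close> are artifacts of
  the cut and cancel; \<open>- ln (pi / 2) + 2 * ln 2\<close> combines to
  \<open>ln (8 / pi)\<close>.\<close>

theorem scaled_gap_asymp:
  "((\<lambda>Y. scaled_gap Y - ln Y) \<longlongrightarrow> euler_mascheroni - 2 + ln (8 / pi)) at_top"
proof -
  let ?c = "\<lambda>Y v. indicator {0..sqrt 2} v * (v * (tanh ((v\<^sup>2 - 1) * Y / 2) / (v\<^sup>2 - 1)))"
  let ?s = "\<lambda>Y v. indicator {0..sqrt 2} v * (tanh ((v\<^sup>2 - 1) * Y / 2) * (v / (v + 1)))"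
  let ?t = "\<lambda>Y v. indicator {sqrt 2<..} v * (v\<^sup>2 * Kdiff 1 (1 / Y) v)"
  let ?o = "\<lambda>v::real. indicator {0..sqrt 2} v :: real"
  have eq: "scaled_gap Y - ln Y = (tanh_int Y - ln Y) + (LINT v|lborel. ?s Y v) + (LINT v|lborel. ?t Y v) - sqrt 2" if Y: "1 \<le> Y" for Y
  proof -
    have Y0: "0 < 1 / Y" "1 / Y \<le> 1" using Y by auto
    have oi: "integrable lborel ?o" by (rule integrable_real_indicator) auto
    have ci: "integrable lborel (?c Y)" using scaled_gap_core(2)[of Y] Y by simp
    have si: "integrable lborel (?s Y)"
    proof (rule Bochner_Integration.integrable_bound[OF oi])
      show "AE v in lborel. norm (?s Y v) \<le> norm (?o v)"
      proof (rule AE_I2)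
        fix v :: real
        have "\<bar>tanh ((v\<^sup>2 - 1) * Y / 2)\<bar> \<le> 1" using tanh_real_abs[of "(v\<^sup>2 - 1) * Y / 2"] tanh_real_lt_1[of "\<bar>(v\<^sup>2 - 1) * Y / 2\<bar>"] by linarith
        moreover have "\<bar>v / (v + 1)\<bar> \<le> 1" if "0 \<le> v" using that by (simp add: abs_of_nonneg)
        ultimately have "\<bar>tanh ((v\<^sup>2 - 1) * Y / 2)\<bar> * \<bar>v / (v + 1)\<bar> \<le> 1 * 1" if "0 \<le> v" using that by (intro mult_mono) auto
        then show "norm (?s Y v) \<le> norm (?o v)" by (auto split: split_indicator simp: abs_mult)
      qed
    qed measurable
    have ti: "integrable lborel (?t Y)"
    proof (rule Bochner_Integration.integrable_bound[OF Kdiff_radial_integrable[OF Y0]])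
      show "AE v in lborel. norm (?t Y v) \<le> norm (indicator {0..} v * (v\<^sup>2 * Kdiff 1 (1 / Y) v))"
      proof (rule AE_I2)
        fix v :: real show "norm (?t Y v) \<le> norm (indicator {0..} v * (v\<^sup>2 * Kdiff 1 (1 / Y) v))"
          using order_trans[of 0 "sqrt 2" v] by (auto split: split_indicator)
      qed
    qed measurable
    have pw: "AE v in lborel. indicator {0..} v * (v\<^sup>2 * Kdiff 1 (1 / Y) v) = ((?c Y v + ?s Y v) - ?o v) + ?t Y v"
      using AE_lborel_singleton[of 0]
    proof eventually_elim
      case (elim v)
      show ?case
      proof (cases "v \<in> {0..sqrt 2}")
        case True
        have a: "v\<^sup>2 * Kdiff 1 (1 / Y) v = v\<^sup>2 * (tanh ((v\<^sup>2 - 1) * Y / 2) / (v\<^sup>2 - 1)) - 1"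
          using elim by (simp add: Kdiff_def Kinv_def right_diff_distrib)
        \<comment> \<open>Partial fractions; at \<open>v = 1\<close> the identity holds because both
          sides are 0 by the convention for division.\<close>
        have b: "v\<^sup>2 * (tanh ((v\<^sup>2 - 1) * Y / 2) / (v\<^sup>2 - 1)) =
            v * (tanh ((v\<^sup>2 - 1) * Y / 2) / (v\<^sup>2 - 1)) + tanh ((v\<^sup>2 - 1) * Y / 2) * (v / (v + 1))"
        proof (cases "v = 1")
          case False
          have "v\<^sup>2 - 1 = (v - 1) * (v + 1)" by (simp add: power2_eq_square algebra_simps)
          moreover have "v - 1 \<noteq> 0" "v + 1 \<noteq> 0" using False True by auto
          moreover have "v\<^sup>2 * (t / ((v - 1) * (v + 1))) = v * (t / ((v - 1) * (v + 1))) + t * (v / (v + 1))"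
            if "v - 1 \<noteq> 0" "v + 1 \<noteq> 0" for t using that by (simp add: divide_simps) (simp add: power2_eq_square algebra_simps)
          ultimately show ?thesis by metis
        qed simp
        show ?thesis using True unfolding a b by simp
      next
        case False
        then show ?thesis using order_trans[of 0 "sqrt 2" v] by (auto split: split_indicator)
      qed
    qed
    have "scaled_gap Y = (LINT v|lborel. ((?c Y v + ?s Y v) - ?o v) + ?t Y v)"
      unfolding scaled_gap_def by (rule integral_cong_AE[OF _ _ pw]) measurable
    also have "\<dots> = (((LINT v|lborel. ?c Y v) + (LINT v|lborel. ?s Y v)) - (LINT v|lborel. ?o v)) + (LINT v|lborel. ?t Y v)"
      using ci si oi ti by (simp only: Bochner_Integration.integral_add Bochner_Integration.integral_diff
        Bochner_Integration.integrable_add Bochner_Integration.integrable_diff)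
    also have "(LINT v|lborel. ?o v) = sqrt 2" by simp
    also have "(LINT v|lborel. ?c Y v) = tanh_int Y" using scaled_gap_core(1)[of Y] Y by simp
    finally show ?thesis by simp
  qed
  have lim: "((\<lambda>Y. (tanh_int Y - ln Y) + (LINT v|lborel. ?s Y v) + (LINT v|lborel. ?t Y v) - sqrt 2) \<longlongrightarrow>
      (euler_mascheroni - ln (pi / 2)) + (sqrt 2 - ln (1 + sqrt 2) - 2 + 2 * ln 2) + ln (1 + sqrt 2) - sqrt 2) at_top"
    by (intro tendsto_add tendsto_diff tendsto_const tanh_int_asymp scaled_gap_smooth_part scaled_gap_tail)
  have val: "(euler_mascheroni - ln (pi / 2)) + (sqrt 2 - ln (1 + sqrt 2) - 2 + 2 * ln 2) + ln (1 + sqrt 2) - sqrt 2 =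
      euler_mascheroni - 2 + ln (8 / pi)"
  proof -
    have "ln (8 :: real) = 3 * ln 2" using ln_realpow[of "2::real" 3] by simp
    then have "ln (8 / pi) = 3 * ln 2 - ln pi" by (simp add: ln_div)
    moreover have "ln (pi / 2) = ln pi - ln 2" by (simp add: ln_div)
    ultimately show ?thesis by simp
  qed
  have ev: "eventually (\<lambda>Y. (tanh_int Y - ln Y) + (LINT v|lborel. ?s Y v) + (LINT v|lborel. ?t Y v) - sqrt 2 = scaled_gap Y - ln Y) at_top"
    using eventually_ge_at_top[of 1] by eventually_elim (simp add: eq)
  show ?thesis by (rule Lim_transform_eventually[OF lim[unfolded val] ev])
qed

section \<open>Moments of the kernel at small momenta\<close>

lemma integral_radial_tails:
  fixes R :: real assumes R: "0 < R"
  shows "integrable lebesgue (\<lambda>p::real^3. indicator {R..} (norm p) * (1 / norm p ^ 4))"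
    and "(LINT p|lebesgue. indicator {R..} (norm (p::real^3)) * (1 / norm p ^ 4)) = 4 * pi / R"
    and "integrable lebesgue (\<lambda>p::real^3. indicator {R..} (norm p) * (1 / (norm p ^ 3 * sqrt (norm p))))"
    and "(LINT p|lebesgue. indicator {R..} (norm (p::real^3)) * (1 / (norm p ^ 3 * sqrt (norm p)))) = 8 * pi / sqrt R"
proof -
  have e4: "4 * pi * r\<^sup>2 * indicator {0..} r * (indicator {R..} r * (1 / r ^ 4)) = (4 * pi) * (indicator {R..} r * (1 / r\<^sup>2))" for r
  proof (cases "R \<le> r")
    case True
    then have "0 < r" using R by linarith
    then show ?thesis by (simp add: power2_eq_square power4_eq_xxxx)
  qed simp
  have e3: "4 * pi * r\<^sup>2 * indicator {0..} r * (indicator {R..} r * (1 / (r ^ 3 * sqrt r))) = (4 * pi) * (indicator {R..} r * (1 / (r * sqrt r)))" for r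
  proof (cases "R \<le> r")
    case True
    then have "0 < r" using R by linarith
    then show ?thesis by (simp add: power2_eq_square power3_eq_cube)
  qed simp
  have m4: "(\<lambda>r::real. indicator {R..} r * (1 / r ^ 4)) \<in> borel_measurable borel" by measurable
  have m3: "(\<lambda>r::real. indicator {R..} r * (1 / (r ^ 3 * sqrt r))) \<in> borel_measurable borel" by measurable
  note I = integral_Ici_power[OF R]
  show "integrable lebesgue (\<lambda>p::real^3. indicator {R..} (norm p) * (1 / norm p ^ 4))"
    unfolding integrable_radial(1)[OF m4] e4 by (intro integrable_mult_right I)
  show "(LINT p|lebesgue. indicator {R..} (norm (p::real^3)) * (1 / norm p ^ 4)) = 4 * pi / R"
    unfolding integrable_radial(2)[OF m4] e4 by (simp only: integral_mult_right_zero I) simp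
  show "integrable lebesgue (\<lambda>p::real^3. indicator {R..} (norm p) * (1 / (norm p ^ 3 * sqrt (norm p))))"
    unfolding integrable_radial(1)[OF m3] e3 by (intro integrable_mult_right I)
  show "(LINT p|lebesgue. indicator {R..} (norm (p::real^3)) * (1 / (norm p ^ 3 * sqrt (norm p)))) = 8 * pi / sqrt R"
    unfolding integrable_radial(2)[OF m3] e3 by (simp only: integral_mult_right_zero I) simp
qed

lemma Kdiff_outside:
  assumes T: "0 < T" "T \<le> \<mu>" and r: "sqrt (2 * \<mu>) \<le> r" shows "\<bar>Kdiff \<mu> T r\<bar> \<le> 8 * \<mu> / r ^ 4"
proof (rule Kdiff_tail[OF T])
  have "(sqrt (2 * \<mu>))\<^sup>2 \<le> r\<^sup>2" using r T by (intro power_mono) auto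
  then show "2 * \<mu> \<le> r\<^sup>2" using T by simp
qed

text \<open>The negative part of \<open>Kdiff\<close> is at most \<open>1 / p^2\<close> inside the
  ball of radius \<open>sqrt (2 \<mu>)\<close> and of the size of the tail outside, so its integral
  is O(sqrt \<mu>). A bound on \<open>gap_int\<close> therefore bounds the L^1-norm as well, however
  small \<open>T\<close> is.\<close>

lemma Kdiff_abs_integral:
  assumes T: "0 < T" "T \<le> \<mu>"
  shows "(LINT p|lebesgue. \<bar>Kdiff \<mu> T (norm (p::real^3))\<bar>) \<le> (LINT p|lebesgue. Kdiff \<mu> T (norm (p::real^3))) + 40 * pi * sqrt (2 * \<mu>)"
proof -
  let ?R = "sqrt (2 * \<mu>)"
  have R: "0 < ?R" using T by simp
  let ?A = "\<lambda>p::real^3. if norm p \<le> ?R then 1 / (norm p)\<^sup>2 else 0"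
  let ?B = "\<lambda>p::real^3. indicator {?R..} (norm p) * (1 / norm p ^ 4) :: real"
  note A = integral_inverse_square_ball[OF less_imp_le[OF R]]
  note B = integral_radial_tails(1,2)[OF R]
  note Di = Kdiff_integrable[OF T]
  have le: "\<bar>Kdiff \<mu> T (norm p)\<bar> \<le> Kdiff \<mu> T (norm p) + 2 * (?A p + 8 * \<mu> * ?B p)" for p :: "real^3"
  proof -
    have "- Kdiff \<mu> T (norm p) \<le> ?A p + 8 * \<mu> * ?B p"
    proof (cases "norm p \<le> ?R")
      case True
      have "- Kdiff \<mu> T (norm p) \<le> 1 / (norm p)\<^sup>2" using Kinv_nonneg[OF T(1), of \<mu> "norm p"] by (simp add: Kdiff_def)
      moreover have "0 \<le> 8 * \<mu> * ?B p" using T by simp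
      ultimately show ?thesis using True by simp
    next
      case False
      then show ?thesis using Kdiff_outside[OF T, of "norm p"] by simp
    qed
    moreover have "0 \<le> ?A p + 8 * \<mu> * ?B p" using T by simp
    moreover have "\<bar>x\<bar> \<le> x + 2 * q" if "- x \<le> q" "0 \<le> q" for x q :: real using that by linarith
    ultimately show ?thesis by blast
  qed
  have ABi: "integrable lebesgue (\<lambda>p. 2 * (?A p + 8 * \<mu> * ?B p))"
    by (rule integrable_mult_right, rule Bochner_Integration.integrable_add, rule A(1), rule integrable_mult_right, rule B(1))
  have "(LINT p|lebesgue. \<bar>Kdiff \<mu> T (norm (p::real^3))\<bar>) \<le> (LINT p|lebesgue. Kdiff \<mu> T (norm (p::real^3)) + 2 * (?A p + 8 * \<mu> * ?B p))"
    by (rule integral_mono[OF integrable_abs[OF Di] Bochner_Integration.integrable_add[OF Di ABi] le])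
  also have "\<dots> = (LINT p|lebesgue. Kdiff \<mu> T (norm (p::real^3))) + (LINT p|lebesgue. 2 * (?A p + 8 * \<mu> * ?B p))"
    by (rule Bochner_Integration.integral_add[OF Di ABi])
  also have "(LINT p|lebesgue. 2 * (?A p + 8 * \<mu> * ?B p)) = 2 * ((LINT p|lebesgue. ?A p) + 8 * \<mu> * (LINT p|lebesgue. ?B p))"
    by (simp only: integral_mult_right_zero Bochner_Integration.integral_add[OF A(1) integrable_mult_right[OF B(1)]])
  also have "\<dots> = 2 * (4 * pi * ?R + 8 * \<mu> * (4 * pi / ?R))" unfolding A(2) B(2) ..
  also have "8 * \<mu> * (4 * pi / ?R) = 16 * pi * ?R"
  proof -
    have "?R * ?R = 2 * \<mu>" using T by simp
    then have "8 * \<mu> * (4 * pi) = 16 * pi * ?R * ?R" by (simp add: algebra_simps)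
    then show ?thesis using R by (simp add: field_simps)
  qed
  finally show ?thesis by simp
qed

text \<open>The envelope for the mean of \<open>min 1 ((p t)^2)\<close> under
  \<open>|Kdiff|\<close>: the first term comes from \<open>p^2 \<le> 2 \<mu>\<close>, the second
  from the tail. Divided by \<open>sqrt \<mu>\<close> it tends to 0 for each \<open>t\<close> and
  stays below \<open>2 * (1 + t)\<close>, which is where the weight on the potential is
  spent.\<close>

definition bw :: "real \<Rightarrow> real \<Rightarrow> real" where
  "bw \<mu> t = min 1 (\<mu> * t\<^sup>2) + sqrt \<mu> * sqrt (sqrt \<mu> * t)"

lemma bw_measurable [measurable]: "bw \<mu> \<in> borel_measurable borel"
  unfolding bw_def by measurable

lemma bw_nonneg: "0 \<le> \<mu> \<Longrightarrow> 0 \<le> t \<Longrightarrow> 0 \<le> bw \<mu> t"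
  by (simp add: bw_def)

lemma Kdiff_weighted_integral:
  assumes T: "0 < T" "T \<le> \<mu>" and N: "(LINT p|lebesgue. \<bar>Kdiff \<mu> T (norm (p::real^3))\<bar>) \<le> N" and t: "0 \<le> t"
  shows "integrable lebesgue (\<lambda>p::real^3. \<bar>Kdiff \<mu> T (norm p)\<bar> * min 1 ((norm p * t)\<^sup>2))"
    and "(LINT p|lebesgue. \<bar>Kdiff \<mu> T (norm (p::real^3))\<bar> * min 1 ((norm p * t)\<^sup>2)) \<le> N"
    and "(LINT p|lebesgue. \<bar>Kdiff \<mu> T (norm (p::real^3))\<bar> * min 1 ((norm p * t)\<^sup>2)) \<le> (2 * N + 64 * pi) * bw \<mu> t"
proof -
  let ?D = "\<lambda>p::real^3. \<bar>Kdiff \<mu> T (norm p)\<bar>"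
  let ?I = "LINT p|lebesgue. ?D p * min 1 ((norm p * t)\<^sup>2)"
  note Di = integrable_abs[OF Kdiff_integrable[OF T]]
  have le1: "?D p * min 1 ((norm p * t)\<^sup>2) \<le> ?D p" for p by (rule mult_left_le) auto
  show i: "integrable lebesgue (\<lambda>p::real^3. ?D p * min 1 ((norm p * t)\<^sup>2))"
    by (rule Bochner_Integration.integrable_bound[OF Di]) (measurable, use le1 in auto)
  have "?I \<le> (LINT p|lebesgue. ?D p)" by (rule integral_mono[OF i Di le1])
  then show "?I \<le> N" using N by linarith
  let ?R = "sqrt (2 * \<mu>)"
  have R: "0 < ?R" using T by simp
  let ?C = "\<lambda>p::real^3. indicator {?R..} (norm p) * (1 / (norm p ^ 3 * sqrt (norm p))) :: real"
  note C = integral_radial_tails(3,4)[OF R]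
  have le2: "?D p * min 1 ((norm p * t)\<^sup>2) \<le> (2 * min 1 (\<mu> * t\<^sup>2)) * ?D p + (8 * \<mu> * sqrt t) * ?C p" for p
  proof (cases "norm p \<le> ?R")
    case True
    then have "(norm p)\<^sup>2 \<le> ?R\<^sup>2" by (intro power_mono) auto
    then have "(norm p * t)\<^sup>2 \<le> 2 * \<mu> * t\<^sup>2" using T by (simp add: power_mult_distrib mult_right_mono)
    then have "min 1 ((norm p * t)\<^sup>2) \<le> 2 * min 1 (\<mu> * t\<^sup>2)" by (auto simp: min_def)
    then have "?D p * min 1 ((norm p * t)\<^sup>2) \<le> ?D p * (2 * min 1 (\<mu> * t\<^sup>2))" by (intro mult_left_mono) auto
    moreover have "0 \<le> (8 * \<mu> * sqrt t) * ?C p" using T t by simp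
    ultimately show ?thesis by (simp add: mult.commute)
  next
    case False
    then have p: "0 < norm p" "?R \<le> norm p" using R by auto
    \<comment> \<open>An exponent below 1 is essential: with \<open>min 1 (s^2) \<le> s\<close> the
      tail of order \<open>|p|^-4\<close> would leave a logarithmically divergent integral. The
      square root converges and still gains a power of \<mu> beyond
      \<open>sqrt \<mu>\<close>.\<close>
    have ms: "min 1 (s\<^sup>2) \<le> sqrt s" if "0 \<le> s" for s :: real
    proof (cases "s \<le> 1")
      case True
      have "s\<^sup>2 \<le> s * 1" using True that unfolding power2_eq_square by (intro mult_left_mono) auto
      also have "\<dots> \<le> sqrt s" using True that by (intro real_le_rsqrt) (simp add: power2_eq_square mult_left_le)
      finally show ?thesis by simp
    qed simp
    have "?D p * min 1 ((norm p * t)\<^sup>2) \<le> 8 * \<mu> / norm p ^ 4 * sqrt (norm p * t)"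
      using Kdiff_outside[OF T p(2)] ms[of "norm p * t"] t T by (intro mult_mono) auto
    also have "\<dots> = (8 * \<mu> * sqrt t) * (1 / (norm p ^ 3 * sqrt (norm p)))"
    proof -
      have "sqrt (norm p) * sqrt (norm p) = norm p" by simp
      then have "norm p ^ 4 = norm p ^ 3 * (sqrt (norm p) * sqrt (norm p))" by (simp add: power4_eq_xxxx power3_eq_cube)
      then show ?thesis using p by (simp add: real_sqrt_mult del: real_sqrt_mult_self)
    qed
    finally have "?D p * min 1 ((norm p * t)\<^sup>2) \<le> (8 * \<mu> * sqrt t) * ?C p" using p by simp
    moreover have "0 \<le> (2 * min 1 (\<mu> * t\<^sup>2)) * ?D p" using T by simp
    ultimately show ?thesis by linarith
  qed
  have "?I \<le> (LINT p|lebesgue. (2 * min 1 (\<mu> * t\<^sup>2)) * ?D p + (8 * \<mu> * sqrt t) * ?C p)"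
    by (rule integral_mono[OF i _ le2]) (intro Bochner_Integration.integrable_add integrable_mult_right Di C)
  also have "\<dots> = (2 * min 1 (\<mu> * t\<^sup>2)) * (LINT p|lebesgue. ?D p) + (8 * \<mu> * sqrt t) * (LINT p|lebesgue. ?C p)"
    by (simp only: integral_mult_right_zero Bochner_Integration.integral_add[OF integrable_mult_right[OF Di] integrable_mult_right[OF C(1)]])
  also have "\<dots> \<le> (2 * min 1 (\<mu> * t\<^sup>2)) * N + (8 * \<mu> * sqrt t) * (8 * pi / sqrt ?R)"
    unfolding C(2) using N T by (intro add_right_mono mult_left_mono) auto
  also have "\<dots> \<le> (2 * N) * min 1 (\<mu> * t\<^sup>2) + (64 * pi) * (sqrt \<mu> * sqrt (sqrt \<mu> * t))"
  proof -
    let ?q = "sqrt (sqrt \<mu>)"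
    have q: "0 < ?q" using T by simp
    have "?q \<le> sqrt ?R" using T by simp
    then have "8 * pi / sqrt ?R \<le> 8 * pi / ?q" using q by (intro divide_left_mono mult_pos_pos) auto
    then have "(8 * \<mu> * sqrt t) * (8 * pi / sqrt ?R) \<le> (8 * \<mu> * sqrt t) * (8 * pi / ?q)"
      using T t by (intro mult_left_mono) auto
    also have "\<dots> = (64 * pi) * (sqrt \<mu> * sqrt (sqrt \<mu> * t))"
    proof -
      have qq: "?q * ?q = sqrt \<mu>" using T by simp
      have "\<mu> = sqrt \<mu> * sqrt \<mu>" using T by simp
      also have "\<dots> = sqrt \<mu> * (?q * ?q)" unfolding qq ..
      finally have "\<mu> / ?q = sqrt \<mu> * ?q" using q by (simp add: field_simps)
      moreover have "(8 * \<mu> * sqrt t) * (8 * pi / ?q) = 64 * pi * (\<mu> / ?q) * sqrt t" by simp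
      ultimately have "(8 * \<mu> * sqrt t) * (8 * pi / ?q) = 64 * pi * (sqrt \<mu> * ?q) * sqrt t" by (simp only:)
      then show ?thesis by (simp add: real_sqrt_mult)
    qed
    finally show ?thesis by simp
  qed
  also have "\<dots> \<le> (2 * N + 64 * pi) * bw \<mu> t"
  proof -
    have "0 \<le> N" using N by (rule order_trans[rotated]) simp
    moreover have "0 \<le> min 1 (\<mu> * t\<^sup>2)" "0 \<le> sqrt \<mu> * sqrt (sqrt \<mu> * t)" using T t by auto
    ultimately have "0 \<le> (64 * pi) * min 1 (\<mu> * t\<^sup>2)" "0 \<le> 2 * N * (sqrt \<mu> * sqrt (sqrt \<mu> * t))" by (auto intro!: mult_nonneg_nonneg)
    then show ?thesis unfolding bw_def by (simp add: ring_distribs)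
  qed
  finally show "?I \<le> (2 * N + 64 * pi) * bw \<mu> t" .
qed

lemma bw_scaled_le:
  assumes "0 < \<mu>" "\<mu> \<le> 1" "0 \<le> t" shows "bw \<mu> t \<le> sqrt \<mu> * (2 * (1 + t))"
proof -
  have "min 1 (\<mu> * t\<^sup>2) \<le> sqrt \<mu> * t"
  proof (cases "sqrt \<mu> * t \<le> 1")
    case True
    have "\<mu> * t\<^sup>2 = (sqrt \<mu> * t) * (sqrt \<mu> * t)" using assms by (simp add: power2_eq_square)
    also have "\<dots> \<le> (sqrt \<mu> * t) * 1" using True assms by (intro mult_left_mono) auto
    finally show ?thesis by simp
  qed simp
  moreover have "sqrt (sqrt \<mu> * t) \<le> 2 + t"
  proof (rule real_le_lsqrt)
    have "sqrt \<mu> * t \<le> 1 * t" using assms by (intro mult_right_mono) auto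
    also have "\<dots> \<le> (2 + t)\<^sup>2" using assms by (simp add: power2_sum)
    finally show "sqrt \<mu> * t \<le> (2 + t)\<^sup>2" .
  qed (use assms in auto)
  then have "sqrt \<mu> * sqrt (sqrt \<mu> * t) \<le> sqrt \<mu> * (2 + t)" using assms by (intro mult_left_mono) auto
  ultimately show ?thesis unfolding bw_def by (simp add: algebra_simps)
qed

lemma bw_integrable:
  fixes G :: "real^3 \<Rightarrow> real"
  assumes G: "integrable lebesgue (\<lambda>x. G x * (1 + norm x))" and mu: "0 < \<mu>" "\<mu> \<le> 1"
    and [measurable]: "G \<in> borel_measurable lebesgue"
  shows "integrable lebesgue (\<lambda>x. G x * bw \<mu> (norm x))"
proof (rule Bochner_Integration.integrable_bound[of _ "\<lambda>x. (2 * sqrt \<mu>) * (G x * (1 + norm x))"])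
  show "integrable lebesgue (\<lambda>x. (2 * sqrt \<mu>) * (G x * (1 + norm x)))" by (intro integrable_mult_right G)
  show "AE x in lebesgue. norm (G x * bw \<mu> (norm x)) \<le> norm ((2 * sqrt \<mu>) * (G x * (1 + norm x)))"
  proof (rule AE_I2)
    fix x :: "real^3"
    have "\<bar>G x\<bar> * bw \<mu> (norm x) \<le> \<bar>G x\<bar> * (sqrt \<mu> * (2 * (1 + norm x)))" using bw_scaled_le[OF mu, of "norm x"] by (intro mult_left_mono) auto
    then show "norm (G x * bw \<mu> (norm x)) \<le> norm ((2 * sqrt \<mu>) * (G x * (1 + norm x)))"
      using mu bw_nonneg[of \<mu> "norm x"] by (simp add: abs_mult abs_of_nonneg ac_simps)
  qed
qed measurable

text \<open>Dominated convergence with majorant \<open>2 |G| (1 + |x|)\<close>: the gain from O(sqrt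
  \<mu>) to o(sqrt \<mu>) comes from pointwise convergence and carries no rate.\<close>

lemma bw_integral_tendsto:
  fixes G :: "real^3 \<Rightarrow> real"
  assumes G: "integrable lebesgue (\<lambda>x. G x * (1 + norm x))" and [measurable]: "G \<in> borel_measurable lebesgue"
  shows "((\<lambda>\<mu>. (LINT x|lebesgue. G x * bw \<mu> (norm x)) / sqrt \<mu>) \<longlongrightarrow> 0) (at_right 0)"
  unfolding filterlim_at_right_to_top
proof -
  let ?f = "\<lambda>Y x. G x * bw (inverse Y) (norm x) / sqrt (inverse Y)"
  have pw: "((\<lambda>Y. bw (inverse Y) t / sqrt (inverse Y)) \<longlongrightarrow> 0) at_top" if t: "0 \<le> t" for t
  proof -
    have i: "((\<lambda>Y::real. inverse Y) \<longlongrightarrow> 0) at_top" by (rule tendsto_inverse_0_at_top) (rule filterlim_ident)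
    have l1: "((\<lambda>Y. sqrt (inverse Y) * t\<^sup>2 + sqrt (sqrt (inverse Y) * t)) \<longlongrightarrow> sqrt 0 * t\<^sup>2 + sqrt (sqrt 0 * t)) at_top"
      by (intro tendsto_intros i)
    have ev: "eventually (\<lambda>Y. norm (bw (inverse Y) t / sqrt (inverse Y)) \<le> sqrt (inverse Y) * t\<^sup>2 + sqrt (sqrt (inverse Y) * t)) at_top"
      using eventually_gt_at_top[of 0]
    proof eventually_elim
      case (elim Y)
      define m where "m = inverse Y"
      have m: "0 < m" using elim by (simp add: m_def)
      have mm: "m / sqrt m = sqrt m" using m by (simp add: real_div_sqrt)
      have "bw m t / sqrt m \<le> (m * t\<^sup>2 + sqrt m * sqrt (sqrt m * t)) / sqrt m"
        unfolding bw_def using m by (intro divide_right_mono) auto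
      also have "\<dots> = sqrt m * t\<^sup>2 + sqrt (sqrt m * t)"
        using m mm by (simp add: add_divide_distrib) (metis times_divide_eq_left)
      finally show ?case using bw_nonneg[of m t] m t by (simp add: m_def)
    qed
    show ?thesis using Lim_null_comparison[OF ev] l1 by simp
  qed
  have "((\<lambda>Y. LINT x|lebesgue. ?f Y x) \<longlongrightarrow> (LINT x|(lebesgue :: (real^3) measure). 0)) at_top"
  proof (rule integral_dominated_convergence_at_top[where w="\<lambda>x. 2 * \<bar>G x * (1 + norm x)\<bar>"])
    show "integrable lebesgue (\<lambda>x. 2 * \<bar>G x * (1 + norm x)\<bar>)" by (intro integrable_mult_right integrable_abs G)
    show "AE x in lebesgue. ((\<lambda>Y. ?f Y x) \<longlongrightarrow> 0) at_top"
    proof (rule AE_I2)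
      fix x :: "real^3"
      have "((\<lambda>Y. G x * (bw (inverse Y) (norm x) / sqrt (inverse Y))) \<longlongrightarrow> G x * 0) at_top"
        by (intro tendsto_intros pw) simp
      then show "((\<lambda>Y. ?f Y x) \<longlongrightarrow> 0) at_top" by simp
    qed
    show "\<forall>\<^sub>F Y in at_top. AE x in lebesgue. norm (?f Y x) \<le> 2 * \<bar>G x * (1 + norm x)\<bar>"
      using eventually_ge_at_top[of 1]
    proof eventually_elim
      case (elim Y)
      define m where "m = inverse Y"
      have m: "0 < m" "m \<le> 1" using elim by (auto simp: m_def inverse_le_1_iff)
      show ?case
      proof (rule AE_I2)
        fix x :: "real^3"
        have "bw m (norm x) / sqrt m \<le> 2 * (1 + norm x)" using bw_scaled_le[OF m, of "norm x"] m by (simp add: field_simps)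
        then have "\<bar>G x\<bar> * (bw m (norm x) / sqrt m) \<le> \<bar>G x\<bar> * (2 * (1 + norm x))" by (intro mult_left_mono) auto
        then show "norm (?f Y x) \<le> 2 * \<bar>G x * (1 + norm x)\<bar>"
          using m bw_nonneg[of m "norm x"] by (simp add: m_def[symmetric] abs_mult abs_of_nonneg ac_simps)
      qed
    qed
  qed measurable
  then show "((\<lambda>Y. (LINT x|lebesgue. G x * bw (inverse Y) (norm x)) / sqrt (inverse Y)) \<longlongrightarrow> 0) at_top"
    by (simp only: integral_divide_zero integral_zero)
qed

text \<open>\<open>bw\<close> is increasing and doubles with factor 4. This separates the variables
  when the kernel is evaluated at \<open>x - y\<close>.\<close>

lemma bw_diff_le:
  fixes x y :: "real^3"
  assumes mu: "0 < \<mu>" shows "bw \<mu> (norm (x - y)) \<le> 4 * (bw \<mu> (norm x) + bw \<mu> (norm y))"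
proof -
  have mono: "bw \<mu> s \<le> bw \<mu> t" if "0 \<le> s" "s \<le> t" for s t
    unfolding bw_def using that mu by (intro add_mono min.mono mult_left_mono power_mono real_sqrt_le_mono) auto
  have dbl: "bw \<mu> (2 * t) \<le> 4 * bw \<mu> t" if "0 \<le> t" for t
  proof -
    have "min 1 (\<mu> * (2 * t)\<^sup>2) \<le> 4 * min 1 (\<mu> * t\<^sup>2)" by (auto simp: min_def power_mult_distrib)
    moreover have "sqrt (sqrt \<mu> * (2 * t)) \<le> 4 * sqrt (sqrt \<mu> * t)"
    proof -
      have "sqrt (sqrt \<mu> * (2 * t)) \<le> sqrt (16 * (sqrt \<mu> * t))" using mu that by simp
      also have "\<dots> = 4 * sqrt (sqrt \<mu> * t)" by (subst real_sqrt_mult) simp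
      finally show ?thesis .
    qed
    then have "sqrt \<mu> * sqrt (sqrt \<mu> * (2 * t)) \<le> sqrt \<mu> * (4 * sqrt (sqrt \<mu> * t))" using mu by (intro mult_left_mono) auto
    ultimately show ?thesis unfolding bw_def by simp
  qed
  let ?m = "max (norm x) (norm y)"
  have "norm (x - y) \<le> 2 * ?m" using norm_triangle_ineq4[of x y] by linarith
  then have "bw \<mu> (norm (x - y)) \<le> bw \<mu> (2 * ?m)" by (rule mono[OF norm_ge_zero])
  also have "\<dots> \<le> 4 * bw \<mu> ?m" by (rule dbl) (simp add: le_max_iff_disj)
  also have "bw \<mu> ?m \<le> bw \<mu> (norm x) + bw \<mu> (norm y)"
    using bw_nonneg[of \<mu> "norm x"] bw_nonneg[of \<mu> "norm y"] mu by (cases "norm x \<le> norm y") (simp_all add: max_def)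
  finally show ?thesis by simp
qed

lemma cmod_cis_minus_one_sq: "(cmod (cis s - 1))\<^sup>2 \<le> 4 * min 1 (s\<^sup>2)"
proof -
  have eq: "(cmod (cis s - 1))\<^sup>2 = 2 - 2 * cos s"
    using sin_cos_squared_add[of s] unfolding cmod_power2 by (simp add: power2_diff)
  have a: "2 - 2 * cos s \<le> 4" using cos_ge_minus_one[of s] by linarith
  have "1 - s\<^sup>2 / 2 \<le> cos s"
  proof -
    have "cos s = 1 - 2 * (sin (s / 2))\<^sup>2" using cos_double_sin[of "s / 2"] by simp
    moreover have "(sin (s / 2))\<^sup>2 \<le> (s / 2)\<^sup>2" using abs_sin_x_le_abs_x[of "s / 2"] by (intro abs_le_square_iff[THEN iffD1])
    ultimately show ?thesis by (simp add: power_divide)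
  qed
  then have "2 - 2 * cos s \<le> 4 * s\<^sup>2" using zero_le_power2[of s] by linarith
  with a show ?thesis unfolding eq by (auto simp: min_def)
qed

text \<open>The kernel is even, so that the first-order term of \<open>e\<^bsup>ixp\<^esup> - 1\<close> drops out.\<close>

lemma Kdiff_kernel_bound:
  fixes x :: "real^3"
  assumes T: "0 < T" "T \<le> \<mu>"
  shows "cmod (LINT p|lebesgue. (cis (p \<bullet> x) - 1) * complex_of_real (Kdiff \<mu> T (norm p))) \<le>
    2 * (LINT p|lebesgue. \<bar>Kdiff \<mu> T (norm (p::real^3))\<bar> * min 1 ((norm p * norm x)\<^sup>2))"
proof -
  let ?D = "\<lambda>p::real^3. Kdiff \<mu> T (norm p)"
  have Di: "integrable lebesgue ?D" by (rule Kdiff_integrable[OF T])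
  have Dc: "integrable lebesgue (\<lambda>p. complex_of_real (?D p))" using Di by simp
  have fi: "integrable lebesgue (\<lambda>p. (cis (p \<bullet> x) - 1) * complex_of_real (?D p))"
    using integrable_cis_mult[OF Dc, of 1 x] Dc by (simp add: left_diff_distrib inner_commute)
  let ?I = "LINT p|lebesgue. (cis (p \<bullet> x) - 1) * complex_of_real (?D p)"
  have Re: "Re ?I = (LINT p|lebesgue. (cos (p \<bullet> x) - 1) * ?D p)"
    using integral_Re[OF fi] by simp
  have Im: "Im ?I = (LINT p|lebesgue. sin (p \<bullet> x) * ?D p)"
    using integral_Im[OF fi] by simp
  have m: "(\<lambda>p. sin (p \<bullet> x) * ?D p) \<in> borel_measurable borel" by measurable
  have "(LINT p|lebesgue. sin (p \<bullet> x) * ?D p) = (LINT p|lborel. sin (p \<bullet> x) * ?D p)"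
    by (rule integral_completion) measurable
  also have "\<dots> = \<bar>-1\<bar> ^ DIM(real^3) *\<^sub>R (LINT p|lborel. sin ((0 + (-1) *\<^sub>R p) \<bullet> x) * ?D (0 + (-1) *\<^sub>R p))"
    by (rule lborel_integral_affine[OF m]) simp
  also have "\<dots> = - (LINT p|lborel. sin (p \<bullet> x) * ?D p)" by simp
  also have "(LINT p|lborel. sin (p \<bullet> x) * ?D p) = (LINT p|lebesgue. sin (p \<bullet> x) * ?D p)"
    by (rule integral_completion[symmetric]) measurable
  finally have Im0: "Im ?I = 0" unfolding Im by simp
  then have "cmod ?I = \<bar>LINT p|lebesgue. (cos (p \<bullet> x) - 1) * ?D p\<bar>" unfolding Re[symmetric] by (simp add: cmod_def)
  also have "\<dots> \<le> (LINT p|lebesgue. \<bar>(cos (p \<bullet> x) - 1) * ?D p\<bar>)" by (rule integral_abs_bound)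
  also have "\<dots> \<le> (LINT p|lebesgue. 2 * (\<bar>?D p\<bar> * min 1 ((norm p * norm x)\<^sup>2)))"
  proof (rule integral_mono_AE')
    show "integrable lebesgue (\<lambda>p. 2 * (\<bar>?D p\<bar> * min 1 ((norm p * norm x)\<^sup>2)))"
      by (intro integrable_mult_right Kdiff_weighted_integral(1)[OF T order_refl]) simp
    show "AE p in lebesgue. \<bar>(cos (p \<bullet> x) - 1) * ?D p\<bar> \<le> 2 * (\<bar>?D p\<bar> * min 1 ((norm p * norm x)\<^sup>2))"
    proof (rule AE_I2)
      fix p :: "real^3"
      let ?s = "p \<bullet> x"
      have "(cmod (cis ?s - 1))\<^sup>2 = 2 - 2 * cos ?s"
        using sin_cos_squared_add[of ?s] unfolding cmod_power2 by (simp add: power2_diff)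
      then have "\<bar>cos ?s - 1\<bar> \<le> 2 * min 1 (?s\<^sup>2)" using cmod_cis_minus_one_sq[of ?s] cos_le_one[of ?s] by linarith
      also have "min 1 (?s\<^sup>2) \<le> min 1 ((norm p * norm x)\<^sup>2)"
        using Cauchy_Schwarz_ineq2[of p x] by (intro min.mono order_refl abs_le_square_iff[THEN iffD1]) simp
      finally have "\<bar>cos ?s - 1\<bar> * \<bar>?D p\<bar> \<le> 2 * min 1 ((norm p * norm x)\<^sup>2) * \<bar>?D p\<bar>" by (intro mult_right_mono) auto
      then show "\<bar>(cos ?s - 1) * ?D p\<bar> \<le> 2 * (\<bar>?D p\<bar> * min 1 ((norm p * norm x)\<^sup>2))" by (simp add: abs_mult ac_simps)
    qed
  qed simp
  finally show ?thesis by simp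
qed

subsection \<open>Bounds on the critical temperature\<close>

lemma cmod_add_sq_weighted:
  assumes "0 < \<alpha>" "\<alpha> < 1" shows "(cmod (a + b))\<^sup>2 \<le> (cmod a)\<^sup>2 / \<alpha> + (cmod b)\<^sup>2 / (1 - \<alpha>)"
proof -
  let ?x = "cmod a" and ?y = "cmod b"
  have "(cmod (a + b))\<^sup>2 \<le> (?x + ?y)\<^sup>2" by (intro power_mono norm_triangle_ineq) auto
  also have "(?x + ?y)\<^sup>2 = ?x\<^sup>2 / \<alpha> + ?y\<^sup>2 / (1 - \<alpha>) - ((1 - \<alpha>) * ?x - \<alpha> * ?y)\<^sup>2 / (\<alpha> * (1 - \<alpha>))"
    using assms by (simp add: divide_simps) (simp add: power2_eq_square algebra_simps)
  also have "\<dots> \<le> ?x\<^sup>2 / \<alpha> + ?y\<^sup>2 / (1 - \<alpha>)" using assms by simp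
  finally show ?thesis .
qed

lemma FT_const_pos: "0 < (2 * pi) powr (-3/2 :: real)" by simp

text \<open>The splitting of \<open>\<psi>'\<close> into a low-momentum part \<open>Fl\<close>, whose inverse transform is close to the
  constant \<open>c\<close>, and a remainder. Where \<open>K \<le> p\<^sup>2\<close>, the remainder is chosen as \<open>K \<psi>' / p\<^sup>2\<close>; where
  \<open>K > p\<^sup>2\<close>, the low-momentum part is fixed to be \<open>\<kappa> (1/K - 1/p\<^sup>2)\<close>. With \<open>\<kappa>\<close> chosen as below the
  negative part of \<open>1/K - 1/p\<^sup>2\<close> enters the resulting bound \<open>|c|\<^sup>2 / gap_int\<close> with its correct sign.\<close>

lemma kinetic_decomposition:
  assumes T: "0 < T" "T \<le> \<mu>" and gap: "0 < gap_int \<mu> T" and psi: "\<psi>' \<in> L2"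
    and Ki: "integrable lebesgue (\<lambda>p. K_symbol \<mu> T p * (cmod (\<psi>' p))\<^sup>2)"
  obtains Fl c R where "integrable lebesgue Fl" "energy (\<lambda>p. \<psi>' p - Fl p)" "L1_L2 Fl" "0 \<le> R"
    "(enorm (\<lambda>p. \<psi>' p - Fl p))\<^sup>2 + R\<^sup>2 + (cmod c)\<^sup>2 / gap_int \<mu> T \<le> (LINT p|lebesgue. K_symbol \<mu> T p * (cmod (\<psi>' p))\<^sup>2)"
    "\<And>x. cmod (FT 1 Fl x - c) \<le>
      2 * ((2 * pi) powr (-3/2))\<^sup>2 / gap_int \<mu> T * cmod c * (LINT p|lebesgue. \<bar>Kdiff \<mu> T (norm (p::real^3))\<bar> * min 1 ((norm p * norm x)\<^sup>2))
      + 2 * (2 * pi) powr (-3/2) * R * sqrt (LINT p|lebesgue. \<bar>Kdiff \<mu> T (norm (p::real^3))\<bar> * min 1 ((norm p * norm x)\<^sup>2))"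
proof -
  define c0 :: real where "c0 = (2 * pi) powr (-3/2)"
  have c0: "0 < c0" unfolding c0_def by (rule FT_const_pos)
  define D where "D p = Kdiff \<mu> T (norm p)" for p :: "real^3"
  define k where "k p = Kinv \<mu> T (norm p)" for p :: "real^3"
  \<comment> \<open>Only the positive part of \<open>1/K - 1/p^2\<close> can serve as the weight of
    an inner product; the negative part is carried along separately.\<close>
  define Dp where "Dp p = max 0 (D p)" for p
  define Dn where "Dn p = max 0 (- D p)" for p
  note L2_measurable[OF psi, measurable]
  have [measurable]: "D \<in> borel_measurable lebesgue" "k \<in> borel_measurable lebesgue" unfolding D_def k_def by measurable
  have [measurable]: "Dp \<in> borel_measurable lebesgue" "Dn \<in> borel_measurable lebesgue" unfolding Dp_def Dn_def by measurable
  have K_eq: "K_symbol \<mu> T = (\<lambda>p. inverse (k p))" by (simp add: K_symbol_eq k_def fun_eq_iff)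
  have [measurable]: "K_symbol \<mu> T \<in> borel_measurable lebesgue" unfolding K_eq by measurable
  have mu: "0 < \<mu>" using T by simp
  have good: "AE p in lebesgue. 0 < k p \<and> p \<noteq> 0"
    using AE_norm_neq[of 0] AE_norm_neq[of "sqrt \<mu>"]
  proof eventually_elim
    case (elim p)
    have "(norm p)\<^sup>2 \<noteq> \<mu>" using elim by (metis norm_ge_zero real_sqrt_unique)
    then show ?case using elim Kinv_pos[OF T(1)] by (auto simp: k_def)
  qed
  have k0: "0 \<le> k p" for p unfolding k_def by (rule Kinv_nonneg[OF T(1)])
  have K0: "0 \<le> K_symbol \<mu> T p" for p unfolding K_eq using k0[of p] by simp
  have D_eq: "D p = k p - 1 / (norm p)\<^sup>2" for p by (simp add: D_def k_def Kdiff_def)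
  have Dpn: "D p = Dp p - Dn p" "0 \<le> Dp p" "0 \<le> Dn p" "Dp p \<le> \<bar>D p\<bar>" "Dn p \<le> \<bar>D p\<bar>" "Dp p \<le> k p" for p
  proof -
    show "D p = Dp p - Dn p" "0 \<le> Dp p" "0 \<le> Dn p" "Dp p \<le> \<bar>D p\<bar>" "Dn p \<le> \<bar>D p\<bar>" unfolding Dp_def Dn_def by (auto simp: max_def)
    have "D p \<le> k p" unfolding D_eq by simp
    then show "Dp p \<le> k p" unfolding Dp_def using k0[of p] by simp
  qed
  have Di: "integrable lebesgue D" unfolding D_def by (rule Kdiff_integrable[OF T])
  have Dpi: "integrable lebesgue Dp" and Dni: "integrable lebesgue Dn"
    using Dpn by (auto intro!: Bochner_Integration.integrable_bound[OF Di])
  define mp where "mp = c0\<^sup>2 * (LINT p|lebesgue. Dp p)"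
  define mn where "mn = c0\<^sup>2 * (LINT p|lebesgue. Dn p)"
  have gap_eq: "gap_int \<mu> T = mp - mn"
  proof -
    have "gap_int \<mu> T = c0\<^sup>2 * (LINT p|lebesgue. D p)" by (simp add: gap_int_def c0_def D_def)
    also have "(LINT p|lebesgue. D p) = (LINT p|lebesgue. Dp p) - (LINT p|lebesgue. Dn p)"
      unfolding Dpn(1) by (rule Bochner_Integration.integral_diff[OF Dpi Dni])
    finally show ?thesis by (simp add: mp_def mn_def right_diff_distrib)
  qed
  have "0 \<le> mn" unfolding mn_def using Dpn(3) by (intro mult_nonneg_nonneg Bochner_Integration.integral_nonneg) auto
  then have mp: "0 < mp" using gap gap_eq by simp
  \<comment> \<open>For a solution of \<open>K \<psi> = - V \<psi>\<close> this is the transform of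
    \<open>- V \<psi>\<close>, which varies slowly at momenta of order sqrt \<mu>. This is why it is
    compared with a constant.\<close>
  define h where "h p = complex_of_real (K_symbol \<mu> T p) * \<psi>' p" for p
  have [measurable]: "h \<in> borel_measurable lebesgue" unfolding h_def by measurable
  have hle: "AE p in lebesgue. Dp p * (cmod (h p))\<^sup>2 \<le> K_symbol \<mu> T p * (cmod (\<psi>' p))\<^sup>2"
    using good
  proof eventually_elim
    case (elim p)
    have "Dp p * (cmod (h p))\<^sup>2 \<le> k p * (cmod (h p))\<^sup>2" by (intro mult_right_mono Dpn(6)) simp
    also have "\<dots> = K_symbol \<mu> T p * (cmod (\<psi>' p))\<^sup>2"
      using elim by (simp add: h_def K_eq norm_mult power_mult_distrib power2_eq_square norm_inverse abs_of_pos)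
    finally show ?case .
  qed
  have Dh2: "integrable lebesgue (\<lambda>p. Dp p * (cmod (h p))\<^sup>2)"
    by (rule Bochner_Integration.integrable_bound[OF Ki])
       (measurable, use hle in eventually_elim, use Dpn(2) K0 in \<open>simp add: abs_mult\<close>)
  have Dh: "integrable lebesgue (\<lambda>p. complex_of_real (Dp p) * h p)"
  proof (rule Bochner_Integration.integrable_bound[of _ "\<lambda>p. Dp p + Dp p * (cmod (h p))\<^sup>2"])
    show "integrable lebesgue (\<lambda>p. Dp p + Dp p * (cmod (h p))\<^sup>2)" using Dpi Dh2 by simp
    show "AE p in lebesgue. norm (complex_of_real (Dp p) * h p) \<le> norm (Dp p + Dp p * (cmod (h p))\<^sup>2)"
    proof (rule AE_I2)
      fix p
      have "cmod (h p) \<le> 1 + (cmod (h p))\<^sup>2"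
        using sum_squares_bound[of 1 "cmod (h p)"] zero_le_power2[of "cmod (h p)"] unfolding power_one mult_1_right by linarith
      then have "Dp p * cmod (h p) \<le> Dp p * (1 + (cmod (h p))\<^sup>2)" by (intro mult_left_mono Dpn)
      then show "norm (complex_of_real (Dp p) * h p) \<le> norm (Dp p + Dp p * (cmod (h p))\<^sup>2)"
        using Dpn(2)[of p] by (simp add: norm_mult ring_distribs)
    qed
  qed measurable
  define a where "a = complex_of_real c0 * (LINT p|lebesgue. complex_of_real (Dp p) * h p)"
  \<comment> \<open>\<open>\<kappa>\<close> is the mean of \<open>h\<close> under the weight
    \<open>Dp\<close>. Using it as the coefficient on the negative part as well makes
    \<open>c\<close>, the value of the low-momentum part at the origin, proportional to
    \<open>mp - mn = gap_int\<close>.\<close>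
  define \<kappa> where "\<kappa> = complex_of_real (c0 / mp) * a"
  define c where "c = complex_of_real (gap_int \<mu> T / mp) * a"
  have \<kappa>c: "c0 * cmod \<kappa> = c0\<^sup>2 / gap_int \<mu> T * cmod c"
    using c0 mp gap by (simp add: \<kappa>_def c_def norm_mult norm_divide power2_eq_square)
  define Fl where "Fl p = complex_of_real (Dp p) * h p - \<kappa> * complex_of_real (Dn p)" for p
  have Flm[measurable]: "Fl \<in> borel_measurable lebesgue" unfolding Fl_def by measurable
  have Dnc: "integrable lebesgue (\<lambda>p. \<kappa> * complex_of_real (Dn p))" using Dni by simp
  have Fli: "integrable lebesgue Fl" unfolding Fl_def by (rule Bochner_Integration.integrable_diff[OF Dh Dnc])
  have intFl: "complex_of_real c0 * (LINT p|lebesgue. Fl p) = c"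
  proof -
    have "complex_of_real c0 * (LINT p|lebesgue. Fl p) = a - complex_of_real c0 * \<kappa> * complex_of_real (LINT p|lebesgue. Dn p)"
      unfolding Fl_def Bochner_Integration.integral_diff[OF Dh Dnc] by (simp add: a_def right_diff_distrib mult.assoc)
    also have "complex_of_real c0 * \<kappa> * complex_of_real (LINT p|lebesgue. Dn p) = complex_of_real (mn / mp) * a"
      by (simp add: \<kappa>_def mn_def power2_eq_square)
    also have "a - complex_of_real (mn / mp) * a = complex_of_real (1 - mn / mp) * a" by (simp add: left_diff_distrib)
    also have "1 - mn / mp = gap_int \<mu> T / mp" using mp by (simp add: gap_eq diff_divide_distrib)
    finally show ?thesis by (simp add: c_def)
  qed
  define Fu where "Fu p = \<psi>' p - Fl p" for p
  have Fum[measurable]: "Fu \<in> borel_measurable lebesgue" unfolding Fu_def by measurable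
  have pw: "AE p in lebesgue. (norm p)\<^sup>2 * (cmod (Fu p))\<^sup>2 + Dp p * (cmod (h p))\<^sup>2 - (cmod \<kappa>)\<^sup>2 * Dn p \<le>
      K_symbol \<mu> T p * (cmod (\<psi>' p))\<^sup>2"
    using good
  proof eventually_elim
    case (elim p)
    define E where "E = (norm p)\<^sup>2"
    define d where "d = D p"
    define kk where "kk = k p"
    have E: "0 < E" and kk: "0 < kk" using elim by (auto simp: E_def kk_def)
    have dE: "d = kk - 1 / E" by (simp add: d_def kk_def E_def D_eq)
    have K: "K_symbol \<mu> T p = 1 / kk" by (simp add: K_eq kk_def inverse_eq_divide)
    show ?case
    proof (cases "0 \<le> d")
      case True
      then have D1: "Dp p = d" "Dn p = 0" by (auto simp: Dp_def Dn_def d_def)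
      have "Fu p = complex_of_real (1 - d * (1 / kk)) * \<psi>' p"
        by (simp add: Fu_def Fl_def D1 h_def K left_diff_distrib mult.assoc)
      moreover have "1 - d * (1 / kk) = 1 / (E * kk)" using E kk by (simp add: dE field_simps)
      ultimately have Fu: "(cmod (Fu p))\<^sup>2 = (1 / (E * kk))\<^sup>2 * (cmod (\<psi>' p))\<^sup>2"
        using E kk by (simp only: norm_mult norm_of_real power_mult_distrib power2_abs)
      have h: "(cmod (h p))\<^sup>2 = (1 / kk)\<^sup>2 * (cmod (\<psi>' p))\<^sup>2"
        by (simp only: h_def K norm_mult norm_of_real power_mult_distrib power2_abs)
      have "E * (1 / (E * kk))\<^sup>2 + d * (1 / kk)\<^sup>2 = 1 / kk"
        using E kk by (simp add: dE field_simps power2_eq_square)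
      then have "(E * (1 / (E * kk))\<^sup>2 + d * (1 / kk)\<^sup>2) * (cmod (\<psi>' p))\<^sup>2 = 1 / kk * (cmod (\<psi>' p))\<^sup>2" by simp
      then show ?thesis unfolding E_def[symmetric] Fu h D1 K by (simp add: ring_distribs)
    next
      case False
      then have D1: "Dp p = 0" "Dn p = - d" by (auto simp: Dp_def Dn_def d_def)
      have Fu: "Fu p = \<psi>' p + \<kappa> * complex_of_real (- d)" by (simp add: Fu_def Fl_def D1)
      \<comment> \<open>Because \<open>1 - E * k = - E * d\<close>, the weight
        \<open>\<alpha> = E * k\<close> is admissible, and the two terms of the weighted inequality
        become exactly \<open>K |\<psi>'|^2\<close> and \<open>|\<kappa>|^2 * Dn\<close>.\<close>
      have al: "0 < E * kk" "E * kk < 1" "1 - E * kk = E * (- d)" using E kk False by (auto simp: dE field_simps)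
      have "E * (cmod (Fu p))\<^sup>2 \<le> E * ((cmod (\<psi>' p))\<^sup>2 / (E * kk) + (cmod (\<kappa> * complex_of_real (- d)))\<^sup>2 / (1 - E * kk))"
        unfolding Fu using E by (intro mult_left_mono cmod_add_sq_weighted al) auto
      also have "(cmod (\<kappa> * complex_of_real (- d)))\<^sup>2 = (cmod \<kappa>)\<^sup>2 * (d * d)"
        by (simp add: norm_mult power_mult_distrib power2_eq_square)
      also have "E * ((cmod (\<psi>' p))\<^sup>2 / (E * kk) + (cmod \<kappa>)\<^sup>2 * (d * d) / (1 - E * kk)) = 1 / kk * (cmod (\<psi>' p))\<^sup>2 + (cmod \<kappa>)\<^sup>2 * (- d)"
        unfolding al(3) using E kk False by (simp add: field_simps)
      finally show ?thesis unfolding E_def[symmetric] D1 K by simp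
    qed
  qed
  have Ui: "integrable lebesgue (\<lambda>p. (norm p)\<^sup>2 * (cmod (Fu p))\<^sup>2)"
  proof (rule Bochner_Integration.integrable_bound[of _ "\<lambda>p. K_symbol \<mu> T p * (cmod (\<psi>' p))\<^sup>2 + (cmod \<kappa>)\<^sup>2 * Dn p"])
    show "integrable lebesgue (\<lambda>p. K_symbol \<mu> T p * (cmod (\<psi>' p))\<^sup>2 + (cmod \<kappa>)\<^sup>2 * Dn p)" using Ki Dni by simp
    show "AE p in lebesgue. norm ((norm p)\<^sup>2 * (cmod (Fu p))\<^sup>2) \<le> norm (K_symbol \<mu> T p * (cmod (\<psi>' p))\<^sup>2 + (cmod \<kappa>)\<^sup>2 * Dn p)"
      using pw
    proof eventually_elim
      case (elim p)
      have "0 \<le> Dp p * (cmod (h p))\<^sup>2" using Dpn(2)[of p] by simp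
      moreover have "0 \<le> (norm p)\<^sup>2 * (cmod (Fu p))\<^sup>2" by simp
      ultimately show ?case using elim unfolding real_norm_def by linarith
    qed
  qed measurable
  have Fu_energy: "energy Fu" by (rule energyI[OF Fum Ui])
  have Fl_L1_L2: "L1_L2 Fl"
  proof -
    have "L1_L2 (\<lambda>p. \<psi>' p + (-1) * Fu p)"
      by (rule L1_L2_add[OF L1_L2_of_L2[OF psi] L1_L2_scale[OF energy_L1_L2[OF Fu_energy]]])
    then show ?thesis by (simp add: Fu_def)
  qed
  \<comment> \<open>The variance of \<open>h\<close> about its mean; \<open>Rsq_eq\<close> splits
    the second moment into variance and squared mean. The variance is kept in the bound to pay for
    fluctuations of the low-momentum part.\<close>
  define Rsq where "Rsq = (LINT p|lebesgue. Dp p * (cmod (h p - \<kappa>))\<^sup>2)"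
  have hk: "(cmod (h p - \<kappa>))\<^sup>2 = (cmod (h p))\<^sup>2 - 2 * Re (cnj \<kappa> * h p) + (cmod \<kappa>)\<^sup>2" for p
    by (simp add: cmod_power2 power2_diff algebra_simps)
  have Dre: "integrable lebesgue (\<lambda>p. Re (cnj \<kappa> * (complex_of_real (Dp p) * h p)))"
    using Dh by (intro integrable_Re integrable_mult_right)
  have eqD: "Dp p * (cmod (h p - \<kappa>))\<^sup>2 = Dp p * (cmod (h p))\<^sup>2 - 2 * Re (cnj \<kappa> * (complex_of_real (Dp p) * h p)) + (cmod \<kappa>)\<^sup>2 * Dp p" for p
    unfolding hk by (simp add: algebra_simps)
  have Ri: "integrable lebesgue (\<lambda>p. Dp p * (cmod (h p - \<kappa>))\<^sup>2)"
    unfolding eqD by (intro Bochner_Integration.integrable_add Bochner_Integration.integrable_diff Dh2 integrable_mult_right Dre Dpi)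
  have R0: "0 \<le> Rsq" unfolding Rsq_def using Dpn(2) by (intro Bochner_Integration.integral_nonneg) auto
  have Rsq_eq: "(LINT p|lebesgue. Dp p * (cmod (h p))\<^sup>2) = Rsq + (cmod a)\<^sup>2 / mp"
  proof -
    have "Rsq = (LINT p|lebesgue. Dp p * (cmod (h p))\<^sup>2) - 2 * (LINT p|lebesgue. Re (cnj \<kappa> * (complex_of_real (Dp p) * h p))) + (cmod \<kappa>)\<^sup>2 * (LINT p|lebesgue. Dp p)"
      unfolding Rsq_def eqD by (simp only: Bochner_Integration.integral_add[OF Bochner_Integration.integrable_diff[OF Dh2 integrable_mult_right[OF Dre]] integrable_mult_right[OF Dpi]] Bochner_Integration.integral_diff[OF Dh2 integrable_mult_right[OF Dre]] integral_mult_right_zero)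
    also have "(LINT p|lebesgue. Re (cnj \<kappa> * (complex_of_real (Dp p) * h p))) = Re (cnj \<kappa> * (LINT p|lebesgue. complex_of_real (Dp p) * h p))"
      using Dh by (subst integral_Re) auto
    also have "cnj \<kappa> * (LINT p|lebesgue. complex_of_real (Dp p) * h p) = complex_of_real ((cmod a)\<^sup>2 / mp)"
    proof -
      have I: "(LINT p|lebesgue. complex_of_real (Dp p) * h p) = a / complex_of_real c0" using c0 by (simp add: a_def)
      have "cnj \<kappa> * (a / complex_of_real c0) = (a * cnj a) / complex_of_real mp" using c0 by (simp add: \<kappa>_def)
      then show ?thesis by (simp only: I of_real_divide complex_norm_square)
    qed
    also have "(cmod \<kappa>)\<^sup>2 * (LINT p|lebesgue. Dp p) = (cmod a)\<^sup>2 / mp"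
    proof -
      have "(LINT p|lebesgue. Dp p) = mp / c0\<^sup>2" using c0 by (simp add: mp_def)
      then show ?thesis using c0 mp by (simp add: \<kappa>_def norm_mult norm_divide power_mult_distrib power_divide power2_eq_square)
    qed
    finally show ?thesis by simp
  qed
  have main: "(enorm Fu)\<^sup>2 + Rsq + (cmod c)\<^sup>2 / gap_int \<mu> T \<le> (LINT p|lebesgue. K_symbol \<mu> T p * (cmod (\<psi>' p))\<^sup>2)"
  proof -
    have "(LINT p|lebesgue. (norm p)\<^sup>2 * (cmod (Fu p))\<^sup>2 + Dp p * (cmod (h p))\<^sup>2 - (cmod \<kappa>)\<^sup>2 * Dn p) \<le>
        (LINT p|lebesgue. K_symbol \<mu> T p * (cmod (\<psi>' p))\<^sup>2)"
      by (rule integral_mono_AE[OF _ Ki pw]) (use Ui Dh2 Dni in auto)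
    also have "(LINT p|lebesgue. (norm p)\<^sup>2 * (cmod (Fu p))\<^sup>2 + Dp p * (cmod (h p))\<^sup>2 - (cmod \<kappa>)\<^sup>2 * Dn p) =
        (enorm Fu)\<^sup>2 + (Rsq + (cmod a)\<^sup>2 / mp) - (cmod \<kappa>)\<^sup>2 * (LINT p|lebesgue. Dn p)"
      using Ui Dh2 Dni by (simp add: enorm_sq Rsq_eq)
    also have "(cmod \<kappa>)\<^sup>2 * (LINT p|lebesgue. Dn p) = (cmod a)\<^sup>2 * mn / mp\<^sup>2"
    proof -
      have "(LINT p|lebesgue. Dn p) = mn / c0\<^sup>2" using c0 by (simp add: mn_def)
      then show ?thesis using c0 mp by (simp add: \<kappa>_def norm_mult norm_divide power_mult_distrib power_divide)
    qed
    \<comment> \<open>Subtracting the cost of the negative part turns \<open>1 / mp\<close> into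
      \<open>(mp - mn) / mp^2\<close>, and the definition of \<open>c\<close> absorbs precisely this
      factor.\<close>
    also have "(enorm Fu)\<^sup>2 + (Rsq + (cmod a)\<^sup>2 / mp) - (cmod a)\<^sup>2 * mn / mp\<^sup>2 = (enorm Fu)\<^sup>2 + Rsq + (cmod c)\<^sup>2 / gap_int \<mu> T"
    proof -
      have "(cmod c)\<^sup>2 / gap_int \<mu> T = (cmod a)\<^sup>2 * gap_int \<mu> T / mp\<^sup>2"
        using gap mp by (simp add: c_def norm_mult norm_divide power_mult_distrib power_divide power2_eq_square)
      also have "\<dots> = (cmod a)\<^sup>2 / mp - (cmod a)\<^sup>2 * mn / mp\<^sup>2"
        using mp unfolding gap_eq by (simp add: field_simps power2_eq_square)
      finally show ?thesis by simp
    qed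
    finally show ?thesis .
  qed
  have low: "cmod (FT 1 Fl x - c) \<le> 2 * c0\<^sup>2 / gap_int \<mu> T * cmod c * (LINT p|lebesgue. \<bar>D p\<bar> * min 1 ((norm p * norm x)\<^sup>2))
      + 2 * c0 * sqrt Rsq * sqrt (LINT p|lebesgue. \<bar>D p\<bar> * min 1 ((norm p * norm x)\<^sup>2))" for x
  proof -
    let ?b = "LINT p|lebesgue. \<bar>D p\<bar> * min 1 ((norm p * norm x)\<^sup>2)"
    let ?e = "\<lambda>p. cis (p \<bullet> x) - 1"
    have bi: "integrable lebesgue (\<lambda>p. \<bar>D p\<bar> * min 1 ((norm p * norm x)\<^sup>2))"
      unfolding D_def by (rule Kdiff_weighted_integral(1)[OF T order_refl]) simp
    have emul: "integrable lebesgue (\<lambda>p. ?e p * f p)" if "integrable lebesgue f" for f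
      using integrable_cis_mult[OF that, of 1 x] that by (simp add: left_diff_distrib inner_commute)
    have Dci: "integrable lebesgue (\<lambda>p. complex_of_real (D p))" using Di by simp
    have rhoi: "integrable lebesgue (\<lambda>p. complex_of_real (Dp p) * (h p - \<kappa>))"
      using Dh Dpi by (simp add: right_diff_distrib)
    have "FT 1 Fl x - c = complex_of_real c0 * (LINT p|lebesgue. ?e p * Fl p)"
    proof -
      have "(LINT p|lebesgue. ?e p * Fl p) = (LINT p|lebesgue. cis (1 * (x \<bullet> p)) * Fl p) - (LINT p|lebesgue. Fl p)"
        using integrable_cis_mult[OF Fli, of 1 x] Fli by (simp add: left_diff_distrib inner_commute)
      then show ?thesis unfolding FT_def intFl[symmetric] c0_def by (simp add: right_diff_distrib)
    qed
    \<comment> \<open>\<open>Fl = \<kappa> * D + Dp * (h - \<kappa>)\<close>. The first term has the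
      even kernel \<open>D\<close> and is linear in the small moment; the second is controlled by
      Cauchy-Schwarz only, as the square root of the moment times \<open>sqrt Rsq\<close>.\<close>
    also have "(LINT p|lebesgue. ?e p * Fl p) = (LINT p|lebesgue. \<kappa> * (?e p * complex_of_real (D p)) + ?e p * (complex_of_real (Dp p) * (h p - \<kappa>)))"
      by (rule Bochner_Integration.integral_cong[OF refl]) (simp add: Fl_def Dpn(1) algebra_simps)
    also have "\<dots> = \<kappa> * (LINT p|lebesgue. ?e p * complex_of_real (D p)) + (LINT p|lebesgue. ?e p * (complex_of_real (Dp p) * (h p - \<kappa>)))"
      by (simp only: Bochner_Integration.integral_add[OF integrable_mult_right[OF emul[OF Dci]] emul[OF rhoi]] integral_mult_right_zero)
    finally have "cmod (FT 1 Fl x - c) = c0 * cmod (\<kappa> * (LINT p|lebesgue. ?e p * complex_of_real (D p)) + (LINT p|lebesgue. ?e p * (complex_of_real (Dp p) * (h p - \<kappa>))))"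
      using c0 by (simp add: norm_mult)
    also have "\<dots> \<le> c0 * (cmod \<kappa> * cmod (LINT p|lebesgue. ?e p * complex_of_real (D p)) + cmod (LINT p|lebesgue. ?e p * (complex_of_real (Dp p) * (h p - \<kappa>))))"
      using c0 by (intro mult_left_mono order_trans[OF norm_triangle_ineq]) (auto simp: norm_mult)
    also have "\<dots> \<le> c0 * (cmod \<kappa> * (2 * ?b) + 2 * sqrt ?b * sqrt Rsq)"
    proof -
      have 1: "cmod (LINT p|lebesgue. ?e p * complex_of_real (D p)) \<le> 2 * ?b"
        unfolding D_def by (rule Kdiff_kernel_bound[OF T])
      let ?f = "\<lambda>p. complex_of_real (cmod (?e p) * sqrt (Dp p))"
      let ?g = "\<lambda>p. complex_of_real (sqrt (Dp p)) * (h p - \<kappa>)"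
      have fsq: "(cmod (?f p))\<^sup>2 \<le> 4 * (\<bar>D p\<bar> * min 1 ((norm p * norm x)\<^sup>2))" for p
      proof -
        have "(cmod (?e p))\<^sup>2 \<le> 4 * min 1 ((p \<bullet> x)\<^sup>2)" by (rule cmod_cis_minus_one_sq)
        also have "\<dots> \<le> 4 * min 1 ((norm p * norm x)\<^sup>2)"
          using Cauchy_Schwarz_ineq2[of p x] by (intro mult_left_mono min.mono order_refl abs_le_square_iff[THEN iffD1]) auto
        finally have "(cmod (?e p))\<^sup>2 * Dp p \<le> 4 * min 1 ((norm p * norm x)\<^sup>2) * \<bar>D p\<bar>" by (intro mult_mono Dpn) auto
        moreover have "(cmod (?f p))\<^sup>2 = (cmod (?e p))\<^sup>2 * Dp p"
          using Dpn(2)[of p] by (simp only: norm_of_real power2_abs power_mult_distrib real_sqrt_pow2)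
        ultimately show ?thesis by (simp add: ac_simps)
      qed
      have fm: "?f \<in> borel_measurable lebesgue" by measurable
      have f2i: "integrable lebesgue (\<lambda>p. (cmod (?f p))\<^sup>2)"
        by (rule Bochner_Integration.integrable_bound[OF integrable_mult_right[OF bi, of 4]]) (measurable, use fsq in \<open>auto intro: order_trans[OF _ abs_ge_self]\<close>)
      have f2: "?f \<in> L2" by (rule L2I[OF fm f2i])
      have fn: "L2_norm ?f \<le> sqrt (4 * ?b)"
      proof -
        have "(LINT p|lebesgue. (cmod (?f p))\<^sup>2) \<le> (LINT p|lebesgue. 4 * (\<bar>D p\<bar> * min 1 ((norm p * norm x)\<^sup>2)))"
          by (rule integral_mono[OF f2i integrable_mult_right[OF bi] fsq])
        then show ?thesis unfolding L2_norm_def by (intro real_sqrt_le_mono) simp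
      qed
      have gsq: "(cmod (?g p))\<^sup>2 = Dp p * (cmod (h p - \<kappa>))\<^sup>2" for p
        using Dpn(2)[of p] by (simp only: norm_mult norm_of_real power2_abs power_mult_distrib real_sqrt_pow2)
      have gm: "?g \<in> borel_measurable lebesgue" by measurable
      have g2: "?g \<in> L2" by (rule L2I[OF gm]) (unfold gsq, rule Ri)
      have gn: "L2_norm ?g = sqrt Rsq" unfolding L2_norm_def gsq Rsq_def ..
      have "cmod (LINT p|lebesgue. ?e p * (complex_of_real (Dp p) * (h p - \<kappa>))) \<le> (LINT p|lebesgue. cmod (?e p * (complex_of_real (Dp p) * (h p - \<kappa>))))"
        by (rule integral_norm_bound)
      also have "\<dots> = (LINT p|lebesgue. cmod (?f p) * cmod (?g p))"
      proof (rule Bochner_Integration.integral_cong[OF refl])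
        fix p
        have "sqrt (Dp p) * sqrt (Dp p) = Dp p" using Dpn(2)[of p] by simp
        then show "cmod (?e p * (complex_of_real (Dp p) * (h p - \<kappa>))) = cmod (?f p) * cmod (?g p)"
          using Dpn(2)[of p] by (simp add: norm_mult mult.assoc mult.left_commute[of _ "cmod (h p - \<kappa>)"] abs_of_nonneg)
      qed
      also have "\<dots> \<le> L2_norm ?f * L2_norm ?g" by (rule L2_Cauchy_Schwarz_cmod[OF f2 g2])
      also have "\<dots> \<le> sqrt (4 * ?b) * sqrt Rsq" unfolding gn using fn R0 by (intro mult_right_mono) auto
      also have "\<dots> = 2 * sqrt ?b * sqrt Rsq" by (simp add: real_sqrt_mult)
      finally have 2: "cmod (LINT p|lebesgue. ?e p * (complex_of_real (Dp p) * (h p - \<kappa>))) \<le> 2 * sqrt ?b * sqrt Rsq" .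
      show ?thesis using c0 by (intro mult_left_mono add_mono 1 2) auto
    qed
    also have "\<dots> = 2 * (c0 * cmod \<kappa>) * ?b + 2 * c0 * sqrt Rsq * sqrt ?b" by (simp add: algebra_simps)
    finally show ?thesis unfolding \<kappa>c by (simp add: mult.assoc)
  qed
  show thesis
  proof (rule that[of Fl "sqrt Rsq" c])
    show "energy (\<lambda>p. \<psi>' p - Fl p)" using Fu_energy by (simp add: Fu_def[abs_def])
    show "(enorm (\<lambda>p. \<psi>' p - Fl p))\<^sup>2 + (sqrt Rsq)\<^sup>2 + (cmod c)\<^sup>2 / gap_int \<mu> T \<le> (LINT p|lebesgue. K_symbol \<mu> T p * (cmod (\<psi>' p))\<^sup>2)"
      using main R0 by (simp add: Fu_def[abs_def])
  qed (use Fli Fl_L1_L2 R0 low[unfolded D_def c0_def] in auto)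
qed

context potential begin

lemma VL2_bounded:
  assumes [measurable]: "f \<in> borel_measurable lebesgue" and B: "\<And>x. cmod (f x) \<le> B"
  shows "VL2 f"
proof (rule VL2_I)
  show "integrable lebesgue (\<lambda>x. \<bar>V x\<bar> * (cmod (f x))\<^sup>2)"
  proof (rule Bochner_Integration.integrable_bound[of _ "\<lambda>x. B\<^sup>2 * \<bar>V x\<bar>"])
    show "integrable lebesgue (\<lambda>x. B\<^sup>2 * \<bar>V x\<bar>)" by (intro integrable_mult_right abs_V_integrable)
    show "AE x in lebesgue. norm (\<bar>V x\<bar> * (cmod (f x))\<^sup>2) \<le> norm (B\<^sup>2 * \<bar>V x\<bar>)"
    proof (rule AE_I2)
      fix x
      have "\<bar>V x\<bar> * (cmod (f x))\<^sup>2 \<le> \<bar>V x\<bar> * B\<^sup>2" using B[of x] by (intro mult_left_mono power_mono) auto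
      then show "norm (\<bar>V x\<bar> * (cmod (f x))\<^sup>2) \<le> norm (B\<^sup>2 * \<bar>V x\<bar>)" by (simp add: abs_mult mult.commute)
    qed
  qed measurable
qed fact

lemma V_bw_integrable: "0 < \<mu> \<Longrightarrow> \<mu> \<le> 1 \<Longrightarrow> integrable lebesgue (\<lambda>x. \<bar>V x\<bar> * bw \<mu> (norm x))"
  using W_integrable by (intro bw_integrable) (simp_all add: W_def[abs_def])

end

context scattering_potential begin

lemma src_measurable [measurable]: "src \<in> borel_measurable lebesgue"
  by (rule borel_measurable_integrable[OF src_integrable])

lemma src_bw_integrable: "0 < \<mu> \<Longrightarrow> \<mu> \<le> 1 \<Longrightarrow> integrable lebesgue (\<lambda>x. cmod (src x) * bw \<mu> (norm x))"
  by (intro bw_integrable src_weighted_integrable) simp_all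

text \<open>The common error scale of both bounds on the critical temperature, covering pairings
  with \<open>psi0\<close> (through \<open>src\<close>) and quadratic errors (through
  \<open>|V|\<close>).\<close>

definition Theta :: "real \<Rightarrow> real" where
  "Theta \<mu> = (LINT x|lebesgue. cmod (src x) * bw \<mu> (norm x)) + (LINT x|lebesgue. \<bar>V x\<bar> * bw \<mu> (norm x))"

lemma Theta_parts:
  assumes "0 < \<mu>"
  shows "0 \<le> (LINT x|lebesgue. cmod (src x) * bw \<mu> (norm x))" "0 \<le> (LINT x|lebesgue. \<bar>V x\<bar> * bw \<mu> (norm x))"
    "(LINT x|lebesgue. cmod (src x) * bw \<mu> (norm x)) \<le> Theta \<mu>" "(LINT x|lebesgue. \<bar>V x\<bar> * bw \<mu> (norm x)) \<le> Theta \<mu>"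
    "0 \<le> Theta \<mu>"
proof -
  show a: "0 \<le> (LINT x|lebesgue. cmod (src x) * bw \<mu> (norm x))" and b: "0 \<le> (LINT x|lebesgue. \<bar>V x\<bar> * bw \<mu> (norm x))"
    using assms by (auto intro!: Bochner_Integration.integral_nonneg mult_nonneg_nonneg bw_nonneg)
  then show "(LINT x|lebesgue. cmod (src x) * bw \<mu> (norm x)) \<le> Theta \<mu>" "(LINT x|lebesgue. \<bar>V x\<bar> * bw \<mu> (norm x)) \<le> Theta \<mu>"
    "0 \<le> Theta \<mu>" by (auto simp: Theta_def)
qed

lemma Theta_tendsto: "((\<lambda>\<mu>. Theta \<mu> / sqrt \<mu>) \<longlongrightarrow> 0) (at_right 0)"
proof -
  have "((\<lambda>\<mu>. (LINT x|lebesgue. cmod (src x) * bw \<mu> (norm x)) / sqrt \<mu> + (LINT x|lebesgue. \<bar>V x\<bar> * bw \<mu> (norm x)) / sqrt \<mu>) \<longlongrightarrow> 0 + 0) (at_right 0)"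
    by (intro tendsto_add bw_integral_tendsto src_weighted_integrable W_integrable[unfolded W_def[abs_def]]) measurable
  then show ?thesis by (simp add: Theta_def add_divide_distrib)
qed

text \<open>Linear in \<open>f\<close>, with the integrable weight \<open>src\<close>. The
  Cauchy-Schwarz bound by \<open>vnorm psi0 * vnorm f\<close> would lose a square root in the
  error.\<close>

lemma vform_psi0_bound:
  assumes f: "VL2 f" and i: "integrable lebesgue (\<lambda>x. cmod (src x) * cmod (f x))"
  shows "cmod (vform psi0 f) \<le> (LINT x|lebesgue. cmod (src x) * cmod (f x))"
proof -
  note VL2_measurable[OF f, measurable]
  have "cmod (vform psi0 f) \<le> (LINT x|lebesgue. cmod (complex_of_real (V x) * (cnj (psi0 x) * f x)))"
    unfolding vform_eq by (rule integral_norm_bound)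
  also have "\<dots> = (LINT x|lebesgue. cmod (src x) * cmod (f x))"
  proof (rule integral_cong_AE)
    show "AE x in lebesgue. cmod (complex_of_real (V x) * (cnj (psi0 x) * f x)) = cmod (src x) * cmod (f x)"
      using src_eq by eventually_elim (simp add: norm_mult)
  qed measurable
  finally show ?thesis .
qed

text \<open>Completing the square around \<open>c * psi0\<close>: \<open>w = u - c * u0\<close> has
  finite energy, and coercivity leaves \<epsilon> times its energy to absorb the coupling of
  \<open>w\<close> to \<open>\<zeta>\<close>, at the price \<open>S / \<epsilon>\<close> times the
  square of \<open>vnorm \<zeta>\<close>. The coupling of \<open>psi0\<close> to
  \<open>\<zeta>\<close> is left linear.\<close>

lemma energy_vquad_lower:
  assumes \<epsilon>: "0 < \<epsilon>" "\<And>F u. has_FT 1 F u \<Longrightarrow> energy F \<Longrightarrow> \<epsilon> * (enorm F)\<^sup>2 \<le> (enorm F)\<^sup>2 + vquad u"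
    and h: "has_FT 1 F u" and F: "energy F" and \<zeta>: "VL2 \<zeta>"
    and psi: "\<And>x. \<psi> x = c + u x + \<zeta> x"
  shows "(cmod c)\<^sup>2 * G0 - 2 * cmod c * cmod (vform psi0 \<zeta>) - (1 + S / \<epsilon>) * (vnorm \<zeta>)\<^sup>2 \<le> (enorm F)\<^sup>2 + vquad \<psi>"
proof -
  define Fw where "Fw p = F p + (- c) * F0 p" for p
  define w where "w x = u x + (- c) * u0 x" for x
  have EcF0: "energy (\<lambda>p. c * F0 p)" for c by (rule energy_scale[OF F0_energy])
  have Ew: "energy Fw" unfolding Fw_def by (rule energy_add[OF F EcF0])
  have hw: "has_FT 1 Fw w" unfolding Fw_def w_def
    by (rule has_FT_add[OF h has_FT_scale[OF has_FT_F0 energy_measurable[OF F0_energy]] energy_L1_L2[OF F] energy_L1_L2[OF EcF0]])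
  have wV: "VL2 w" by (rule VL2_energy[OF hw Ew])
  let ?X = "\<lambda>x. c * psi0 x + w x"
  have cpsiV: "VL2 (\<lambda>x. c * psi0 x)" by (rule VL2_scale[OF psi0_VL2])
  have XV: "VL2 ?X" by (rule VL2_add[OF cpsiV wV])
  have psi_eq: "\<psi> = (\<lambda>x. ?X x + \<zeta> x)" by (auto simp: psi w_def psi0_def algebra_simps)
  have F_eq: "F = (\<lambda>p. Fw p + c * F0 p)" by (auto simp: Fw_def)
  have 1: "vquad \<psi> = vquad ?X + 2 * Re (vform ?X \<zeta>) + vquad \<zeta>" unfolding psi_eq by (rule vquad_add[OF XV \<zeta>])
  have 2: "vquad ?X = (cmod c)\<^sup>2 * vquad psi0 + 2 * Re (vform (\<lambda>x. c * psi0 x) w) + vquad w"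
    unfolding vquad_add[OF cpsiV wV] vquad_scale ..
  have "(enorm (\<lambda>p. Fw p + c * F0 p))\<^sup>2 = (enorm Fw)\<^sup>2 + 2 * Re (einner Fw (\<lambda>p. c * F0 p)) + (cmod c)\<^sup>2 * (enorm F0)\<^sup>2"
    unfolding enorm_add_sq[OF Ew EcF0] enorm_scale power_mult_distrib ..
  then have 3: "(enorm F)\<^sup>2 = (enorm Fw)\<^sup>2 + 2 * Re (einner Fw (\<lambda>p. c * F0 p)) + (cmod c)\<^sup>2 * (enorm F0)\<^sup>2"
    using F_eq by simp
  \<comment> \<open>The cross term of the kinetic energy is the negative of the cross term in
    \<open>vquad ?X\<close>, so both disappear from the sum.\<close>
  have 4: "Re (einner Fw (\<lambda>p. c * F0 p)) = - Re (vform (\<lambda>x. c * psi0 x) w)"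
  proof -
    have "einner Fw (\<lambda>p. c * F0 p) = - (c * vform w psi0)" by (simp add: einner_scale_right einner_F0[OF hw Ew])
    moreover have "vform (\<lambda>x. c * psi0 x) w = cnj (c * vform w psi0)" unfolding vform_scale_left vform_cnj[of psi0 w] by simp
    ultimately show ?thesis by simp
  qed
  have 5: "Re (vform ?X \<zeta>) \<ge> - (cmod c * cmod (vform psi0 \<zeta>)) - vnorm w * vnorm \<zeta>"
  proof -
    have e: "vform ?X \<zeta> = cnj c * vform psi0 \<zeta> + vform w \<zeta>"
      by (simp add: vform_add_left[OF cpsiV wV \<zeta>] vform_scale_left)
    have "- Re (cnj c * vform psi0 \<zeta>) \<le> cmod c * cmod (vform psi0 \<zeta>)"
      using abs_Re_le_cmod[of "cnj c * vform psi0 \<zeta>"] by (simp add: norm_mult)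
    moreover have "- Re (vform w \<zeta>) \<le> vnorm w * vnorm \<zeta>"
      using abs_Re_le_cmod[of "vform w \<zeta>"] vform_bound[OF wV \<zeta>] by linarith
    ultimately show ?thesis unfolding e plus_complex.sel by linarith
  qed
  have 6: "2 * (vnorm w * vnorm \<zeta>) \<le> \<epsilon> * (enorm Fw)\<^sup>2 + S / \<epsilon> * (vnorm \<zeta>)\<^sup>2"
  proof -
    have z0: "0 \<le> vnorm \<zeta>" by (simp add: vnorm_def)
    have "2 * (vnorm w * vnorm \<zeta>) \<le> 2 * ((sqrt S * enorm Fw) * vnorm \<zeta>)"
      using vnorm_energy[OF hw Ew] z0 by (intro mult_left_mono mult_right_mono) auto
    also have "\<dots> = 2 * (sqrt \<epsilon> * enorm Fw) * (sqrt S / sqrt \<epsilon> * vnorm \<zeta>)" using \<epsilon> by simp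
    also have "\<dots> \<le> (sqrt \<epsilon> * enorm Fw)\<^sup>2 + (sqrt S / sqrt \<epsilon> * vnorm \<zeta>)\<^sup>2" by (rule sum_squares_bound)
    also have "\<dots> = \<epsilon> * (enorm Fw)\<^sup>2 + S / \<epsilon> * (vnorm \<zeta>)\<^sup>2" using \<epsilon> S_pos by (simp add: power_mult_distrib power_divide)
    finally show ?thesis .
  qed
  have 7: "\<epsilon> * (enorm Fw)\<^sup>2 \<le> (enorm Fw)\<^sup>2 + vquad w" by (rule \<epsilon>(2)[OF hw Ew])
  have 8: "- (vnorm \<zeta>)\<^sup>2 \<le> vquad \<zeta>" using vquad_bound[OF \<zeta>] by linarith
  have "(enorm F)\<^sup>2 + vquad \<psi> = (cmod c)\<^sup>2 * G0 + ((enorm Fw)\<^sup>2 + vquad w) + 2 * Re (vform ?X \<zeta>) + vquad \<zeta>"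
    unfolding 1 2 3 4 G0_def by (simp add: algebra_simps)
  then show ?thesis using 5 6 7 8 by (simp add: algebra_simps)
qed

text \<open>The constants depend only on a lower bound for \<open>gap_int\<close> and on an upper
  bound for the L^1-norm of \<open>Kdiff\<close>, so they can be fixed before \<mu> and
  \<open>T\<close>. The condition \<open>C1 * Theta \<mu> \<le> 1 / gap_int \<mu> T + G0\<close>
  says that the coefficient of \<open>|c|^2\<close> survives the error.\<close>

theorem K_plus_V_nonneg_if:
  assumes m0: "0 < m0" and N: "0 \<le> N"
  obtains C1 C2 where "0 \<le> C1" "0 \<le> C2"
    "\<And>\<mu> T. 0 < T \<Longrightarrow> T \<le> \<mu> \<Longrightarrow> \<mu> \<le> 1 \<Longrightarrow> m0 \<le> gap_int \<mu> T \<Longrightarrow>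
      (LINT p|lebesgue. \<bar>Kdiff \<mu> T (norm (p::real^3))\<bar>) \<le> N \<Longrightarrow> C2 * Theta \<mu> \<le> 1 / 2 \<Longrightarrow>
      C1 * Theta \<mu> \<le> 1 / gap_int \<mu> T + G0 \<Longrightarrow> K_plus_V_nonneg V \<mu> T"
proof -
  obtain \<epsilon> where \<epsilon>: "0 < \<epsilon>" "\<And>F u. has_FT 1 F u \<Longrightarrow> energy F \<Longrightarrow> \<epsilon> * (enorm F)\<^sup>2 \<le> (enorm F)\<^sup>2 + vquad u"
    using coercive by blast
  define c0 :: real where "c0 = (2 * pi) powr (-3/2)"
  have c0: "0 < c0" unfolding c0_def by (rule FT_const_pos)
  define s1 where "s1 = (LINT x|lebesgue. cmod (src x))"
  have s1: "0 \<le> s1" by (simp add: s1_def)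
  \<comment> \<open>Chosen so that the linear error consumes at most half of the available
    \<open>R^2\<close>; the added 1 avoids division by 0 when \<open>src\<close> vanishes.\<close>
  define \<delta> where "\<delta> = 1 / (2 * (s1 + 1))"
  have \<delta>: "0 < \<delta>" "\<delta> * s1 \<le> 1 / 2" using s1 by (auto simp: \<delta>_def field_simps)
  define C where "C = 2 * N + 64 * pi"
  have C: "0 \<le> C" using N by (simp add: C_def)
  define A1 where "A1 = 2 * c0\<^sup>2 / m0"
  have A1: "0 \<le> A1" using m0 by (simp add: A1_def)
  define Mv where "Mv = 1 + S / \<epsilon>"
  have Mv: "0 \<le> Mv" using \<epsilon>(1) S_pos by (simp add: Mv_def)
  define C1 where "C1 = (2 * A1 * C + 4 * c0\<^sup>2 * C / \<delta>) + Mv * (2 * A1\<^sup>2 * N * C)"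
  define C2 where "C2 = Mv * (8 * c0\<^sup>2 * C)"
  show thesis
  proof (rule that[of C1 C2])
    show "0 \<le> C1" unfolding C1_def using A1 C \<delta> Mv N by (intro add_nonneg_nonneg mult_nonneg_nonneg divide_nonneg_pos) auto
    show "0 \<le> C2" unfolding C2_def using C Mv by simp
    fix \<mu> T
    assume T: "0 < T" "T \<le> \<mu>" and mu1: "\<mu> \<le> 1" and m: "m0 \<le> gap_int \<mu> T"
      and DN: "(LINT p|lebesgue. \<bar>Kdiff \<mu> T (norm (p::real^3))\<bar>) \<le> N"
      and th2: "C2 * Theta \<mu> \<le> 1 / 2" and th1: "C1 * Theta \<mu> \<le> 1 / gap_int \<mu> T + G0"
    have mu: "0 < \<mu>" using T by simp
    let ?m = "gap_int \<mu> T"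
    have mpos: "0 < ?m" using m m0 by simp
    show "K_plus_V_nonneg V \<mu> T"
      unfolding K_plus_V_nonneg_def
    proof (intro ballI allI impI)
      fix \<psi> \<psi>' assume psi: "\<psi> \<in> L2" and ft: "has_fourier \<psi> \<psi>'"
        and Ki: "integrable lebesgue (\<lambda>p. K_symbol \<mu> T p * (cmod (\<psi>' p))\<^sup>2)"
      have h1: "has_FT (-1) \<psi> \<psi>'" using ft by (simp add: has_fourier_iff)
      have psi': "\<psi>' \<in> L2" by (rule has_FT_L2[OF h1 psi]) simp
      have h2: "has_FT 1 \<psi>' \<psi>" using FT_inversion[OF h1 psi] by simp
      obtain Fl c R where Fl: "integrable lebesgue Fl" "energy (\<lambda>p. \<psi>' p - Fl p)" "L1_L2 Fl" and R: "0 \<le> R"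
        and kin: "(enorm (\<lambda>p. \<psi>' p - Fl p))\<^sup>2 + R\<^sup>2 + (cmod c)\<^sup>2 / ?m \<le> (LINT p|lebesgue. K_symbol \<mu> T p * (cmod (\<psi>' p))\<^sup>2)"
        and low: "\<And>x. cmod (FT 1 Fl x - c) \<le>
          2 * c0\<^sup>2 / ?m * cmod c * (LINT p|lebesgue. \<bar>Kdiff \<mu> T (norm (p::real^3))\<bar> * min 1 ((norm p * norm x)\<^sup>2))
          + 2 * c0 * R * sqrt (LINT p|lebesgue. \<bar>Kdiff \<mu> T (norm (p::real^3))\<bar> * min 1 ((norm p * norm x)\<^sup>2))"
        proof (rule kinetic_decomposition[OF T mpos psi' Ki, folded c0_def], goal_cases)
          case (1 Fl c R)
          show ?case by (rule 1(1)[OF 1(2-7)])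
        qed
      define \<zeta> where "\<zeta> x = FT 1 Fl x - c" for x
      define u where "u x = \<psi> x - FT 1 Fl x" for x
      have hl: "has_FT 1 Fl (FT 1 Fl)" by (rule has_FT_integrable[OF Fl(3,1)]) simp
      have hu: "has_FT 1 (\<lambda>p. \<psi>' p - Fl p) u" unfolding u_def by (rule has_FT_diff[OF h2 hl L1_L2_of_L2[OF psi'] Fl(3)])
      note L1_L2_measurable[OF Fl(3), measurable]
      have zm[measurable]: "\<zeta> \<in> borel_measurable lebesgue" unfolding \<zeta>_def by measurable
      have zb: "cmod (\<zeta> x) \<le> (2 * pi) powr (-3/2) * (LINT x|lebesgue. cmod (Fl x)) + cmod c" for x
        unfolding \<zeta>_def using norm_triangle_ineq4[of "FT 1 Fl x" c] FT_bound[of 1 Fl x] by linarith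
      have zV: "VL2 \<zeta>" by (rule VL2_bounded[OF zm zb])
      have zsrc: "integrable lebesgue (\<lambda>x. cmod (src x) * cmod (\<zeta> x))"
      proof (rule Bochner_Integration.integrable_bound[of _ "\<lambda>x. ((2 * pi) powr (-3/2) * (LINT x|lebesgue. cmod (Fl x)) + cmod c) * cmod (src x)"])
        show "integrable lebesgue (\<lambda>x. ((2 * pi) powr (-3/2) * (LINT x|lebesgue. cmod (Fl x)) + cmod c) * cmod (src x))"
          by (intro integrable_mult_right integrable_norm src_integrable)
        show "AE x in lebesgue. norm (cmod (src x) * cmod (\<zeta> x)) \<le> norm (((2 * pi) powr (-3/2) * (LINT x|lebesgue. cmod (Fl x)) + cmod c) * cmod (src x))"
        proof (rule AE_I2)
          fix x
          have "cmod (src x) * cmod (\<zeta> x) \<le> cmod (src x) * ((2 * pi) powr (-3/2) * (LINT x|lebesgue. cmod (Fl x)) + cmod c)" by (intro mult_left_mono zb) simp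
          then show "norm (cmod (src x) * cmod (\<zeta> x)) \<le> norm (((2 * pi) powr (-3/2) * (LINT x|lebesgue. cmod (Fl x)) + cmod c) * cmod (src x))"
            by (simp add: mult.commute[of _ "cmod (src x)"] abs_mult)
        qed
      qed measurable
      have en: "(cmod c)\<^sup>2 * G0 - 2 * cmod c * cmod (vform psi0 \<zeta>) - Mv * (vnorm \<zeta>)\<^sup>2 \<le> (enorm (\<lambda>p. \<psi>' p - Fl p))\<^sup>2 + vquad \<psi>"
        unfolding Mv_def by (rule energy_vquad_lower[OF \<epsilon> hu Fl(2) zV]) (simp_all add: u_def \<zeta>_def)
      define b where "b x = (LINT p|lebesgue. \<bar>Kdiff \<mu> T (norm (p::real^3))\<bar> * min 1 ((norm p * norm x)\<^sup>2))" for x :: "real^3"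
      have b0: "0 \<le> b x" for x unfolding b_def by (intro Bochner_Integration.integral_nonneg) auto
      have bN: "b x \<le> N" and bC: "b x \<le> C * bw \<mu> (norm x)" for x
        using Kdiff_weighted_integral(2,3)[OF T DN, of "norm x"] unfolding b_def C_def by auto
      have zle: "cmod (\<zeta> x) \<le> A1 * cmod c * b x + 2 * c0 * R * sqrt (b x)" for x
      proof -
        have "2 * c0\<^sup>2 / ?m \<le> A1" unfolding A1_def using m m0 by (intro divide_left_mono) auto
        then have "2 * c0\<^sup>2 / ?m * cmod c * b x \<le> A1 * cmod c * b x" using b0 by (intro mult_right_mono) auto
        then show ?thesis using low[of x] unfolding \<zeta>_def b_def[symmetric] by linarith
      qed
      \<comment> \<open>The mixed product of \<open>c\<close>, \<open>R\<close> and
        \<open>sqrt b\<close> is split by the arithmetic-geometric mean inequality into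
        \<open>\<delta> * R^2\<close>, to be absorbed, and a multiple of \<open>|c|^2 * b\<close>,
        which is small enough because it is linear in \<open>b\<close>.\<close>
      have lin: "2 * cmod c * cmod (\<zeta> x) \<le> (2 * A1 * C + 4 * c0\<^sup>2 * C / \<delta>) * (cmod c)\<^sup>2 * bw \<mu> (norm x) + \<delta> * R\<^sup>2" for x
      proof -
        have "2 * cmod c * cmod (\<zeta> x) \<le> 2 * cmod c * (A1 * cmod c * b x + 2 * c0 * R * sqrt (b x))" by (intro mult_left_mono zle) simp
        also have "\<dots> = 2 * A1 * (cmod c)\<^sup>2 * b x + 2 * (sqrt \<delta> * R) * (2 * c0 * cmod c * sqrt (b x) / sqrt \<delta>)"
          using \<delta> by (simp add: power2_eq_square algebra_simps)
        also have "\<dots> \<le> 2 * A1 * (cmod c)\<^sup>2 * b x + ((sqrt \<delta> * R)\<^sup>2 + (2 * c0 * cmod c * sqrt (b x) / sqrt \<delta>)\<^sup>2)"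
          by (intro add_left_mono sum_squares_bound)
        also have "(sqrt \<delta> * R)\<^sup>2 = \<delta> * R\<^sup>2" using \<delta> by (simp add: power_mult_distrib)
        also have "(2 * c0 * cmod c * sqrt (b x) / sqrt \<delta>)\<^sup>2 = 4 * c0\<^sup>2 / \<delta> * (cmod c)\<^sup>2 * b x"
          using \<delta> b0[of x] by (simp add: power_mult_distrib power_divide)
        also have "2 * A1 * (cmod c)\<^sup>2 * b x + (\<delta> * R\<^sup>2 + 4 * c0\<^sup>2 / \<delta> * (cmod c)\<^sup>2 * b x) =
            (2 * A1 + 4 * c0\<^sup>2 / \<delta>) * (cmod c)\<^sup>2 * b x + \<delta> * R\<^sup>2" by (simp add: ring_distribs)
        also have "\<dots> \<le> (2 * A1 + 4 * c0\<^sup>2 / \<delta>) * (cmod c)\<^sup>2 * (C * bw \<mu> (norm x)) + \<delta> * R\<^sup>2"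
          using A1 \<delta> by (intro add_right_mono mult_left_mono bC mult_nonneg_nonneg add_nonneg_nonneg divide_nonneg_pos) auto
        finally show ?thesis by (simp add: ring_distribs ac_simps)
      qed
      \<comment> \<open>In \<open>b * b\<close> one factor is bounded by \<open>N\<close> and the
        other by \<open>C * bw\<close>, so the square stays linear in \<open>bw\<close> and its
        integral against \<open>|V|\<close> is controlled by \<open>Theta\<close>.\<close>
      have sq: "(cmod (\<zeta> x))\<^sup>2 \<le> (2 * A1\<^sup>2 * N * C * (cmod c)\<^sup>2 + 8 * c0\<^sup>2 * C * R\<^sup>2) * bw \<mu> (norm x)" for x
      proof -
        have "(cmod (\<zeta> x))\<^sup>2 \<le> (A1 * cmod c * b x + 2 * c0 * R * sqrt (b x))\<^sup>2" by (intro power_mono zle) simp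
        also have "\<dots> \<le> 2 * (A1 * cmod c * b x)\<^sup>2 + 2 * (2 * c0 * R * sqrt (b x))\<^sup>2"
          using norm_add_sq_le[of "A1 * cmod c * b x" "2 * c0 * R * sqrt (b x)"] by simp
        also have "(A1 * cmod c * b x)\<^sup>2 = A1\<^sup>2 * (cmod c)\<^sup>2 * (b x * b x)" by (simp add: power_mult_distrib power2_eq_square)
        also have "(2 * c0 * R * sqrt (b x))\<^sup>2 = 4 * c0\<^sup>2 * R\<^sup>2 * b x" using b0[of x] by (simp add: power_mult_distrib)
        also have "2 * (A1\<^sup>2 * (cmod c)\<^sup>2 * (b x * b x)) + 2 * (4 * c0\<^sup>2 * R\<^sup>2 * b x) \<le>
            2 * (A1\<^sup>2 * (cmod c)\<^sup>2 * (N * (C * bw \<mu> (norm x)))) + 2 * (4 * c0\<^sup>2 * R\<^sup>2 * (C * bw \<mu> (norm x)))"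
          using b0[of x] N by (intro add_mono mult_left_mono mult_mono bN bC) auto
        finally show ?thesis by (simp add: algebra_simps)
      qed
      let ?t1 = "LINT x|lebesgue. cmod (src x) * bw \<mu> (norm x)"
      let ?t2 = "LINT x|lebesgue. \<bar>V x\<bar> * bw \<mu> (norm x)"
      let ?B = "2 * A1 * C + 4 * c0\<^sup>2 * C / \<delta>"
      have E1: "2 * cmod c * cmod (vform psi0 \<zeta>) \<le> ?B * (cmod c)\<^sup>2 * ?t1 + \<delta> * R\<^sup>2 * s1"
      proof -
        have "2 * cmod c * cmod (vform psi0 \<zeta>) \<le> 2 * cmod c * (LINT x|lebesgue. cmod (src x) * cmod (\<zeta> x))"
          by (intro mult_left_mono vform_psi0_bound[OF zV zsrc]) simp
        also have "\<dots> = (LINT x|lebesgue. 2 * cmod c * (cmod (src x) * cmod (\<zeta> x)))" by (rule integral_mult_right_zero[symmetric])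
        also have "\<dots> \<le> (LINT x|lebesgue. ?B * (cmod c)\<^sup>2 * (cmod (src x) * bw \<mu> (norm x)) + \<delta> * R\<^sup>2 * cmod (src x))"
        proof (rule integral_mono)
          show "integrable lebesgue (\<lambda>x. 2 * cmod c * (cmod (src x) * cmod (\<zeta> x)))" by (rule integrable_mult_right[OF zsrc])
          show "integrable lebesgue (\<lambda>x. ?B * (cmod c)\<^sup>2 * (cmod (src x) * bw \<mu> (norm x)) + \<delta> * R\<^sup>2 * cmod (src x))"
            by (intro Bochner_Integration.integrable_add integrable_mult_right src_bw_integrable[OF mu mu1] integrable_norm src_integrable)
          fix x
          have "cmod (src x) * (2 * cmod c * cmod (\<zeta> x)) \<le> cmod (src x) * (?B * (cmod c)\<^sup>2 * bw \<mu> (norm x) + \<delta> * R\<^sup>2)"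
            by (intro mult_left_mono lin) simp
          then show "2 * cmod c * (cmod (src x) * cmod (\<zeta> x)) \<le> ?B * (cmod c)\<^sup>2 * (cmod (src x) * bw \<mu> (norm x)) + \<delta> * R\<^sup>2 * cmod (src x)"
            by (simp add: algebra_simps)
        qed
        also have "\<dots> = ?B * (cmod c)\<^sup>2 * ?t1 + \<delta> * R\<^sup>2 * s1"
          unfolding s1_def by (simp only: integral_mult_right_zero Bochner_Integration.integral_add[OF
            integrable_mult_right[OF src_bw_integrable[OF mu mu1]] integrable_mult_right[OF integrable_norm[OF src_integrable]]])
        finally show ?thesis .
      qed
      have E2: "(vnorm \<zeta>)\<^sup>2 \<le> (2 * A1\<^sup>2 * N * C * (cmod c)\<^sup>2 + 8 * c0\<^sup>2 * C * R\<^sup>2) * ?t2" (is "_ \<le> ?q * _")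
      proof -
        have "(vnorm \<zeta>)\<^sup>2 \<le> (LINT x|lebesgue. ?q * (\<bar>V x\<bar> * bw \<mu> (norm x)))"
          unfolding vnorm_sq
        proof (rule integral_mono[OF VL2_integrable[OF zV] integrable_mult_right[OF V_bw_integrable[OF mu mu1]]])
          fix x
          have "\<bar>V x\<bar> * (cmod (\<zeta> x))\<^sup>2 \<le> \<bar>V x\<bar> * (?q * bw \<mu> (norm x))" by (intro mult_left_mono sq) simp
          then show "\<bar>V x\<bar> * (cmod (\<zeta> x))\<^sup>2 \<le> ?q * (\<bar>V x\<bar> * bw \<mu> (norm x))" by (simp only: mult.left_commute)
        qed
        then show ?thesis by (simp only: integral_mult_right_zero)
      qed
      note tp = Theta_parts[OF mu]
      have E1': "2 * cmod c * cmod (vform psi0 \<zeta>) \<le> ?B * (cmod c)\<^sup>2 * Theta \<mu> + R\<^sup>2 / 2"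
      proof -
        have "?B * (cmod c)\<^sup>2 * ?t1 \<le> ?B * (cmod c)\<^sup>2 * Theta \<mu>"
          using A1 C \<delta> by (intro mult_left_mono tp mult_nonneg_nonneg add_nonneg_nonneg divide_nonneg_pos) auto
        moreover have "(\<delta> * s1) * R\<^sup>2 \<le> 1 / 2 * R\<^sup>2" by (intro mult_right_mono \<delta>) simp
        then have "\<delta> * R\<^sup>2 * s1 \<le> R\<^sup>2 / 2" by (simp add: ac_simps)
        ultimately show ?thesis using E1 by linarith
      qed
      have E2': "Mv * (vnorm \<zeta>)\<^sup>2 \<le> Mv * (2 * A1\<^sup>2 * N * C) * (cmod c)\<^sup>2 * Theta \<mu> + R\<^sup>2 / 2"
      proof -
        have "?q * ?t2 \<le> ?q * Theta \<mu>" using N C by (intro mult_left_mono tp add_nonneg_nonneg mult_nonneg_nonneg) auto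
        then have "Mv * (vnorm \<zeta>)\<^sup>2 \<le> Mv * (?q * Theta \<mu>)" using E2 Mv by (intro mult_left_mono) auto
        also have "\<dots> = Mv * (2 * A1\<^sup>2 * N * C) * (cmod c)\<^sup>2 * Theta \<mu> + (C2 * Theta \<mu>) * R\<^sup>2"
          unfolding C2_def by (simp add: algebra_simps)
        also have "(C2 * Theta \<mu>) * R\<^sup>2 \<le> 1 / 2 * R\<^sup>2" by (intro mult_right_mono th2) simp
        finally show ?thesis by simp
      qed
      \<comment> \<open>The term \<open>R^2\<close> of the kinetic bound is used up by the two
        halves in \<open>E1'\<close> and \<open>E2'\<close>; the coefficient of \<open>|c|^2\<close>
        is what remains.\<close>
      have "0 \<le> (cmod c)\<^sup>2 * (1 / ?m + G0 - C1 * Theta \<mu>)" using th1 by simp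
      also have "\<dots> = (cmod c)\<^sup>2 / ?m + (cmod c)\<^sup>2 * G0 - (?B * (cmod c)\<^sup>2 * Theta \<mu> + Mv * (2 * A1\<^sup>2 * N * C) * (cmod c)\<^sup>2 * Theta \<mu>)"
      proof -
        have "x * (y + g - (B + D) * t) = x * y + x * g - (B * x * t + D * x * t)" for x y g B D t :: real
          by (simp add: algebra_simps)
        from this[of "(cmod c)\<^sup>2" "1 / ?m" G0 ?B "Mv * (2 * A1\<^sup>2 * N * C)" "Theta \<mu>"] show ?thesis unfolding C1_def by simp
      qed
      also have "\<dots> \<le> (LINT p|lebesgue. K_symbol \<mu> T p * (cmod (\<psi>' p))\<^sup>2) + vquad \<psi>"
        using kin en E1' E2' by linarith
      finally show "0 \<le> (LINT p|lebesgue. K_symbol \<mu> T p * (cmod (\<psi>' p))\<^sup>2) + (LINT x|lebesgue. V x * (cmod (\<psi> x))\<^sup>2)"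
        by (simp add: vquad_def)
    qed
  qed
qed

end

section \<open>Monotonicity in the temperature and the trial function\<close>

lemma Kinv_antimono:
  assumes "0 < T'" "T' \<le> T" shows "Kinv \<mu> T r \<le> Kinv \<mu> T' r"
proof -
  let ?y = "\<bar>r\<^sup>2 - \<mu>\<bar>"
  have "?y / (2 * T) \<le> ?y / (2 * T')" using assms by (intro divide_left_mono) auto
  then have "tanh (?y / (2 * T)) / ?y \<le> tanh (?y / (2 * T')) / ?y" by (intro divide_right_mono) auto
  then show ?thesis unfolding Kinv_def by (subst (1 2) tanh_quotient_abs)
qed

lemma K_symbol_mono:
  assumes "0 < T'" "T' \<le> T" shows "K_symbol \<mu> T' p \<le> K_symbol \<mu> T p" "0 \<le> K_symbol \<mu> T p"
proof -
  have "0 < T" using assms by simp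
  note k = Kinv_nonneg[OF this, of \<mu> "norm p"]
  show "0 \<le> K_symbol \<mu> T p" using k by (simp add: K_symbol_eq)
  show "K_symbol \<mu> T' p \<le> K_symbol \<mu> T p"
  proof (cases "(norm p)\<^sup>2 = \<mu>")
    case True then show ?thesis by (simp add: K_symbol_eq Kinv_def)
  next
    case False
    then show ?thesis unfolding K_symbol_eq
      using Kinv_pos[OF \<open>0 < T\<close> False] by (intro le_imp_inverse_le Kinv_antimono assms)
  qed
qed

lemma K_symbol_measurable [measurable]: "K_symbol \<mu> T \<in> borel_measurable lebesgue"
proof -
  have "K_symbol \<mu> T = (\<lambda>p. inverse (Kinv \<mu> T (norm p)))" by (simp add: K_symbol_eq fun_eq_iff)
  then show ?thesis by simp
qed

text \<open>\<open>K_symbol\<close> increases with the temperature, so a function in the form domain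
  at \<open>T\<close> also lies in the one at \<open>T'\<close>. The set defining the critical
  temperature is therefore closed upwards, and a negative direction at one temperature excludes all
  lower ones.\<close>

lemma K_plus_V_nonneg_mono:
  assumes T: "0 < T'" "T' \<le> T" and nn: "K_plus_V_nonneg V \<mu> T'" shows "K_plus_V_nonneg V \<mu> T"
  unfolding K_plus_V_nonneg_def
proof (intro ballI allI impI)
  fix \<psi> \<psi>' assume psi: "\<psi> \<in> L2" and ft: "has_fourier \<psi> \<psi>'"
    and Ki: "integrable lebesgue (\<lambda>p. K_symbol \<mu> T p * (cmod (\<psi>' p))\<^sup>2)"
    and Vi: "integrable lebesgue (\<lambda>x. V x * (cmod (\<psi> x))\<^sup>2)"
  have "\<psi>' \<in> L2" by (rule has_FT_L2[OF ft[unfolded has_fourier_iff] psi]) simp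
  note L2_measurable[OF this, measurable]
  have le: "K_symbol \<mu> T' p * (cmod (\<psi>' p))\<^sup>2 \<le> K_symbol \<mu> T p * (cmod (\<psi>' p))\<^sup>2" for p
    by (intro mult_right_mono K_symbol_mono[OF T]) simp
  have Ki': "integrable lebesgue (\<lambda>p. K_symbol \<mu> T' p * (cmod (\<psi>' p))\<^sup>2)"
  proof (rule Bochner_Integration.integrable_bound[OF Ki])
    show "AE p in lebesgue. norm (K_symbol \<mu> T' p * (cmod (\<psi>' p))\<^sup>2) \<le> norm (K_symbol \<mu> T p * (cmod (\<psi>' p))\<^sup>2)"
      using le K_symbol_mono(2)[OF T] K_symbol_mono(2)[OF T(1) order_refl] by (intro AE_I2) (simp add: abs_mult)
  qed measurable
  have "0 \<le> (LINT p|lebesgue. K_symbol \<mu> T' p * (cmod (\<psi>' p))\<^sup>2) + (LINT x|lebesgue. V x * (cmod (\<psi> x))\<^sup>2)"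
    by (rule nn[unfolded K_plus_V_nonneg_def, rule_format, OF psi ft Ki' Vi])
  also have "\<dots> \<le> (LINT p|lebesgue. K_symbol \<mu> T p * (cmod (\<psi>' p))\<^sup>2) + (LINT x|lebesgue. V x * (cmod (\<psi> x))\<^sup>2)"
    by (intro add_right_mono integral_mono Ki Ki' le)
  finally show "0 \<le> (LINT p|lebesgue. K_symbol \<mu> T p * (cmod (\<psi>' p))\<^sup>2) + (LINT x|lebesgue. V x * (cmod (\<psi> x))\<^sup>2)" .
qed

text \<open>Multiplication by \<open>Kdiff\<close> is convolution with a kernel whose value at 0 is
  \<open>gap_int\<close>, up to the normalization of the transform. Subtracting this value leaves
  the combination \<open>cis - 1\<close>, to which \<open>Kdiff_kernel_bound\<close>
  applies.\<close>

lemma FT_Kdiff_convolution: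
  fixes g :: "real^3 \<Rightarrow> complex"
  assumes T: "0 < T" "T \<le> \<mu>" and g: "integrable lebesgue g"
  shows "FT 1 (\<lambda>p. complex_of_real (Kdiff \<mu> T (norm p)) * FT (-1) g p) x - complex_of_real (gap_int \<mu> T) * (LINT y|lebesgue. g y) =
    complex_of_real (((2 * pi) powr (-3/2))\<^sup>2) *
    (LINT y|lebesgue. g y * (LINT p|lebesgue. (cis (p \<bullet> (x - y)) - 1) * complex_of_real (Kdiff \<mu> T (norm p))))"
proof -
  define c0 where "c0 = complex_of_real ((2 * pi) powr (-3/2))"
  define D where "D p = complex_of_real (Kdiff \<mu> T (norm p))" for p :: "real^3"
  have Di: "integrable lebesgue D" unfolding D_def using Kdiff_integrable[OF T] by simp
  note [measurable] = borel_measurable_integrable[OF Di] borel_measurable_integrable[OF g]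
  let ?k = "\<lambda>(p, y). cis (p \<bullet> (x - y)) - 1"
  have km: "?k \<in> borel_measurable (lebesgue \<Otimes>\<^sub>M lebesgue)" by measurable
  have kb: "cmod (?k z) \<le> 2" for z
    using norm_triangle_ineq4[of "cis (fst z \<bullet> (x - snd z))" 1] by (cases z) simp
  have Dg: "integrable lebesgue (\<lambda>p. D p * (FT (-1) g p))"
  proof (rule Bochner_Integration.integrable_bound[OF integrable_mult_left[OF Di, of "complex_of_real ((2 * pi) powr (-3/2) * (LINT x|lebesgue. cmod (g x)))"]])
    show "AE p in lebesgue. norm (D p * FT (-1) g p) \<le> norm (D p * complex_of_real ((2 * pi) powr (-3/2) * (LINT x|lebesgue. cmod (g x))))"
      using FT_bound[of "-1" g] by (intro AE_I2) (simp add: norm_mult mult_left_mono)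
  qed measurable
  have "(LINT y|lebesgue. g y * (LINT p|lebesgue. (cis (p \<bullet> (x - y)) - 1) * D p)) =
      (LINT y|lebesgue. LINT p|lebesgue. ?k (p, y) * (D p * g y))"
  proof (rule Bochner_Integration.integral_cong[OF refl])
    fix y :: "real^3"
    have "g y * (LINT p|lebesgue. (cis (p \<bullet> (x - y)) - 1) * D p) = (LINT p|lebesgue. g y * ((cis (p \<bullet> (x - y)) - 1) * D p))"
      by (rule integral_mult_right_zero[symmetric])
    then show "g y * (LINT p|lebesgue. (cis (p \<bullet> (x - y)) - 1) * D p) = (LINT p|lebesgue. ?k (p, y) * (D p * g y))"
      by (simp add: ac_simps)
  qed
  also have "\<dots> = (LINT p|lebesgue. LINT y|lebesgue. ?k (p, y) * (D p * g y))"
    by (rule Fubini_bounded_kernel[OF Di g km kb])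
  also have "\<dots> = (LINT p|lebesgue. cis (p \<bullet> x) * (D p * FT (-1) g p) / c0 - D p * (LINT y|lebesgue. g y))"
  proof (rule Bochner_Integration.integral_cong[OF refl])
    fix p :: "real^3"
    have c: "cis (p \<bullet> (x - y)) = cis (p \<bullet> x) * cis (- 1 * (p \<bullet> y))" for y by (simp add: cis_mult inner_diff_right)
    have "(LINT y|lebesgue. ?k (p, y) * (D p * g y)) =
        (LINT y|lebesgue. (D p * cis (p \<bullet> x)) * (cis (- 1 * (p \<bullet> y)) * g y) - D p * g y)"
      by (simp only: prod.case c) (simp add: algebra_simps)
    also have "\<dots> = (D p * cis (p \<bullet> x)) * (LINT y|lebesgue. cis (- 1 * (p \<bullet> y)) * g y) - D p * (LINT y|lebesgue. g y)"
      by (simp only: integral_mult_right_zero Bochner_Integration.integral_diff[OF integrable_mult_right[OF integrable_cis_mult[OF g]] integrable_mult_right[OF g]])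
    also have "(LINT y|lebesgue. cis (- 1 * (p \<bullet> y)) * g y) = FT (-1) g p / c0" by (simp add: FT_def c0_def)
    finally show "(LINT y|lebesgue. ?k (p, y) * (D p * g y)) = cis (p \<bullet> x) * (D p * FT (-1) g p) / c0 - D p * (LINT y|lebesgue. g y)"
      by (simp add: ac_simps)
  qed
  also have "\<dots> = (LINT p|lebesgue. cis (p \<bullet> x) * (D p * FT (-1) g p)) / c0 - (LINT p|lebesgue. D p) * (LINT y|lebesgue. g y)"
  proof -
    have "integrable lebesgue (\<lambda>p. cis (p \<bullet> x) * (D p * FT (-1) g p))"
      using integrable_cis_mult[OF Dg, of 1 x] by (simp add: inner_commute)
    then show ?thesis
      by (simp only: integral_divide_zero integral_mult_left_zero Bochner_Integration.integral_diff[OF integrable_divide integrable_mult_left[OF Di]])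
  qed
  also have "c0 * c0 * \<dots> = FT 1 (\<lambda>p. D p * FT (-1) g p) x - complex_of_real (gap_int \<mu> T) * (LINT y|lebesgue. g y)"
  proof -
    have "(LINT p|lebesgue. D p) = complex_of_real (LINT p|lebesgue. Kdiff \<mu> T (norm (p::real^3)))" unfolding D_def by (rule integral_complex_of_real)
    then have "c0 * c0 * (LINT p|lebesgue. D p) = complex_of_real (gap_int \<mu> T)" by (simp add: gap_int_def c0_def power2_eq_square)
    moreover have "c0 * (LINT p|lebesgue. cis (p \<bullet> x) * (D p * FT (-1) g p)) = FT 1 (\<lambda>p. D p * FT (-1) g p) x"
      unfolding FT_def[of 1 "\<lambda>p. D p * FT (-1) g p"] c0_def mult_1_left inner_commute[of x] ..
    moreover have "c0 \<noteq> 0" by (simp add: c0_def)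
    ultimately show ?thesis by (simp add: right_diff_distrib mult.assoc[symmetric])
  qed
  finally show ?thesis by (simp add: D_def c0_def power2_eq_square)
qed

context scattering_potential begin

text \<open>The trial function \<open>-K\<^sub>T\<^sup>-\<^sup>1 (V psi0)\<close>. It satisfies the Birman-Schwinger equation up to the
  deviation of its low-momentum part from the constant \<open>1\<close>, which is close to \<open>1 + gap_int * G0\<close>.\<close>

lemma trial_form_value:
  assumes T: "0 < T" "T \<le> \<mu>"
  defines "\<zeta> \<equiv> FT 1 (\<lambda>p. - (complex_of_real (Kdiff \<mu> T (norm p)) * fourier src p))"
  defines "X \<equiv> (LINT p|lebesgue. Kdiff \<mu> T (norm p) * (cmod (fourier src p))\<^sup>2)"
  obtains \<psi> \<psi>' where "\<psi> \<in> L2" "has_fourier \<psi> \<psi>'"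
    "integrable lebesgue (\<lambda>p. K_symbol \<mu> T p * (cmod (\<psi>' p))\<^sup>2)"
    "integrable lebesgue (\<lambda>x. V x * (cmod (\<psi> x))\<^sup>2)"
    "(LINT p|lebesgue. K_symbol \<mu> T p * (cmod (\<psi>' p))\<^sup>2) + (LINT x|lebesgue. V x * (cmod (\<psi> x))\<^sup>2)
      = - X - G0 + vquad (\<lambda>x. \<zeta> x - 1)"
    "VL2 \<zeta>" "vform psi0 \<zeta> = - complex_of_real X"
proof -
  define B where "B = (2 * pi) powr (-3/2) * (LINT x|lebesgue. cmod (src x))"
  define g where "g = fourier src"
  define D where "D p = Kdiff \<mu> T (norm p)" for p :: "real^3"
  define k where "k p = Kinv \<mu> T (norm p)" for p :: "real^3"
  define F1 where "F1 p = - (complex_of_real (D p) * g p)" for p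
  \<comment> \<open>The sum is minus the transform of \<open>src\<close> divided by
    \<open>K\<close>. The split isolates \<open>F0\<close>, whose transform is \<open>u0\<close>,
    from \<open>F1\<close>, which is integrable and has a bounded transform.\<close>
  define \<psi>' where "\<psi>' p = F0 p + F1 p" for p
  have [measurable]: "g \<in> borel_measurable lebesgue" unfolding g_def fourier_eq_FT by measurable
  have [measurable]: "D \<in> borel_measurable lebesgue" "k \<in> borel_measurable lebesgue" unfolding D_def k_def by measurable
  have [measurable]: "F1 \<in> borel_measurable lebesgue" unfolding F1_def by measurable
  note energy_measurable[OF F0_energy, measurable]
  have pm[measurable]: "\<psi>' \<in> borel_measurable lebesgue" unfolding \<psi>'_def by measurable
  have B0: "0 \<le> B" by (simp add: B_def)
  have gB: "cmod (g p) \<le> B" for p unfolding g_def B_def fourier_eq_FT by (rule FT_bound)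
  have Di: "integrable lebesgue D" unfolding D_def by (rule Kdiff_integrable[OF T])
  have Fi: "integrable lebesgue F1"
  proof (rule Bochner_Integration.integrable_bound[OF integrable_mult_left[OF Di, of B]])
    show "AE p in lebesgue. norm (F1 p) \<le> norm (D p * B)"
      using gB B0 by (intro AE_I2) (simp add: F1_def norm_mult abs_mult mult_left_mono)
  qed measurable
  have Xi: "integrable lebesgue (\<lambda>p. D p * (cmod (g p))\<^sup>2)"
  proof (rule Bochner_Integration.integrable_bound[OF integrable_mult_left[OF Di, of "B\<^sup>2"]])
    show "AE p in lebesgue. norm (D p * (cmod (g p))\<^sup>2) \<le> norm (D p * B\<^sup>2)"
      using gB B0 by (intro AE_I2) (simp add: abs_mult mult_left_mono power_mono)
  qed measurable
  have psi'_eq: "\<psi>' p = - (complex_of_real (k p) * g p)" for p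
    by (simp add: \<psi>'_def F1_def F0_eq D_def k_def g_def Kdiff_def algebra_simps)
  have Ei: "integrable lebesgue (\<lambda>p. (norm p)\<^sup>2 * (cmod (F0 p))\<^sup>2)" by (rule energy_integrable[OF F0_energy])
  have good: "AE p in lebesgue. 0 < k p"
    using AE_norm_neq[of "sqrt \<mu>"]
  proof eventually_elim
    case (elim p)
    have "(norm p)\<^sup>2 \<noteq> \<mu>" using elim by (metis norm_ge_zero real_sqrt_unique)
    then show ?case using Kinv_pos[OF T(1)] by (simp add: k_def)
  qed
  have kg: "k p * (cmod (g p))\<^sup>2 = D p * (cmod (g p))\<^sup>2 + (norm p)\<^sup>2 * (cmod (F0 p))\<^sup>2" for p
  proof (cases "p = 0")
    case False
    have "cmod (F0 p) = cmod (g p) / (norm p)\<^sup>2"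
      unfolding F0_eq g_def[symmetric] norm_minus_cancel norm_divide norm_of_real abs_power2 ..
    then show ?thesis using False
      by (simp add: D_def k_def Kdiff_def power2_eq_square field_simps)
  qed (simp add: D_def k_def Kdiff_def)
  have kgi: "integrable lebesgue (\<lambda>p. k p * (cmod (g p))\<^sup>2)" unfolding kg by (rule Bochner_Integration.integrable_add[OF Xi Ei])
  have Kk: "AE p in lebesgue. K_symbol \<mu> T p * (cmod (\<psi>' p))\<^sup>2 = k p * (cmod (g p))\<^sup>2"
    using good
  proof eventually_elim
    case (elim p)
    then show ?case
      by (simp add: psi'_eq K_symbol_eq k_def[symmetric] norm_mult power_mult_distrib power2_eq_square)
  qed
  have m1: "(\<lambda>p. K_symbol \<mu> T p * (cmod (\<psi>' p))\<^sup>2) \<in> borel_measurable lebesgue"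
    and m2: "(\<lambda>p. k p * (cmod (g p))\<^sup>2) \<in> borel_measurable lebesgue" by measurable
  have Ki: "integrable lebesgue (\<lambda>p. K_symbol \<mu> T p * (cmod (\<psi>' p))\<^sup>2)"
    using integrable_cong_AE[OF m1 m2 Kk] kgi by simp
  have Keq: "(LINT p|lebesgue. K_symbol \<mu> T p * (cmod (\<psi>' p))\<^sup>2) = X + (enorm F0)\<^sup>2"
  proof -
    have "(LINT p|lebesgue. K_symbol \<mu> T p * (cmod (\<psi>' p))\<^sup>2) = (LINT p|lebesgue. D p * (cmod (g p))\<^sup>2 + (norm p)\<^sup>2 * (cmod (F0 p))\<^sup>2)"
      unfolding kg[symmetric] by (rule integral_cong_AE[OF m1 m2 Kk])
    also have "\<dots> = X + (enorm F0)\<^sup>2"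
      using Bochner_Integration.integral_add[OF Xi Ei] unfolding X_def D_def g_def enorm_sq .
    finally show ?thesis .
  qed
  \<comment> \<open>The bound \<open>Kinv \<le> 1 / (2 T)\<close> shows that the trial function is
    square integrable although \<open>F0\<close> need not be: the singularities at zero momentum
    cancel in the sum.\<close>
  have psi'2: "\<psi>' \<in> L2"
  proof (rule L2I[OF pm], rule Bochner_Integration.integrable_bound[OF integrable_mult_right[OF kgi, of "1 / (2 * T)"]])
    show "AE p in lebesgue. norm ((cmod (\<psi>' p))\<^sup>2) \<le> norm (1 / (2 * T) * (k p * (cmod (g p))\<^sup>2))"
    proof (rule AE_I2)
      fix p
      have k: "0 \<le> k p" "k p \<le> 1 / (2 * T)" unfolding k_def using Kinv_nonneg[OF T(1)] Kinv_le[OF T(1)] by auto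
      have "(cmod (\<psi>' p))\<^sup>2 = k p * (k p * (cmod (g p))\<^sup>2)" using k by (simp add: psi'_eq norm_mult power_mult_distrib power2_eq_square)
      also have "\<dots> \<le> 1 / (2 * T) * (k p * (cmod (g p))\<^sup>2)" using k by (intro mult_right_mono) auto
      finally show "norm ((cmod (\<psi>' p))\<^sup>2) \<le> norm (1 / (2 * T) * (k p * (cmod (g p))\<^sup>2))" using k T by simp
    qed
  qed measurable
  have L1: "L1_L2 F1"
  proof -
    have "L1_L2 (\<lambda>p. \<psi>' p + (-1) * F0 p)" by (rule L1_L2_add[OF L1_L2_of_L2[OF psi'2] L1_L2_scale[OF energy_L1_L2[OF F0_energy]]])
    then show ?thesis by (simp add: \<psi>'_def)
  qed
  have \<zeta>_eq: "\<zeta> = FT 1 F1" unfolding \<zeta>_def F1_def D_def g_def ..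
  define \<psi> where "\<psi> x = u0 x + \<zeta> x" for x
  have h: "has_FT 1 \<psi>' \<psi>" unfolding \<psi>'_def \<psi>_def \<zeta>_eq
    by (rule has_FT_add[OF has_FT_F0 has_FT_integrable[OF L1 Fi] energy_L1_L2[OF F0_energy] L1]) simp
  have psi2: "\<psi> \<in> L2" by (rule has_FT_L2[OF h psi'2]) simp
  have hf: "has_fourier \<psi> \<psi>'" unfolding has_fourier_iff by (rule FT_inversion[OF h psi'2]) simp
  have zm: "\<zeta> \<in> borel_measurable lebesgue" unfolding \<zeta>_eq by measurable
  have zV: "VL2 \<zeta>" unfolding \<zeta>_eq by (rule VL2_bounded[OF zm[unfolded \<zeta>_eq] FT_bound])
  have z1V: "VL2 (\<lambda>x. \<zeta> x + (-1))" by (rule VL2_add[OF zV VL2_const])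
  \<comment> \<open>Expansion around \<open>psi0\<close>: the deviation \<open>\<zeta> - 1\<close>
    is small when \<open>gap_int * G0\<close> is close to -1.\<close>
  have psi_eq: "\<psi> = (\<lambda>x. psi0 x + (\<zeta> x + (-1)))" by (auto simp: \<psi>_def psi0_def)
  have psiV: "VL2 \<psi>" unfolding psi_eq by (rule VL2_add[OF psi0_VL2 z1V])
  have vz: "vform psi0 v = (LINT x|lebesgue. cnj (src x) * v x)" if [measurable]: "v \<in> borel_measurable lebesgue" for v
    unfolding vform_eq
  proof (rule integral_cong_AE)
    show "AE x in lebesgue. complex_of_real (V x) * (cnj (psi0 x) * v x) = cnj (src x) * v x"
      using src_eq by eventually_elim simp
  qed measurable
  have vfz: "vform psi0 \<zeta> = - complex_of_real X"
  proof -
    have "vform psi0 \<zeta> = (LINT x|lebesgue. cnj (src x) * FT (- (-1)) F1 x)" unfolding vz[OF zm] by (simp add: \<zeta>_eq)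
    also have "\<dots> = (LINT p|lebesgue. cnj (FT (-1) src p) * F1 p)" by (rule FT_multiplication_formula[OF src_integrable Fi, symmetric])
    also have "\<dots> = (LINT p|lebesgue. - complex_of_real (D p * (cmod (g p))\<^sup>2))"
    proof (rule Bochner_Integration.integral_cong[OF refl])
      fix p
      have "cnj (FT (-1) src p) * F1 p = - (complex_of_real (D p) * (g p * cnj (g p)))" by (simp add: F1_def g_def fourier_eq_FT)
      then show "cnj (FT (-1) src p) * F1 p = - complex_of_real (D p * (cmod (g p))\<^sup>2)" by (simp only: of_real_mult complex_norm_square)
    qed
    also have "\<dots> = - complex_of_real X" unfolding Bochner_Integration.integral_minus integral_complex_of_real X_def D_def g_def ..
    finally show ?thesis .
  qed
  have vf1: "vform psi0 (\<lambda>x. -1) = - complex_of_real G0"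
  proof -
    have "(LINT x|lebesgue. cnj (src x)) = cnj (LINT x|lebesgue. src x)" by (rule Bochner_Integration.integral_cnj)
    moreover have c: "(\<lambda>x::real^3. - (1::complex)) \<in> borel_measurable lebesgue" by simp
    ultimately show ?thesis unfolding vz[OF c] by (simp add: integral_src)
  qed
  have "vquad \<psi> = vquad psi0 + 2 * Re (vform psi0 (\<lambda>x. \<zeta> x + (-1))) + vquad (\<lambda>x. \<zeta> x + (-1))"
    unfolding psi_eq by (rule vquad_add[OF psi0_VL2 z1V])
  also have "vform psi0 (\<lambda>x. \<zeta> x + (-1)) = - complex_of_real X - complex_of_real G0"
    unfolding vform_add_right[OF zV VL2_const psi0_VL2] vfz vf1 by simp
  finally have vq: "vquad \<psi> = vquad psi0 - 2 * X - 2 * G0 + vquad (\<lambda>x. \<zeta> x - 1)" by simp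
  show thesis
  proof (rule that[OF psi2 hf Ki VL2_V_integrable[OF psiV] _ zV vfz])
    show "(LINT p|lebesgue. K_symbol \<mu> T p * (cmod (\<psi>' p))\<^sup>2) + (LINT x|lebesgue. V x * (cmod (\<psi> x))\<^sup>2)
      = - X - G0 + vquad (\<lambda>x. \<zeta> x - 1)"
      unfolding Keq vquad_def[of \<psi>, symmetric] vq by (simp add: G0_def)
  qed
qed

text \<open>Up to \<open>Theta\<close>, \<open>\<zeta>\<close> is the constant
  \<open>- gap_int * G0\<close> and \<open>X\<close> is \<open>gap_int * G0^2\<close>. The form
  value has the leading term \<open>- G0 * (1 + gap_int * G0)\<close>, which for
  \<open>G0 < 0\<close> turns negative once \<open>gap_int\<close> exceeds \<open>-1 / G0\<close>;
  the remaining potential term is quadratic in the same small factor.\<close>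

theorem not_K_plus_V_nonneg_if:
  assumes N: "0 \<le> N"
  obtains C v1 where "0 \<le> C" "0 \<le> v1"
    "\<And>\<mu> T T'. 0 < T' \<Longrightarrow> T' \<le> T \<Longrightarrow> T \<le> \<mu> \<Longrightarrow> \<mu> \<le> 1 \<Longrightarrow>
      (LINT p|lebesgue. \<bar>Kdiff \<mu> T (norm (p::real^3))\<bar>) \<le> N \<Longrightarrow>
      - G0 * (1 + gap_int \<mu> T * G0) + 2 * v1 * (1 + gap_int \<mu> T * G0)\<^sup>2 + C * Theta \<mu> < 0 \<Longrightarrow>
      \<not> K_plus_V_nonneg V \<mu> T'"
proof -
  define c0 :: real where "c0 = (2 * pi) powr (-3/2)"
  define s1 where "s1 = (LINT x|lebesgue. cmod (src x))"
  define v1 where "v1 = (LINT x|lebesgue. \<bar>V x\<bar>)"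
  define M where "M = 2 * N + 64 * pi"
  define A where "A = 8 * c0\<^sup>2 * M"
  define A' where "A' = 2 * c0\<^sup>2 * N * s1"
  define C where "C = 2 * A * s1 + 2 * A' * A * (s1 + v1)"
  have nn: "0 \<le> s1" "0 \<le> v1" "0 \<le> M" using N by (simp_all add: s1_def v1_def M_def)
  then have A0: "0 \<le> A" "0 \<le> A'" using N by (simp_all add: A_def A'_def)
  then have C0: "0 \<le> C" using nn by (simp add: C_def)
  show thesis
  proof (rule that[OF C0 nn(2)])
    fix \<mu> T T'
    assume T': "0 < T'" "T' \<le> T" and T2: "T \<le> \<mu>" and mu1: "\<mu> \<le> 1"
      and DN: "(LINT p|lebesgue. \<bar>Kdiff \<mu> T (norm (p::real^3))\<bar>) \<le> N"
      and neg: "- G0 * (1 + gap_int \<mu> T * G0) + 2 * v1 * (1 + gap_int \<mu> T * G0)\<^sup>2 + C * Theta \<mu> < 0"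
    have T: "0 < T" "T \<le> \<mu>" and mu: "0 < \<mu>" using T' T2 by auto
    define m where "m = gap_int \<mu> T"
    define \<zeta> where "\<zeta> = FT 1 (\<lambda>p. - (complex_of_real (Kdiff \<mu> T (norm p)) * fourier src p))"
    define X where "X = (LINT p|lebesgue. Kdiff \<mu> T (norm p) * (cmod (fourier src p))\<^sup>2)"
    obtain \<psi> \<psi>' where psi: "\<psi> \<in> L2" "has_fourier \<psi> \<psi>'"
      "integrable lebesgue (\<lambda>p. K_symbol \<mu> T p * (cmod (\<psi>' p))\<^sup>2)"
      "integrable lebesgue (\<lambda>x. V x * (cmod (\<psi> x))\<^sup>2)"
      and val: "(LINT p|lebesgue. K_symbol \<mu> T p * (cmod (\<psi>' p))\<^sup>2) + (LINT x|lebesgue. V x * (cmod (\<psi> x))\<^sup>2)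
        = - X - G0 + vquad (\<lambda>x. \<zeta> x - 1)"
      and zV: "VL2 \<zeta>" and vfz: "vform psi0 \<zeta> = - complex_of_real X"
      unfolding \<zeta>_def X_def by (rule trial_form_value[OF T])
    note VL2_measurable[OF zV, measurable]
    define \<theta>1 where "\<theta>1 = (LINT x|lebesgue. cmod (src x) * bw \<mu> (norm x))"
    define \<theta>2 where "\<theta>2 = (LINT x|lebesgue. \<bar>V x\<bar> * bw \<mu> (norm x))"
    have tp: "0 \<le> \<theta>1" "0 \<le> \<theta>2" "\<theta>1 \<le> Theta \<mu>" "\<theta>2 \<le> Theta \<mu>" "0 \<le> Theta \<mu>" unfolding \<theta>1_def \<theta>2_def by (rule Theta_parts[OF mu])+
    define r where "r x = \<zeta> x + complex_of_real (m * G0)" for x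
    define I where "I z = (LINT p|lebesgue. (cis (p \<bullet> z) - 1) * complex_of_real (Kdiff \<mu> T (norm p)))" for z :: "real^3"
    have Ibound: "cmod (I z) \<le> 2 * N" "cmod (I z) \<le> 2 * (M * bw \<mu> (norm z))" for z
      using Kdiff_kernel_bound[OF T, of z] Kdiff_weighted_integral(2,3)[OF T DN, of "norm z"] unfolding I_def M_def by auto
    have r_eq: "r x = - (complex_of_real (c0\<^sup>2) * (LINT y|lebesgue. src y * I (x - y)))" for x
    proof -
      have "\<zeta> x = - FT 1 (\<lambda>p. complex_of_real (Kdiff \<mu> T (norm p)) * FT (-1) src p) x"
        unfolding \<zeta>_def fourier_eq_FT using FT_scale[of 1 "-1"] by simp
      then have "r x = - (FT 1 (\<lambda>p. complex_of_real (Kdiff \<mu> T (norm p)) * FT (-1) src p) x - complex_of_real m * complex_of_real G0)"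
        by (simp add: r_def)
      then show ?thesis using FT_Kdiff_convolution[OF T src_integrable, of x] unfolding I_def c0_def m_def integral_src by simp
    qed
    have Im: "I \<in> borel_measurable lebesgue" unfolding I_def by measurable
    have r_le: "cmod (r x) \<le> c0\<^sup>2 * (LINT y|lebesgue. cmod (src y) * cmod (I (x - y)))" for x
    proof -
      have "cmod (r x) = c0\<^sup>2 * cmod (LINT y|lebesgue. src y * I (x - y))" by (simp add: r_eq norm_mult norm_power)
      also have "\<dots> \<le> c0\<^sup>2 * (LINT y|lebesgue. cmod (src y * I (x - y)))" by (intro mult_left_mono integral_norm_bound) simp
      finally show ?thesis by (simp add: norm_mult)
    qed
    have sI: "integrable lebesgue (\<lambda>y. cmod (src y) * cmod (I (x - y)))" for x
    proof (rule Bochner_Integration.integrable_bound[OF integrable_mult_left[OF integrable_norm[OF src_integrable], of "2 * N"]])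
      show "AE y in lebesgue. norm (cmod (src y) * cmod (I (x - y))) \<le> norm (cmod (src y) * (2 * N))"
        using Ibound(1) N by (intro AE_I2) (simp add: abs_mult mult_left_mono)
      have "(\<lambda>y. I (x - y)) \<in> borel_measurable lebesgue" unfolding I_def by measurable
      then show "(\<lambda>y. cmod (src y) * cmod (I (x - y))) \<in> borel_measurable lebesgue" by measurable
    qed
    note bwi = src_bw_integrable[OF mu mu1] and si = integrable_norm[OF src_integrable]
    \<comment> \<open>Two bounds on the deviation from the predicted constant are combined: this
      uniform one and \<open>r2\<close>, which is linear in \<open>bw\<close>. Their product bounds
      \<open>|r|^2\<close> without squaring \<open>bw\<close>.\<close>
    have r1: "cmod (r x) \<le> A'" for x
    proof -
      have "(LINT y|lebesgue. cmod (src y) * cmod (I (x - y))) \<le> (LINT y|lebesgue. cmod (src y) * (2 * N))"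
        by (intro integral_mono[OF sI integrable_mult_left[OF si]] mult_left_mono Ibound) simp
      also have "\<dots> = s1 * (2 * N)" unfolding s1_def by (rule integral_mult_left_zero)
      finally have "c0\<^sup>2 * (LINT y|lebesgue. cmod (src y) * cmod (I (x - y))) \<le> c0\<^sup>2 * (s1 * (2 * N))" by (rule mult_left_mono) simp
      then show ?thesis using r_le[of x] by (simp add: A'_def ac_simps)
    qed
    have r2: "cmod (r x) \<le> A * (s1 * bw \<mu> (norm x) + \<theta>1)" for x
    proof -
      have "(LINT y|lebesgue. cmod (src y) * cmod (I (x - y))) \<le>
          (LINT y|lebesgue. (8 * M * bw \<mu> (norm x)) * cmod (src y) + (8 * M) * (cmod (src y) * bw \<mu> (norm y)))"
      proof (rule integral_mono[OF sI])
        show "integrable lebesgue (\<lambda>y. (8 * M * bw \<mu> (norm x)) * cmod (src y) + (8 * M) * (cmod (src y) * bw \<mu> (norm y)))"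
          by (intro Bochner_Integration.integrable_add integrable_mult_right si bwi)
        fix y
        have "cmod (I (x - y)) \<le> 2 * (M * (4 * (bw \<mu> (norm x) + bw \<mu> (norm y))))"
          by (rule order_trans[OF Ibound(2)]) (intro mult_left_mono bw_diff_le mu nn, simp)
        then have "cmod (src y) * cmod (I (x - y)) \<le> cmod (src y) * (2 * (M * (4 * (bw \<mu> (norm x) + bw \<mu> (norm y)))))"
          by (rule mult_left_mono) simp
        then show "cmod (src y) * cmod (I (x - y)) \<le> (8 * M * bw \<mu> (norm x)) * cmod (src y) + (8 * M) * (cmod (src y) * bw \<mu> (norm y))"
          by (simp add: algebra_simps)
      qed
      also have "\<dots> = (8 * M * bw \<mu> (norm x)) * s1 + (8 * M) * \<theta>1"
        unfolding s1_def \<theta>1_def by (simp only: integral_mult_right_zero Bochner_Integration.integral_add[OF integrable_mult_right[OF si] integrable_mult_right[OF bwi]])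
      finally have "c0\<^sup>2 * (LINT y|lebesgue. cmod (src y) * cmod (I (x - y))) \<le> c0\<^sup>2 * ((8 * M * bw \<mu> (norm x)) * s1 + (8 * M) * \<theta>1)" by (rule mult_left_mono) simp
      then show ?thesis using r_le[of x] by (simp add: A_def algebra_simps)
    qed
    have rV: "VL2 r" unfolding r_def by (rule VL2_add[OF zV VL2_const])
    have rm[measurable]: "r \<in> borel_measurable lebesgue" by (rule VL2_measurable[OF rV])
    \<comment> \<open>Pairing \<open>r\<close> with \<open>psi0\<close> gives exactly
      \<open>m * G0^2 - X\<close>, so the pointwise bound on \<open>r\<close> integrated against
      \<open>src\<close> controls \<open>X\<close>.\<close>
    have Xb: "m * G0\<^sup>2 - X \<le> 2 * A * s1 * Theta \<mu>"
    proof -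
      have sr: "integrable lebesgue (\<lambda>x. cmod (src x) * cmod (r x))"
      proof (rule Bochner_Integration.integrable_bound[OF integrable_mult_left[OF si, of A']])
        show "AE y in lebesgue. norm (cmod (src y) * cmod (r y)) \<le> norm (cmod (src y) * A')"
          using r1 A0 by (intro AE_I2) (simp add: abs_mult mult_left_mono)
      qed measurable
      have "vform psi0 (\<lambda>x. complex_of_real (m * G0) * 1) = complex_of_real (m * G0) * vform psi0 (\<lambda>x. 1)" by (rule vform_scale_right)
      also have "vform psi0 (\<lambda>x. 1) = (LINT x|lebesgue. cnj (src x))" unfolding vform_eq
      proof (rule integral_cong_AE)
        show "AE x in lebesgue. complex_of_real (V x) * (cnj (psi0 x) * 1) = cnj (src x)"
          using src_eq by eventually_elim simp
      qed measurable
      also have "\<dots> = complex_of_real G0" unfolding Bochner_Integration.integral_cnj integral_src by simp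
      finally have "vform psi0 r = complex_of_real (m * G0\<^sup>2 - X)"
        using vform_add_right[OF zV VL2_const psi0_VL2, of "complex_of_real (m * G0)"] unfolding vfz r_def by (simp add: power2_eq_square)
      then have "m * G0\<^sup>2 - X \<le> cmod (vform psi0 r)" by (simp only: norm_of_real abs_ge_self)
      also have "\<dots> \<le> (LINT x|lebesgue. cmod (src x) * cmod (r x))" by (rule vform_psi0_bound[OF rV sr])
      also have "\<dots> \<le> (LINT x|lebesgue. (A * s1) * (cmod (src x) * bw \<mu> (norm x)) + (A * \<theta>1) * cmod (src x))"
      proof (rule integral_mono[OF sr])
        show "integrable lebesgue (\<lambda>x. (A * s1) * (cmod (src x) * bw \<mu> (norm x)) + (A * \<theta>1) * cmod (src x))"
          by (intro Bochner_Integration.integrable_add integrable_mult_right si bwi)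
        fix x
        have "cmod (src x) * cmod (r x) \<le> cmod (src x) * (A * (s1 * bw \<mu> (norm x) + \<theta>1))" by (intro mult_left_mono r2) simp
        then show "cmod (src x) * cmod (r x) \<le> (A * s1) * (cmod (src x) * bw \<mu> (norm x)) + (A * \<theta>1) * cmod (src x)" by (simp add: algebra_simps)
      qed
      also have "\<dots> = (A * s1) * \<theta>1 + (A * \<theta>1) * s1"
        unfolding s1_def[symmetric] \<theta>1_def[symmetric]
        by (simp only: integral_mult_right_zero Bochner_Integration.integral_add[OF integrable_mult_right[OF bwi] integrable_mult_right[OF si]] s1_def[symmetric] \<theta>1_def[symmetric])
      also have "\<dots> = 2 * A * s1 * \<theta>1" by simp
      also have "\<dots> \<le> 2 * A * s1 * Theta \<mu>" using A0 nn tp by (intro mult_left_mono) auto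
      finally show ?thesis .
    qed
    have vqb: "vquad (\<lambda>x. \<zeta> x - 1) \<le> 2 * v1 * (1 + m * G0)\<^sup>2 + 2 * A' * A * (s1 + v1) * Theta \<mu>"
    proof -
      have zV1: "VL2 (\<lambda>x. \<zeta> x - 1)" using VL2_add[OF zV VL2_const[of "-1"]] by simp
      have i1: "integrable lebesgue (\<lambda>x. \<bar>V x\<bar> * (cmod (\<zeta> x - 1))\<^sup>2)" by (rule VL2_integrable[OF zV1])
      have i2: "integrable lebesgue (\<lambda>x. V x * (cmod (\<zeta> x - 1))\<^sup>2)" by (rule VL2_V_integrable[OF zV1])
      note vbi = V_bw_integrable[OF mu mu1]
      let ?a = "2 * (1 + m * G0)\<^sup>2 + 2 * A' * A * \<theta>1" and ?b = "2 * A' * A * s1"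
      have "vquad (\<lambda>x. \<zeta> x - 1) \<le> (LINT x|lebesgue. ?a * \<bar>V x\<bar> + ?b * (\<bar>V x\<bar> * bw \<mu> (norm x)))"
        unfolding vquad_def
      proof (rule integral_mono[OF i2])
        show "integrable lebesgue (\<lambda>x. ?a * \<bar>V x\<bar> + ?b * (\<bar>V x\<bar> * bw \<mu> (norm x)))"
          by (intro Bochner_Integration.integrable_add integrable_mult_right abs_V_integrable vbi)
        fix x
        have e: "\<zeta> x - 1 = r x + complex_of_real (- (1 + m * G0))" by (simp add: r_def)
        have "(cmod (\<zeta> x - 1))\<^sup>2 \<le> 2 * (cmod (r x))\<^sup>2 + 2 * (cmod (complex_of_real (- (1 + m * G0))))\<^sup>2"
          unfolding e by (rule norm_add_sq_le)
        also have "(cmod (complex_of_real (- (1 + m * G0))))\<^sup>2 = (1 + m * G0)\<^sup>2" unfolding norm_of_real power2_abs power2_minus ..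
        also have "(cmod (r x))\<^sup>2 \<le> A' * (A * (s1 * bw \<mu> (norm x) + \<theta>1))"
          unfolding power2_eq_square using r1 r2 A0 by (intro mult_mono) auto
        finally have "(cmod (\<zeta> x - 1))\<^sup>2 \<le> ?a + ?b * bw \<mu> (norm x)" by (simp add: algebra_simps)
        then have "\<bar>V x\<bar> * (cmod (\<zeta> x - 1))\<^sup>2 \<le> \<bar>V x\<bar> * (?a + ?b * bw \<mu> (norm x))" by (rule mult_left_mono) simp
        moreover have "V x * (cmod (\<zeta> x - 1))\<^sup>2 \<le> \<bar>V x\<bar> * (cmod (\<zeta> x - 1))\<^sup>2" by (intro mult_right_mono) auto
        ultimately show "V x * (cmod (\<zeta> x - 1))\<^sup>2 \<le> ?a * \<bar>V x\<bar> + ?b * (\<bar>V x\<bar> * bw \<mu> (norm x))" by (simp add: algebra_simps)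
      qed
      also have "\<dots> = ?a * v1 + ?b * \<theta>2"
        unfolding v1_def \<theta>2_def by (simp only: integral_mult_right_zero Bochner_Integration.integral_add[OF integrable_mult_right[OF abs_V_integrable] integrable_mult_right[OF vbi]])
      also have "\<dots> = 2 * v1 * (1 + m * G0)\<^sup>2 + (2 * A' * A * v1 * \<theta>1 + 2 * A' * A * s1 * \<theta>2)" by (simp add: algebra_simps)
      also have "\<dots> \<le> 2 * v1 * (1 + m * G0)\<^sup>2 + (2 * A' * A * v1 * Theta \<mu> + 2 * A' * A * s1 * Theta \<mu>)"
        using A0 nn tp by (intro add_left_mono add_mono mult_left_mono) auto
      also have "\<dots> = 2 * v1 * (1 + m * G0)\<^sup>2 + 2 * A' * A * (s1 + v1) * Theta \<mu>" by (simp add: algebra_simps)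
      finally show ?thesis .
    qed
    have "- X - G0 + vquad (\<lambda>x. \<zeta> x - 1) \<le>
        - G0 - m * G0\<^sup>2 + 2 * v1 * (1 + m * G0)\<^sup>2 + (2 * A * s1 * Theta \<mu> + 2 * A' * A * (s1 + v1) * Theta \<mu>)"
      using Xb vqb by linarith
    also have "2 * A * s1 * Theta \<mu> + 2 * A' * A * (s1 + v1) * Theta \<mu> = C * Theta \<mu>" by (simp only: C_def ring_distribs)
    also have "- G0 - m * G0\<^sup>2 = - G0 * (1 + m * G0)" by (simp add: power2_eq_square algebra_simps)
    also have "- G0 * (1 + m * G0) + 2 * v1 * (1 + m * G0)\<^sup>2 + C * Theta \<mu> < 0" using neg unfolding m_def .
    finally have "\<not> K_plus_V_nonneg V \<mu> T" using psi val unfolding K_plus_V_nonneg_def by fastforce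
    then show "\<not> K_plus_V_nonneg V \<mu> T'" using K_plus_V_nonneg_mono[OF T'] by blast
  qed
qed

end

subsection \<open>The limit of small chemical potential\<close>

context scattering_potential begin

text \<open>\<open>T_test \<sigma> \<mu>\<close> is the predicted critical temperature with its logarithm shifted by \<open>-\<sigma>\<close>.\<close>

definition ln_ratio :: "real \<Rightarrow> real" where
  "ln_ratio \<mu> = 2 - euler_mascheroni - ln (8 / pi) - pi / (2 * sqrt \<mu> * (G0 / (4 * pi)))"

definition T_test :: "real \<Rightarrow> real \<Rightarrow> real" where
  "T_test \<sigma> \<mu> = \<mu> / exp (ln_ratio \<mu> + \<sigma>)"

context assumes G0_neg: "G0 < 0" begin

text \<open>Here the sign of the scattering length enters: \<open>\<mu> / T\<close> at the test
  temperatures becomes infinite, which is the regime of \<open>scaled_gap_asymp\<close>.\<close>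

lemma ln_ratio_at_top: "filterlim ln_ratio at_top (at_right 0)"
proof -
  have "filterlim (\<lambda>\<mu>. inverse (sqrt \<mu>)) at_top (at_right 0)"
    by real_asymp
  then have "filterlim (\<lambda>\<mu>. (- 2 * pi\<^sup>2 / G0) * inverse (sqrt \<mu>)) at_top (at_right 0)"
    using G0_neg by (intro filterlim_tendsto_pos_mult_at_top[OF tendsto_const]) (simp_all add: divide_pos_neg)
  then have "filterlim (\<lambda>\<mu>. (2 - euler_mascheroni - ln (8 / pi)) + (- 2 * pi\<^sup>2 / G0) * inverse (sqrt \<mu>)) at_top (at_right 0)"
    by (rule filterlim_tendsto_add_at_top[OF tendsto_const])
  moreover have "ln_ratio = (\<lambda>\<mu>. (2 - euler_mascheroni - ln (8 / pi)) + (- 2 * pi\<^sup>2 / G0) * inverse (sqrt \<mu>))"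
    by (auto simp: ln_ratio_def divide_simps power2_eq_square)
  ultimately show ?thesis by simp
qed

lemma T_test_bounds: "eventually (\<lambda>\<mu>. 0 < T_test \<sigma> \<mu> \<and> T_test \<sigma> \<mu> \<le> \<mu> \<and> \<mu> \<le> 1) (at_right 0)"
proof -
  have "eventually (\<lambda>\<mu>. - \<sigma> \<le> ln_ratio \<mu>) (at_right 0)"
    using ln_ratio_at_top by (simp add: filterlim_at_top)
  moreover have "eventually (\<lambda>\<mu>::real. 0 < \<mu> \<and> \<mu> \<le> 1) (at_right 0)"
    unfolding eventually_at_right_field by (intro exI[of _ 1]) auto
  ultimately show ?thesis
  proof eventually_elim
    case (elim \<mu>)
    then have "1 \<le> exp (ln_ratio \<mu> + \<sigma>)" by simp
    then have "\<mu> / exp (ln_ratio \<mu> + \<sigma>) \<le> \<mu> / 1" using elim by (intro divide_left_mono) auto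
    then show ?case using elim by (simp add: T_test_def)
  qed
qed

text \<open>\<open>ln_ratio\<close> is built to cancel the constant of
  \<open>scaled_gap_asymp\<close> and to turn its term in \<open>1 / sqrt \<mu>\<close> into
  \<open>-1 / G0\<close>. Only the shift \<sigma> is left, so the sign of \<sigma> decides on which
  side of \<open>-1 / G0\<close> the gap integral lies.\<close>

lemma gap_T_test: "((\<lambda>\<mu>. (gap_int \<mu> (T_test \<sigma> \<mu>) + 1 / G0) / sqrt \<mu>) \<longlongrightarrow> \<sigma> / (2 * pi\<^sup>2)) (at_right 0)"
proof -
  let ?Y = "\<lambda>\<mu>. exp (ln_ratio \<mu> + \<sigma>)"
  let ?L = "2 - euler_mascheroni - ln (8 / pi)"
  have "filterlim (\<lambda>\<mu>. \<sigma> + ln_ratio \<mu>) at_top (at_right 0)"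
    by (rule filterlim_tendsto_add_at_top[OF tendsto_const ln_ratio_at_top])
  then have "filterlim ?Y at_top (at_right 0)"
    using filterlim_compose[OF exp_at_top] by (simp add: add.commute)
  from filterlim_compose[OF scaled_gap_asymp this]
  have "((\<lambda>\<mu>. scaled_gap (?Y \<mu>) - ln (?Y \<mu>)) \<longlongrightarrow> - ?L) (at_right 0)" by (simp add: algebra_simps)
  then have "((\<lambda>\<mu>. (scaled_gap (?Y \<mu>) - ln (?Y \<mu>) + ?L + \<sigma>) / (2 * pi\<^sup>2)) \<longlongrightarrow> (- ?L + ?L + \<sigma>) / (2 * pi\<^sup>2)) (at_right 0)"
    by (intro tendsto_intros) auto
  then have "((\<lambda>\<mu>. (scaled_gap (?Y \<mu>) - ln (?Y \<mu>) + ?L + \<sigma>) / (2 * pi\<^sup>2)) \<longlongrightarrow> \<sigma> / (2 * pi\<^sup>2)) (at_right 0)" by simp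
  moreover have "eventually (\<lambda>\<mu>. (scaled_gap (?Y \<mu>) - ln (?Y \<mu>) + ?L + \<sigma>) / (2 * pi\<^sup>2) = (gap_int \<mu> (T_test \<sigma> \<mu>) + 1 / G0) / sqrt \<mu>) (at_right 0)"
    using T_test_bounds[of \<sigma>]
  proof eventually_elim
    case (elim \<mu>)
    then have mu: "0 < \<mu>" by linarith
    have q: "\<mu> / T_test \<sigma> \<mu> = ?Y \<mu>" using mu by (simp add: T_test_def)
    have "gap_int \<mu> (T_test \<sigma> \<mu>) = sqrt \<mu> / (2 * pi\<^sup>2) * scaled_gap (?Y \<mu>)"
      using gap_int_eq[of "T_test \<sigma> \<mu>" \<mu>] elim unfolding q by simp
    moreover have "ln (?Y \<mu>) - ?L - \<sigma> = - (2 * pi\<^sup>2) / (G0 * sqrt \<mu>)"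
      by (simp add: ln_ratio_def power2_eq_square mult.commute mult.left_commute)
    then have "scaled_gap (?Y \<mu>) - ln (?Y \<mu>) + ?L + \<sigma> = scaled_gap (?Y \<mu>) + (2 * pi\<^sup>2) / (G0 * sqrt \<mu>)" by linarith
    moreover have "(s + p / (G0 * r)) / p = (r / p * s + 1 / G0) / r" if "p \<noteq> 0" "r \<noteq> 0" for s p r :: real
      using that G0_neg by (simp add: field_simps)
    from this[of "2 * pi\<^sup>2" "sqrt \<mu>" "scaled_gap (?Y \<mu>)"]
    have "(scaled_gap (?Y \<mu>) + (2 * pi\<^sup>2) / (G0 * sqrt \<mu>)) / (2 * pi\<^sup>2) = (sqrt \<mu> / (2 * pi\<^sup>2) * scaled_gap (?Y \<mu>) + 1 / G0) / sqrt \<mu>"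
      using mu by simp
    ultimately show ?case by (simp only:)
  qed
  ultimately show ?thesis by (rule Lim_transform_eventually)
qed

lemma gap_T_test_tendsto: "((\<lambda>\<mu>. gap_int \<mu> (T_test \<sigma> \<mu>)) \<longlongrightarrow> - 1 / G0) (at_right 0)"
proof -
  have s: "((\<lambda>\<mu>. sqrt \<mu>) \<longlongrightarrow> 0) (at_right 0)" by real_asymp
  have "((\<lambda>\<mu>. (gap_int \<mu> (T_test \<sigma> \<mu>) + 1 / G0) / sqrt \<mu> * sqrt \<mu> - 1 / G0) \<longlongrightarrow> \<sigma> / (2 * pi\<^sup>2) * 0 - 1 / G0) (at_right 0)"
    by (intro tendsto_diff tendsto_mult gap_T_test s tendsto_const)
  moreover have "eventually (\<lambda>\<mu>. (gap_int \<mu> (T_test \<sigma> \<mu>) + 1 / G0) / sqrt \<mu> * sqrt \<mu> - 1 / G0 = gap_int \<mu> (T_test \<sigma> \<mu>)) (at_right 0)"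
    using eventually_at_right_less[of "0::real"] by eventually_elim simp
  ultimately show ?thesis by (simp add: Lim_transform_eventually)
qed

text \<open>\<open>gap_int\<close> converges to \<open>-1 / G0\<close>, and
  \<open>Kdiff_abs_integral\<close> turns this into a bound on the L^1-norm. The bound
  \<open>N\<close> is independent of \<sigma> and available before the error constants are
  chosen.\<close>

lemma Kdiff_T_test:
  "\<exists>N\<ge>0. \<forall>\<sigma>. eventually (\<lambda>\<mu>. (LINT p|lebesgue. \<bar>Kdiff \<mu> (T_test \<sigma> \<mu>) (norm (p::real^3))\<bar>) \<le> N) (at_right 0)"
proof -
  define c0 :: real where "c0 = (2 * pi) powr (-3/2)"
  have c0: "0 < c0" unfolding c0_def by (rule FT_const_pos)
  define N where "N = (- 1 / G0 + 1) / c0\<^sup>2 + 1"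
  have "0 < - 1 / G0" using G0_neg by (simp add: divide_neg_neg)
  then have "0 \<le> (- 1 / G0 + 1) / c0\<^sup>2" by (intro divide_nonneg_nonneg zero_le_power2) linarith
  then have N0: "0 \<le> N" unfolding N_def by linarith
  show ?thesis
  proof (rule exI[of _ N], intro conjI allI N0)
    fix \<sigma>
    have "((\<lambda>\<mu>. 40 * pi * sqrt (2 * \<mu>)) \<longlongrightarrow> 0) (at_right 0)" by real_asymp
    then have "eventually (\<lambda>\<mu>. 40 * pi * sqrt (2 * \<mu>) < 1) (at_right 0)" by (rule order_tendstoD) simp
    moreover have "eventually (\<lambda>\<mu>. gap_int \<mu> (T_test \<sigma> \<mu>) < - 1 / G0 + 1) (at_right 0)"
      by (rule order_tendstoD[OF gap_T_test_tendsto]) simp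
    ultimately show "eventually (\<lambda>\<mu>. (LINT p|lebesgue. \<bar>Kdiff \<mu> (T_test \<sigma> \<mu>) (norm (p::real^3))\<bar>) \<le> N) (at_right 0)"
      using T_test_bounds[of \<sigma>]
    proof eventually_elim
      case (elim \<mu>)
      have "(LINT p|lebesgue. Kdiff \<mu> (T_test \<sigma> \<mu>) (norm (p::real^3))) = gap_int \<mu> (T_test \<sigma> \<mu>) / c0\<^sup>2"
        using c0 by (simp add: gap_int_def c0_def)
      also have "\<dots> \<le> (- 1 / G0 + 1) / c0\<^sup>2" using elim(2) by (intro divide_right_mono) auto
      finally show ?case using Kdiff_abs_integral[of "T_test \<sigma> \<mu>" \<mu>] elim by (simp add: N_def)
    qed
  qed
qed

lemma K_plus_V_nonneg_T_test:
  assumes \<eta>: "0 < \<eta>" shows "eventually (\<lambda>\<mu>. K_plus_V_nonneg V \<mu> (T_test (- \<eta>) \<mu>)) (at_right 0)"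
proof -
  obtain N where N: "0 \<le> N" "\<And>\<sigma>. eventually (\<lambda>\<mu>. (LINT p|lebesgue. \<bar>Kdiff \<mu> (T_test \<sigma> \<mu>) (norm (p::real^3))\<bar>) \<le> N) (at_right 0)"
    using Kdiff_T_test by blast
  \<comment> \<open>Half of the limit of \<open>gap_int\<close>, so that it is eventually a positive
    lower bound.\<close>
  define m0 where "m0 = - 1 / (2 * G0)"
  have m0: "0 < m0" "m0 < - 1 / G0" using G0_neg by (auto simp: m0_def divide_simps)
  obtain C1 C2 where C: "0 \<le> C1" "0 \<le> C2"
    "\<And>\<mu> T. 0 < T \<Longrightarrow> T \<le> \<mu> \<Longrightarrow> \<mu> \<le> 1 \<Longrightarrow> m0 \<le> gap_int \<mu> T \<Longrightarrow>
      (LINT p|lebesgue. \<bar>Kdiff \<mu> T (norm (p::real^3))\<bar>) \<le> N \<Longrightarrow> C2 * Theta \<mu> \<le> 1 / 2 \<Longrightarrow>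
      C1 * Theta \<mu> \<le> 1 / gap_int \<mu> T + G0 \<Longrightarrow> K_plus_V_nonneg V \<mu> T"
  proof (rule K_plus_V_nonneg_if[OF m0(1) N(1)], goal_cases)
    case (1 C1 C2)
    show ?case by (rule 1(1)[OF 1(2-4)])
  qed
  let ?m = "\<lambda>\<mu>. gap_int \<mu> (T_test (- \<eta>) \<mu>)"
  let ?d = "\<lambda>\<mu>. (?m \<mu> + 1 / G0) / sqrt \<mu>"
  \<comment> \<open>The criterion divided by \<open>sqrt \<mu>\<close>, using
    \<open>1 / ?m + G0 = G0 * ?d * sqrt \<mu> / ?m\<close>. Both \<open>G0\<close> and the limit of
    \<open>?d\<close> are negative, so the limit is positive while the error tends to 0.\<close>
  have "((\<lambda>\<mu>. G0 * ?d \<mu> / ?m \<mu> - C1 * (Theta \<mu> / sqrt \<mu>)) \<longlongrightarrow> G0 * (- \<eta> / (2 * pi\<^sup>2)) / (- 1 / G0) - C1 * 0) (at_right 0)"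
    using G0_neg by (intro tendsto_diff tendsto_divide tendsto_mult tendsto_const gap_T_test gap_T_test_tendsto Theta_tendsto) simp
  moreover have "G0 * (- \<eta> / (2 * pi\<^sup>2)) / (- 1 / G0) - C1 * 0 = \<eta> * G0\<^sup>2 / (2 * pi\<^sup>2)"
    by (simp add: power2_eq_square)
  moreover have "0 < \<eta> * G0\<^sup>2 / (2 * pi\<^sup>2)" using G0_neg \<eta> by simp
  ultimately have "((\<lambda>\<mu>. G0 * ?d \<mu> / ?m \<mu> - C1 * (Theta \<mu> / sqrt \<mu>)) \<longlongrightarrow> \<eta> * G0\<^sup>2 / (2 * pi\<^sup>2)) (at_right 0)"
    and "0 < \<eta> * G0\<^sup>2 / (2 * pi\<^sup>2)" by (simp_all only:)
  then have e1: "eventually (\<lambda>\<mu>. 0 < G0 * ?d \<mu> / ?m \<mu> - C1 * (Theta \<mu> / sqrt \<mu>)) (at_right 0)"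
    by (rule order_tendstoD)
  have "((\<lambda>\<mu>. C2 * (Theta \<mu> / sqrt \<mu> * sqrt \<mu>)) \<longlongrightarrow> C2 * (0 * 0)) (at_right 0)"
  proof (intro tendsto_mult tendsto_const Theta_tendsto)
    show "((\<lambda>\<mu>. sqrt \<mu>) \<longlongrightarrow> 0) (at_right 0)" by real_asymp
  qed
  then have e2: "eventually (\<lambda>\<mu>. C2 * (Theta \<mu> / sqrt \<mu> * sqrt \<mu>) < 1 / 2) (at_right 0)" by (rule order_tendstoD) simp
  have e3: "eventually (\<lambda>\<mu>. m0 < ?m \<mu>) (at_right 0)" by (rule order_tendstoD(1)[OF gap_T_test_tendsto m0(2)])
  show ?thesis using e1 e2 e3 T_test_bounds[of "- \<eta>"] N(2)[of "- \<eta>"]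
  proof eventually_elim
    case (elim \<mu>)
    have mu: "0 < \<mu>" using elim(4) by linarith
    have mp: "0 < ?m \<mu>" using elim(3) m0 by linarith
    have "0 \<le> (G0 * ?d \<mu> / ?m \<mu> - C1 * (Theta \<mu> / sqrt \<mu>)) * sqrt \<mu>" using elim(1) mu by simp
    also have "\<dots> = (1 / ?m \<mu> + G0) - C1 * Theta \<mu>" using mu mp G0_neg by (simp add: field_simps)
    finally have "C1 * Theta \<mu> \<le> 1 / ?m \<mu> + G0" by simp
    moreover have "C2 * Theta \<mu> \<le> 1 / 2" using elim(2) mu by simp
    ultimately show ?case using elim(3-5) by (intro C(3)) auto
  qed
qed

lemma not_K_plus_V_nonneg_T_test:
  assumes \<eta>: "0 < \<eta>"
  shows "eventually (\<lambda>\<mu>. \<forall>T. 0 < T \<and> T \<le> T_test \<eta> \<mu> \<longrightarrow> \<not> K_plus_V_nonneg V \<mu> T) (at_right 0)"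
proof -
  obtain N where N: "0 \<le> N" "\<And>\<sigma>. eventually (\<lambda>\<mu>. (LINT p|lebesgue. \<bar>Kdiff \<mu> (T_test \<sigma> \<mu>) (norm (p::real^3))\<bar>) \<le> N) (at_right 0)"
    using Kdiff_T_test by blast
  obtain C v1 where C: "0 \<le> C" "0 \<le> v1"
    "\<And>\<mu> T T'. 0 < T' \<Longrightarrow> T' \<le> T \<Longrightarrow> T \<le> \<mu> \<Longrightarrow> \<mu> \<le> 1 \<Longrightarrow>
      (LINT p|lebesgue. \<bar>Kdiff \<mu> T (norm (p::real^3))\<bar>) \<le> N \<Longrightarrow>
      - G0 * (1 + gap_int \<mu> T * G0) + 2 * v1 * (1 + gap_int \<mu> T * G0)\<^sup>2 + C * Theta \<mu> < 0 \<Longrightarrow>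
      \<not> K_plus_V_nonneg V \<mu> T'"
  proof (rule not_K_plus_V_nonneg_if[OF N(1)], goal_cases)
    case (1 C v1)
    show ?case by (rule 1(1)[OF 1(2-4)])
  qed
  let ?m = "\<lambda>\<mu>. gap_int \<mu> (T_test \<eta> \<mu>)"
  let ?d = "\<lambda>\<mu>. (?m \<mu> + 1 / G0) / sqrt \<mu>"
  \<comment> \<open>Again the criterion divided by \<open>sqrt \<mu>\<close>. The quadratic term
    retains a factor \<open>sqrt \<mu>\<close> and vanishes together with the error, leaving
    \<open>- G0^2 * \<eta> / (2 * pi^2)\<close>.\<close>
  let ?e = "\<lambda>\<mu>. - (G0\<^sup>2 * ?d \<mu>) + 2 * v1 * (G0\<^sup>2 * ((?d \<mu>)\<^sup>2 * sqrt \<mu>)) + C * (Theta \<mu> / sqrt \<mu>)"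
  have "(?e \<longlongrightarrow> - (G0\<^sup>2 * (\<eta> / (2 * pi\<^sup>2))) + 2 * v1 * (G0\<^sup>2 * ((\<eta> / (2 * pi\<^sup>2))\<^sup>2 * 0)) + C * 0) (at_right 0)"
  proof (intro tendsto_add tendsto_minus tendsto_mult tendsto_power tendsto_const gap_T_test Theta_tendsto)
    show "((\<lambda>\<mu>. sqrt \<mu>) \<longlongrightarrow> 0) (at_right 0)" by real_asymp
  qed
  moreover have "- (G0\<^sup>2 * (\<eta> / (2 * pi\<^sup>2))) + 2 * v1 * (G0\<^sup>2 * ((\<eta> / (2 * pi\<^sup>2))\<^sup>2 * 0)) + C * 0 < 0"
    using G0_neg \<eta> by simp
  ultimately have e1: "eventually (\<lambda>\<mu>. ?e \<mu> < 0) (at_right 0)" by (rule order_tendstoD)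
  show ?thesis using e1 T_test_bounds[of \<eta>] N(2)[of \<eta>]
  proof eventually_elim
    case (elim \<mu>)
    have mu: "0 < \<mu>" using elim(2) by linarith
    have d: "1 + ?m \<mu> * G0 = G0 * (?d \<mu> * sqrt \<mu>)" using mu G0_neg by (simp add: field_simps)
    have s: "\<mu> = sqrt \<mu> * sqrt \<mu>" using mu by simp
    have "- G0 * (1 + ?m \<mu> * G0) + 2 * v1 * (1 + ?m \<mu> * G0)\<^sup>2 + C * Theta \<mu> = ?e \<mu> * sqrt \<mu>"
    proof -
      have "- g * (g * (x * y)) + 2 * v * (g * (x * y))\<^sup>2 + C * t = (- (g\<^sup>2 * x) + 2 * v * (g\<^sup>2 * (x\<^sup>2 * y)) + C * (t / y)) * y"
        if "y \<noteq> 0" for g x y v t :: real using that by (simp add: power2_eq_square field_simps)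
      from this[of "sqrt \<mu>" G0 "?d \<mu>" v1 "Theta \<mu>"] show ?thesis unfolding d using mu by (simp only: real_sqrt_eq_zero_cancel_iff)
    qed
    also have "\<dots> < 0" using elim(1) mu by (intro mult_neg_pos) auto
    finally show ?case using C(3)[of _ "T_test \<eta> \<mu>" \<mu>] elim(2,3) by blast
  qed
qed

lemma critical_temperature_bounds:
  assumes \<eta>: "0 < \<eta>"
  shows "eventually (\<lambda>\<mu>. 0 < T_test \<eta> \<mu> \<and> T_test \<eta> \<mu> \<le> critical_temperature V \<mu> \<and> critical_temperature V \<mu> \<le> T_test (- \<eta>) \<mu>) (at_right 0)"
  using K_plus_V_nonneg_T_test[OF \<eta>] not_K_plus_V_nonneg_T_test[OF \<eta>] T_test_bounds[of \<eta>] T_test_bounds[of "- \<eta>"]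
proof eventually_elim
  case (elim \<mu>)
  let ?A = "{T. T > 0 \<and> K_plus_V_nonneg V \<mu> T}"
  \<comment> \<open>This member makes the set nonempty, so that the infimum is a genuine one and is
    caught between the two test temperatures.\<close>
  have mem: "T_test (- \<eta>) \<mu> \<in> ?A" using elim by simp
  have "T_test \<eta> \<mu> \<le> T" if "T \<in> ?A" for T using that elim(2) by force
  then have "T_test \<eta> \<mu> \<le> critical_temperature V \<mu>"
    unfolding critical_temperature_def using mem by (intro cInf_greatest) auto
  moreover have "critical_temperature V \<mu> \<le> T_test (- \<eta>) \<mu>"
    unfolding critical_temperature_def by (rule cInf_lower[OF mem]) (auto intro: bdd_belowI[of _ 0])
  ultimately show ?case using elim(3) by simp
qed

theorem critical_temperature_tendsto:
  "((\<lambda>\<mu>. ln (\<mu> / critical_temperature V \<mu>) + pi / (2 * sqrt \<mu> * scattering_length V))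
    \<longlongrightarrow> 2 - euler_mascheroni - ln (8 / pi)) (at_right 0)"
proof (rule tendstoI)
  fix e :: real assume "0 < e"
  then have \<eta>: "0 < e / 2" by simp
  show "eventually (\<lambda>\<mu>. dist (ln (\<mu> / critical_temperature V \<mu>) + pi / (2 * sqrt \<mu> * scattering_length V))
    (2 - euler_mascheroni - ln (8 / pi)) < e) (at_right 0)"
    using critical_temperature_bounds[OF \<eta>] T_test_bounds[of "e / 2"]
  proof eventually_elim
    case (elim \<mu>)
    let ?Tc = "critical_temperature V \<mu>"
    have mu: "0 < \<mu>" and Tc: "0 < ?Tc" using elim by linarith+
    have ln_T: "ln (\<mu> / T_test \<sigma> \<mu>) = ln_ratio \<mu> + \<sigma>" for \<sigma> using mu by (simp add: T_test_def)
    have "ln (\<mu> / ?Tc) \<le> ln (\<mu> / T_test (e / 2) \<mu>)"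
      using mu Tc elim by (intro ln_mono divide_left_mono) auto
    moreover have "ln (\<mu> / T_test (- (e / 2)) \<mu>) \<le> ln (\<mu> / ?Tc)"
      using mu Tc elim by (intro ln_mono divide_left_mono mult_pos_pos) auto
    ultimately have "\<bar>ln (\<mu> / ?Tc) - ln_ratio \<mu>\<bar> \<le> e / 2" unfolding ln_T by linarith
    then show ?case using \<open>0 < e\<close> unfolding dist_real_def scattering_length_eq ln_ratio_def by linarith
  qed
qed

end

end

theorem theorem3p4:
  fixes V :: "real^3 \<Rightarrow> real"
  assumes "integrable lebesgue (\<lambda>x. V x * (1 + norm x))"
    and "integrable lebesgue (\<lambda>x. \<bar>V x * (1 + norm x)\<bar> powr (3/2))"
    and "L2_spectrum (birman_schwinger V) \<subseteq> complex_of_real ` {-1<..}"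
    and "scattering_length V < 0"
  shows "((\<lambda>\<mu>. ln (\<mu> / critical_temperature V \<mu>) + pi / (2 * sqrt \<mu> * scattering_length V))
           \<longlongrightarrow> 2 - euler_mascheroni - ln (8 / pi)) (at_right 0)"
proof -
  interpret scattering_potential V
    by unfold_locales (rule assms)+
  have "G0 < 0" using assms(4) unfolding scattering_length_eq by (simp add: divide_less_0_iff)
  then show ?thesis by (rule critical_temperature_tendsto)
qed

end
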